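(* Let $F\dashv U$, with $U\colon \mathsf{U}\to\mathsf{V}$, be an ideally exact context such that the functor $U$ is full on isomorphisms. Then the following statements are equivalent: (i) the ideally exact context is BAT; (ii) for any object $B$ of $\mathsf{U}$, the commutative square of functors $$(-)\circ\gamma_B\colon\mathsf{V}^{B\#}\to\mathsf{V}^{U(B)\flat},\quad S\colon\mathsf{V}^{B\#}\to\mathsf{V},\quad (-)\circ(U(\iota_B)\flat\mathrm{id})\colon\mathsf{V}^{U(B)\flat}\to\mathsf{V}^{UF(0)\flat},\quad [\xi_0]\colon\mathsf{V}\to\mathsf{V}^{UF(0)\flat}$$ (so that $\big((-)\circ(U(\iota_B)\flat\mathrm{id})\big)\circ\big((-)\circ\gamma_B\big)=[\xi_0]\circ S$) is a pullback of categories; (iii) for any object $B$ of $\mathsf{U}$, the square of functors (commuting up to isomorphism) $$U'\colon\mathrm{Pt}_{\mathsf{U}}(B)\to\mathrm{Pt}_{\mathsf{V}}(U(B)),\quad \iota_B^*\colon\mathrm{Pt}_{\mathsf{U}}(B)\to\mathrm{Pt}_{\mathsf{U}}(F(0)),\quad U(\iota_B)^*\colon\mathrm{Pt}_{\mathsf{V}}(U(B))\to\mathrm{Pt}_{\mathsf{V}}(UF(0)),\quad U_0'\colon\mathrm{Pt}_{\mathsf{U}}(F(0))\to\mathrm{Pt}_{\mathsf{V}}(UF(0))$$ (so that $U(\iota_B)^*\circ U'\cong U_0'\circ\iota_B^*$) is a pseudopullback.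
   Context: A category is semi-abelian if it is pointed, protomodular, Barr-exact and has finite coproducts. A category is ideally exact if it is Barr-exact, protomodular, has finite coproducts, and the unique morphism from its initial object to its terminal object is a regular epimorphism. An ideally exact context is a monadic adjunction $F\dashv U$, $U\colon\mathsf{U}\to\mathsf{V}$, with $\mathsf{U}$ ideally exact, $\mathsf{V}$ semi-abelian, and cartesian unit $\eta$ (all naturality squares of $\eta$ are pullbacks). Then $F(0)$ is initial in $\mathsf{U}$. Write $\iota_B\colon F(0)\to B$ for the unique morphism in $\mathsf{U}$, and $\tau_X\colon X\to 0$, $\iota_X\colon 0\to X$ for the unique morphisms in $\mathsf{V}$. $U$ is full on isomorphisms if for every isomorphism $\alpha\colon U(A)\to U(B)$ there is an isomorphism $\beta\colon A\to B$ with $U(\beta)=\alpha$. $\mathrm{Pt}_{\mathsf{C}}(B)$ is the category of points over $B$: split epimorphisms over $B$ with chosen section; morphisms are morphisms between the domains commuting with retractions and sections. For $f\colon E\to B$, $f^*\colon\mathrm{Pt}_{\mathsf{C}}(B)\to\mathrm{Pt}_{\mathsf{C}}(E)$ is pullback along $f$. $U'$ and $U'_0$ apply $U$ to the point: $(p',s')\mapsto(U(p'),U(s'))$. A square commuting up to isomorphism is a pseudopullback if the comparison functor into the iso-comma category (of triples of two objects and an isomorphism between their images) is an equivalence. Internal actions in $\mathsf{V}$: $\kappa_{C,X}\colon C\flat X\to C+X$ denotes a kernel of $[\mathrm{id}_C,0]\colon C+X\to C$. $C\flat(-)$ is a monad on $\mathsf{V}$ (unit $u_X$ with $\kappa_{C,X}u_X=i_2$,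 multiplication $\mu_X$ with $\kappa_{C,X}\mu_X=[i_1,\kappa_{C,X}]\kappa_{C,C\flat X}$); an internal action of $C$ on $X$ is an algebra $\xi\colon C\flat X\to X$, and $\mathsf{V}^{C\flat}$ is the category of algebras. For $g\colon C\to D$, $g\flat\mathrm{id}_X\colon C\flat X\to D\flat X$ is the unique morphism with $\kappa_{D,X}(g\flat\mathrm{id}_X)=(g+\mathrm{id}_X)\kappa_{C,X}$. A point $(p\colon A\to C,s)$ is associated with $\xi$ if there is a kernel $k\colon X\to A$ of $p$ with $k\xi=[s,k]\kappa_{C,X}$; this gives an equivalence $\mathrm{Pt}_{\mathsf{V}}(C)\simeq\mathsf{V}^{C\flat}$. A relative $U$-action of $B\in\mathsf{U}$ on $X\in\mathsf{V}$ is an internal action $\xi\colon U(B)\flat X\to X$. $\xi_0\colon UF(0)\flat X\to X$ is the action determined by $\eta_X\xi_0=[UF(\iota_X),\eta_X]\kappa_{UF(0),X}$ (associated with the point $(UF(\tau_X),UF(\iota_X))$ with kernel $\eta_X$), and $[\xi_0]\colon\mathsf{V}\to\mathsf{V}^{UF(0)\flat}$ sends $X$ to $(X,\xi_0)$. $\xi$ is coherent if $\xi\circ(U(\iota_B)\flat\mathrm{id}_X)=\xi_0$. A point $(p\colon A\to U(B),s)$ in $\mathsf{V}$ is ideal if there exist a point $(p'\colon A'\to B,s')$ in $\mathsf{U}$ and an isomorphism $\sigma\colon U(A')\to A$ with $p\sigma=U(p')$, $\sigma U(s')=s$; a relative $U$-action is ideal if any associated point is ideal. A morphism $h\colon A_1\to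 A_2$ of ideal points $(p_i\colon A_i\to U(B),s_i)$, $i=1,2$, over $U(B)$ is ideal if there is a morphism $h'\colon A_1'\to A_2'$ in $\mathrm{Pt}_{\mathsf{U}}(B)$ between corresponding points $(p_i'\colon A_i'\to B,s_i')$ (with isomorphisms $\sigma_i\colon U(A_i')\to A_i$ satisfying $p_i\sigma_i=U(p_i')$ and $\sigma_iU(s_i')=s_i$) such that $h\sigma_1=\sigma_2U(h')$; a morphism of ideal actions (of the same $B$) is ideal if the corresponding morphism of points is. The ideally exact context is BAT if all coherent actions are ideal and all morphisms of such actions are ideal. The monad $B\#(-)$ on $\mathsf{V}$: it is the monad of the adjunction $F^B\dashv U^B$ where $U^B\colon\mathrm{Pt}_{\mathsf{U}}(B)\to\mathsf{V}$ sends $(p',s')$ to the kernel of $U(p')$ and $F^B(X)$ is the point $[\mathrm{id}_B,\iota_B\circ F(\tau_X)]\colon B+F(X)\to B$ with section $i_1$. Thus $\tilde\kappa_{B,X}\colon B\#X\to U(B+F(X))$ is a kernel of $U([\mathrm{id}_B,\iota_B\circ F(\tau_X)])$. $\mathsf{V}^{B\#}$ is its category of algebras and $S$ is the forgetful functor. The morphism of monads $\gamma_B$ has components $\gamma_{B,X}\colon U(B)\flat X\to B\#X$ determined by $\tilde\kappa_{B,X}\gamma_{B,X}=[U(i_1),U(i_2)\circ\eta_X]\kappa_{U(B),X}$, and $(-)\circ\gamma_B$ sends an algebra $\xi'\colon B\#X\to X$ to $\xi'\circ\gamma_{B,X}$. *)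

theory Defs
  imports Main
begin

section \<open>Categories, functors, natural transformations\<close>

record ('o, 'm) cat =
  Ob :: "'o set"
  Ar :: "'m set"
  Dom :: "'m \<Rightarrow> 'o"
  Cod :: "'m \<Rightarrow> 'o"
  Ide :: "'o \<Rightarrow> 'm"
  Cmp :: "'m \<Rightarrow> 'm \<Rightarrow> 'm"  (infixl "\<cdot>\<index>" 70)

definition Hom :: "('o, 'm) cat \<Rightarrow> 'o \<Rightarrow> 'o \<Rightarrow> 'm set" where
  "Hom C a b = {f \<in> Ar C. Dom C f = a \<and> Cod C f = b}"

definition category :: "('o, 'm) cat \<Rightarrow> bool" where
  "category C \<longleftrightarrow>
    (\<forall>f\<in>Ar C. Dom C f \<in> Ob C \<and> Cod C f \<in> Ob C) \<and>
    (\<forall>a\<in>Ob C. Ide C a \<in> Hom C a a) \<and>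
    (\<forall>f\<in>Ar C. \<forall>g\<in>Ar C. Cod C f = Dom C g \<longrightarrow> g \<cdot>\<^bsub>C\<^esub> f \<in> Hom C (Dom C f) (Cod C g)) \<and>
    (\<forall>f\<in>Ar C. f \<cdot>\<^bsub>C\<^esub> Ide C (Dom C f) = f \<and> Ide C (Cod C f) \<cdot>\<^bsub>C\<^esub> f = f) \<and>
    (\<forall>f\<in>Ar C. \<forall>g\<in>Ar C. \<forall>h\<in>Ar C. Cod C f = Dom C g \<longrightarrow> Cod C g = Dom C h \<longrightarrow>
      h \<cdot>\<^bsub>C\<^esub> (g \<cdot>\<^bsub>C\<^esub> f) = (h \<cdot>\<^bsub>C\<^esub> g) \<cdot>\<^bsub>C\<^esub> f)"

definition iso :: "('o, 'm) cat \<Rightarrow> 'm \<Rightarrow> bool" where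
  "iso C f \<longleftrightarrow> f \<in> Ar C \<and>
    (\<exists>g\<in>Hom C (Cod C f) (Dom C f). g \<cdot>\<^bsub>C\<^esub> f = Ide C (Dom C f) \<and> f \<cdot>\<^bsub>C\<^esub> g = Ide C (Cod C f))"

record ('o1, 'm1, 'o2, 'm2) func =
  FOb :: "'o1 \<Rightarrow> 'o2"
  FAr :: "'m1 \<Rightarrow> 'm2"

definition "functor" :: "('o1, 'm1) cat \<Rightarrow> ('o2, 'm2) cat \<Rightarrow> ('o1, 'm1, 'o2, 'm2) func \<Rightarrow> bool" where
  "functor C D F \<longleftrightarrow> category C \<and> category D \<and>
    (\<forall>a\<in>Ob C. FOb F a \<in> Ob D) \<and>
    (\<forall>f\<in>Ar C. FAr F f \<in> Hom D (FOb F (Dom C f)) (FOb F (Cod C f))) \<and>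
    (\<forall>a\<in>Ob C. FAr F (Ide C a) = Ide D (FOb F a)) \<and>
    (\<forall>f\<in>Ar C. \<forall>g\<in>Ar C. Cod C f = Dom C g \<longrightarrow> FAr F (g \<cdot>\<^bsub>C\<^esub> f) = FAr F g \<cdot>\<^bsub>D\<^esub> FAr F f)"

definition id_func :: "('o, 'm, 'o, 'm) func" where
  "id_func = \<lparr>FOb = (\<lambda>a. a), FAr = (\<lambda>f. f)\<rparr>"

definition comp_func :: "('o2, 'm2, 'o3, 'm3) func \<Rightarrow> ('o1, 'm1, 'o2, 'm2) func \<Rightarrow> ('o1, 'm1, 'o3, 'm3) func"
    (infixl "\<circ>\<^sub>F" 55) where
  "G \<circ>\<^sub>F F = \<lparr>FOb = (\<lambda>a. FOb G (FOb F a)), FAr = (\<lambda>f. FAr G (FAr F f))\<rparr>"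

text \<open>Functors are total functions on the underlying types; only their values on the objects and
  arrows of the source category are meaningful.\<close>

definition func_eq :: "('o1, 'm1) cat \<Rightarrow> ('o1, 'm1, 'o2, 'm2) func \<Rightarrow> ('o1, 'm1, 'o2, 'm2) func \<Rightarrow> bool" where
  "func_eq C F G \<longleftrightarrow> (\<forall>a\<in>Ob C. FOb F a = FOb G a) \<and> (\<forall>f\<in>Ar C. FAr F f = FAr G f)"

definition nat_trans :: "('o1, 'm1) cat \<Rightarrow> ('o2, 'm2) cat \<Rightarrow> ('o1, 'm1, 'o2, 'm2) func \<Rightarrow>
    ('o1, 'm1, 'o2, 'm2) func \<Rightarrow> ('o1 \<Rightarrow> 'm2) \<Rightarrow> bool" where
  "nat_trans C D F G \<alpha> \<longleftrightarrow> functor C D F \<and> functor C D G \<and>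
    (\<forall>a\<in>Ob C. \<alpha> a \<in> Hom D (FOb F a) (FOb G a)) \<and>
    (\<forall>f\<in>Ar C. \<alpha> (Cod C f) \<cdot>\<^bsub>D\<^esub> FAr F f = FAr G f \<cdot>\<^bsub>D\<^esub> \<alpha> (Dom C f))"

definition nat_iso :: "('o1, 'm1) cat \<Rightarrow> ('o2, 'm2) cat \<Rightarrow> ('o1, 'm1, 'o2, 'm2) func \<Rightarrow>
    ('o1, 'm1, 'o2, 'm2) func \<Rightarrow> ('o1 \<Rightarrow> 'm2) \<Rightarrow> bool" where
  "nat_iso C D F G \<alpha> \<longleftrightarrow> nat_trans C D F G \<alpha> \<and> (\<forall>a\<in>Ob C. iso D (\<alpha> a))"

definition equivalence_of_cats :: "('o1, 'm1) cat \<Rightarrow> ('o2, 'm2) cat \<Rightarrow> ('o1, 'm1, 'o2, 'm2) func \<Rightarrow> bool" where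
  "equivalence_of_cats C D F \<longleftrightarrow> functor C D F \<and>
    (\<exists>G. functor D C G \<and> (\<exists>\<alpha>. nat_iso C C id_func (G \<circ>\<^sub>F F) \<alpha>) \<and> (\<exists>\<beta>. nat_iso D D (F \<circ>\<^sub>F G) id_func \<beta>))"

definition isomorphism_of_cats :: "('o1, 'm1) cat \<Rightarrow> ('o2, 'm2) cat \<Rightarrow> ('o1, 'm1, 'o2, 'm2) func \<Rightarrow> bool" where
  "isomorphism_of_cats C D F \<longleftrightarrow> functor C D F \<and>
    (\<exists>G. functor D C G \<and> func_eq C (G \<circ>\<^sub>F F) id_func \<and> func_eq D (F \<circ>\<^sub>F G) id_func)"

definition reflects_isos :: "('o1, 'm1) cat \<Rightarrow> ('o2, 'm2) cat \<Rightarrow> ('o1, 'm1, 'o2, 'm2) func \<Rightarrow> bool" where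
  "reflects_isos C D F \<longleftrightarrow> (\<forall>f\<in>Ar C. iso D (FAr F f) \<longrightarrow> iso C f)"

definition full_on_isos :: "('o1, 'm1) cat \<Rightarrow> ('o2, 'm2) cat \<Rightarrow> ('o1, 'm1, 'o2, 'm2) func \<Rightarrow> bool" where
  "full_on_isos C D F \<longleftrightarrow>
    (\<forall>a\<in>Ob C. \<forall>b\<in>Ob C. \<forall>\<alpha>\<in>Hom D (FOb F a) (FOb F b). iso D \<alpha> \<longrightarrow>
      (\<exists>\<beta>\<in>Hom C a b. iso C \<beta> \<and> FAr F \<beta> = \<alpha>))"


section \<open>Pullbacks and pseudopullbacks of categories\<close>

text \<open>A square of functors has legs \<open>P: A \<rightarrow> B\<close>, \<open>Q: A \<rightarrow> C\<close>, \<open>H: B \<rightarrow> D\<close>, \<open>K: C \<rightarrow> D\<close>.\<close>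

definition pullback_cat :: "('bo, 'bm) cat \<Rightarrow> ('co, 'cm) cat \<Rightarrow> ('bo, 'bm, 'do, 'dm) func \<Rightarrow>
    ('co, 'cm, 'do, 'dm) func \<Rightarrow> ('bo \<times> 'co, 'bm \<times> 'cm) cat" where
  "pullback_cat B C H K = \<lparr>
    Ob = {(b, c). b \<in> Ob B \<and> c \<in> Ob C \<and> FOb H b = FOb K c},
    Ar = {(f, g). f \<in> Ar B \<and> g \<in> Ar C \<and> FAr H f = FAr K g},
    Dom = (\<lambda>(f, g). (Dom B f, Dom C g)),
    Cod = (\<lambda>(f, g). (Cod B f, Cod C g)),
    Ide = (\<lambda>(b, c). (Ide B b, Ide C c)),
    Cmp = (\<lambda>(f', g') (f, g). (f' \<cdot>\<^bsub>B\<^esub> f, g' \<cdot>\<^bsub>C\<^esub> g))\<rparr>"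

definition is_pullback_of_cats :: "('ao, 'am) cat \<Rightarrow> ('bo, 'bm) cat \<Rightarrow> ('co, 'cm) cat \<Rightarrow> ('do, 'dm) cat \<Rightarrow>
    ('ao, 'am, 'bo, 'bm) func \<Rightarrow> ('ao, 'am, 'co, 'cm) func \<Rightarrow>
    ('bo, 'bm, 'do, 'dm) func \<Rightarrow> ('co, 'cm, 'do, 'dm) func \<Rightarrow> bool" where
  "is_pullback_of_cats A B C D P Q H K \<longleftrightarrow>
    functor A B P \<and> functor A C Q \<and> functor B D H \<and> functor C D K \<and>
    func_eq A (H \<circ>\<^sub>F P) (K \<circ>\<^sub>F Q) \<and>
    isomorphism_of_cats A (pullback_cat B C H K)
      \<lparr>FOb = (\<lambda>a. (FOb P a, FOb Q a)), FAr = (\<lambda>f. (FAr P f, FAr Q f))\<rparr>"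

definition iso_comma_cat :: "('bo, 'bm) cat \<Rightarrow> ('co, 'cm) cat \<Rightarrow> ('do, 'dm) cat \<Rightarrow>
    ('bo, 'bm, 'do, 'dm) func \<Rightarrow> ('co, 'cm, 'do, 'dm) func \<Rightarrow>
    ('bo \<times> 'co \<times> 'dm, ('bo \<times> 'co \<times> 'dm) \<times> ('bm \<times> 'cm) \<times> ('bo \<times> 'co \<times> 'dm)) cat" where
  "iso_comma_cat B C D H K = (let
    obs = {(b, c, \<theta>). b \<in> Ob B \<and> c \<in> Ob C \<and> \<theta> \<in> Hom D (FOb H b) (FOb K c) \<and> iso D \<theta>} in \<lparr>
    Ob = obs,
    Ar = {(x, (f, g), y). x \<in> obs \<and> y \<in> obs \<and> (case (x, y) of ((b, c, \<theta>), (b', c', \<theta>')) \<Rightarrow>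
        f \<in> Hom B b b' \<and> g \<in> Hom C c c' \<and> FAr K g \<cdot>\<^bsub>D\<^esub> \<theta> = \<theta>' \<cdot>\<^bsub>D\<^esub> FAr H f)},
    Dom = (\<lambda>(x, fg, y). x),
    Cod = (\<lambda>(x, fg, y). y),
    Ide = (\<lambda>(b, c, \<theta>). ((b, c, \<theta>), (Ide B b, Ide C c), (b, c, \<theta>))),
    Cmp = (\<lambda>(y, (f', g'), z) (x, (f, g), y'). (x, (f' \<cdot>\<^bsub>B\<^esub> f, g' \<cdot>\<^bsub>C\<^esub> g), z))\<rparr>)"

definition is_pseudopullback_of_cats :: "('ao, 'am) cat \<Rightarrow> ('bo, 'bm) cat \<Rightarrow> ('co, 'cm) cat \<Rightarrow> ('do, 'dm) cat \<Rightarrow>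
    ('ao, 'am, 'bo, 'bm) func \<Rightarrow> ('ao, 'am, 'co, 'cm) func \<Rightarrow>
    ('bo, 'bm, 'do, 'dm) func \<Rightarrow> ('co, 'cm, 'do, 'dm) func \<Rightarrow> ('ao \<Rightarrow> 'dm) \<Rightarrow> bool" where
  "is_pseudopullback_of_cats A B C D P Q H K \<phi> \<longleftrightarrow>
    functor A B P \<and> functor A C Q \<and> functor B D H \<and> functor C D K \<and>
    nat_iso A D (H \<circ>\<^sub>F P) (K \<circ>\<^sub>F Q) \<phi> \<and>
    equivalence_of_cats A (iso_comma_cat B C D H K)
      \<lparr>FOb = (\<lambda>a. (FOb P a, FOb Q a, \<phi> a)),
       FAr = (\<lambda>f. ((FOb P (Dom A f), FOb Q (Dom A f), \<phi> (Dom A f)), (FAr P f, FAr Q f),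
                    (FOb P (Cod A f), FOb Q (Cod A f), \<phi> (Cod A f))))\<rparr>"


section \<open>Limits and colimits in a category\<close>

definition is_initial :: "('o, 'm) cat \<Rightarrow> 'o \<Rightarrow> bool" where
  "is_initial C z \<longleftrightarrow> z \<in> Ob C \<and> (\<forall>a\<in>Ob C. \<exists>!f. f \<in> Hom C z a)"

definition is_terminal :: "('o, 'm) cat \<Rightarrow> 'o \<Rightarrow> bool" where
  "is_terminal C t \<longleftrightarrow> t \<in> Ob C \<and> (\<forall>a\<in>Ob C. \<exists>!f. f \<in> Hom C a t)"

definition is_zero_object :: "('o, 'm) cat \<Rightarrow> 'o \<Rightarrow> bool" where
  "is_zero_object C z \<longleftrightarrow> is_initial C z \<and> is_terminal C z"

text \<open>The square \<open>f p = g q\<close> is a pullback; the vertex is \<open>Dom C p\<close>.\<close>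

definition is_pullback :: "('o, 'm) cat \<Rightarrow> 'm \<Rightarrow> 'm \<Rightarrow> 'm \<Rightarrow> 'm \<Rightarrow> bool" where
  "is_pullback C f g p q \<longleftrightarrow>
    f \<in> Ar C \<and> g \<in> Ar C \<and> Cod C f = Cod C g \<and>
    p \<in> Ar C \<and> q \<in> Ar C \<and> Dom C p = Dom C q \<and> Cod C p = Dom C f \<and> Cod C q = Dom C g \<and>
    f \<cdot>\<^bsub>C\<^esub> p = g \<cdot>\<^bsub>C\<^esub> q \<and>
    (\<forall>x\<in>Ar C. \<forall>y\<in>Ar C. Dom C x = Dom C y \<longrightarrow> Cod C x = Dom C f \<longrightarrow> Cod C y = Dom C g \<longrightarrow>
      f \<cdot>\<^bsub>C\<^esub> x = g \<cdot>\<^bsub>C\<^esub> y \<longrightarrow>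
      (\<exists>!w. w \<in> Hom C (Dom C x) (Dom C p) \<and> p \<cdot>\<^bsub>C\<^esub> w = x \<and> q \<cdot>\<^bsub>C\<^esub> w = y))"

definition finitely_complete :: "('o, 'm) cat \<Rightarrow> bool" where
  "finitely_complete C \<longleftrightarrow> (\<exists>t. is_terminal C t) \<and>
    (\<forall>f\<in>Ar C. \<forall>g\<in>Ar C. Cod C f = Cod C g \<longrightarrow> (\<exists>p q. is_pullback C f g p q))"

definition is_coproduct :: "('o, 'm) cat \<Rightarrow> 'o \<Rightarrow> 'o \<Rightarrow> 'm \<Rightarrow> 'm \<Rightarrow> bool" where
  "is_coproduct C a b i j \<longleftrightarrow>
    i \<in> Ar C \<and> j \<in> Ar C \<and> Dom C i = a \<and> Dom C j = b \<and> Cod C i = Cod C j \<and>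
    (\<forall>f\<in>Ar C. \<forall>g\<in>Ar C. Dom C f = a \<longrightarrow> Dom C g = b \<longrightarrow> Cod C f = Cod C g \<longrightarrow>
      (\<exists>!h. h \<in> Hom C (Cod C i) (Cod C f) \<and> h \<cdot>\<^bsub>C\<^esub> i = f \<and> h \<cdot>\<^bsub>C\<^esub> j = g))"

definition has_finite_coproducts :: "('o, 'm) cat \<Rightarrow> bool" where
  "has_finite_coproducts C \<longleftrightarrow> (\<exists>z. is_initial C z) \<and>
    (\<forall>a\<in>Ob C. \<forall>b\<in>Ob C. \<exists>i j. is_coproduct C a b i j)"

definition is_coequalizer :: "('o, 'm) cat \<Rightarrow> 'm \<Rightarrow> 'm \<Rightarrow> 'm \<Rightarrow> bool" where
  "is_coequalizer C u v e \<longleftrightarrow>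
    u \<in> Ar C \<and> v \<in> Ar C \<and> Dom C u = Dom C v \<and> Cod C u = Cod C v \<and>
    e \<in> Ar C \<and> Dom C e = Cod C u \<and> e \<cdot>\<^bsub>C\<^esub> u = e \<cdot>\<^bsub>C\<^esub> v \<and>
    (\<forall>x\<in>Ar C. Dom C x = Cod C u \<longrightarrow> x \<cdot>\<^bsub>C\<^esub> u = x \<cdot>\<^bsub>C\<^esub> v \<longrightarrow>
      (\<exists>!w. w \<in> Hom C (Cod C e) (Cod C x) \<and> w \<cdot>\<^bsub>C\<^esub> e = x))"

definition regular_epi :: "('o, 'm) cat \<Rightarrow> 'm \<Rightarrow> bool" where
  "regular_epi C e \<longleftrightarrow> (\<exists>u v. is_coequalizer C u v e)"


section \<open>Chosen limits and colimits\<close>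

text \<open>Canonical objects are picked with Hilbert's choice operator, so that the functors built from
  them are honest functors. The chosen arrows carry the chosen object as domain or codomain.\<close>

definition pb1 :: "('o, 'm) cat \<Rightarrow> 'm \<Rightarrow> 'm \<Rightarrow> 'm" where
  "pb1 C f g = fst (SOME (p, q). is_pullback C f g p q)"

definition pb2 :: "('o, 'm) cat \<Rightarrow> 'm \<Rightarrow> 'm \<Rightarrow> 'm" where
  "pb2 C f g = snd (SOME (p, q). is_pullback C f g p q)"

text \<open>The arrow into a pullback vertex (projections \<open>p\<close>, \<open>q\<close>) with components \<open>x\<close> and \<open>y\<close>.\<close>

definition pb_lift :: "('o, 'm) cat \<Rightarrow> 'm \<Rightarrow> 'm \<Rightarrow> 'm \<Rightarrow> 'm \<Rightarrow> 'm" where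
  "pb_lift C p q x y = (THE w. w \<in> Hom C (Dom C x) (Dom C p) \<and> p \<cdot>\<^bsub>C\<^esub> w = x \<and> q \<cdot>\<^bsub>C\<^esub> w = y)"

definition inj1 :: "('o, 'm) cat \<Rightarrow> 'o \<Rightarrow> 'o \<Rightarrow> 'm" where
  "inj1 C a b = fst (SOME (i, j). is_coproduct C a b i j)"

definition inj2 :: "('o, 'm) cat \<Rightarrow> 'o \<Rightarrow> 'o \<Rightarrow> 'm" where
  "inj2 C a b = snd (SOME (i, j). is_coproduct C a b i j)"

text \<open>\<open>cotuple C f g\<close> is \<open>[f, g]\<close> and \<open>coprod_map C f g\<close> is \<open>f + g\<close>.\<close>

definition cotuple :: "('o, 'm) cat \<Rightarrow> 'm \<Rightarrow> 'm \<Rightarrow> 'm" where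
  "cotuple C f g = (let i = inj1 C (Dom C f) (Dom C g); j = inj2 C (Dom C f) (Dom C g) in
    THE h. h \<in> Hom C (Cod C i) (Cod C f) \<and> h \<cdot>\<^bsub>C\<^esub> i = f \<and> h \<cdot>\<^bsub>C\<^esub> j = g)"

definition coprod_map :: "('o, 'm) cat \<Rightarrow> 'm \<Rightarrow> 'm \<Rightarrow> 'm" where
  "coprod_map C f g =
    cotuple C (inj1 C (Cod C f) (Cod C g) \<cdot>\<^bsub>C\<^esub> f) (inj2 C (Cod C f) (Cod C g) \<cdot>\<^bsub>C\<^esub> g)"

definition zero_ob :: "('o, 'm) cat \<Rightarrow> 'o" where
  "zero_ob C = (SOME z. is_zero_object C z)"

definition from_zero :: "('o, 'm) cat \<Rightarrow> 'o \<Rightarrow> 'm" where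
  "from_zero C a = (THE f. f \<in> Hom C (zero_ob C) a)"

definition to_zero :: "('o, 'm) cat \<Rightarrow> 'o \<Rightarrow> 'm" where
  "to_zero C a = (THE f. f \<in> Hom C a (zero_ob C))"

definition zero_arrow :: "('o, 'm) cat \<Rightarrow> 'o \<Rightarrow> 'o \<Rightarrow> 'm" where
  "zero_arrow C a b = from_zero C b \<cdot>\<^bsub>C\<^esub> to_zero C a"

definition is_kernel :: "('o, 'm) cat \<Rightarrow> 'm \<Rightarrow> 'm \<Rightarrow> bool" where
  "is_kernel C f k \<longleftrightarrow> f \<in> Ar C \<and> k \<in> Ar C \<and> Cod C k = Dom C f \<and>
    f \<cdot>\<^bsub>C\<^esub> k = zero_arrow C (Dom C k) (Cod C f) \<and>
    (\<forall>x\<in>Ar C. Cod C x = Dom C f \<longrightarrow> f \<cdot>\<^bsub>C\<^esub> x = zero_arrow C (Dom C x) (Cod C f) \<longrightarrow>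
      (\<exists>!w. w \<in> Hom C (Dom C x) (Dom C k) \<and> k \<cdot>\<^bsub>C\<^esub> w = x))"

definition ker :: "('o, 'm) cat \<Rightarrow> 'm \<Rightarrow> 'm" where
  "ker C f = (SOME k. is_kernel C f k)"

definition factor_through :: "('o, 'm) cat \<Rightarrow> 'm \<Rightarrow> 'm \<Rightarrow> 'm" where
  "factor_through C k x = (THE w. w \<in> Hom C (Dom C x) (Dom C k) \<and> k \<cdot>\<^bsub>C\<^esub> w = x)"


section \<open>Points\<close>

text \<open>A point over \<open>B\<close> is a pair \<open>(p, s)\<close> with \<open>p s = id\<^sub>B\<close>; its domain object is \<open>Dom C p\<close>.\<close>

definition Pt :: "('o, 'm) cat \<Rightarrow> 'o \<Rightarrow> ('m \<times> 'm, ('m \<times> 'm) \<times> 'm \<times> ('m \<times> 'm)) cat" where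
  "Pt C B = (let
    obs = {(p, s). p \<in> Ar C \<and> Cod C p = B \<and> s \<in> Hom C B (Dom C p) \<and> p \<cdot>\<^bsub>C\<^esub> s = Ide C B} in \<lparr>
    Ob = obs,
    Ar = {(x, h, y). x \<in> obs \<and> y \<in> obs \<and> (case (x, y) of ((p, s), (q, t)) \<Rightarrow>
        h \<in> Hom C (Dom C p) (Dom C q) \<and> q \<cdot>\<^bsub>C\<^esub> h = p \<and> h \<cdot>\<^bsub>C\<^esub> s = t)},
    Dom = (\<lambda>(x, h, y). x),
    Cod = (\<lambda>(x, h, y). y),
    Ide = (\<lambda>(p, s). ((p, s), Ide C (Dom C p), (p, s))),
    Cmp = (\<lambda>(y, h', z) (x, h, y'). (x, h' \<cdot>\<^bsub>C\<^esub> h, z))\<rparr>)"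

text \<open>\<open>pt_pullback C f\<close> is \<open>f\<^sup>*\<close>. For \<open>f: E \<rightarrow> B\<close>, the section of \<open>f\<^sup>* (p, s)\<close> has
  components \<open>id\<^sub>E\<close> and \<open>s f\<close>.\<close>

definition pt_pullback :: "('o, 'm) cat \<Rightarrow> 'm \<Rightarrow>
    ('m \<times> 'm, ('m \<times> 'm) \<times> 'm \<times> ('m \<times> 'm), 'm \<times> 'm, ('m \<times> 'm) \<times> 'm \<times> ('m \<times> 'm)) func" where
  "pt_pullback C f = (let
    ob = (\<lambda>(p, s). (pb1 C f p, pb_lift C (pb1 C f p) (pb2 C f p) (Ide C (Dom C f)) (s \<cdot>\<^bsub>C\<^esub> f))) in
    \<lparr>FOb = ob,
     FAr = (\<lambda>((p, s), h, (q, t)). (ob (p, s),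
       pb_lift C (pb1 C f q) (pb2 C f q) (pb1 C f p) (h \<cdot>\<^bsub>C\<^esub> pb2 C f p), ob (q, t)))\<rparr>)"

definition pt_map :: "('o1, 'm1, 'o2, 'm2) func \<Rightarrow>
    ('m1 \<times> 'm1, ('m1 \<times> 'm1) \<times> 'm1 \<times> ('m1 \<times> 'm1), 'm2 \<times> 'm2, ('m2 \<times> 'm2) \<times> 'm2 \<times> ('m2 \<times> 'm2)) func" where
  "pt_map U = \<lparr>FOb = (\<lambda>(p, s). (FAr U p, FAr U s)),
    FAr = (\<lambda>((p, s), h, (q, t)). ((FAr U p, FAr U s), FAr U h, (FAr U q, FAr U t)))\<rparr>"


section \<open>Exactness properties\<close>

definition is_equivalence_relation :: "('o, 'm) cat \<Rightarrow> 'm \<Rightarrow> 'm \<Rightarrow> bool" where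
  "is_equivalence_relation C r1 r2 \<longleftrightarrow>
    r1 \<in> Ar C \<and> r2 \<in> Ar C \<and> Dom C r1 = Dom C r2 \<and> Cod C r1 = Cod C r2 \<and>
    (\<forall>x\<in>Ar C. \<forall>y\<in>Ar C. Dom C x = Dom C y \<longrightarrow> Cod C x = Dom C r1 \<longrightarrow> Cod C y = Dom C r1 \<longrightarrow>
      r1 \<cdot>\<^bsub>C\<^esub> x = r1 \<cdot>\<^bsub>C\<^esub> y \<longrightarrow> r2 \<cdot>\<^bsub>C\<^esub> x = r2 \<cdot>\<^bsub>C\<^esub> y \<longrightarrow> x = y) \<and>
    (\<exists>d\<in>Hom C (Cod C r1) (Dom C r1). r1 \<cdot>\<^bsub>C\<^esub> d = Ide C (Cod C r1) \<and> r2 \<cdot>\<^bsub>C\<^esub> d = Ide C (Cod C r1)) \<and>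
    (\<exists>s\<in>Hom C (Dom C r1) (Dom C r1). r1 \<cdot>\<^bsub>C\<^esub> s = r2 \<and> r2 \<cdot>\<^bsub>C\<^esub> s = r1) \<and>
    (\<forall>p q. is_pullback C r2 r1 p q \<longrightarrow>
      (\<exists>t\<in>Hom C (Dom C p) (Dom C r1). r1 \<cdot>\<^bsub>C\<^esub> t = r1 \<cdot>\<^bsub>C\<^esub> p \<and> r2 \<cdot>\<^bsub>C\<^esub> t = r2 \<cdot>\<^bsub>C\<^esub> q))"

definition regular_category :: "('o, 'm) cat \<Rightarrow> bool" where
  "regular_category C \<longleftrightarrow> category C \<and> finitely_complete C \<and>
    (\<forall>f p q. is_pullback C f f p q \<longrightarrow> (\<exists>e. is_coequalizer C p q e)) \<and>
    (\<forall>f g p q. is_pullback C f g p q \<longrightarrow> regular_epi C g \<longrightarrow> regular_epi C p)"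

definition barr_exact :: "('o, 'm) cat \<Rightarrow> bool" where
  "barr_exact C \<longleftrightarrow> regular_category C \<and>
    (\<forall>r1 r2. is_equivalence_relation C r1 r2 \<longrightarrow> (\<exists>f. is_pullback C f f r1 r2))"

definition protomodular :: "('o, 'm) cat \<Rightarrow> bool" where
  "protomodular C \<longleftrightarrow> category C \<and> finitely_complete C \<and>
    (\<forall>f\<in>Ar C. reflects_isos (Pt C (Cod C f)) (Pt C (Dom C f)) (pt_pullback C f))"

definition pointed :: "('o, 'm) cat \<Rightarrow> bool" where
  "pointed C \<longleftrightarrow> (\<exists>z. is_zero_object C z)"

definition semi_abelian :: "('o, 'm) cat \<Rightarrow> bool" where
  "semi_abelian C \<longleftrightarrow> category C \<and> pointed C \<and> protomodular C \<and> barr_exact C \<and> has_finite_coproducts C"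

definition ideally_exact :: "('o, 'm) cat \<Rightarrow> bool" where
  "ideally_exact C \<longleftrightarrow> category C \<and> barr_exact C \<and> protomodular C \<and> has_finite_coproducts C \<and>
    (\<forall>z t f. is_initial C z \<longrightarrow> is_terminal C t \<longrightarrow> f \<in> Hom C z t \<longrightarrow> regular_epi C f)"


section \<open>Monads and adjunctions\<close>

record ('o, 'm) monad =
  MFun :: "('o, 'm, 'o, 'm) func"
  MUnit :: "'o \<Rightarrow> 'm"
  MMult :: "'o \<Rightarrow> 'm"

definition Alg :: "('o, 'm) cat \<Rightarrow> ('o, 'm) monad \<Rightarrow> ('o \<times> 'm, ('o \<times> 'm) \<times> 'm \<times> ('o \<times> 'm)) cat" where
  "Alg C T = (let
    obs = {(X, \<xi>). X \<in> Ob C \<and> \<xi> \<in> Hom C (FOb (MFun T) X) X \<and>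
      \<xi> \<cdot>\<^bsub>C\<^esub> MUnit T X = Ide C X \<and> \<xi> \<cdot>\<^bsub>C\<^esub> MMult T X = \<xi> \<cdot>\<^bsub>C\<^esub> FAr (MFun T) \<xi>} in \<lparr>
    Ob = obs,
    Ar = {(x, f, y). x \<in> obs \<and> y \<in> obs \<and> (case (x, y) of ((X, \<xi>), (Y, \<theta>)) \<Rightarrow>
        f \<in> Hom C X Y \<and> f \<cdot>\<^bsub>C\<^esub> \<xi> = \<theta> \<cdot>\<^bsub>C\<^esub> FAr (MFun T) f)},
    Dom = (\<lambda>(x, f, y). x),
    Cod = (\<lambda>(x, f, y). y),
    Ide = (\<lambda>(X, \<xi>). ((X, \<xi>), Ide C X, (X, \<xi>))),
    Cmp = (\<lambda>(y, f', z) (x, f, y'). (x, f' \<cdot>\<^bsub>C\<^esub> f, z))\<rparr>)"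

definition alg_forget :: "('o \<times> 'm, ('o \<times> 'm) \<times> 'm \<times> ('o \<times> 'm), 'o, 'm) func" where
  "alg_forget = \<lparr>FOb = (\<lambda>(X, \<xi>). X), FAr = (\<lambda>(x, f, y). f)\<rparr>"

text \<open>\<open>alg_restrict C \<gamma>\<close> is \<open>(-) \<circ> \<gamma>\<close>.\<close>

definition alg_restrict :: "('o, 'm) cat \<Rightarrow> ('o \<Rightarrow> 'm) \<Rightarrow>
    ('o \<times> 'm, ('o \<times> 'm) \<times> 'm \<times> ('o \<times> 'm), 'o \<times> 'm, ('o \<times> 'm) \<times> 'm \<times> ('o \<times> 'm)) func" where
  "alg_restrict C \<gamma> = \<lparr>FOb = (\<lambda>(X, \<xi>). (X, \<xi> \<cdot>\<^bsub>C\<^esub> \<gamma> X)),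
    FAr = (\<lambda>((X, \<xi>), f, (Y, \<theta>)). ((X, \<xi> \<cdot>\<^bsub>C\<^esub> \<gamma> X), f, (Y, \<theta> \<cdot>\<^bsub>C\<^esub> \<gamma> Y)))\<rparr>"

text \<open>\<open>UC\<close> is the domain and \<open>VC\<close> the codomain of the right adjoint \<open>Radj\<close>.\<close>

record ('uo, 'um, 'vo, 'vm) adj =
  UC :: "('uo, 'um) cat"
  VC :: "('vo, 'vm) cat"
  Ladj :: "('vo, 'vm, 'uo, 'um) func"
  Radj :: "('uo, 'um, 'vo, 'vm) func"
  Unit :: "'vo \<Rightarrow> 'vm"
  Counit :: "'uo \<Rightarrow> 'um"

definition adjunction :: "('uo, 'um, 'vo, 'vm) adj \<Rightarrow> bool" where
  "adjunction A \<longleftrightarrow>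
    functor (VC A) (UC A) (Ladj A) \<and> functor (UC A) (VC A) (Radj A) \<and>
    nat_trans (VC A) (VC A) id_func (Radj A \<circ>\<^sub>F Ladj A) (Unit A) \<and>
    nat_trans (UC A) (UC A) (Ladj A \<circ>\<^sub>F Radj A) id_func (Counit A) \<and>
    (\<forall>X\<in>Ob (VC A). Counit A (FOb (Ladj A) X) \<cdot>\<^bsub>UC A\<^esub> FAr (Ladj A) (Unit A X) = Ide (UC A) (FOb (Ladj A) X)) \<and>
    (\<forall>B\<in>Ob (UC A). FAr (Radj A) (Counit A B) \<cdot>\<^bsub>VC A\<^esub> Unit A (FOb (Radj A) B) = Ide (VC A) (FOb (Radj A) B))"

definition adj_monad :: "('uo, 'um, 'vo, 'vm) adj \<Rightarrow> ('vo, 'vm) monad" where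
  "adj_monad A = \<lparr>MFun = Radj A \<circ>\<^sub>F Ladj A, MUnit = Unit A,
    MMult = (\<lambda>X. FAr (Radj A) (Counit A (FOb (Ladj A) X)))\<rparr>"

definition adj_comparison :: "('uo, 'um, 'vo, 'vm) adj \<Rightarrow>
    ('uo, 'um, 'vo \<times> 'vm, ('vo \<times> 'vm) \<times> 'vm \<times> ('vo \<times> 'vm)) func" where
  "adj_comparison A = (let ob = (\<lambda>B. (FOb (Radj A) B, FAr (Radj A) (Counit A B))) in
    \<lparr>FOb = ob, FAr = (\<lambda>f. (ob (Dom (UC A) f), FAr (Radj A) f, ob (Cod (UC A) f)))\<rparr>)"

definition monadic :: "('uo, 'um, 'vo, 'vm) adj \<Rightarrow> bool" where
  "monadic A \<longleftrightarrow> equivalence_of_cats (UC A) (Alg (VC A) (adj_monad A)) (adj_comparison A)"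

definition cartesian_unit :: "('uo, 'um, 'vo, 'vm) adj \<Rightarrow> bool" where
  "cartesian_unit A \<longleftrightarrow> (\<forall>f\<in>Ar (VC A). is_pullback (VC A)
    (Unit A (Cod (VC A) f)) (FAr (Radj A \<circ>\<^sub>F Ladj A) f) f (Unit A (Dom (VC A) f)))"

definition ideally_exact_context :: "('uo, 'um, 'vo, 'vm) adj \<Rightarrow> bool" where
  "ideally_exact_context A \<longleftrightarrow> adjunction A \<and> monadic A \<and>
    ideally_exact (UC A) \<and> semi_abelian (VC A) \<and> cartesian_unit A"


section \<open>Internal actions\<close>

definition flat_kappa :: "('o, 'm) cat \<Rightarrow> 'o \<Rightarrow> 'o \<Rightarrow> 'm" where
  "flat_kappa C D X = ker C (cotuple C (Ide C D) (zero_arrow C X D))"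

definition flat_ob :: "('o, 'm) cat \<Rightarrow> 'o \<Rightarrow> 'o \<Rightarrow> 'o" where
  "flat_ob C D X = Dom C (flat_kappa C D X)"

text \<open>\<open>flat_map C g f\<close> is \<open>g \<flat> f\<close>.\<close>

definition flat_map :: "('o, 'm) cat \<Rightarrow> 'm \<Rightarrow> 'm \<Rightarrow> 'm" where
  "flat_map C g f = factor_through C (flat_kappa C (Cod C g) (Cod C f))
    (coprod_map C g f \<cdot>\<^bsub>C\<^esub> flat_kappa C (Dom C g) (Dom C f))"

definition flat_monad :: "('o, 'm) cat \<Rightarrow> 'o \<Rightarrow> ('o, 'm) monad" where
  "flat_monad C D = \<lparr>
    MFun = \<lparr>FOb = flat_ob C D, FAr = flat_map C (Ide C D)\<rparr>,
    MUnit = (\<lambda>X. factor_through C (flat_kappa C D X) (inj2 C D X)),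
    MMult = (\<lambda>X. factor_through C (flat_kappa C D X)
      (cotuple C (inj1 C D X) (flat_kappa C D X) \<cdot>\<^bsub>C\<^esub> flat_kappa C D (flat_ob C D X)))\<rparr>"

definition action :: "('o, 'm) cat \<Rightarrow> 'o \<Rightarrow> 'o \<Rightarrow> 'm \<Rightarrow> bool" where
  "action C D X \<xi> \<longleftrightarrow> (X, \<xi>) \<in> Ob (Alg C (flat_monad C D))"

text \<open>\<open>assoc_point C D X \<xi> p s k\<close>: the point \<open>(p, s)\<close> over \<open>D\<close> is associated with \<open>\<xi>: D \<flat> X \<rightarrow> X\<close>
  via the kernel \<open>k\<close> of \<open>p\<close>.\<close>

definition assoc_point :: "('o, 'm) cat \<Rightarrow> 'o \<Rightarrow> 'o \<Rightarrow> 'm \<Rightarrow> 'm \<Rightarrow> 'm \<Rightarrow> 'm \<Rightarrow> bool" where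
  "assoc_point C D X \<xi> p s k \<longleftrightarrow> (p, s) \<in> Ob (Pt C D) \<and> is_kernel C p k \<and> Dom C k = X \<and>
    k \<cdot>\<^bsub>C\<^esub> \<xi> = cotuple C s k \<cdot>\<^bsub>C\<^esub> flat_kappa C D X"


section \<open>Relative actions in an ideally exact context\<close>

definition F0 :: "('uo, 'um, 'vo, 'vm) adj \<Rightarrow> 'uo" where
  "F0 A = FOb (Ladj A) (zero_ob (VC A))"

definition iota :: "('uo, 'um, 'vo, 'vm) adj \<Rightarrow> 'uo \<Rightarrow> 'um" where
  "iota A B = (THE f. f \<in> Hom (UC A) (F0 A) B)"

definition UB_monad :: "('uo, 'um, 'vo, 'vm) adj \<Rightarrow> 'uo \<Rightarrow> ('vo, 'vm) monad" where
  "UB_monad A B = flat_monad (VC A) (FOb (Radj A) B)"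

definition relative_action :: "('uo, 'um, 'vo, 'vm) adj \<Rightarrow> 'uo \<Rightarrow> 'vo \<Rightarrow> 'vm \<Rightarrow> bool" where
  "relative_action A B X \<xi> \<longleftrightarrow> action (VC A) (FOb (Radj A) B) X \<xi>"

definition xi0 :: "('uo, 'um, 'vo, 'vm) adj \<Rightarrow> 'vo \<Rightarrow> 'vm" where
  "xi0 A X = factor_through (VC A) (Unit A X)
    (cotuple (VC A) (FAr (Radj A \<circ>\<^sub>F Ladj A) (from_zero (VC A) X)) (Unit A X)
      \<cdot>\<^bsub>VC A\<^esub> flat_kappa (VC A) (FOb (Radj A) (F0 A)) X)"

definition xi0_func :: "('uo, 'um, 'vo, 'vm) adj \<Rightarrow>
    ('vo, 'vm, 'vo \<times> 'vm, ('vo \<times> 'vm) \<times> 'vm \<times> ('vo \<times> 'vm)) func" where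
  "xi0_func A = \<lparr>FOb = (\<lambda>X. (X, xi0 A X)),
    FAr = (\<lambda>f. ((Dom (VC A) f, xi0 A (Dom (VC A) f)), f, (Cod (VC A) f, xi0 A (Cod (VC A) f))))\<rparr>"

text \<open>The components of the monad morphism \<open>U(\<iota>\<^sub>B) \<flat> id\<close>.\<close>

definition iota_flat :: "('uo, 'um, 'vo, 'vm) adj \<Rightarrow> 'uo \<Rightarrow> 'vo \<Rightarrow> 'vm" where
  "iota_flat A B X = flat_map (VC A) (FAr (Radj A) (iota A B)) (Ide (VC A) X)"

definition coherent :: "('uo, 'um, 'vo, 'vm) adj \<Rightarrow> 'uo \<Rightarrow> 'vo \<Rightarrow> 'vm \<Rightarrow> bool" where
  "coherent A B X \<xi> \<longleftrightarrow> \<xi> \<cdot>\<^bsub>VC A\<^esub> iota_flat A B X = xi0 A X"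

text \<open>\<open>lifts_point A B p' s' \<sigma> p s\<close>: the point \<open>(p', s')\<close> of \<open>UC A\<close> over \<open>B\<close> corresponds to the point
  \<open>(p, s)\<close> of \<open>VC A\<close> over \<open>U(B)\<close> via the isomorphism \<open>\<sigma>\<close>.\<close>

definition lifts_point :: "('uo, 'um, 'vo, 'vm) adj \<Rightarrow> 'uo \<Rightarrow> 'um \<Rightarrow> 'um \<Rightarrow> 'vm \<Rightarrow> 'vm \<Rightarrow> 'vm \<Rightarrow> bool" where
  "lifts_point A B p' s' \<sigma> p s \<longleftrightarrow> (p', s') \<in> Ob (Pt (UC A) B) \<and>
    \<sigma> \<in> Hom (VC A) (FOb (Radj A) (Dom (UC A) p')) (Dom (VC A) p) \<and> iso (VC A) \<sigma> \<and>
    p \<cdot>\<^bsub>VC A\<^esub> \<sigma> = FAr (Radj A) p' \<and> \<sigma> \<cdot>\<^bsub>VC A\<^esub> FAr (Radj A) s' = s"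

definition ideal_point :: "('uo, 'um, 'vo, 'vm) adj \<Rightarrow> 'uo \<Rightarrow> 'vm \<Rightarrow> 'vm \<Rightarrow> bool" where
  "ideal_point A B p s \<longleftrightarrow> (p, s) \<in> Ob (Pt (VC A) (FOb (Radj A) B)) \<and>
    (\<exists>p' s' \<sigma>. lifts_point A B p' s' \<sigma> p s)"

definition ideal_action :: "('uo, 'um, 'vo, 'vm) adj \<Rightarrow> 'uo \<Rightarrow> 'vo \<Rightarrow> 'vm \<Rightarrow> bool" where
  "ideal_action A B X \<xi> \<longleftrightarrow> relative_action A B X \<xi> \<and>
    (\<forall>p s k. assoc_point (VC A) (FOb (Radj A) B) X \<xi> p s k \<longrightarrow> ideal_point A B p s)"

definition ideal_point_morphism :: "('uo, 'um, 'vo, 'vm) adj \<Rightarrow> 'uo \<Rightarrow> 'vm \<times> 'vm \<Rightarrow> 'vm \<Rightarrow> 'vm \<times> 'vm \<Rightarrow> bool" where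
  "ideal_point_morphism A B x1 h x2 \<longleftrightarrow> (x1, h, x2) \<in> Ar (Pt (VC A) (FOb (Radj A) B)) \<and>
    (\<exists>p1' s1' \<sigma>1 p2' s2' \<sigma>2 h'.
      lifts_point A B p1' s1' \<sigma>1 (fst x1) (snd x1) \<and> lifts_point A B p2' s2' \<sigma>2 (fst x2) (snd x2) \<and>
      ((p1', s1'), h', (p2', s2')) \<in> Ar (Pt (UC A) B) \<and>
      h \<cdot>\<^bsub>VC A\<^esub> \<sigma>1 = \<sigma>2 \<cdot>\<^bsub>VC A\<^esub> FAr (Radj A) h')"

text \<open>Under the equivalence between points and actions, the morphism of points corresponding to the
  morphism of actions \<open>f: (X\<^sub>1, \<xi>\<^sub>1) \<rightarrow> (X\<^sub>2, \<xi>\<^sub>2)\<close> is the \<open>h\<close> that restricts to \<open>f\<close> on the kernels.\<close>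

definition ideal_action_morphism :: "('uo, 'um, 'vo, 'vm) adj \<Rightarrow> 'uo \<Rightarrow> 'vo \<times> 'vm \<Rightarrow> 'vm \<Rightarrow> 'vo \<times> 'vm \<Rightarrow> bool" where
  "ideal_action_morphism A B x1 f x2 \<longleftrightarrow> (x1, f, x2) \<in> Ar (Alg (VC A) (UB_monad A B)) \<and>
    (\<forall>p1 s1 k1 p2 s2 k2 h.
      assoc_point (VC A) (FOb (Radj A) B) (fst x1) (snd x1) p1 s1 k1 \<longrightarrow>
      assoc_point (VC A) (FOb (Radj A) B) (fst x2) (snd x2) p2 s2 k2 \<longrightarrow>
      ((p1, s1), h, (p2, s2)) \<in> Ar (Pt (VC A) (FOb (Radj A) B)) \<longrightarrow>
      h \<cdot>\<^bsub>VC A\<^esub> k1 = k2 \<cdot>\<^bsub>VC A\<^esub> f \<longrightarrow>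
      ideal_point_morphism A B (p1, s1) h (p2, s2))"

definition BAT :: "('uo, 'um, 'vo, 'vm) adj \<Rightarrow> bool" where
  "BAT A \<longleftrightarrow>
    (\<forall>B\<in>Ob (UC A). \<forall>X \<xi>. relative_action A B X \<xi> \<longrightarrow> coherent A B X \<xi> \<longrightarrow> ideal_action A B X \<xi>) \<and>
    (\<forall>B\<in>Ob (UC A). \<forall>X1 \<xi>1 X2 \<xi>2 f.
      ((X1, \<xi>1), f, (X2, \<xi>2)) \<in> Ar (Alg (VC A) (UB_monad A B)) \<longrightarrow>
      coherent A B X1 \<xi>1 \<longrightarrow> coherent A B X2 \<xi>2 \<longrightarrow>
      ideal_action_morphism A B (X1, \<xi>1) f (X2, \<xi>2))"


section \<open>The monad \<open>B # (-)\<close>\<close>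

text \<open>\<open>sharp_adj A B\<close> is the adjunction \<open>F\<^sup>B \<stileturn> U\<^sup>B\<close> between \<open>Pt (UC A) B\<close> and \<open>VC A\<close>.\<close>

definition sharp_point :: "('uo, 'um, 'vo, 'vm) adj \<Rightarrow> 'uo \<Rightarrow> 'vo \<Rightarrow> 'um \<times> 'um" where
  "sharp_point A B X =
    (cotuple (UC A) (Ide (UC A) B) (iota A B \<cdot>\<^bsub>UC A\<^esub> FAr (Ladj A) (to_zero (VC A) X)),
     inj1 (UC A) B (FOb (Ladj A) X))"

definition sharp_kappa :: "('uo, 'um, 'vo, 'vm) adj \<Rightarrow> 'uo \<Rightarrow> 'vo \<Rightarrow> 'vm" where
  "sharp_kappa A B X = ker (VC A) (FAr (Radj A) (fst (sharp_point A B X)))"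

definition sharp_adj :: "('uo, 'um, 'vo, 'vm) adj \<Rightarrow> 'uo \<Rightarrow>
    ('um \<times> 'um, ('um \<times> 'um) \<times> 'um \<times> ('um \<times> 'um), 'vo, 'vm) adj" where
  "sharp_adj A B = \<lparr>
    UC = Pt (UC A) B,
    VC = VC A,
    Ladj = \<lparr>FOb = sharp_point A B,
      FAr = (\<lambda>f. (sharp_point A B (Dom (VC A) f),
        coprod_map (UC A) (Ide (UC A) B) (FAr (Ladj A) f), sharp_point A B (Cod (VC A) f)))\<rparr>,
    Radj = \<lparr>FOb = (\<lambda>(p, s). Dom (VC A) (ker (VC A) (FAr (Radj A) p))),
      FAr = (\<lambda>((p, s), h, (q, t)). factor_through (VC A) (ker (VC A) (FAr (Radj A) q))
        (FAr (Radj A) h \<cdot>\<^bsub>VC A\<^esub> ker (VC A) (FAr (Radj A) p)))\<rparr>,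
    Unit = (\<lambda>X. factor_through (VC A) (sharp_kappa A B X)
      (FAr (Radj A) (inj2 (UC A) B (FOb (Ladj A) X)) \<cdot>\<^bsub>VC A\<^esub> Unit A X)),
    Counit = (\<lambda>(p, s). let k = ker (VC A) (FAr (Radj A) p) in
      (sharp_point A B (Dom (VC A) k),
       cotuple (UC A) s (Counit A (Dom (UC A) p) \<cdot>\<^bsub>UC A\<^esub> FAr (Ladj A) k),
       (p, s)))\<rparr>"

definition sharp_monad :: "('uo, 'um, 'vo, 'vm) adj \<Rightarrow> 'uo \<Rightarrow> ('vo, 'vm) monad" where
  "sharp_monad A B = adj_monad (sharp_adj A B)"

definition gamma :: "('uo, 'um, 'vo, 'vm) adj \<Rightarrow> 'uo \<Rightarrow> 'vo \<Rightarrow> 'vm" where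
  "gamma A B X = factor_through (VC A) (sharp_kappa A B X)
    (cotuple (VC A)
       (FAr (Radj A) (inj1 (UC A) B (FOb (Ladj A) X)))
       (FAr (Radj A) (inj2 (UC A) B (FOb (Ladj A) X)) \<cdot>\<^bsub>VC A\<^esub> Unit A X)
     \<cdot>\<^bsub>VC A\<^esub> flat_kappa (VC A) (FOb (Radj A) B) X)"


section \<open>The square of change-of-base functors\<close>

text \<open>The canonical isomorphism \<open>U(\<iota>\<^sub>B)\<^sup>* U' \<cong> U\<^sub>0' \<iota>\<^sub>B\<^sup>*\<close>: as \<open>U\<close> preserves pullbacks, both sides
  are pullbacks of \<open>U(p')\<close> along \<open>U(\<iota>\<^sub>B)\<close>, and the isomorphism commutes with the projections.\<close>

definition base_change_iso :: "('uo, 'um, 'vo, 'vm) adj \<Rightarrow> 'uo \<Rightarrow> 'um \<times> 'um \<Rightarrow>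
    ('vm \<times> 'vm) \<times> 'vm \<times> ('vm \<times> 'vm)" where
  "base_change_iso A B x = (let U = FAr (Radj A); \<iota> = iota A B; p = fst x in
    (FOb (pt_pullback (VC A) (U \<iota>) \<circ>\<^sub>F pt_map (Radj A)) x,
     pb_lift (VC A) (U (pb1 (UC A) \<iota> p)) (U (pb2 (UC A) \<iota> p))
       (pb1 (VC A) (U \<iota>) (U p)) (pb2 (VC A) (U \<iota>) (U p)),
     FOb (pt_map (Radj A) \<circ>\<^sub>F pt_pullback (UC A) \<iota>) x))"

end

theory Submission
  imports Defs
begin

text \<open>All three conditions say the same thing about points: for each \<open>B\<close>, (a) every point over \<open>U(B)\<close>
  whose action is coherent is isomorphic to the image of a point over \<open>B\<close>, and (b) every morphism
  over \<open>U(B)\<close> between images of points over \<open>B\<close> is the image of a morphism over \<open>B\<close>.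

  The bridge to algebras is the monadicity of the kernel functor \<open>U\<^sup>B\<close>. An algebra is turned into a point
  by taking the quotient of the image of the reflexive pair \<open>B + F(B # X) \<rightrightarrows> B + F(X)\<close>; this image is an
  effective equivalence relation, since relations in protomodular categories are difunctional and \<open>U\<close>
  is exact, and the kernel of the quotient is computed by a split coequalizer. The monad \<open>D \<flat> (-)\<close> is
  the instance of \<open>B # (-)\<close> for the identity adjunction, so the equivalence between points and internal
  actions comes for free. As the unit is cartesian, \<open>\<eta>\<^sub>X\<close> is a kernel and points over \<open>F(0)\<close> are the same as
  objects of \<open>V\<close>; hence an action is coherent iff the base change of its point to \<open>UF(0)\<close> is the image of
  a point over \<open>F(0)\<close>, and \<open>U\<close> is fully faithful on points over \<open>F(0)\<close>.\<close>

section \<open>Categories, regular epimorphisms and finite limits\<close>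

text \<open>Monadicity is used through two consequences: the right adjoint is faithful and reflects
  isomorphisms. That it preserves regular epimorphisms is not formal and has to be extracted from
  the cartesian unit. Exactness supplies coequalizers of kernel pairs only, which is why a reflexive
  pair is replaced by its image before a quotient is taken. The pullback in (ii) is strict while
  points lift only up to isomorphism; the gap closes because an isomorphism of points carries the
  action over unchanged, moving only the kernel. Fullness on isomorphisms serves the passage from
  (i): an ideal morphism lifts between some points corresponding to its ends, and the two comparison
  isomorphisms must themselves lift to move it to the given ends. The functors in (ii) and (iii) are
  built from chosen kernels and pullbacks, but the argument needs arbitrary ones; hence the
  relations \<open>sact\<close> and \<open>point_action\<close>, which tie an algebra to any point
  and any kernel of it.\<close>

lemma Hom_iff [simp]: "f \<in> Hom C a b \<longleftrightarrow> f \<in> Ar C \<and> Dom C f = a \<and> Cod C f = b"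
  by (simp add: Hom_def)

definition monic :: "('o, 'm) cat \<Rightarrow> 'm \<Rightarrow> bool" where
  "monic C m \<longleftrightarrow> m \<in> Ar C \<and> (\<forall>x\<in>Ar C. \<forall>y\<in>Ar C. Dom C x = Dom C y \<longrightarrow> Cod C x = Dom C m \<longrightarrow>
    Cod C y = Dom C m \<longrightarrow> m \<cdot>\<^bsub>C\<^esub> x = m \<cdot>\<^bsub>C\<^esub> y \<longrightarrow> x = y)"

definition is_product :: "('o, 'm) cat \<Rightarrow> 'o \<Rightarrow> 'o \<Rightarrow> 'm \<Rightarrow> 'm \<Rightarrow> bool" where
  "is_product C a b p q \<longleftrightarrow> p \<in> Ar C \<and> q \<in> Ar C \<and> Dom C q = Dom C p \<and> Cod C p = a \<and> Cod C q = b \<and>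
    (\<forall>x\<in>Ar C. \<forall>y\<in>Ar C. Dom C x = Dom C y \<longrightarrow> Cod C x = a \<longrightarrow> Cod C y = b \<longrightarrow>
      (\<exists>w. w \<in> Ar C \<and> Dom C w = Dom C x \<and> Cod C w = Dom C p \<and> p \<cdot>\<^bsub>C\<^esub> w = x \<and> q \<cdot>\<^bsub>C\<^esub> w = y)) \<and>
    (\<forall>w\<in>Ar C. \<forall>w'\<in>Ar C. Dom C w = Dom C w' \<longrightarrow> Cod C w = Dom C p \<longrightarrow> Cod C w' = Dom C p \<longrightarrow>
      p \<cdot>\<^bsub>C\<^esub> w = p \<cdot>\<^bsub>C\<^esub> w' \<longrightarrow> q \<cdot>\<^bsub>C\<^esub> w = q \<cdot>\<^bsub>C\<^esub> w' \<longrightarrow> w = w')"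

text \<open>\<open>iso\<close> hides the inverse behind a quantifier. With both arrows named,
  \<open>invD\<close> delivers the typing facts and the two cancellation rules at once.\<close>

definition inverse_arrows :: "('o, 'm) cat \<Rightarrow> 'm \<Rightarrow> 'm \<Rightarrow> bool" where
  "inverse_arrows C f g \<longleftrightarrow> f \<in> Ar C \<and> g \<in> Ar C \<and> Dom C g = Cod C f \<and> Cod C g = Dom C f \<and>
    g \<cdot>\<^bsub>C\<^esub> f = Ide C (Dom C f) \<and> f \<cdot>\<^bsub>C\<^esub> g = Ide C (Cod C f)"

text \<open>Packed typing conditions: as premises of an instantiated fact, bare equations between objects
  can make the simplifier loop.\<close>

definition composable :: "('o, 'm) cat \<Rightarrow> 'm \<Rightarrow> 'm \<Rightarrow> bool" where
  "composable C g f \<longleftrightarrow> f \<in> Ar C \<and> g \<in> Ar C \<and> Cod C f = Dom C g"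

definition cone :: "('o, 'm) cat \<Rightarrow> 'm \<Rightarrow> 'm \<Rightarrow> 'm \<Rightarrow> 'm \<Rightarrow> bool" where
  "cone C f g x y \<longleftrightarrow> x \<in> Ar C \<and> y \<in> Ar C \<and> Dom C x = Dom C y \<and> Cod C x = Dom C f \<and> Cod C y = Dom C g \<and>
    f \<cdot>\<^bsub>C\<^esub> x = g \<cdot>\<^bsub>C\<^esub> y"

locale cat_loc =
  fixes C :: "('o, 'm) cat" (structure)
  assumes cat: "category C"
begin

lemma Dom_Ob [simp]: "f \<in> Ar C \<Longrightarrow> Dom C f \<in> Ob C"
  and Cod_Ob [simp]: "f \<in> Ar C \<Longrightarrow> Cod C f \<in> Ob C"
  and Ide_Ar [simp]: "a \<in> Ob C \<Longrightarrow> Ide C a \<in> Ar C"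
  and Dom_Ide [simp]: "a \<in> Ob C \<Longrightarrow> Dom C (Ide C a) = a"
  and Cod_Ide [simp]: "a \<in> Ob C \<Longrightarrow> Cod C (Ide C a) = a"
  and Cmp_Ar [simp]: "\<lbrakk>f \<in> Ar C; g \<in> Ar C; Cod C f = Dom C g\<rbrakk> \<Longrightarrow> g \<cdot> f \<in> Ar C"
  and Dom_Cmp [simp]: "\<lbrakk>f \<in> Ar C; g \<in> Ar C; Cod C f = Dom C g\<rbrakk> \<Longrightarrow> Dom C (g \<cdot> f) = Dom C f"
  and Cod_Cmp [simp]: "\<lbrakk>f \<in> Ar C; g \<in> Ar C; Cod C f = Dom C g\<rbrakk> \<Longrightarrow> Cod C (g \<cdot> f) = Cod C g"
  and Cmp_Ide [simp]: "\<lbrakk>f \<in> Ar C; Dom C f = a\<rbrakk> \<Longrightarrow> f \<cdot> Ide C a = f"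
  and Ide_Cmp [simp]: "\<lbrakk>f \<in> Ar C; Cod C f = a\<rbrakk> \<Longrightarrow> Ide C a \<cdot> f = f"
  and assoc [simp]: "\<lbrakk>f \<in> Ar C; g \<in> Ar C; h \<in> Ar C; Cod C f = Dom C g; Cod C g = Dom C h\<rbrakk> \<Longrightarrow>
      (h \<cdot> g) \<cdot> f = h \<cdot> (g \<cdot> f)"
  using cat by (auto simp: category_def Hom_def)

lemma composableI [simp]: "\<lbrakk>f \<in> Ar C; g \<in> Ar C; Cod C f = Dom C g\<rbrakk> \<Longrightarrow> composable C g f"
  by (simp add: composable_def)

text \<open>Composites are normalized to the right by \<open>assoc\<close>, so an equation between
  two-fold composites no longer matches inside a longer one. This rule and \<open>cmp_ext1\<close>
  extend such an equation by a further arrow.\<close>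

lemma cmp_ext:
  assumes "g \<cdot> f = g' \<cdot> f'" "composable C g f" "composable C g' f'" "composable C f x" "composable C f' x"
  shows "g \<cdot> (f \<cdot> x) = g' \<cdot> (f' \<cdot> x)"
proof -
  have "(g \<cdot> f) \<cdot> x = (g' \<cdot> f') \<cdot> x" using assms(1) by presburger
  thus ?thesis using assms(2-) by (simp add: composable_def)
qed

lemma cmp_ext1:
  assumes "g \<cdot> f = h" "composable C g f" "composable C f x"
  shows "g \<cdot> (f \<cdot> x) = h \<cdot> x"
  using assms(2-) by (simp add: composable_def flip: assms(1))

lemma monicD: "\<lbrakk>monic C m; x \<in> Ar C; y \<in> Ar C; Dom C x = Dom C y; Cod C x = Dom C m;
    Cod C y = Dom C m; m \<cdot> x = m \<cdot> y\<rbrakk> \<Longrightarrow> x = y"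
  by (auto simp: monic_def)

lemma isoI: "\<lbrakk>f \<in> Hom C a b; g \<in> Hom C b a; g \<cdot> f = Ide C a; f \<cdot> g = Ide C b\<rbrakk> \<Longrightarrow> iso C f"
  unfolding iso_def by auto

lemma isoE:
  assumes "iso C f"
  obtains g where "inverse_arrows C f g"
  using assms by (auto simp: iso_def inverse_arrows_def)

lemma inverse_arrows_iso: "inverse_arrows C f g \<Longrightarrow> iso C f" "inverse_arrows C f g \<Longrightarrow> iso C g"
  by (auto simp: iso_def inverse_arrows_def)

lemma invD:
  assumes "inverse_arrows C f g"
  shows "f \<in> Ar C" "g \<in> Ar C" "Dom C g = Cod C f" "Cod C g = Dom C f"
    "g \<cdot> f = Ide C (Dom C f)" "f \<cdot> g = Ide C (Cod C f)"
    "\<And>x. x \<in> Ar C \<Longrightarrow> Cod C x = Dom C f \<Longrightarrow> g \<cdot> (f \<cdot> x) = x"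
    "\<And>x. x \<in> Ar C \<Longrightarrow> Cod C x = Cod C f \<Longrightarrow> f \<cdot> (g \<cdot> x) = x"
proof -
  show g: "f \<in> Ar C" "g \<in> Ar C" "Dom C g = Cod C f" "Cod C g = Dom C f"
    "g \<cdot> f = Ide C (Dom C f)" "f \<cdot> g = Ide C (Cod C f)" using assms by (auto simp: inverse_arrows_def)
  show "g \<cdot> (f \<cdot> x) = x" if "x \<in> Ar C" "Cod C x = Dom C f" for x
    using cmp_ext1[OF g(5), of x] g that by simp
  show "f \<cdot> (g \<cdot> x) = x" if "x \<in> Ar C" "Cod C x = Cod C f" for x
    using cmp_ext1[OF g(6), of x] g that by simp
qed

lemma iso_Ide [simp]: "a \<in> Ob C \<Longrightarrow> iso C (Ide C a)"
  by (rule isoI[of _ a a "Ide C a"]) simp_all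

lemma iso_Ar: "iso C f \<Longrightarrow> f \<in> Ar C"
  by (simp add: iso_def)

lemma iso_comp:
  assumes "iso C f" "iso C g" "Cod C f = Dom C g"
  shows "iso C (g \<cdot> f)"
proof -
  obtain f' g' where fg: "inverse_arrows C f f'" "inverse_arrows C g g'" using assms isoE by metis
  note f' = invD[OF fg(1)] and g' = invD[OF fg(2)]
  show ?thesis
    by (rule isoI[of _ "Dom C f" "Cod C g" "f' \<cdot> g'"]) (use f' g' assms(3) in simp_all)
qed

lemma iso_monic:
  assumes "iso C f" shows "monic C f"
proof -
  obtain g where g: "inverse_arrows C f g" using assms by (rule isoE)
  note g' = invD(7)[OF g]
  have "x = y" if "x \<in> Ar C" "y \<in> Ar C" "Cod C x = Dom C f" "Cod C y = Dom C f" "f \<cdot> x = f \<cdot> y" for x y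
    using g'[OF that(1,3)] g'[OF that(2,4)] that(5) by metis
  thus ?thesis unfolding monic_def using invD(1)[OF g] by blast
qed

lemma monic_split_iso:
  assumes "monic C m" "w \<in> Hom C (Cod C m) (Dom C m)" "m \<cdot> w = Ide C (Cod C m)"
  shows "iso C m"
proof -
  have m: "m \<in> Ar C" using assms by (simp add: monic_def)
  have "m \<cdot> (w \<cdot> m) = m" using cmp_ext1[OF assms(3), of m] assms m by simp
  hence "w \<cdot> m = Ide C (Dom C m)"
    using monicD[OF assms(1), of "w \<cdot> m" "Ide C (Dom C m)"] assms m by simp
  thus ?thesis using isoI[of m "Dom C m" "Cod C m" w] assms m by simp
qed

lemma pb_typed:
  assumes "is_pullback C f g p q"
  shows "f \<in> Ar C" "g \<in> Ar C" "Cod C f = Cod C g" "p \<in> Ar C" "q \<in> Ar C" "Dom C p = Dom C q"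
    "Cod C p = Dom C f" "Cod C q = Dom C g" "f \<cdot> p = g \<cdot> q"
  using assms by (auto simp: is_pullback_def)

lemma pb_ex1:
  assumes "is_pullback C f g p q" "x \<in> Ar C" "y \<in> Ar C" "Dom C x = Dom C y" "Cod C x = Dom C f"
    "Cod C y = Dom C g" "f \<cdot> x = g \<cdot> y"
  shows "\<exists>!w. w \<in> Hom C (Dom C x) (Dom C p) \<and> p \<cdot> w = x \<and> q \<cdot> w = y"
  using assms unfolding is_pullback_def by blast

lemma pb_univ:
  assumes "is_pullback C f g p q" "x \<in> Ar C" "y \<in> Ar C" "Dom C x = Dom C y" "Cod C x = Dom C f"
    "Cod C y = Dom C g" "f \<cdot> x = g \<cdot> y"
  obtains w where "w \<in> Ar C" "Dom C w = Dom C x" "Cod C w = Dom C p" "p \<cdot> w = x" "q \<cdot> w = y"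
  using assms unfolding is_pullback_def Hom_iff by blast

lemma pb_uniq:
  assumes pb: "is_pullback C f g p q" and w: "w \<in> Ar C" "w' \<in> Ar C" "Dom C w = Dom C w'" "Cod C w = Dom C p"
    "Cod C w' = Dom C p" "p \<cdot> w = p \<cdot> w'" "q \<cdot> w = q \<cdot> w'"
  shows "w = w'"
proof -
  note t = pb_typed[OF pb]
  have e: "f \<cdot> (p \<cdot> w) = g \<cdot> (q \<cdot> w)" by (rule cmp_ext[OF t(9)]) (use t(1-8) w(1-5) in simp_all)
  have "\<exists>!v. v \<in> Hom C (Dom C (p \<cdot> w)) (Dom C p) \<and> p \<cdot> v = p \<cdot> w \<and> q \<cdot> v = q \<cdot> w"
    by (rule pb_ex1[OF pb]) (use e t(1-8) w(1-5) in simp_all)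
  moreover have "w \<in> Hom C (Dom C (p \<cdot> w)) (Dom C p)" "w' \<in> Hom C (Dom C (p \<cdot> w)) (Dom C p)"
    using t(1-8) w by simp_all
  ultimately show ?thesis using w(6,7) by metis
qed

lemma pbI:
  assumes "f \<in> Ar C" "g \<in> Ar C" "Cod C f = Cod C g" "p \<in> Ar C" "q \<in> Ar C" "Dom C p = Dom C q"
    "Cod C p = Dom C f" "Cod C q = Dom C g" "f \<cdot> p = g \<cdot> q"
    and ex: "\<And>x y. \<lbrakk>x \<in> Ar C; y \<in> Ar C; Dom C x = Dom C y; Cod C x = Dom C f; Cod C y = Dom C g; f \<cdot> x = g \<cdot> y\<rbrakk>
      \<Longrightarrow> \<exists>w. w \<in> Ar C \<and> Dom C w = Dom C x \<and> Cod C w = Dom C p \<and> p \<cdot> w = x \<and> q \<cdot> w = y"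
    and un: "\<And>w w'. \<lbrakk>w \<in> Ar C; w' \<in> Ar C; Dom C w = Dom C w'; Cod C w = Dom C p; Cod C w' = Dom C p;
      p \<cdot> w = p \<cdot> w'; q \<cdot> w = q \<cdot> w'\<rbrakk> \<Longrightarrow> w = w'"
  shows "is_pullback C f g p q"
proof -
  have "\<exists>!w. w \<in> Hom C (Dom C x) (Dom C p) \<and> p \<cdot> w = x \<and> q \<cdot> w = y"
    if "x \<in> Ar C" "y \<in> Ar C" "Dom C x = Dom C y" "Cod C x = Dom C f" "Cod C y = Dom C g" "f \<cdot> x = g \<cdot> y" for x y
    using ex[OF that] un by (auto intro!: ex_ex1I)
  thus ?thesis using assms(1-9) by (simp add: is_pullback_def)
qed

lemma coneI [simp]: "\<lbrakk>x \<in> Ar C; y \<in> Ar C; Dom C x = Dom C y; Cod C x = Dom C f; Cod C y = Dom C g;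
    f \<cdot> x = g \<cdot> y\<rbrakk> \<Longrightarrow> cone C f g x y"
  by (simp add: cone_def)

lemma pb_lift:
  assumes pb: "is_pullback C f g p q" and x: "cone C f g x y"
  shows "pb_lift C p q x y \<in> Ar C" "Dom C (pb_lift C p q x y) = Dom C x"
    "Cod C (pb_lift C p q x y) = Dom C p" "p \<cdot> pb_lift C p q x y = x" "q \<cdot> pb_lift C p q x y = y"
proof -
  have "\<exists>!w. w \<in> Hom C (Dom C x) (Dom C p) \<and> p \<cdot> w = x \<and> q \<cdot> w = y"
    by (rule pb_ex1[OF pb]) (use x in \<open>simp_all add: cone_def\<close>)
  from theI'[OF this] show "pb_lift C p q x y \<in> Ar C" "Dom C (pb_lift C p q x y) = Dom C x"
    "Cod C (pb_lift C p q x y) = Dom C p" "p \<cdot> pb_lift C p q x y = x" "q \<cdot> pb_lift C p q x y = y"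
    unfolding pb_lift_def by auto
qed

lemma pb_fact:
  assumes "is_pullback C f g p q" "cone C f g x y"
  shows "\<exists>w. w \<in> Ar C \<and> Dom C w = Dom C x \<and> Cod C w = Dom C p \<and> p \<cdot> w = x \<and> q \<cdot> w = y"
  using pb_lift[OF assms] by blast

lemma productD:
  assumes "is_product C a b p q"
  shows "p \<in> Ar C" "q \<in> Ar C" "Dom C q = Dom C p" "Cod C p = a" "Cod C q = b"
  using assms by (auto simp: is_product_def)

lemma product_univ:
  assumes "is_product C a b p q" "x \<in> Ar C" "y \<in> Ar C" "Dom C x = Dom C y" "Cod C x = a" "Cod C y = b"
  shows "\<exists>w. w \<in> Ar C \<and> Dom C w = Dom C x \<and> Cod C w = Dom C p \<and> p \<cdot> w = x \<and> q \<cdot> w = y"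
  using assms unfolding is_product_def by blast

lemma product_uniq:
  assumes "is_product C a b p q" "w \<in> Ar C" "w' \<in> Ar C" "Dom C w = Dom C w'" "Cod C w = Dom C p"
    "Cod C w' = Dom C p" "p \<cdot> w = p \<cdot> w'" "q \<cdot> w = q \<cdot> w'"
  shows "w = w'"
  using assms unfolding is_product_def by blast

lemma regular_epi_Ar: "regular_epi C e \<Longrightarrow> e \<in> Ar C"
  by (auto simp: regular_epi_def is_coequalizer_def)

lemma coeqD:
  assumes "is_coequalizer C u v e"
  shows "u \<in> Ar C" "v \<in> Ar C" "Dom C u = Dom C v" "Cod C u = Cod C v" "e \<in> Ar C" "Dom C e = Cod C u" "e \<cdot> u = e \<cdot> v"
  using assms by (auto simp: is_coequalizer_def)

lemma coeq_ex1:
  assumes "is_coequalizer C u v e" "x \<in> Ar C" "Dom C x = Cod C u" "x \<cdot> u = x \<cdot> v"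
  shows "\<exists>!w. w \<in> Hom C (Cod C e) (Cod C x) \<and> w \<cdot> e = x"
  using assms unfolding is_coequalizer_def by blast

lemma coeq_univ:
  assumes "is_coequalizer C u v e" "x \<in> Ar C" "Dom C x = Cod C u" "x \<cdot> u = x \<cdot> v"
  obtains w where "w \<in> Ar C" "Dom C w = Cod C e" "Cod C w = Cod C x" "w \<cdot> e = x"
  using assms unfolding is_coequalizer_def Hom_iff by blast

lemma regular_epi_cancel:
  assumes "regular_epi C e" and x: "x \<in> Ar C" "y \<in> Ar C" "Dom C x = Cod C e" "Dom C y = Cod C e"
    and e: "x \<cdot> e = y \<cdot> e"
  shows "x = y"
proof -
  from assms obtain u v where c: "is_coequalizer C u v e" by (auto simp: regular_epi_def)
  note t = coeqD[OF c]
  \<comment> \<open>\<open>is_coequalizer\<close> gives uniqueness among arrows with one fixed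
    codomain, so the codomains are first identified through the common composite.\<close>
  have c1: "Cod C x = Cod C y" using arg_cong[OF e, of "Cod C"] t x by simp
  have "(x \<cdot> e) \<cdot> u = (x \<cdot> e) \<cdot> v" using t x by simp
  hence "\<exists>!w. w \<in> Hom C (Cod C e) (Cod C (x \<cdot> e)) \<and> w \<cdot> e = x \<cdot> e"
    by (intro coeq_ex1[OF c]) (use x t in simp_all)
  moreover have "x \<in> Hom C (Cod C e) (Cod C (x \<cdot> e))" "y \<in> Hom C (Cod C e) (Cod C (x \<cdot> e))"
    using x t c1 by simp_all
  ultimately show ?thesis using e by metis
qed

lemma iso_regular_epi:
  assumes e: "regular_epi C e" and i: "iso C i" and d: "Dom C i = Cod C e"
  shows "regular_epi C (i \<cdot> e)"
proof -
  from e obtain u v where c: "is_coequalizer C u v e" by (auto simp: regular_epi_def)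
  note t = coeqD[OF c]
  obtain j where ij: "inverse_arrows C i j" using i by (rule isoE)
  note j = invD[OF ij]
  have "\<exists>!w. w \<in> Hom C (Cod C (i \<cdot> e)) (Cod C x) \<and> w \<cdot> (i \<cdot> e) = x"
    if x: "x \<in> Ar C" "Dom C x = Cod C u" "x \<cdot> u = x \<cdot> v" for x
  proof (rule ex_ex1I)
    obtain w where w: "w \<in> Ar C" "Dom C w = Cod C e" "Cod C w = Cod C x" "w \<cdot> e = x"
      using coeq_univ[OF c x] by metis
    have "(w \<cdot> j) \<cdot> (i \<cdot> e) = x" using w j t d by simp
    thus "\<exists>w. w \<in> Hom C (Cod C (i \<cdot> e)) (Cod C x) \<and> w \<cdot> (i \<cdot> e) = x"
      using w j t d by (intro exI[of _ "w \<cdot> j"]) simp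
  next
    fix w w' assume a: "w \<in> Hom C (Cod C (i \<cdot> e)) (Cod C x) \<and> w \<cdot> (i \<cdot> e) = x"
      "w' \<in> Hom C (Cod C (i \<cdot> e)) (Cod C x) \<and> w' \<cdot> (i \<cdot> e) = x"
    have "(w \<cdot> i) \<cdot> e = (w' \<cdot> i) \<cdot> e" using a j t d by simp
    hence "w \<cdot> i = w' \<cdot> i" using regular_epi_cancel[OF e, of "w \<cdot> i" "w' \<cdot> i"] a j t d by simp
    hence "(w \<cdot> i) \<cdot> j = (w' \<cdot> i) \<cdot> j" by simp
    thus "w = w'" using a j t d by simp
  qed
  moreover have "(i \<cdot> e) \<cdot> u = (i \<cdot> e) \<cdot> v" using t j d by simp
  ultimately have "is_coequalizer C u v (i \<cdot> e)" using t j d by (simp add: is_coequalizer_def)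
  thus ?thesis by (auto simp: regular_epi_def)
qed


text \<open>\<open>f\<close> identifies the pair that \<open>m f\<close> coequalizes, because
  \<open>m\<close> is monic. The induced factorization of \<open>f\<close> through
  \<open>m f\<close> is a right inverse of \<open>m\<close>.\<close>

lemma regular_epi_factor_monic_iso:
  assumes e: "regular_epi C (m \<cdot> f)" and m: "monic C m" and f: "f \<in> Ar C" "Cod C f = Dom C m"
  shows "iso C m"
proof -
  have ma: "m \<in> Ar C" using m by (simp add: monic_def)
  from e obtain u v where c: "is_coequalizer C u v (m \<cdot> f)" by (auto simp: regular_epi_def)
  note t = coeqD[OF c]
  have uv: "Cod C u = Dom C f" "Cod C v = Dom C f" using t f ma by simp_all
  have "m \<cdot> (f \<cdot> u) = m \<cdot> (f \<cdot> v)" using t f ma uv by simp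
  hence "f \<cdot> u = f \<cdot> v" using monicD[OF m, of "f \<cdot> u" "f \<cdot> v"] t f ma uv by simp
  then obtain w where w: "w \<in> Ar C" "Dom C w = Cod C (m \<cdot> f)" "Cod C w = Cod C f" "w \<cdot> (m \<cdot> f) = f"
    using coeq_univ[OF c f(1)] uv by metis
  have "(m \<cdot> w) \<cdot> (m \<cdot> f) = Ide C (Cod C m) \<cdot> (m \<cdot> f)" using w f ma by simp
  hence "m \<cdot> w = Ide C (Cod C m)" using regular_epi_cancel[OF e, of "m \<cdot> w" "Ide C (Cod C m)"] w f ma by simp
  thus ?thesis using monic_split_iso[OF m] w f ma by simp
qed

end

section \<open>Products and equalizers from pullbacks and a terminal object\<close>

locale fc_loc = cat_loc +
  assumes fc: "finitely_complete C"
begin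

lemma pb_ex: "\<lbrakk>f \<in> Ar C; g \<in> Ar C; Cod C f = Cod C g\<rbrakk> \<Longrightarrow> \<exists>p q. is_pullback C f g p q"
  using fc by (simp add: finitely_complete_def)

lemma pb_chosen:
  assumes "f \<in> Ar C" "g \<in> Ar C" "Cod C f = Cod C g"
  shows "is_pullback C f g (pb1 C f g) (pb2 C f g)"
proof -
  have "\<exists>x. case x of (p, q) \<Rightarrow> is_pullback C f g p q" using pb_ex[OF assms] by auto
  from someI_ex[OF this] have *: "case SOME (p, q). is_pullback C f g p q of (p, q) \<Rightarrow> is_pullback C f g p q" .
  obtain p q where e: "(SOME (p, q). is_pullback C f g p q) = (p, q)" by fastforce
  show ?thesis using * by (simp add: pb1_def pb2_def e)
qed

lemma prod_ex:
  assumes "a \<in> Ob C" "b \<in> Ob C"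
  shows "\<exists>p q. is_product C a b p q"
proof -
  obtain t where t: "is_terminal C t" using fc by (auto simp: finitely_complete_def)
  obtain f g where f: "f \<in> Hom C a t" and g: "g \<in> Hom C b t"
    using t assms unfolding is_terminal_def by metis
  obtain p q where pq: "is_pullback C f g p q" using pb_ex[of f g] f g by auto
  note T = pb_typed[OF pq]
  have "\<exists>w. w \<in> Ar C \<and> Dom C w = Dom C x \<and> Cod C w = Dom C p \<and> p \<cdot> w = x \<and> q \<cdot> w = y"
    if x: "x \<in> Ar C" "y \<in> Ar C" "Dom C x = Dom C y" "Cod C x = a" "Cod C y = b" for x y
  proof -
    have "f \<cdot> x \<in> Hom C (Dom C x) t" "g \<cdot> y \<in> Hom C (Dom C x) t" using x f g by simp_all
    hence "f \<cdot> x = g \<cdot> y" using t x unfolding is_terminal_def by (metis Dom_Ob)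
    thus ?thesis using pb_univ[OF pq x(1,2,3)] x f g by (metis Hom_iff)
  qed
  thus ?thesis using T f g pb_uniq[OF pq] unfolding is_product_def
    by (intro exI[of _ p] exI[of _ q]) auto
qed

text \<open>The arrow with components \<open>u\<close> and \<open>v\<close> into the square of the
  codomain is pulled back along the diagonal \<open>d\<close>.\<close>

lemma equalizer_ex:
  assumes u: "u \<in> Ar C" "v \<in> Ar C" "Dom C u = Dom C v" "Cod C u = Cod C v"
  obtains m where "monic C m" "Cod C m = Dom C u" "u \<cdot> m = v \<cdot> m"
    "\<And>x. \<lbrakk>x \<in> Ar C; Cod C x = Dom C u; u \<cdot> x = v \<cdot> x\<rbrakk> \<Longrightarrow>
      \<exists>w. w \<in> Ar C \<and> Dom C w = Dom C x \<and> Cod C w = Dom C m \<and> m \<cdot> w = x"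
proof -
  let ?a = "Dom C u" let ?z = "Cod C u"
  obtain p q where pq: "is_product C ?z ?z p q" using prod_ex[of ?z ?z] u by auto
  note p = productD[OF pq] and ex = product_univ[OF pq] and un = product_uniq[OF pq]
  obtain w where w: "w \<in> Ar C" "Dom C w = ?a" "Cod C w = Dom C p" "p \<cdot> w = u" "q \<cdot> w = v"
    using ex[of u v] u by metis
  obtain d where d: "d \<in> Ar C" "Dom C d = ?z" "Cod C d = Dom C p" "p \<cdot> d = Ide C ?z" "q \<cdot> d = Ide C ?z"
    using ex[of "Ide C ?z" "Ide C ?z"] u by auto
  obtain m n where pb: "is_pullback C w d m n" using pb_ex[of w d] w d by auto
  note t = pb_typed[OF pb]
  have ext: "p \<cdot> (w \<cdot> x) = u \<cdot> x" "q \<cdot> (w \<cdot> x) = v \<cdot> x" if "x \<in> Ar C" "Cod C x = ?a" for x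
    by (rule cmp_ext1[OF w(4)], use that w p in simp_all) (rule cmp_ext1[OF w(5)], use that w p in simp_all)
  have extd: "p \<cdot> (d \<cdot> x) = x" "q \<cdot> (d \<cdot> x) = x" if "x \<in> Ar C" "Cod C x = ?z" for x
    using cmp_ext1[OF d(4), of x] cmp_ext1[OF d(5), of x] that d(1-3) p u by simp_all
  have mn: "u \<cdot> m = n" "v \<cdot> m = n" using ext[of m] extd[of n] t w d by simp_all
  show thesis
  proof (rule that[of m])
    show "monic C m" unfolding monic_def
    proof (intro conjI ballI impI)
      fix x y assume x: "x \<in> Ar C" "y \<in> Ar C" "Dom C x = Dom C y" "Cod C x = Dom C m" "Cod C y = Dom C m" "m \<cdot> x = m \<cdot> y"
      have "n \<cdot> x = n \<cdot> y" using cmp_ext1[OF mn(1), of x] cmp_ext1[OF mn(1), of y] x t w u by simp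
      thus "x = y" using pb_uniq[OF pb x] by simp
    qed (use t in simp)
    show "\<exists>y. y \<in> Ar C \<and> Dom C y = Dom C x \<and> Cod C y = Dom C m \<and> m \<cdot> y = x"
      if x: "x \<in> Ar C" "Cod C x = ?a" "u \<cdot> x = v \<cdot> x" for x
    proof -
      have "w \<cdot> x = d \<cdot> (u \<cdot> x)"
        by (rule un) (use x w d u p ext[of x] extd[of "u \<cdot> x"] in simp_all)
      thus ?thesis using pb_univ[OF pb, of x "u \<cdot> x"] x w d u by (metis Dom_Cmp Cod_Cmp Cmp_Ar)
    qed
  qed (use t w mn in simp_all)
qed

end

section \<open>Protomodular categories\<close>

lemma Pt_Ob_iff: "(p, s) \<in> Ob (Pt C B) \<longleftrightarrow>
    p \<in> Ar C \<and> Cod C p = B \<and> s \<in> Ar C \<and> Dom C s = B \<and> Cod C s = Dom C p \<and> p \<cdot>\<^bsub>C\<^esub> s = Ide C B"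
  by (auto simp: Pt_def Let_def)

lemma Pt_Ar_iff: "((p, s), h, (q, t)) \<in> Ar (Pt C B) \<longleftrightarrow>
    (p, s) \<in> Ob (Pt C B) \<and> (q, t) \<in> Ob (Pt C B) \<and> h \<in> Ar C \<and> Dom C h = Dom C p \<and> Cod C h = Dom C q \<and>
    q \<cdot>\<^bsub>C\<^esub> h = p \<and> h \<cdot>\<^bsub>C\<^esub> s = t"
  by (auto simp: Pt_def Let_def)

lemma Pt_simps [simp]:
  "Dom (Pt C B) (x, h, y) = x" "Cod (Pt C B) (x, h, y) = y"
  "Ide (Pt C B) (p, s) = ((p, s), Ide C (Dom C p), (p, s))"
  "(y, k, z) \<cdot>\<^bsub>Pt C B\<^esub> (x, h, y') = (x, k \<cdot>\<^bsub>C\<^esub> h, z)"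
  by (simp_all add: Pt_def Let_def)

context cat_loc
begin

lemma category_Pt: "category (Pt C B)"
  unfolding category_def
proof (intro conjI ballI impI)
  fix f assume "f \<in> Ar (Pt C B)"
  then obtain p s h q t where f: "f = ((p, s), h, (q, t))" "((p, s), h, (q, t)) \<in> Ar (Pt C B)"
    by (cases f) auto
  show "Dom (Pt C B) f \<in> Ob (Pt C B)" "Cod (Pt C B) f \<in> Ob (Pt C B)"
    using f by (auto simp: Pt_Ar_iff)
  show "f \<cdot>\<^bsub>Pt C B\<^esub> Ide (Pt C B) (Dom (Pt C B) f) = f" "Ide (Pt C B) (Cod (Pt C B) f) \<cdot>\<^bsub>Pt C B\<^esub> f = f"
    using f by (auto simp: Pt_Ar_iff)
  fix g assume "g \<in> Ar (Pt C B)" and c: "Cod (Pt C B) f = Dom (Pt C B) g"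
  then obtain k r u where g: "g = ((q, t), k, (r, u))" "((q, t), k, (r, u)) \<in> Ar (Pt C B)"
    using f by (cases g) auto
  have "r \<cdot> (k \<cdot> h) = p" "(k \<cdot> h) \<cdot> s = u" 
    using f g cmp_ext1[of r k q h] by (auto simp: Pt_Ar_iff Pt_Ob_iff)
  thus "g \<cdot>\<^bsub>Pt C B\<^esub> f \<in> Hom (Pt C B) (Dom (Pt C B) f) (Cod (Pt C B) g)"
    using f g by (auto simp: Pt_Ar_iff)
next
  fix a assume "a \<in> Ob (Pt C B)"
  thus "Ide (Pt C B) a \<in> Hom (Pt C B) a a" by (cases a) (auto simp: Pt_Ar_iff Pt_Ob_iff)
next
  fix f g h assume "f \<in> Ar (Pt C B)" "g \<in> Ar (Pt C B)" "h \<in> Ar (Pt C B)"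
    "Cod (Pt C B) f = Dom (Pt C B) g" "Cod (Pt C B) g = Dom (Pt C B) h"
  thus "h \<cdot>\<^bsub>Pt C B\<^esub> (g \<cdot>\<^bsub>Pt C B\<^esub> f) = (h \<cdot>\<^bsub>Pt C B\<^esub> g) \<cdot>\<^bsub>Pt C B\<^esub> f"
    by (cases f; cases g; cases h) (auto simp: Pt_Ar_iff)
qed

text \<open>The inverse of an underlying isomorphism automatically respects retractions and
  sections.\<close>

lemma Pt_iso_iff:
  assumes "((p, s), h, (q, t)) \<in> Ar (Pt C B)"
  shows "iso (Pt C B) ((p, s), h, (q, t)) \<longleftrightarrow> iso C h"
proof
  interpret P: cat_loc "Pt C B" by unfold_locales (rule category_Pt)
  assume "iso (Pt C B) ((p, s), h, (q, t))"
  then obtain k where "k \<in> Hom (Pt C B) (q, t) (p, s)"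
      "k \<cdot>\<^bsub>Pt C B\<^esub> ((p, s), h, (q, t)) = Ide (Pt C B) (p, s)"
      "((p, s), h, (q, t)) \<cdot>\<^bsub>Pt C B\<^esub> k = Ide (Pt C B) (q, t)"
    by (auto simp: iso_def)
  then obtain k' where k: "((q, t), k', (p, s)) \<in> Ar (Pt C B)" "k' \<cdot> h = Ide C (Dom C p)" "h \<cdot> k' = Ide C (Dom C q)"
    by (cases k) auto
  thus "iso C h" using assms by (intro isoI[of h "Dom C p" "Dom C q" k']) (auto simp: Pt_Ar_iff)
next
  assume "iso C h"
  then obtain k where hk: "inverse_arrows C h k" by (rule isoE)
  note k = invD[OF hk]
  have h: "(p, s) \<in> Ob (Pt C B)" "(q, t) \<in> Ob (Pt C B)" "Dom C h = Dom C p" "Cod C h = Dom C q"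
    "q \<cdot> h = p" "h \<cdot> s = t" using assms by (auto simp: Pt_Ar_iff)
  have "k \<cdot> (h \<cdot> s) = s" using k h(1-4) by (simp add: Pt_Ob_iff)
  hence 1: "k \<cdot> t = s" by (simp add: h)
  have "q \<cdot> (h \<cdot> k) = p \<cdot> k" using cmp_ext1[OF h(5), of k] k h(1-4) by (simp add: Pt_Ob_iff)
  hence 2: "p \<cdot> k = q" using k h(1-4) by (simp add: Pt_Ob_iff)
  have "((q, t), k, (p, s)) \<in> Ar (Pt C B)" using 1 2 h(1-4) k(1-4) by (simp add: Pt_Ar_iff)
  thus "iso (Pt C B) ((p, s), h, (q, t))" using assms k(5,6) h(3,4) unfolding iso_def
    by (auto intro!: bexI[of _ "((q, t), k, (p, s))"])
qed

lemma pb_comparison_iso: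
  assumes pb: "is_pullback C f g p q" and pb': "is_pullback C f g p' q'"
    and w: "w \<in> Ar C" "Dom C w = Dom C p'" "Cod C w = Dom C p" "p \<cdot> w = p'" "q \<cdot> w = q'"
  shows "iso C w"
proof -
  note t = pb_typed[OF pb] and t' = pb_typed[OF pb']
  obtain v where v: "v \<in> Ar C" "Dom C v = Dom C p" "Cod C v = Dom C p'" "p' \<cdot> v = p" "q' \<cdot> v = q"
    using pb_univ[OF pb' t(4,5,6,7,8,9)] by metis
  have e: "p \<cdot> (w \<cdot> v) = p" "q \<cdot> (w \<cdot> v) = q"
    using cmp_ext1[OF w(4), of v] cmp_ext1[OF w(5), of v] w(1-3) v t(1-8) by simp_all
  have "w \<cdot> v = Ide C (Dom C p)" by (rule pb_uniq[OF pb]) (use e w(1-3) v(1-3) t(1-8) in simp_all)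
  moreover have e': "p' \<cdot> (v \<cdot> w) = p'" "q' \<cdot> (v \<cdot> w) = q'"
    using cmp_ext1[OF v(4), of w] cmp_ext1[OF v(5), of w] w v(1-3) t'(1-8) by simp_all
  have "v \<cdot> w = Ide C (Dom C p')" by (rule pb_uniq[OF pb']) (use e' w(1-3) v(1-3) t'(1-8) in simp_all)
  ultimately show ?thesis by (intro isoI[of w "Dom C p'" "Dom C p" v]) (use w(1-3) v(1-3) in simp_all)
qed

end

context fc_loc
begin

lemma pt_pullback_FOb:
  "FOb (pt_pullback C g) (p, s) = (pb1 C g p, pb_lift C (pb1 C g p) (pb2 C g p) (Ide C (Dom C g)) (s \<cdot> g))"
  by (simp add: pt_pullback_def Let_def)

lemma pt_pullback_FAr:
  "FAr (pt_pullback C g) ((p, s), h, (q, t)) =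
    (FOb (pt_pullback C g) (p, s), pb_lift C (pb1 C g q) (pb2 C g q) (pb1 C g p) (h \<cdot> pb2 C g p), FOb (pt_pullback C g) (q, t))"
  by (simp add: pt_pullback_def Let_def)

lemma pt_section_lift:
  assumes g: "g \<in> Ar C" and x: "(p, s) \<in> Ob (Pt C (Cod C g))" and pb: "is_pullback C g p a b"
  defines "z \<equiv> pb_lift C a b (Ide C (Dom C g)) (s \<cdot> g)"
  shows "z \<in> Ar C" "Dom C z = Dom C g" "Cod C z = Dom C a" "a \<cdot> z = Ide C (Dom C g)" "b \<cdot> z = s \<cdot> g"
    "(a, z) \<in> Ob (Pt C (Dom C g))"
proof -
  have "p \<cdot> (s \<cdot> g) = g" using x g cmp_ext1[of p s "Ide C (Cod C g)" g] by (simp add: Pt_Ob_iff)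
  note l = pb_lift[OF pb, of "Ide C (Dom C g)" "s \<cdot> g", folded z_def]
  have l': "z \<in> Ar C" "Dom C z = Dom C g" "Cod C z = Dom C a" "a \<cdot> z = Ide C (Dom C g)" "b \<cdot> z = s \<cdot> g"
    using l x g \<open>p \<cdot> (s \<cdot> g) = g\<close> by (simp_all add: Pt_Ob_iff)
  thus "z \<in> Ar C" "Dom C z = Dom C g" "Cod C z = Dom C a" "a \<cdot> z = Ide C (Dom C g)" "b \<cdot> z = s \<cdot> g" by simp_all
  show "(a, z) \<in> Ob (Pt C (Dom C g))" using l' pb_typed[OF pb] by (simp_all add: Pt_Ob_iff)
qed

lemma pt_arrow_lift:
  assumes g: "g \<in> Ar C" and h: "((p, s), h, (q, t)) \<in> Ar (Pt C (Cod C g))"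
    and pb: "is_pullback C g p a b" and pb': "is_pullback C g q a' b'"
  defines "l \<equiv> pb_lift C a' b' a (h \<cdot> b)"
  shows "l \<in> Ar C" "Dom C l = Dom C a" "Cod C l = Dom C a'" "a' \<cdot> l = a" "b' \<cdot> l = h \<cdot> b"
    "((a, pb_lift C a b (Ide C (Dom C g)) (s \<cdot> g)), l, (a', pb_lift C a' b' (Ide C (Dom C g)) (t \<cdot> g))) \<in> Ar (Pt C (Dom C g))"
proof -
  have h': "(p, s) \<in> Ob (Pt C (Cod C g))" "(q, t) \<in> Ob (Pt C (Cod C g))" "h \<in> Ar C" "Dom C h = Dom C p" "Cod C h = Dom C q"
    "q \<cdot> h = p" "h \<cdot> s = t" using h by (auto simp: Pt_Ar_iff)
  note T = pb_typed[OF pb] and T' = pb_typed[OF pb']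
  have e: "q \<cdot> (h \<cdot> b) = p \<cdot> b" using cmp_ext1[OF h'(6), of b] h'(3,4,5) T(1-8) T'(1-8) by simp
  have l: "l \<in> Ar C" "Dom C l = Dom C a" "Cod C l = Dom C a'" "a' \<cdot> l = a" "b' \<cdot> l = h \<cdot> b"
    using pb_lift[OF pb', of a "h \<cdot> b", folded l_def] T T' e h'(3,4,5) by simp_all
  thus "l \<in> Ar C" "Dom C l = Dom C a" "Cod C l = Dom C a'" "a' \<cdot> l = a" "b' \<cdot> l = h \<cdot> b" by simp_all
  note z = pt_section_lift[OF g h'(1) pb] and z' = pt_section_lift[OF g h'(2) pb']
  have "l \<cdot> pb_lift C a b (Ide C (Dom C g)) (s \<cdot> g) = pb_lift C a' b' (Ide C (Dom C g)) (t \<cdot> g)" (is "l \<cdot> ?z = ?z'")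
  proof (rule pb_uniq[OF pb'])
    show "a' \<cdot> (l \<cdot> ?z) = a' \<cdot> ?z'" using cmp_ext1[OF l(4), of ?z] l(1-3) z z' T'(1-8) by simp_all
    have "b' \<cdot> (l \<cdot> ?z) = h \<cdot> (b \<cdot> ?z)" using cmp_ext[OF l(5), of ?z] l(1-3) z(1-3) T(1-8) T'(1-8) h'(3-5) by simp_all
    also have "\<dots> = b' \<cdot> ?z'" using z(5) z'(5) cmp_ext1[OF h'(7), of g] h'(1-5) g by (simp_all add: Pt_Ob_iff)
    finally show "b' \<cdot> (l \<cdot> ?z) = b' \<cdot> ?z'" .
  qed (use l(1-3) z(1-3) z'(1-3) T'(1-8) in simp_all)
  thus "((a, ?z), l, (a', ?z')) \<in> Ar (Pt C (Dom C g))" using l z(6) z'(6) by (simp add: Pt_Ar_iff)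
qed

lemma functor_pt_pullback:
  assumes g: "g \<in> Ar C"
  shows "functor (Pt C (Cod C g)) (Pt C (Dom C g)) (pt_pullback C g)"
  unfolding functor_def
proof (intro conjI ballI impI)
  show "category (Pt C (Cod C g))" "category (Pt C (Dom C g))" by (rule category_Pt)+
  have pb: "is_pullback C g p (pb1 C g p) (pb2 C g p)" if "(p, s) \<in> Ob (Pt C (Cod C g))" for p s
    using pb_chosen[of g p] that g by (simp add: Pt_Ob_iff)
  fix x assume x: "x \<in> Ob (Pt C (Cod C g))"
  obtain p s where xe: "x = (p, s)" by fastforce
  show "FOb (pt_pullback C g) x \<in> Ob (Pt C (Dom C g))"
    using pt_section_lift(6)[OF g x[unfolded xe] pb] x by (simp add: xe pt_pullback_FOb)
  have T: "is_pullback C g p (pb1 C g p) (pb2 C g p)" using pb x xe by simp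
  note t = pb_typed[OF T]
  have "pb_lift C (pb1 C g p) (pb2 C g p) (pb1 C g p) (Ide C (Dom C p) \<cdot> pb2 C g p) = Ide C (Dom C (pb1 C g p))"
    by (rule pb_uniq[OF T]) (use pb_lift[OF T, of "pb1 C g p" "pb2 C g p"] t in simp_all)
  thus "FAr (pt_pullback C g) (Ide (Pt C (Cod C g)) x) = Ide (Pt C (Dom C g)) (FOb (pt_pullback C g) x)"
    by (simp add: xe pt_pullback_FAr pt_pullback_FOb)
next
  have pb: "is_pullback C g p (pb1 C g p) (pb2 C g p)" if "(p, s) \<in> Ob (Pt C (Cod C g))" for p s
    using pb_chosen[of g p] that g by (simp add: Pt_Ob_iff)
  fix f assume f: "f \<in> Ar (Pt C (Cod C g))"
  obtain p s h q t where fe: "f = ((p, s), h, (q, t))" by (cases f) auto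
  have ob: "(p, s) \<in> Ob (Pt C (Cod C g))" "(q, t) \<in> Ob (Pt C (Cod C g))"
    using f by (simp_all add: Pt_Ar_iff fe)
  note pbs = pb[OF ob(1)] pb[OF ob(2)]
  note L = pt_arrow_lift[OF g f[unfolded fe] pbs]
  show "FAr (pt_pullback C g) f \<in> Hom (Pt C (Dom C g)) (FOb (pt_pullback C g) (Dom (Pt C (Cod C g)) f))
           (FOb (pt_pullback C g) (Cod (Pt C (Cod C g)) f))"
    using L(6) by (simp add: fe pt_pullback_FAr pt_pullback_FOb)
  fix f' assume f': "f' \<in> Ar (Pt C (Cod C g))" and c: "Cod (Pt C (Cod C g)) f = Dom (Pt C (Cod C g)) f'"
  obtain h' q' t' where fe': "f' = ((q, t), h', (q', t'))" using c fe by (cases f') auto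
  have ob': "(q', t') \<in> Ob (Pt C (Cod C g))" using f' by (simp_all add: Pt_Ar_iff fe')
  note pb' = pb[OF ob']
  note L' = pt_arrow_lift[OF g f'[unfolded fe'] pbs(2) pb']
  have comp: "((p, s), h' \<cdot> h, (q', t')) \<in> Ar (Pt C (Cod C g))"
  proof -
    interpret P: cat_loc "Pt C (Cod C g)" by unfold_locales (rule category_Pt)
    show ?thesis using P.Cmp_Ar[of f f'] f f' by (simp add: fe fe')
  qed
  note L'' = pt_arrow_lift[OF g comp pbs(1) pb']
  have ht: "h \<in> Ar C" "h' \<in> Ar C" "Dom C h = Dom C p" "Cod C h = Dom C q" "Dom C h' = Dom C q" "Cod C h' = Dom C q'"
    using f f' by (auto simp: fe fe' Pt_Ar_iff)
  let ?l = "pb_lift C (pb1 C g q) (pb2 C g q) (pb1 C g p) (h \<cdot> pb2 C g p)"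
  let ?l' = "pb_lift C (pb1 C g q') (pb2 C g q') (pb1 C g q) (h' \<cdot> pb2 C g q)"
  let ?l'' = "pb_lift C (pb1 C g q') (pb2 C g q') (pb1 C g p) ((h' \<cdot> h) \<cdot> pb2 C g p)"
  note t1 = pb_typed(1-8)[OF pbs(1)] and t2 = pb_typed(1-8)[OF pbs(2)] and t3 = pb_typed(1-8)[OF pb']
  have "?l'' = ?l' \<cdot> ?l"
  proof (rule pb_uniq[OF pb'])
    have "pb1 C g q' \<cdot> (?l' \<cdot> ?l) = pb1 C g p" using cmp_ext1[OF L'(4), of ?l] L(1-4) L'(1-3) t1 t2 t3 by simp_all
    thus "pb1 C g q' \<cdot> ?l'' = pb1 C g q' \<cdot> (?l' \<cdot> ?l)" using L''(4) by simp
    have "pb2 C g q' \<cdot> (?l' \<cdot> ?l) = h' \<cdot> (pb2 C g q \<cdot> ?l)"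
      by (rule cmp_ext[OF L'(5)]) (use L(1-3) L'(1-3) t1 t2 t3 ht in simp_all)
    also have "\<dots> = (h' \<cdot> h) \<cdot> pb2 C g p" using L(5) ht t1 by simp
    finally show "pb2 C g q' \<cdot> ?l'' = pb2 C g q' \<cdot> (?l' \<cdot> ?l)" using L''(5) by simp
  qed (use L(1-3) L'(1-3) L''(1-3) t3 in simp_all)
  thus "FAr (pt_pullback C g) (f' \<cdot>\<^bsub>Pt C (Cod C g)\<^esub> f) = FAr (pt_pullback C g) f' \<cdot>\<^bsub>Pt C (Dom C g)\<^esub> FAr (pt_pullback C g) f"
    by (simp add: fe fe' pt_pullback_FAr)
qed

end

section \<open>Protomodularity for arbitrary pullbacks and its generation principle\<close>

locale pm_loc = fc_loc +
  assumes pm: "protomodular C"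
begin

text \<open>\<open>protomodular\<close> speaks of the functor built from chosen pullbacks. The
  comparison isomorphisms \<open>i\<close> and \<open>j\<close> conjugate the given \<open>f\<close>
  into the arrow between the chosen pullbacks, so reflection of isomorphisms applies to any pair of
  pullbacks.\<close>

lemma protomodular_iso:
  assumes g: "g \<in> Ar C" and h: "((p, s), h, (q, t)) \<in> Ar (Pt C (Cod C g))"
    and pb: "is_pullback C g p a b" and pb': "is_pullback C g q a' b'"
    and f: "iso C f" "Dom C f = Dom C a" "Cod C f = Dom C a'" "a' \<cdot> f = a" "b' \<cdot> f = h \<cdot> b"
  shows "iso C h"
proof -
  have ob: "(p, s) \<in> Ob (Pt C (Cod C g))" "(q, t) \<in> Ob (Pt C (Cod C g))" using h by (simp_all add: Pt_Ar_iff)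
  have ht: "h \<in> Ar C" "Dom C h = Dom C p" "Cod C h = Dom C q" using h by (simp_all add: Pt_Ar_iff)
  let ?a = "pb1 C g p" let ?b = "pb2 C g p" let ?a' = "pb1 C g q" let ?b' = "pb2 C g q"
  have c: "is_pullback C g p ?a ?b" "is_pullback C g q ?a' ?b'"
    using pb_chosen[of g p] pb_chosen[of g q] ob g by (simp_all add: Pt_Ob_iff)
  note t = pb_typed[OF pb] and t' = pb_typed[OF pb'] and tc = pb_typed[OF c(1)] and tc' = pb_typed[OF c(2)]
  obtain i where i: "i \<in> Ar C" "Dom C i = Dom C ?a" "Cod C i = Dom C a" "a \<cdot> i = ?a" "b \<cdot> i = ?b"
    using pb_univ[OF pb tc(4,5,6,7,8,9)] by metis
  obtain j where j: "j \<in> Ar C" "Dom C j = Dom C a'" "Cod C j = Dom C ?a'" "?a' \<cdot> j = a'" "?b' \<cdot> j = b'"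
    using pb_univ[OF c(2) t'(4,5,6,7,8,9)] by metis
  have ij: "iso C i" "iso C j"
    using pb_comparison_iso[OF pb c(1) i] pb_comparison_iso[OF c(2) pb' j] by simp_all
  note L = pt_arrow_lift[OF g h c]
  let ?l = "pb_lift C ?a' ?b' ?a (h \<cdot> ?b)"
  note fa = iso_Ar[OF f(1)]
  have "?l = j \<cdot> (f \<cdot> i)"
  proof (rule pb_uniq[OF c(2)])
    have "?a' \<cdot> (j \<cdot> (f \<cdot> i)) = a' \<cdot> (f \<cdot> i)"
      by (rule cmp_ext1[OF j(4)]) (use i(1-3) j(1-3) fa f(2,3) tc' in simp_all)
    also have "\<dots> = a \<cdot> i" by (rule cmp_ext1[OF f(4)]) (use i(1-3) fa f(2,3) t' in simp_all)
    finally show "?a' \<cdot> ?l = ?a' \<cdot> (j \<cdot> (f \<cdot> i))" using L(4) i by simp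
    have "?b' \<cdot> (j \<cdot> (f \<cdot> i)) = b' \<cdot> (f \<cdot> i)"
      by (rule cmp_ext1[OF j(5)]) (use i(1-3) j(1-3) fa f(2,3) tc' in simp_all)
    also have "\<dots> = h \<cdot> (b \<cdot> i)" by (rule cmp_ext[OF f(5)]) (use i(1-3) fa f(2,3) t(1-8) t'(1-8) ht in simp_all)
    finally show "?b' \<cdot> ?l = ?b' \<cdot> (j \<cdot> (f \<cdot> i))" using L(5) i by simp
  qed (use L(1-3) i(1-3) j(1-3) fa f(2,3) in simp_all)
  moreover have "iso C (j \<cdot> (f \<cdot> i))" by (intro iso_comp) (use ij f(1-3) i(1-3) j(1-3) fa in simp_all)
  ultimately have "iso C ?l" by simp
  hence "iso (Pt C (Dom C g)) (FAr (pt_pullback C g) ((p, s), h, (q, t)))"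
    using Pt_iso_iff[OF L(6)] by (simp add: pt_pullback_FAr pt_pullback_FOb)
  moreover have "reflects_isos (Pt C (Cod C g)) (Pt C (Dom C g)) (pt_pullback C g)"
    using pm g by (simp add: protomodular_def)
  ultimately have "iso (Pt C (Cod C g)) ((p, s), h, (q, t))" using h by (simp add: reflects_isos_def)
  thus ?thesis using Pt_iso_iff[OF h] by simp
qed

text \<open>If the section and the projection \<open>b\<close> both factor through a mono
  \<open>m\<close>, then the domain of \<open>m\<close> is a point with the same pullback along
  \<open>g\<close>. So \<open>m\<close> is a morphism of points whose base change is an identity,
  and protomodularity makes it invertible.\<close>

lemma section_pullback_extremal:
  assumes x: "(p, s) \<in> Ob (Pt C D)" and D: "Cod C g = D" and pb: "is_pullback C g p a b"
    and m: "monic C m" "Cod C m = Dom C p"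
    and s': "s' \<in> Ar C" "Cod C s' = Dom C m" "m \<cdot> s' = s"
    and b': "b' \<in> Ar C" "Cod C b' = Dom C m" "m \<cdot> b' = b"
  shows "iso C m"
proof -
  note t = pb_typed[OF pb]
  have ma: "m \<in> Ar C" using m by (simp add: monic_def)
  have xt: "p \<in> Ar C" "Cod C p = D" "s \<in> Ar C" "Dom C s = D" "Cod C s = Dom C p" "p \<cdot> s = Ide C D"
    using x by (simp_all add: Pt_Ob_iff)
  have d: "Dom C s' = D" "Dom C b' = Dom C a"
    using arg_cong[OF s'(3), of "Dom C"] arg_cong[OF b'(3), of "Dom C"] s'(1,2) b'(1,2) ma xt t by simp_all
  have pt: "((p \<cdot> m, s'), m, (p, s)) \<in> Ar (Pt C D)"
    using x s' d ma m(2) xt by (simp add: Pt_Ar_iff Pt_Ob_iff)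
  have pb': "is_pullback C g (p \<cdot> m) a b'"
  proof (rule pbI)
    show "\<exists>w. w \<in> Ar C \<and> Dom C w = Dom C u \<and> Cod C w = Dom C a \<and> a \<cdot> w = u \<and> b' \<cdot> w = v"
      if u: "u \<in> Ar C" "v \<in> Ar C" "Dom C u = Dom C v" "Cod C u = Dom C g" "Cod C v = Dom C (p \<cdot> m)" "g \<cdot> u = (p \<cdot> m) \<cdot> v" for u v
    proof -
      have "cone C g p u (m \<cdot> v)" by (rule coneI) (use u ma m(2) xt(1-5) in simp_all)
      then obtain w where w: "w \<in> Ar C" "Dom C w = Dom C u" "Cod C w = Dom C a" "a \<cdot> w = u" "b \<cdot> w = m \<cdot> v"
        using pb_fact[OF pb] by blast
      have "m \<cdot> (b' \<cdot> w) = m \<cdot> v" using cmp_ext1[OF b'(3), of w] w b'(1,2) d ma by simp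
      hence "b' \<cdot> w = v" by (intro monicD[OF m(1), of "b' \<cdot> w" v]) (use w(1-3) b'(1,2) d u(1-5) ma m(2) xt(1) in simp_all)
      thus ?thesis using w by auto
    qed
    show "w = w'" if w: "w \<in> Ar C" "w' \<in> Ar C" "Dom C w = Dom C w'" "Cod C w = Dom C a" "Cod C w' = Dom C a"
      "a \<cdot> w = a \<cdot> w'" "b' \<cdot> w = b' \<cdot> w'" for w w'
    proof -
      have "b \<cdot> w = m \<cdot> (b' \<cdot> w)" "b \<cdot> w' = m \<cdot> (b' \<cdot> w')"
        using cmp_ext1[OF b'(3), of w] cmp_ext1[OF b'(3), of w'] w(1-5) b'(1,2) d ma by simp_all
      thus ?thesis using pb_uniq[OF pb w(1-6)] w(7) by simp
    qed
    show "g \<cdot> a = (p \<cdot> m) \<cdot> b'" using t b' ma m(2) xt by simp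
  qed (use t(1-8) b'(1,2) d ma m(2) xt in simp_all)
  show ?thesis
    by (rule protomodular_iso[OF t(1) pt[folded D] pb' pb, of "Ide C (Dom C a)"]) (use t b' in simp_all)
qed

text \<open>The equalizer of \<open>u\<close> and \<open>v\<close> is a mono through which the
  section and \<open>b\<close> factor, hence invertible.\<close>

lemma section_pullback_joint_epi:
  assumes x: "(p, s) \<in> Ob (Pt C D)" and D: "Cod C g = D" and pb: "is_pullback C g p a b"
    and u: "u \<in> Ar C" "v \<in> Ar C" "Dom C u = Dom C p" "Dom C v = Dom C p" 
    and e: "u \<cdot> s = v \<cdot> s" "u \<cdot> b = v \<cdot> b"
  shows "u = v"
proof -
  have xt: "p \<in> Ar C" "Cod C p = D" "s \<in> Ar C" "Dom C s = D" "Cod C s = Dom C p"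
    using x by (simp_all add: Pt_Ob_iff)
  have c: "Cod C u = Cod C v" using arg_cong[OF e(1), of "Cod C"] u xt by simp
  note t = pb_typed[OF pb]
  obtain m where m: "monic C m" "Cod C m = Dom C u" "u \<cdot> m = v \<cdot> m"
    and ex: "\<And>x. \<lbrakk>x \<in> Ar C; Cod C x = Dom C u; u \<cdot> x = v \<cdot> x\<rbrakk> \<Longrightarrow>
      \<exists>w. w \<in> Ar C \<and> Dom C w = Dom C x \<and> Cod C w = Dom C m \<and> m \<cdot> w = x"
    by (rule equalizer_ex[OF u(1,2)]) (use u c in simp_all)
  obtain s' where s': "s' \<in> Ar C" "Cod C s' = Dom C m" "m \<cdot> s' = s" using ex[OF xt(3) _ e(1)] xt(5) u(3) by auto
  obtain b' where b': "b' \<in> Ar C" "Cod C b' = Dom C m" "m \<cdot> b' = b" using ex[OF t(5) _ e(2)] t(8) u(3) by auto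
  have "iso C m" by (rule section_pullback_extremal[OF x D pb m(1) _ s' b']) (use m u in simp)
  then obtain n where mn: "inverse_arrows C m n" by (rule isoE)
  note n = invD(1-4,6)[OF mn]
  have "u \<cdot> (m \<cdot> n) = v \<cdot> (m \<cdot> n)" by (rule cmp_ext[OF m(3)]) (use n(1-4) m(2) u in simp_all)
  thus ?thesis using n m(2) u by simp
qed

end

section \<open>Relations, images and coproducts in exact protomodular categories\<close>

definition jointly_monic :: "('o, 'm) cat \<Rightarrow> 'm \<Rightarrow> 'm \<Rightarrow> bool" where
  "jointly_monic C r1 r2 \<longleftrightarrow> r1 \<in> Ar C \<and> r2 \<in> Ar C \<and> Dom C r2 = Dom C r1 \<and>
    (\<forall>x\<in>Ar C. \<forall>y\<in>Ar C. Dom C x = Dom C y \<longrightarrow> Cod C x = Dom C r1 \<longrightarrow> Cod C y = Dom C r1 \<longrightarrow>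
      r1 \<cdot>\<^bsub>C\<^esub> x = r1 \<cdot>\<^bsub>C\<^esub> y \<longrightarrow> r2 \<cdot>\<^bsub>C\<^esub> x = r2 \<cdot>\<^bsub>C\<^esub> y \<longrightarrow> x = y)"

context pm_loc
begin

lemma jointly_monicD:
  assumes "jointly_monic C r1 r2" "x \<in> Ar C" "y \<in> Ar C" "Dom C x = Dom C y" "Cod C x = Dom C r1" "Cod C y = Dom C r1"
    "r1 \<cdot> x = r1 \<cdot> y" "r2 \<cdot> x = r2 \<cdot> y"
  shows "x = y"
  using assms unfolding jointly_monic_def by blast

lemma pb_fact':
  assumes "is_pullback C f g p q" "cone C f g x y" "Dom C x = T" "Dom C p = P"
  shows "\<exists>w. w \<in> Ar C \<and> Dom C w = T \<and> Cod C w = P \<and> p \<cdot> w = x \<and> q \<cdot> w = y"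
  using pb_fact[OF assms(1,2)] assms(3,4) by simp

lemma prod_arrow:
  assumes "is_product C a b p q" "x \<in> Ar C" "y \<in> Ar C" "Dom C x = Dom C y" "Cod C x = a" "Cod C y = b"
  obtains w where "w \<in> Ar C" "Dom C w = Dom C x" "Cod C w = Dom C p" "p \<cdot> w = x" "q \<cdot> w = y"
  using product_univ[OF assms] by blast

text \<open>Bourn: relations in a protomodular category are difunctional, because the triples of related
  pairs witnessing it are generated by the degenerate ones.\<close>

lemma relation_difunctional:
  assumes J: "jointly_monic C r1 r2"
    and w: "w1 \<in> Ar C" "w2 \<in> Ar C" "w3 \<in> Ar C" "Dom C w1 = T" "Dom C w2 = T" "Dom C w3 = T"
      "Cod C w1 = Dom C r1" "Cod C w2 = Dom C r1" "Cod C w3 = Dom C r1"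
    and e: "r2 \<cdot> w1 = r2 \<cdot> w2" "r1 \<cdot> w2 = r1 \<cdot> w3"
  shows "\<exists>w4. w4 \<in> Ar C \<and> Dom C w4 = T \<and> Cod C w4 = Dom C r1 \<and> r1 \<cdot> w4 = r1 \<cdot> w1 \<and> r2 \<cdot> w4 = r2 \<cdot> w3"
proof -
  define R X Y where "R = Dom C r1" and "X = Cod C r1" and "Y = Cod C r2"
  have r: "r1 \<in> Ar C" "r2 \<in> Ar C" "Dom C r1 = R" "Dom C r2 = R" "Cod C r1 = X" "Cod C r2 = Y"
    using J by (simp_all add: jointly_monic_def R_def X_def Y_def)
  have ob: "R \<in> Ob C" "X \<in> Ob C" "Y \<in> Ob C" using r by (metis Dom_Ob Cod_Ob)+
  obtain a1 a2 where pa: "is_pullback C r2 r2 a1 a2" using pb_ex[of r2 r2] r by auto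
  define N where "N = Dom C a1"
  have a: "a1 \<in> Ar C" "a2 \<in> Ar C" "Dom C a1 = N" "Dom C a2 = N" "Cod C a1 = R" "Cod C a2 = R" 
    and ae: "r2 \<cdot> a1 = r2 \<cdot> a2"
    using pb_typed[OF pa] r by (simp_all add: N_def)
  have N: "N \<in> Ob C" using a by (metis Dom_Ob)
  obtain n c where pc: "is_pullback C (r1 \<cdot> a2) r1 n c" using pb_ex[of "r1 \<cdot> a2" r1] r a by auto
  define P where "P = Dom C n"
  have nc: "n \<in> Ar C" "c \<in> Ar C" "Dom C n = P" "Dom C c = P" "Cod C n = N" "Cod C c = R"
    and nce: "r1 \<cdot> (a2 \<cdot> n) = r1 \<cdot> c"
    using pb_typed[OF pc] r a by (simp_all add: P_def)
  have P: "P \<in> Ob C" using nc by (metis Dom_Ob)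
  \<comment> \<open>The section \<open>\<sigma>\<close> of \<open>n\<close> repeats the last entry:
    (w1, w2, w2).\<close>
  have "cone C (r1 \<cdot> a2) r1 (Ide C N) a2" by (rule coneI) (use r a N in simp_all)
  then obtain \<sigma> where s: "\<sigma> \<in> Ar C" "Dom C \<sigma> = N" "Cod C \<sigma> = P" and se: "n \<cdot> \<sigma> = Ide C N" "c \<cdot> \<sigma> = a2"
    using pb_fact'[OF pc _ Dom_Ide[OF N] nc(3)] by blast
  have "cone C r2 r2 (Ide C R) (Ide C R)" by (rule coneI) (use r ob in simp_all)
  then obtain g where g: "g \<in> Ar C" "Dom C g = R" "Cod C g = N" and ge: "a1 \<cdot> g = Ide C R" "a2 \<cdot> g = Ide C R"
    using pb_fact'[OF pa _ Dom_Ide[OF ob(1)] a(3)] by blast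
  obtain b1 b2 where pl: "is_pullback C r1 r1 b1 b2" using pb_ex[of r1 r1] r by auto
  define L where "L = Dom C b1"
  have b: "b1 \<in> Ar C" "b2 \<in> Ar C" "Dom C b1 = L" "Dom C b2 = L" "Cod C b1 = R" "Cod C b2 = R"
    and be: "r1 \<cdot> b1 = r1 \<cdot> b2"
    using pb_typed[OF pl] r by (simp_all add: L_def)
  have g_ext: "a1 \<cdot> (g \<cdot> x) = x" "a2 \<cdot> (g \<cdot> x) = x" if "x \<in> Ar C" "Cod C x = R" for x
    using cmp_ext1[OF ge(1), of x] cmp_ext1[OF ge(2), of x] a g that ob by simp_all
  \<comment> \<open>\<open>\<beta>\<close> sends a pair (w, w') identified by \<open>r1\<close> to
    the triple (w, w, w'). These triples form the pullback of \<open>n\<close> along the diagonal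
    \<open>g\<close>, so \<open>\<sigma>\<close> and \<open>\<beta>\<close> generate
    \<open>P\<close>.\<close>
  have "cone C (r1 \<cdot> a2) r1 (g \<cdot> b1) b2" by (rule coneI) (use r a g b be g_ext in simp_all)
  then obtain \<beta> where be': "\<beta> \<in> Ar C" "Dom C \<beta> = L" "Cod C \<beta> = P" and bee: "n \<cdot> \<beta> = g \<cdot> b1" "c \<cdot> \<beta> = b2"
    using pb_fact'[OF pc _ _ nc(3), of "g \<cdot> b1" b2 L] g b(1,3,5) by auto
  have pb: "is_pullback C g n b1 \<beta>"
  proof (rule pbI)
    fix x y assume x: "x \<in> Ar C" "y \<in> Ar C" "Dom C x = Dom C y" "Cod C x = Dom C g" "Cod C y = Dom C n"
      and xe: "g \<cdot> x = n \<cdot> y"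
    have "r1 \<cdot> x = r1 \<cdot> (a2 \<cdot> (g \<cdot> x))" using g_ext x g by simp
    also have "\<dots> = r1 \<cdot> (a2 \<cdot> (n \<cdot> y))" by (simp only: xe)
    also have "\<dots> = (r1 \<cdot> (a2 \<cdot> n)) \<cdot> y" using r a nc x by simp
    also have "\<dots> = r1 \<cdot> (c \<cdot> y)" unfolding nce using r nc x by simp
    finally have "cone C r1 r1 x (c \<cdot> y)" by (intro coneI) (use r nc x g in simp_all)
    then obtain w where w: "w \<in> Ar C" "Dom C w = Dom C x" "Cod C w = L" and we: "b1 \<cdot> w = x" "b2 \<cdot> w = c \<cdot> y"
      using pb_fact'[OF pl _ refl b(3)] by blast
    have "\<beta> \<cdot> w = y"
    proof (rule pb_uniq[OF pc])
      have "n \<cdot> (\<beta> \<cdot> w) = g \<cdot> (b1 \<cdot> w)" by (rule cmp_ext[OF bee(1)]) (use nc be' g b w in simp_all)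
      thus "n \<cdot> (\<beta> \<cdot> w) = n \<cdot> y" using we xe by simp
      have "c \<cdot> (\<beta> \<cdot> w) = b2 \<cdot> w" by (rule cmp_ext1[OF bee(2)]) (use nc be' g b w in simp_all)
      thus "c \<cdot> (\<beta> \<cdot> w) = c \<cdot> y" using we by simp
    qed (use be' w nc x in simp_all)
    thus "\<exists>w. w \<in> Ar C \<and> Dom C w = Dom C x \<and> Cod C w = Dom C b1 \<and> b1 \<cdot> w = x \<and> \<beta> \<cdot> w = y"
      using w we b(3) by (intro exI[of _ w]) simp
  next
    fix w w' assume w: "w \<in> Ar C" "w' \<in> Ar C" "Dom C w = Dom C w'" "Cod C w = Dom C b1" "Cod C w' = Dom C b1"
      "b1 \<cdot> w = b1 \<cdot> w'" and we: "\<beta> \<cdot> w = \<beta> \<cdot> w'"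
    have "b2 \<cdot> w = c \<cdot> (\<beta> \<cdot> w)" "b2 \<cdot> w' = c \<cdot> (\<beta> \<cdot> w')"
      using cmp_ext1[OF bee(2), of w] cmp_ext1[OF bee(2), of w'] nc be' b w(1-5) by simp_all
    thus "w = w'" using pb_uniq[OF pl w] we by simp
  qed (use g nc b be' bee in simp_all)
  obtain p1 p2 where pr: "is_product C X Y p1 p2" using prod_ex ob by blast
  note prd = productD[OF pr]
  obtain \<rho> where rho: "\<rho> \<in> Ar C" "Dom C \<rho> = R" "Cod C \<rho> = Dom C p1" and rhoe: "p1 \<cdot> \<rho> = r1" "p2 \<cdot> \<rho> = r2"
    by (rule prod_arrow[OF pr, of r1 r2]) (use r in simp_all)
  \<comment> \<open>\<open>\<phi>\<close> is the pair (r1 w1, r2 w3) that has to be shown related,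
    and \<open>M\<close> below is the subobject of triples for which it is.\<close>
  obtain \<phi> where phi: "\<phi> \<in> Ar C" "Dom C \<phi> = P" "Cod C \<phi> = Dom C p1"
     and phie: "p1 \<cdot> \<phi> = r1 \<cdot> (a1 \<cdot> n)" "p2 \<cdot> \<phi> = r2 \<cdot> c"
    by (rule prod_arrow[OF pr, of "r1 \<cdot> (a1 \<cdot> n)" "r2 \<cdot> c"]) (use r a nc in simp_all)
  obtain m w where pm: "is_pullback C \<phi> \<rho> m w" using pb_ex[of \<phi> \<rho>] phi rho by auto
  define M where "M = Dom C m"
  have m: "m \<in> Ar C" "w \<in> Ar C" "Dom C m = M" "Dom C w = M" "Cod C m = P" "Cod C w = R" and me: "\<phi> \<cdot> m = \<rho> \<cdot> w"
    using pb_typed[OF pm] phi rho by (simp_all add: M_def)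
  have rho_ext: "p1 \<cdot> (\<rho> \<cdot> x) = r1 \<cdot> x" "p2 \<cdot> (\<rho> \<cdot> x) = r2 \<cdot> x" if "x \<in> Ar C" "Cod C x = R" for x
    using cmp_ext1[OF rhoe(1), of x] cmp_ext1[OF rhoe(2), of x] prd rho that by simp_all
  have phi_ext: "p1 \<cdot> (\<phi> \<cdot> x) = r1 \<cdot> (a1 \<cdot> (n \<cdot> x))" "p2 \<cdot> (\<phi> \<cdot> x) = r2 \<cdot> (c \<cdot> x)" if "x \<in> Ar C" "Cod C x = P" for x
    using cmp_ext1[OF phie(1), of x] cmp_ext1[OF phie(2), of x] prd phi r a nc that by simp_all
  have mono: "monic C m" unfolding monic_def
  proof (intro conjI ballI impI)
    fix x y assume x: "x \<in> Ar C" "y \<in> Ar C" "Dom C x = Dom C y" "Cod C x = Dom C m" "Cod C y = Dom C m"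
      and xe: "m \<cdot> x = m \<cdot> y"
    have eq: "\<rho> \<cdot> (w \<cdot> x) = \<rho> \<cdot> (w \<cdot> y)"
      using cmp_ext[OF me, of x] cmp_ext[OF me, of y] phi rho m x xe by simp
    have "w \<cdot> x = w \<cdot> y"
    proof (rule jointly_monicD[OF J])
      have "p1 \<cdot> (\<rho> \<cdot> (w \<cdot> x)) = p1 \<cdot> (\<rho> \<cdot> (w \<cdot> y))" "p2 \<cdot> (\<rho> \<cdot> (w \<cdot> x)) = p2 \<cdot> (\<rho> \<cdot> (w \<cdot> y))"
        by (simp_all only: eq)
      thus "r1 \<cdot> (w \<cdot> x) = r1 \<cdot> (w \<cdot> y)" "r2 \<cdot> (w \<cdot> x) = r2 \<cdot> (w \<cdot> y)"
        using rho_ext[of "w \<cdot> x"] rho_ext[of "w \<cdot> y"] m x by simp_all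
    qed (use m x r in simp_all)
    thus "x = y" using pb_uniq[OF pm x xe] by simp
  qed (use m in simp)
  have fac: "\<exists>z'. z' \<in> Ar C \<and> Cod C z' = M \<and> m \<cdot> z' = z"
    if z: "z \<in> Ar C" "Cod C z = P" and v: "v \<in> Ar C" "Dom C v = Dom C z" "Cod C v = R"
      and ve: "r1 \<cdot> v = r1 \<cdot> (a1 \<cdot> (n \<cdot> z))" "r2 \<cdot> v = r2 \<cdot> (c \<cdot> z)" for z v
  proof -
    have "\<phi> \<cdot> z = \<rho> \<cdot> v"
      by (rule product_uniq[OF pr]) (use z v ve phi rho rho_ext[of v] phi_ext[of z] in simp_all)
    hence "cone C \<phi> \<rho> z v" by (intro coneI) (use z v phi rho in simp_all)
    thus ?thesis using pb_fact'[OF pm _ refl m(3)] by blast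
  qed
  have sig: "n \<cdot> \<sigma> = Ide C N" "c \<cdot> \<sigma> = a2" using se by auto
  \<comment> \<open>The degenerate triples lie in \<open>M\<close>: for (w1, w2, w2) the pair is
    witnessed by w1, since \<open>r2\<close> identifies w1 and w2; for (w, w, w') by w', since
    \<open>r1\<close> identifies w and w'.\<close>
  obtain \<sigma>' where s': "\<sigma>' \<in> Ar C" "Cod C \<sigma>' = Dom C m" "m \<cdot> \<sigma>' = \<sigma>"
    using fac[of \<sigma> a1] s a se ae m(3) by auto
  obtain \<beta>' where b': "\<beta>' \<in> Ar C" "Cod C \<beta>' = Dom C m" "m \<cdot> \<beta>' = \<beta>"
    using fac[of \<beta> b2] be' b bee be g_ext[of b1] m(3) by auto
  have pt: "(n, \<sigma>) \<in> Ob (Pt C N)" using nc s se by (simp add: Pt_Ob_iff)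
  have "iso C m" by (rule section_pullback_extremal[OF pt g(3) pb mono _ s' b']) (use m nc in simp)
  then obtain m' where mm: "inverse_arrows C m m'" by (rule isoE)
  note i = invD[OF mm]
  have "cone C r2 r2 w1 w2" by (rule coneI) (use r w e R_def in simp_all)
  then obtain v where v: "v \<in> Ar C" "Dom C v = T" "Cod C v = N" and ve: "a1 \<cdot> v = w1" "a2 \<cdot> v = w2"
    using pb_fact'[OF pa _ w(4) a(3)] by blast
  have "cone C (r1 \<cdot> a2) r1 v w3" by (rule coneI) (use r a v ve e w R_def in simp_all)
  then obtain z where z: "z \<in> Ar C" "Dom C z = T" "Cod C z = P" and ze: "n \<cdot> z = v" "c \<cdot> z = w3"
    using pb_fact'[OF pc _ v(2) nc(3)] by blast
  define w4 where "w4 = w \<cdot> (m' \<cdot> z)"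
  have w4: "w4 \<in> Ar C" "Dom C w4 = T" "Cod C w4 = Dom C r1" using m i(1-4) z r by (simp_all add: w4_def)
  have "\<rho> \<cdot> w4 = \<phi> \<cdot> (m \<cdot> (m' \<cdot> z))"
    unfolding w4_def by (rule cmp_ext[OF me[symmetric]]) (use m i(1-4) z phi rho in simp_all)
  also have "\<dots> = \<phi> \<cdot> z" using i(8)[of z] z m by simp
  finally have f: "\<rho> \<cdot> w4 = \<phi> \<cdot> z" .
  have "r1 \<cdot> w4 = r1 \<cdot> w1" "r2 \<cdot> w4 = r2 \<cdot> w3"
    using rho_ext[of w4] phi_ext[of z] f w4 r z ze ve by simp_all
  thus ?thesis using w4 by blast
qed

text \<open>Both remaining laws are instances of difunctionality with degenerate entries: symmetry
  from the triple (\<open>d r2\<close>, identity, \<open>d r1\<close>), transitivity from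
  (\<open>p\<close>, \<open>d r2 p\<close>, \<open>q\<close>).\<close>

lemma reflexive_relation_equivalence:
  assumes J: "jointly_monic C r1 r2" and c: "Cod C r1 = Q" "Cod C r2 = Q"
    and d: "d \<in> Ar C" "Dom C d = Q" "Cod C d = Dom C r1" "r1 \<cdot> d = Ide C Q" "r2 \<cdot> d = Ide C Q"
  shows "is_equivalence_relation C r1 r2"
proof -
  have r: "r1 \<in> Ar C" "r2 \<in> Ar C" "Dom C r2 = Dom C r1" using J by (simp_all add: jointly_monic_def)
  have Q: "Q \<in> Ob C" using c r by (metis Cod_Ob)
  have d_ext: "r1 \<cdot> (d \<cdot> x) = x" "r2 \<cdot> (d \<cdot> x) = x" if "x \<in> Ar C" "Cod C x = Q" for x
    using cmp_ext1[OF d(4), of x] cmp_ext1[OF d(5), of x] r c d that by simp_all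
  have s: "\<exists>s\<in>Hom C (Dom C r1) (Dom C r1). r1 \<cdot> s = r2 \<and> r2 \<cdot> s = r1"
  proof -
    have "\<exists>w4. w4 \<in> Ar C \<and> Dom C w4 = Dom C r1 \<and> Cod C w4 = Dom C r1 \<and> r1 \<cdot> w4 = r1 \<cdot> (d \<cdot> r2) \<and> r2 \<cdot> w4 = r2 \<cdot> (d \<cdot> r1)"
      by (rule relation_difunctional[OF J, of _ "Ide C (Dom C r1)"]) (use r c d(1-3) d_ext in simp_all)
    thus ?thesis using d_ext[OF r(1) c(1)] d_ext[OF r(2) c(2)] unfolding Bex_def Hom_iff by simp
  qed
  have t: "\<exists>t\<in>Hom C (Dom C p) (Dom C r1). r1 \<cdot> t = r1 \<cdot> p \<and> r2 \<cdot> t = r2 \<cdot> q"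
    if pb: "is_pullback C r2 r1 p q" for p q
  proof -
    have T: "p \<in> Ar C" "q \<in> Ar C" "Dom C q = Dom C p" "Cod C p = Dom C r1" "Cod C q = Dom C r1" "r2 \<cdot> p = r1 \<cdot> q"
      using pb_typed[OF pb] r by simp_all
    have rp: "r2 \<cdot> p \<in> Ar C" "Cod C (r2 \<cdot> p) = Q" "Dom C (r2 \<cdot> p) = Dom C p" using T r c by simp_all
    have "\<exists>w4. w4 \<in> Ar C \<and> Dom C w4 = Dom C p \<and> Cod C w4 = Dom C r1 \<and> r1 \<cdot> w4 = r1 \<cdot> p \<and> r2 \<cdot> w4 = r2 \<cdot> q"
      by (rule relation_difunctional[OF J, of _ "d \<cdot> (r2 \<cdot> p)"])
        (use T r c d(1-3) d_ext rp in simp_all)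
    thus ?thesis unfolding Bex_def Hom_iff by blast
  qed
  have dd: "\<exists>d\<in>Hom C (Cod C r1) (Dom C r1). r1 \<cdot> d = Ide C (Cod C r1) \<and> r2 \<cdot> d = Ide C (Cod C r1)"
    using d c by auto
  show ?thesis unfolding is_equivalence_relation_def
  proof (intro conjI allI impI)
    show "\<forall>x\<in>Ar C. \<forall>y\<in>Ar C. Dom C x = Dom C y \<longrightarrow> Cod C x = Dom C r1 \<longrightarrow> Cod C y = Dom C r1 \<longrightarrow>
      r1 \<cdot> x = r1 \<cdot> y \<longrightarrow> r2 \<cdot> x = r2 \<cdot> y \<longrightarrow> x = y"
      using J by (simp add: jointly_monic_def)
  qed (use r c s t dd in simp_all)
qed

end

section \<open>Images and effective quotients\<close>

locale exact_loc = pm_loc +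
  assumes be: "barr_exact C" and cop: "has_finite_coproducts C"
begin

lemma kernel_pair_coeq: "is_pullback C f f p q \<Longrightarrow> \<exists>e. is_coequalizer C p q e"
  and regular_epi_stable: "is_pullback C f g p q \<Longrightarrow> regular_epi C g \<Longrightarrow> regular_epi C p"
  and effective: "is_equivalence_relation C r1 r2 \<Longrightarrow> \<exists>f. is_pullback C f f r1 r2"
  using be unfolding barr_exact_def regular_category_def by blast+

text \<open>This stands in for choosing preimages of elements: every \<open>u\<close> lifts through
  a regular epimorphism once its domain is replaced by a cover \<open>t\<close>.\<close>

lemma cover_lift:
  assumes e: "regular_epi C e" and u: "u \<in> Ar C" "Cod C u = Cod C e"
  obtains t a where "regular_epi C t" "t \<in> Ar C" "Cod C t = Dom C u" "a \<in> Ar C" "Dom C a = Dom C t" "Cod C a = Dom C e"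
    "e \<cdot> a = u \<cdot> t"
proof -
  obtain t a where pb: "is_pullback C u e t a" using pb_ex[of u e] u regular_epi_Ar[OF e] by auto
  show thesis by (rule that[OF regular_epi_stable[OF pb e]]) (use pb_typed[OF pb] in simp_all)
qed

text \<open>\<open>e\<close> is the coequalizer of the kernel pair of \<open>f\<close>. If
  \<open>m\<close> identifies \<open>u\<close> and \<open>v\<close>, they lift over a common cover
  to arrows \<open>a\<close> and \<open>b\<close> that \<open>f\<close> identifies; so
  \<open>e\<close> identifies the lifts, and the covers can be cancelled.\<close>

lemma image_factorization:
  assumes f: "f \<in> Ar C"
  obtains e m where "regular_epi C e" "e \<in> Ar C" "monic C m" "m \<in> Ar C" "Dom C e = Dom C f" "Cod C e = Dom C m" "Cod C m = Cod C f" "m \<cdot> e = f"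
proof -
  obtain p q where pb: "is_pullback C f f p q" using pb_ex[of f f] f by auto
  note T = pb_typed(4-9)[OF pb]
  obtain e where c: "is_coequalizer C p q e" using kernel_pair_coeq[OF pb] by auto
  hence re: "regular_epi C e" by (auto simp: regular_epi_def)
  note E = coeqD(5-7)[OF c]
  obtain m where m: "m \<in> Ar C" "Dom C m = Cod C e" "Cod C m = Cod C f" "m \<cdot> e = f"
    by (rule coeq_univ[OF c f]) (use T in simp_all)
  have de: "Dom C e = Dom C f" using E T by simp
  have "monic C m" unfolding monic_def
  proof (intro conjI ballI impI)
    fix u v assume u: "u \<in> Ar C" "v \<in> Ar C" "Dom C u = Dom C v" "Cod C u = Dom C m" "Cod C v = Dom C m"
      and ue: "m \<cdot> u = m \<cdot> v"
    obtain t1 a where t1: "regular_epi C t1" "t1 \<in> Ar C" "Cod C t1 = Dom C u" "a \<in> Ar C" "Dom C a = Dom C t1" "Cod C a = Dom C e"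
      and a: "e \<cdot> a = u \<cdot> t1" by (rule cover_lift[OF re u(1)]) (use u m in simp_all)
    have vt: "v \<cdot> t1 \<in> Ar C" "Cod C (v \<cdot> t1) = Cod C e" "Dom C (v \<cdot> t1) = Dom C t1" using u t1 m by simp_all
    obtain t2 b where t2: "regular_epi C t2" "t2 \<in> Ar C" "Cod C t2 = Dom C t1" "b \<in> Ar C" "Dom C b = Dom C t2" "Cod C b = Dom C e"
      and b: "e \<cdot> b = (v \<cdot> t1) \<cdot> t2" by (rule cover_lift[OF re vt(1,2)]) (use vt(3) in simp_all)
    have 1: "e \<cdot> (a \<cdot> t2) = u \<cdot> (t1 \<cdot> t2)"
      by (rule cmp_ext[OF a]) (use E(1) t1 t2 u m in simp_all)
    have "f \<cdot> (a \<cdot> t2) = m \<cdot> (e \<cdot> (a \<cdot> t2))"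
      by (rule cmp_ext1[OF m(4), symmetric]) (use E(1) t1 t2 m in simp_all)
    also have "\<dots> = (m \<cdot> u) \<cdot> (t1 \<cdot> t2)" unfolding 1 using u t1 t2 m by simp
    also have "\<dots> = m \<cdot> (e \<cdot> b)" unfolding ue b using u t1 t2 m by simp
    also have "\<dots> = f \<cdot> b" by (rule cmp_ext1[OF m(4)]) (use E(1) t2 m in simp_all)
    finally have "cone C f f (a \<cdot> t2) b" by (intro coneI) (use t1 t2 de in simp_all)
    then obtain w where w: "w \<in> Ar C" "Cod C w = Dom C p" and we: "p \<cdot> w = a \<cdot> t2" "q \<cdot> w = b"
      using pb_fact[OF pb] by blast
    have "e \<cdot> (p \<cdot> w) = e \<cdot> (q \<cdot> w)" by (rule cmp_ext[OF E(3)]) (use w E(1) T(1-5) de in simp_all)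
    hence 2: "(u \<cdot> t1) \<cdot> t2 = (v \<cdot> t1) \<cdot> t2" unfolding we 1 b using u t1 t2 by simp
    have 3: "u \<cdot> t1 = v \<cdot> t1" by (rule regular_epi_cancel[OF t2(1) _ _ _ _ 2]) (use u t1 t2 in simp_all)
    show "u = v" by (rule regular_epi_cancel[OF t1(1) _ _ _ _ 3]) (use u t1 t2 in simp_all)
  qed (use m in simp)
  thus thesis by (intro that[OF re E(1) _ m(1) de]) (use m in simp_all)
qed

text \<open>The pair need not be a kernel pair, but its image \<open>r1\<close>, \<open>r2\<close>
  in the square of \<open>Q\<close> is a reflexive relation through \<open>i\<close>, hence an
  effective equivalence relation. The cover \<open>c\<close> is returned so that elements of the
  relation can be traced back to \<open>P\<close>.\<close>

lemma reflexive_pair_effective: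
  assumes d: "d0 \<in> Ar C" "d1 \<in> Ar C" "Dom C d0 = P" "Dom C d1 = P" "Cod C d0 = Q" "Cod C d1 = Q"
    and i: "i \<in> Ar C" "Dom C i = Q" "Cod C i = P" "d0 \<cdot> i = Ide C Q" "d1 \<cdot> i = Ide C Q"
  obtains c r1 r2 e where "regular_epi C c" "c \<in> Ar C" "Dom C c = P" "Cod C c = Dom C r1" "r1 \<cdot> c = d0" "r2 \<cdot> c = d1"
    "is_pullback C e e r1 r2" "regular_epi C e" "e \<in> Ar C" "Dom C e = Q"
proof -
  have Q: "Q \<in> Ob C" using i(1,2) by auto
  obtain p1 p2 where pr: "is_product C Q Q p1 p2" using prod_ex Q by blast
  note prd = productD[OF pr]
  obtain \<phi> where phi: "\<phi> \<in> Ar C" "Dom C \<phi> = P" "Cod C \<phi> = Dom C p1" and phie: "p1 \<cdot> \<phi> = d0" "p2 \<cdot> \<phi> = d1"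
    by (rule prod_arrow[OF pr, of d0 d1]) (use d in simp_all)
  obtain c m where c: "regular_epi C c" "c \<in> Ar C" "monic C m" "m \<in> Ar C" "Dom C c = Dom C \<phi>" "Cod C c = Dom C m" "Cod C m = Cod C \<phi>"
    and mc: "m \<cdot> c = \<phi>" by (rule image_factorization[OF phi(1)])
  define r1 r2 where "r1 = p1 \<cdot> m" and "r2 = p2 \<cdot> m"
  have r: "r1 \<in> Ar C" "r2 \<in> Ar C" "Dom C r1 = Dom C m" "Dom C r2 = Dom C m" "Cod C r1 = Q" "Cod C r2 = Q"
    unfolding r1_def r2_def using prd phi c by simp_all
  have rc: "r1 \<cdot> c = d0" "r2 \<cdot> c = d1" unfolding r1_def r2_def using prd phi c phie mc by simp_all
  have J: "jointly_monic C r1 r2" unfolding jointly_monic_def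
  proof (intro conjI ballI impI)
    fix x y assume x: "x \<in> Ar C" "y \<in> Ar C" "Dom C x = Dom C y" "Cod C x = Dom C r1" "Cod C y = Dom C r1"
      and e: "r1 \<cdot> x = r1 \<cdot> y" "r2 \<cdot> x = r2 \<cdot> y"
    have mxy: "m \<cdot> x = m \<cdot> y"
    proof (rule product_uniq[OF pr])
      show "p1 \<cdot> (m \<cdot> x) = p1 \<cdot> (m \<cdot> y)" "p2 \<cdot> (m \<cdot> x) = p2 \<cdot> (m \<cdot> y)"
        using e x r c phi prd by (simp_all add: r1_def r2_def)
    qed (use x r c phi prd in simp_all)
    show "x = y" by (rule monicD[OF c(3) _ _ _ _ _ mxy]) (use x r in simp_all)
  qed (use r in simp_all)
  have "is_equivalence_relation C r1 r2"
  proof (rule reflexive_relation_equivalence[OF J r(5,6), of "c \<cdot> i"])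
    show "r1 \<cdot> (c \<cdot> i) = Ide C Q" "r2 \<cdot> (c \<cdot> i) = Ide C Q"
      using cmp_ext1[OF rc(1), of i] cmp_ext1[OF rc(2), of i] r c i phi d by simp_all
  qed (use c i phi r in simp_all)
  then obtain f where pf: "is_pullback C f f r1 r2" using effective by blast
  note F = pb_typed[OF pf]
  \<comment> \<open>Effectiveness provides just some \<open>f\<close> with kernel pair
    \<open>r1\<close>, \<open>r2\<close>. The coequalizer \<open>e\<close> of that pair has the same
    kernel pair, because \<open>f\<close> factors through \<open>e\<close>.\<close>
  obtain e where ce: "is_coequalizer C r1 r2 e" using kernel_pair_coeq[OF pf] by blast
  hence re: "regular_epi C e" by (auto simp: regular_epi_def)
  note E = coeqD(5-7)[OF ce]
  obtain w where w: "w \<in> Ar C" "Dom C w = Cod C e" "Cod C w = Cod C f" "w \<cdot> e = f"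
    by (rule coeq_univ[OF ce F(1)]) (use F in simp_all)
  have pe: "is_pullback C e e r1 r2"
  proof (rule pbI)
    fix x y assume x: "x \<in> Ar C" "y \<in> Ar C" "Dom C x = Dom C y" "Cod C x = Dom C e" "Cod C y = Dom C e" and ex: "e \<cdot> x = e \<cdot> y"
    have "f \<cdot> x = f \<cdot> y" using cmp_ext1[OF w(4), of x] cmp_ext1[OF w(4), of y] x w(1-3) E(1) ex by simp
    hence "cone C f f x y" by (intro coneI) (use x E(2) F r in simp_all)
    thus "\<exists>w. w \<in> Ar C \<and> Dom C w = Dom C x \<and> Cod C w = Dom C r1 \<and> r1 \<cdot> w = x \<and> r2 \<cdot> w = y"
      using pb_fact[OF pf] by blast
  next
    show "w = w'" if "w \<in> Ar C" "w' \<in> Ar C" "Dom C w = Dom C w'" "Cod C w = Dom C r1" "Cod C w' = Dom C r1"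
      "r1 \<cdot> w = r1 \<cdot> w'" "r2 \<cdot> w = r2 \<cdot> w'" for w w' by (rule pb_uniq[OF pf that])
  qed (use E r in simp_all)
  show thesis by (rule that[OF c(1,2) _ _ rc pe re E(1)]) (use c phi r E in simp_all)
qed

section \<open>Calculus of chosen coproducts\<close>

lemma coprod_chosen:
  assumes "a \<in> Ob C" "b \<in> Ob C"
  shows "is_coproduct C a b (inj1 C a b) (inj2 C a b)"
proof -
  have "\<exists>x. case x of (i, j) \<Rightarrow> is_coproduct C a b i j" using cop assms by (auto simp: has_finite_coproducts_def)
  from someI_ex[OF this] have *: "case SOME (i, j). is_coproduct C a b i j of (i, j) \<Rightarrow> is_coproduct C a b i j" .
  obtain i j where e: "(SOME (i, j). is_coproduct C a b i j) = (i, j)" by fastforce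
  show ?thesis using * by (simp add: inj1_def inj2_def e)
qed

lemma inj_simps [simp]:
  assumes "a \<in> Ob C" "b \<in> Ob C"
  shows "inj1 C a b \<in> Ar C" "inj2 C a b \<in> Ar C" "Dom C (inj1 C a b) = a" "Dom C (inj2 C a b) = b"
    "Cod C (inj2 C a b) = Cod C (inj1 C a b)"
  using coprod_chosen[OF assms] by (auto simp: is_coproduct_def)

lemma coprod_ex1:
  assumes "f \<in> Ar C" "g \<in> Ar C" "Cod C f = Cod C g"
  shows "\<exists>!h. h \<in> Hom C (Cod C (inj1 C (Dom C f) (Dom C g))) (Cod C f) \<and>
    h \<cdot> inj1 C (Dom C f) (Dom C g) = f \<and> h \<cdot> inj2 C (Dom C f) (Dom C g) = g"
  using coprod_chosen[of "Dom C f" "Dom C g"] assms Dom_Ob unfolding is_coproduct_def by blast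

lemma cotuple_props:
  assumes "f \<in> Ar C" "g \<in> Ar C" "Cod C f = Cod C g"
  shows "cotuple C f g \<in> Ar C" "Dom C (cotuple C f g) = Cod C (inj1 C (Dom C f) (Dom C g))"
    "Cod C (cotuple C f g) = Cod C f"
    "cotuple C f g \<cdot> inj1 C (Dom C f) (Dom C g) = f" "cotuple C f g \<cdot> inj2 C (Dom C f) (Dom C g) = g"
  using theI'[OF coprod_ex1[OF assms]] unfolding cotuple_def Let_def by auto

lemmas cotuple_typed [simp] = cotuple_props(1-3)

lemma cotuple_inj [simp]:
  assumes "f \<in> Ar C" "g \<in> Ar C" "Cod C f = Cod C g" "Dom C f = a" "Dom C g = b"
  shows "cotuple C f g \<cdot> inj1 C a b = f" "cotuple C f g \<cdot> inj2 C a b = g"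
  using cotuple_props(4,5)[OF assms(1-3)] assms(4,5) by auto

lemma cotuple_inj_ext [simp]:
  assumes "f \<in> Ar C" "g \<in> Ar C" "Cod C f = Cod C g" "Dom C f = a" "Dom C g = b" "x \<in> Ar C"
  shows "Cod C x = a \<Longrightarrow> cotuple C f g \<cdot> (inj1 C a b \<cdot> x) = f \<cdot> x"
    "Cod C x = b \<Longrightarrow> cotuple C f g \<cdot> (inj2 C a b \<cdot> x) = g \<cdot> x"
  using cmp_ext1[OF cotuple_inj(1)[OF assms(1-5)], of x] cmp_ext1[OF cotuple_inj(2)[OF assms(1-5)], of x] assms
  by auto

lemma coprod_eqI:
  assumes "a \<in> Ob C" "b \<in> Ob C" "h \<in> Ar C" "h' \<in> Ar C" "Dom C h = Cod C (inj1 C a b)" "Dom C h' = Cod C (inj1 C a b)"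
    "h \<cdot> inj1 C a b = h' \<cdot> inj1 C a b" "h \<cdot> inj2 C a b = h' \<cdot> inj2 C a b"
  shows "h = h'"
proof -
  have c: "Cod C h = Cod C h'" using arg_cong[OF assms(7), of "Cod C"] assms(1-6) by simp
  have "\<exists>!k. k \<in> Hom C (Cod C (inj1 C a b)) (Cod C h) \<and> k \<cdot> inj1 C a b = h \<cdot> inj1 C a b \<and> k \<cdot> inj2 C a b = h \<cdot> inj2 C a b"
    using coprod_ex1[of "h \<cdot> inj1 C a b" "h \<cdot> inj2 C a b"] assms(1-6) by simp
  moreover have "h \<in> Hom C (Cod C (inj1 C a b)) (Cod C h)" "h' \<in> Hom C (Cod C (inj1 C a b)) (Cod C h)"
    using assms(3-6) c by simp_all
  ultimately show ?thesis using assms(7,8) by metis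
qed

text \<open>As a simp rule it pushes \<open>h\<close> into the cotuple. Proofs that must keep the
  composite, in order to regroup it by associativity or functoriality, delete it.\<close>

lemma cotuple_comp [simp]:
  assumes "f \<in> Ar C" "g \<in> Ar C" "Cod C f = Cod C g" "h \<in> Ar C" "Cod C g = Dom C h"
  shows "h \<cdot> cotuple C f g = cotuple C (h \<cdot> f) (h \<cdot> g)"
  by (rule coprod_eqI[of "Dom C f" "Dom C g"]) (use assms in simp_all)

lemma cotuple_Ide [simp]:
  assumes "a \<in> Ob C" "b \<in> Ob C"
  shows "cotuple C (inj1 C a b) (inj2 C a b) = Ide C (Cod C (inj1 C a b))"
  by (rule coprod_eqI[of a b]) (use assms in simp_all)

lemma coprod_map_simps [simp]:
  assumes "f \<in> Ar C" "g \<in> Ar C"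
  shows "coprod_map C f g \<in> Ar C" "Dom C (coprod_map C f g) = Cod C (inj1 C (Dom C f) (Dom C g))"
    "Cod C (coprod_map C f g) = Cod C (inj1 C (Cod C f) (Cod C g))"
  using assms by (simp_all add: coprod_map_def)

lemma coprod_map_inj [simp]:
  assumes "f \<in> Ar C" "g \<in> Ar C" "Dom C f = a" "Dom C g = b"
  shows "coprod_map C f g \<cdot> inj1 C a b = inj1 C (Cod C f) (Cod C g) \<cdot> f"
    "coprod_map C f g \<cdot> inj2 C a b = inj2 C (Cod C f) (Cod C g) \<cdot> g"
  using assms by (auto simp: coprod_map_def)

lemma cotuple_coprod_map [simp]:
  assumes "f \<in> Ar C" "g \<in> Ar C" "Cod C f = Cod C g" "u \<in> Ar C" "v \<in> Ar C" "Cod C u = Dom C f" "Cod C v = Dom C g"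
  shows "cotuple C f g \<cdot> coprod_map C u v = cotuple C (f \<cdot> u) (g \<cdot> v)"
  by (rule coprod_eqI[of "Dom C u" "Dom C v"]) (use assms in simp_all)

end

section \<open>Kernels in semi-abelian categories\<close>

definition annihilated :: "('o, 'm) cat \<Rightarrow> 'm \<Rightarrow> 'm \<Rightarrow> bool" where
  "annihilated C f x \<longleftrightarrow> x \<in> Ar C \<and> Cod C x = Dom C f \<and> f \<cdot>\<^bsub>C\<^esub> x = zero_arrow C (Dom C x) (Cod C f)"

locale semi_loc = exact_loc +
  assumes ptd: "pointed C"
begin

lemma zero_object: "is_zero_object C (zero_ob C)"
  using someI_ex[OF ptd[unfolded pointed_def]] by (simp add: zero_ob_def)

lemma zero_ob_Ob [simp]: "zero_ob C \<in> Ob C"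
  using zero_object by (simp add: is_zero_object_def is_terminal_def)

lemma from_zero_ex1: "a \<in> Ob C \<Longrightarrow> \<exists>!f. f \<in> Hom C (zero_ob C) a"
  and to_zero_ex1: "a \<in> Ob C \<Longrightarrow> \<exists>!f. f \<in> Hom C a (zero_ob C)"
  using zero_object unfolding is_zero_object_def is_terminal_def is_initial_def by blast+

lemma from_zero_simps [simp]:
  assumes "a \<in> Ob C"
  shows "from_zero C a \<in> Ar C" "Dom C (from_zero C a) = zero_ob C" "Cod C (from_zero C a) = a"
  using theI'[OF from_zero_ex1[OF assms]] by (auto simp: from_zero_def)

lemma to_zero_simps [simp]:
  assumes "a \<in> Ob C"
  shows "to_zero C a \<in> Ar C" "Dom C (to_zero C a) = a" "Cod C (to_zero C a) = zero_ob C"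
  using theI'[OF to_zero_ex1[OF assms]] by (auto simp: to_zero_def)

lemma from_zero_unique: "\<lbrakk>f \<in> Ar C; Dom C f = zero_ob C; Cod C f = a\<rbrakk> \<Longrightarrow> f = from_zero C a"
  using from_zero_ex1[of a] from_zero_simps[of a] by (metis Cod_Ob Hom_iff)

lemma to_zero_unique: "\<lbrakk>f \<in> Ar C; Cod C f = zero_ob C; Dom C f = a\<rbrakk> \<Longrightarrow> f = to_zero C a"
  using to_zero_ex1[of a] to_zero_simps[of a] by (metis Dom_Ob Hom_iff)

lemma zero_arrow_simps [simp]:
  assumes "a \<in> Ob C" "b \<in> Ob C"
  shows "zero_arrow C a b \<in> Ar C" "Dom C (zero_arrow C a b) = a" "Cod C (zero_arrow C a b) = b"
  using assms by (simp_all add: zero_arrow_def)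

lemma from_zero_comp [simp]: "\<lbrakk>a \<in> Ob C; x \<in> Ar C; Cod C x = zero_ob C\<rbrakk> \<Longrightarrow> from_zero C a \<cdot> x = zero_arrow C (Dom C x) a"
  using to_zero_unique[of x "Dom C x"] by (simp add: zero_arrow_def)

lemma comp_to_zero [simp]: "\<lbrakk>a \<in> Ob C; x \<in> Ar C; Dom C x = zero_ob C\<rbrakk> \<Longrightarrow> x \<cdot> to_zero C a = zero_arrow C a (Cod C x)"
  using from_zero_unique[of x "Cod C x"] by (simp add: zero_arrow_def)

lemma to_zero_comp [simp]: "\<lbrakk>x \<in> Ar C; Cod C x = a\<rbrakk> \<Longrightarrow> to_zero C a \<cdot> x = to_zero C (Dom C x)"
  by (rule to_zero_unique) auto

lemma comp_from_zero [simp]: "\<lbrakk>x \<in> Ar C; Dom C x = a\<rbrakk> \<Longrightarrow> x \<cdot> from_zero C a = from_zero C (Cod C x)"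
  by (rule from_zero_unique) auto

lemma comp_zero_arrow [simp]: "\<lbrakk>a \<in> Ob C; f \<in> Ar C; Dom C f = b\<rbrakk> \<Longrightarrow> f \<cdot> zero_arrow C a b = zero_arrow C a (Cod C f)"
  unfolding zero_arrow_def by (subst cmp_ext1[OF comp_from_zero]) auto

lemma zero_arrow_comp [simp]: "\<lbrakk>c \<in> Ob C; f \<in> Ar C; Cod C f = b\<rbrakk> \<Longrightarrow> zero_arrow C b c \<cdot> f = zero_arrow C (Dom C f) c"
  unfolding zero_arrow_def by (subst assoc) auto

lemma annihilatedI [simp]:
  "\<lbrakk>x \<in> Ar C; Cod C x = Dom C f; f \<cdot> x = zero_arrow C (Dom C x) (Cod C f)\<rbrakk> \<Longrightarrow> annihilated C f x"
  by (simp add: annihilated_def)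

lemma kernelD:
  assumes "is_kernel C f k"
  shows "f \<in> Ar C" "k \<in> Ar C" "Cod C k = Dom C f" "f \<cdot> k = zero_arrow C (Dom C k) (Cod C f)"
  using assms by (auto simp: is_kernel_def)

lemma kernel_ex1: "is_kernel C f k \<Longrightarrow> annihilated C f x \<Longrightarrow> \<exists>!w. w \<in> Hom C (Dom C x) (Dom C k) \<and> k \<cdot> w = x"
  unfolding is_kernel_def annihilated_def by blast

lemma kernel_monic:
  assumes k: "is_kernel C f k" shows "monic C k"
  unfolding monic_def
proof (intro conjI ballI impI)
  note t = kernelD[OF k]
  fix x y assume x: "x \<in> Ar C" "y \<in> Ar C" "Dom C x = Dom C y" "Cod C x = Dom C k" "Cod C y = Dom C k" and e: "k \<cdot> x = k \<cdot> y"
  have "f \<cdot> (k \<cdot> x) = zero_arrow C (Dom C x) (Cod C f)"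
    by (subst cmp_ext1[OF t(4)]) (use t(1-3) x in simp_all)
  hence "annihilated C f (k \<cdot> x)" by (intro annihilatedI) (use t x in simp_all)
  from kernel_ex1[OF k this] show "x = y"
    using x e t(2) by (metis Dom_Cmp Hom_iff)
qed (use kernelD[OF k] in simp)

lemma factor_kernel:
  assumes k: "is_kernel C f k" and x: "annihilated C f x"
  shows "factor_through C k x \<in> Ar C" "Dom C (factor_through C k x) = Dom C x"
    "Cod C (factor_through C k x) = Dom C k" "k \<cdot> factor_through C k x = x"
  using theI'[OF kernel_ex1[OF k x]] unfolding factor_through_def by auto

lemma kernel_fact:
  assumes k: "is_kernel C f k" and x: "annihilated C f x" and d: "Dom C x = T" "Dom C k = X"
  shows "\<exists>w. w \<in> Ar C \<and> Dom C w = T \<and> Cod C w = X \<and> k \<cdot> w = x"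
  using factor_kernel[OF k x] d by auto

lemma kernelI:
  assumes "f \<in> Ar C" "k \<in> Ar C" "Cod C k = Dom C f" "f \<cdot> k = zero_arrow C (Dom C k) (Cod C f)" "monic C k"
    and ex: "\<And>x. annihilated C f x \<Longrightarrow> \<exists>w. w \<in> Ar C \<and> Dom C w = Dom C x \<and> Cod C w = Dom C k \<and> k \<cdot> w = x"
  shows "is_kernel C f k"
proof -
  have "\<exists>!w. w \<in> Hom C (Dom C x) (Dom C k) \<and> k \<cdot> w = x" 
    if x: "x \<in> Ar C" "Cod C x = Dom C f" "f \<cdot> x = zero_arrow C (Dom C x) (Cod C f)" for x
  proof (rule ex_ex1I)
    show "\<exists>w. w \<in> Hom C (Dom C x) (Dom C k) \<and> k \<cdot> w = x" using ex[OF annihilatedI[OF x]] by simp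
    show "v = w" if "v \<in> Hom C (Dom C x) (Dom C k) \<and> k \<cdot> v = x" "w \<in> Hom C (Dom C x) (Dom C k) \<and> k \<cdot> w = x" for v w
      by (rule monicD[OF assms(5)]) (use that in simp_all)
  qed
  thus ?thesis using assms(1-4) unfolding is_kernel_def by blast
qed

text \<open>Kernels become base changes along the arrow from the zero object, which is how the
  protomodularity lemmas get to speak of them.\<close>

lemma kernel_pullback:
  assumes k: "is_kernel C f k"
  shows "is_pullback C (from_zero C (Cod C f)) f (to_zero C (Dom C k)) k"
proof (rule pbI)
  note t = kernelD[OF k]
  fix x y assume x: "x \<in> Ar C" "y \<in> Ar C" "Dom C x = Dom C y" "Cod C x = Dom C (from_zero C (Cod C f))" "Cod C y = Dom C f"
    and e: "from_zero C (Cod C f) \<cdot> x = f \<cdot> y"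
  have "annihilated C f y" by (rule annihilatedI) (use x e[symmetric] t in simp_all)
  from kernel_fact[OF k this refl refl] obtain w where "w \<in> Ar C" "Dom C w = Dom C y" "Cod C w = Dom C k" "k \<cdot> w = y" by blast
  thus "\<exists>w. w \<in> Ar C \<and> Dom C w = Dom C x \<and> Cod C w = Dom C (to_zero C (Dom C k)) \<and> to_zero C (Dom C k) \<cdot> w = x \<and> k \<cdot> w = y"
    using to_zero_unique[of x "Dom C x"] x t by (intro exI[of _ w]) simp
next
  note t = kernelD[OF k]
  fix w w' assume "w \<in> Ar C" "w' \<in> Ar C" "Dom C w = Dom C w'" "Cod C w = Dom C (to_zero C (Dom C k))"
    "Cod C w' = Dom C (to_zero C (Dom C k))" "k \<cdot> w = k \<cdot> w'"
  thus "w = w'" by (intro monicD[OF kernel_monic[OF k], of w w']) (use t in simp_all)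
qed (use kernelD[OF k] in simp_all)

lemma pullback_kernel:
  assumes pb: "is_pullback C (from_zero C D) f p k" and D: "Cod C f = D"
  shows "is_kernel C f k"
proof -
  have f: "f \<in> Ar C" using pb_typed[OF pb] by simp
  have Do: "D \<in> Ob C" using f D by auto
  note T = pb_typed(4,5,6,7,8,9)[OF pb]
  have p: "p = to_zero C (Dom C k)" by (rule to_zero_unique) (use T f Do in simp_all)
  show ?thesis
  proof (rule kernelI)
    show "monic C k" unfolding monic_def
    proof (intro conjI ballI impI)
      show "x = y" if "x \<in> Ar C" "y \<in> Ar C" "Dom C x = Dom C y" "Cod C x = Dom C k" "Cod C y = Dom C k" "k \<cdot> x = k \<cdot> y" for x y
        by (rule pb_uniq[OF pb]) (use that T in \<open>simp_all add: p\<close>)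
    qed (use T in simp)
    fix x assume x: "annihilated C f x"
    hence "cone C (from_zero C D) f (to_zero C (Dom C x)) x" by (intro coneI) (use f D Do in \<open>simp_all add: annihilated_def\<close>)
    from pb_fact'[OF pb this _ T(3), of "Dom C x"] show "\<exists>w. w \<in> Ar C \<and> Dom C w = Dom C x \<and> Cod C w = Dom C k \<and> k \<cdot> w = x"
      using x by (auto simp: annihilated_def)
  next
    show "f \<cdot> k = zero_arrow C (Dom C k) (Cod C f)" using T(6)[symmetric] T(1-5) f D Do by (simp add: p)
  qed (use T f in simp_all)
qed

lemma ker_ex:
  assumes f: "f \<in> Ar C"
  shows "\<exists>k. is_kernel C f k"
  using pb_ex[of "from_zero C (Cod C f)" f] f pullback_kernel[OF _ refl] by fastforce

lemma ker_kernel: "f \<in> Ar C \<Longrightarrow> is_kernel C f (ker C f)"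
  unfolding ker_def using ker_ex by (rule someI_ex)

text \<open>The arrow with components zero and \<open>k\<close> is a kernel of the pulled back
  retraction. A point and its base change thus share the kernel object, so their actions live on the
  same \<open>X\<close>.\<close>

lemma kernel_of_base_change:
  assumes pb: "is_pullback C g p a b" and k: "is_kernel C p k"
  obtains k' where "is_kernel C a k'" "Dom C k' = Dom C k" "b \<cdot> k' = k"
proof -
  note T = pb_typed[OF pb] and t = kernelD[OF k]
  have X: "Dom C k \<in> Ob C" "Dom C g \<in> Ob C" using t T by simp_all
  have "cone C g p (zero_arrow C (Dom C k) (Dom C g)) k" by (rule coneI) (use T t X in simp_all)
  then obtain k' where k': "k' \<in> Ar C" "Dom C k' = Dom C k" "Cod C k' = Dom C a" 
    and e: "a \<cdot> k' = zero_arrow C (Dom C k) (Dom C g)" "b \<cdot> k' = k"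
    using pb_fact'[OF pb _ zero_arrow_simps(2)[OF X] refl] by blast
  have "is_kernel C a k'"
  proof (rule kernelI)
    show "monic C k'" unfolding monic_def
    proof (intro conjI ballI impI)
      fix x y assume x: "x \<in> Ar C" "y \<in> Ar C" "Dom C x = Dom C y" "Cod C x = Dom C k'" "Cod C y = Dom C k'" and xy: "k' \<cdot> x = k' \<cdot> y"
      have "k \<cdot> x = b \<cdot> (k' \<cdot> x)" "k \<cdot> y = b \<cdot> (k' \<cdot> y)"
        using cmp_ext1[OF e(2), of x] cmp_ext1[OF e(2), of y] T k' x by simp_all
      hence "k \<cdot> x = k \<cdot> y" using xy by simp
      thus "x = y" using x k' by (intro monicD[OF kernel_monic[OF k], of x y]) simp_all
    qed (use k' in simp)
    fix x assume "annihilated C a x"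
    hence x: "x \<in> Ar C" "Cod C x = Dom C a" "a \<cdot> x = zero_arrow C (Dom C x) (Dom C g)" using T(7) by (simp_all add: annihilated_def)
    have "p \<cdot> (b \<cdot> x) = g \<cdot> (a \<cdot> x)" by (rule cmp_ext[OF T(9)[symmetric]]) (use T(1-8) x in simp_all)
    hence "annihilated C p (b \<cdot> x)" by (intro annihilatedI) (use T(1-8) x in simp_all)
    then obtain w where w: "w \<in> Ar C" "Dom C w = Dom C x" "Cod C w = Dom C k" "k \<cdot> w = b \<cdot> x"
      using kernel_fact[OF k _ _ refl, of "b \<cdot> x" "Dom C x"] T x by auto
    have "k' \<cdot> w = x"
    proof (rule pb_uniq[OF pb])
      show "a \<cdot> (k' \<cdot> w) = a \<cdot> x" using cmp_ext1[OF e(1), of w] T(4,7) k' w x X by simp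
      show "b \<cdot> (k' \<cdot> w) = b \<cdot> x" using cmp_ext1[OF e(2), of w] T(4-6) k' w x X by simp
    qed (use k' w x T in simp_all)
    thus "\<exists>w. w \<in> Ar C \<and> Dom C w = Dom C x \<and> Cod C w = Dom C k' \<and> k' \<cdot> w = x" using w k' by auto
  qed (use T k' e in simp_all)
  thus thesis using that k' e by blast
qed

lemma kernel_iso:
  assumes k: "is_kernel C p k" and h: "inverse_arrows C h h'" "Dom C h = Dom C p" and q: "q \<in> Ar C" "Dom C q = Cod C h" "q \<cdot> h = p"
  shows "is_kernel C q (h \<cdot> k)"
proof (rule kernelI)
  note t = kernelD[OF k] and i = invD[OF h(1)]
  have X: "Dom C k \<in> Ob C" using t by simp
  have c: "Cod C p = Cod C q" using arg_cong[OF q(3), of "Cod C"] q(1,2) i by simp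
  show "monic C (h \<cdot> k)" unfolding monic_def
  proof (intro conjI ballI impI)
    fix x y assume x: "x \<in> Ar C" "y \<in> Ar C" "Dom C x = Dom C y" "Cod C x = Dom C (h \<cdot> k)" "Cod C y = Dom C (h \<cdot> k)"
      and e: "(h \<cdot> k) \<cdot> x = (h \<cdot> k) \<cdot> y"
    have "k \<cdot> x = k \<cdot> y"
      by (rule monicD[OF iso_monic[OF inverse_arrows_iso(1)[OF h(1)]]]) (use e x t i h(2) in simp_all)
    thus "x = y" using x t i h(2) by (intro monicD[OF kernel_monic[OF k], of x y]) simp_all
  qed (use t i h(2) in simp)
  show "q \<cdot> (h \<cdot> k) = zero_arrow C (Dom C (h \<cdot> k)) (Cod C q)"
    using cmp_ext1[OF q(3), of k] t i q(1,2) h(2) c by simp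
  fix x assume "annihilated C q x"
  hence x: "x \<in> Ar C" "Cod C x = Dom C q" "q \<cdot> x = zero_arrow C (Dom C x) (Cod C q)" by (simp_all add: annihilated_def)
  have "p \<cdot> (h' \<cdot> x) = q \<cdot> (h \<cdot> (h' \<cdot> x))" by (rule cmp_ext1[OF q(3), symmetric]) (use i(1-4) x q(1,2) in simp_all)
  hence "annihilated C p (h' \<cdot> x)" by (intro annihilatedI) (use i x q h(2) c in simp_all)
  then obtain w where w: "w \<in> Ar C" "Dom C w = Dom C x" "Cod C w = Dom C k" "k \<cdot> w = h' \<cdot> x"
    using kernel_fact[OF k _ _ refl, of "h' \<cdot> x" "Dom C x"] i(1-4) x q(1,2) by auto
  hence "(h \<cdot> k) \<cdot> w = x" using t i h(2) x q(1,2) by simp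
  thus "\<exists>w. w \<in> Ar C \<and> Dom C w = Dom C x \<and> Cod C w = Dom C (h \<cdot> k) \<and> (h \<cdot> k) \<cdot> w = x"
    using w t i(1-4) h(2) by auto
qed (use kernelD[OF k] invD(1-4)[OF h(1)] h(2) q in simp_all)

text \<open>This is \<open>protomodular_iso\<close> for base change along the arrow from zero, where
  the fibres are the kernels.\<close>

lemma short_five:
  assumes h: "((p, s), h, (q, t)) \<in> Ar (Pt C D)" and k: "is_kernel C p k" and l: "is_kernel C q l"
    and f: "iso C f" "Dom C f = Dom C k" "Cod C f = Dom C l" "l \<cdot> f = h \<cdot> k"
  shows "iso C h"
proof -
  have c: "Cod C p = D" "Cod C q = D" "p \<in> Ar C" using h by (simp_all add: Pt_Ar_iff Pt_Ob_iff)
  have D: "D \<in> Ob C" using c by auto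
  have h': "((p, s), h, (q, t)) \<in> Ar (Pt C (Cod C (from_zero C D)))" using h D by simp
  show ?thesis
    by (rule protomodular_iso[OF _ h' kernel_pullback[OF k, unfolded c] kernel_pullback[OF l, unfolded c] f(1)])
      (use f D iso_Ar[OF f(1)] kernelD[OF k] kernelD[OF l] in simp_all)
qed

lemma section_kernel_joint_epi:
  assumes x: "(p, s) \<in> Ob (Pt C D)" and k: "is_kernel C p k"
    and u: "u \<in> Ar C" "v \<in> Ar C" "Dom C u = Dom C p" "Dom C v = Dom C p" 
    and e: "u \<cdot> s = v \<cdot> s" "u \<cdot> k = v \<cdot> k"
  shows "u = v"
proof -
  have c: "Cod C p = D" "p \<in> Ar C" using x by (simp_all add: Pt_Ob_iff)
  have D: "D \<in> Ob C" using c by auto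
  show ?thesis by (rule section_pullback_joint_epi[OF x _ kernel_pullback[OF k, unfolded c(1)] u e]) (use D in simp)
qed

lemma section_kernel_extremal:
  assumes x: "(p, s) \<in> Ob (Pt C D)" and k: "is_kernel C p k"
    and m: "monic C m" "Cod C m = Dom C p"
    and s': "s' \<in> Ar C" "Cod C s' = Dom C m" "m \<cdot> s' = s"
    and k': "k' \<in> Ar C" "Cod C k' = Dom C m" "m \<cdot> k' = k"
  shows "iso C m"
proof -
  have c: "Cod C p = D" "p \<in> Ar C" using x by (simp_all add: Pt_Ob_iff)
  have D: "D \<in> Ob C" using c by auto
  show ?thesis by (rule section_pullback_extremal[OF x _ kernel_pullback[OF k, unfolded c(1)] m s' k']) (use D in simp)
qed

text \<open>The kernel pair \<open>a\<close>, \<open>b\<close> of \<open>f\<close> is a point under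
  its diagonal \<open>d\<close>. If \<open>k\<close> is a kernel of \<open>a\<close>, then
  \<open>b k\<close> is killed by \<open>f\<close> and so zero; \<open>a\<close> and
  \<open>b\<close> agree on \<open>d\<close> and on \<open>k\<close>, hence coincide.\<close>

lemma trivial_kernel_monic:
  assumes f: "f \<in> Ar C" and z: "\<And>x. annihilated C f x \<Longrightarrow> x = zero_arrow C (Dom C x) (Dom C f)"
  shows "monic C f"
proof -
  obtain a b where pb: "is_pullback C f f a b" using pb_ex[of f f] f by auto
  define N A where "N = Dom C a" and "A = Dom C f"
  have t: "a \<in> Ar C" "b \<in> Ar C" "Dom C a = N" "Dom C b = N" "Cod C a = A" "Cod C b = A" "f \<cdot> a = f \<cdot> b" "Dom C f = A"
    using pb_typed[OF pb] by (simp_all add: N_def A_def)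
  have ob: "A \<in> Ob C" "N \<in> Ob C" using t f by auto
  have "cone C f f (Ide C A) (Ide C A)" by (rule coneI) (use f t ob in simp_all)
  then obtain d where d: "d \<in> Ar C" "Dom C d = A" "Cod C d = N" "a \<cdot> d = Ide C A" "b \<cdot> d = Ide C A"
    using pb_fact'[OF pb _ Dom_Ide[OF ob(1)] t(3)] by blast
  have pt: "(a, d) \<in> Ob (Pt C A)" using t d by (simp add: Pt_Ob_iff)
  obtain k where k: "is_kernel C a k" using ker_ex t by blast
  note kt = kernelD[OF k]
  have X: "Dom C k \<in> Ob C" using kt by simp
  have "f \<cdot> (b \<cdot> k) = f \<cdot> (a \<cdot> k)" by (rule cmp_ext[OF t(7)[symmetric]]) (use f t(1-6,8) kt in simp_all)
  hence "annihilated C f (b \<cdot> k)" by (intro annihilatedI) (use f t(1-6,8) kt X in simp_all)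
  hence bk: "b \<cdot> k = zero_arrow C (Dom C k) A" using z[of "b \<cdot> k"] t(1-6,8) kt by simp
  have ab: "a = b"
    by (rule section_kernel_joint_epi[OF pt k]) (use t d kt bk in simp_all)
  show ?thesis unfolding monic_def
  proof (intro conjI ballI impI)
    fix x y assume x: "x \<in> Ar C" "y \<in> Ar C" "Dom C x = Dom C y" "Cod C x = Dom C f" "Cod C y = Dom C f" "f \<cdot> x = f \<cdot> y"
    hence "cone C f f x y" by (intro coneI) simp_all
    from pb_fact[OF pb this] show "x = y" using ab by auto
  qed (rule f)
qed

end

section \<open>Points over an object as algebras of the monad of the kernel functor\<close>

locale adj_pre = U: exact_loc "UC A" + V: semi_loc "VC A" for A :: "('uo, 'um, 'vo, 'vm) adj" +
  assumes adj: "adjunction A"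
begin

abbreviation compU (infixl "\<cdot>\<^sub>U" 70) where "g \<cdot>\<^sub>U f \<equiv> g \<cdot>\<^bsub>UC A\<^esub> f"
abbreviation compV (infixl "\<cdot>\<^sub>V" 70) where "g \<cdot>\<^sub>V f \<equiv> g \<cdot>\<^bsub>VC A\<^esub> f"
abbreviation U0 where "U0 \<equiv> FOb (Radj A)"
abbreviation U1 where "U1 \<equiv> FAr (Radj A)"
abbreviation L0 where "L0 \<equiv> FOb (Ladj A)"
abbreviation L1 where "L1 \<equiv> FAr (Ladj A)"
abbreviation eta ("\<eta>") where "\<eta> \<equiv> Unit A"
abbreviation eps ("\<epsilon>") where "\<epsilon> \<equiv> Counit A"

lemma U_simps [simp]:
  "f \<in> Ar (UC A) \<Longrightarrow> U1 f \<in> Ar (VC A)"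
  "f \<in> Ar (UC A) \<Longrightarrow> Dom (VC A) (U1 f) = U0 (Dom (UC A) f)"
  "f \<in> Ar (UC A) \<Longrightarrow> Cod (VC A) (U1 f) = U0 (Cod (UC A) f)"
  "B \<in> Ob (UC A) \<Longrightarrow> U0 B \<in> Ob (VC A)"
  "B \<in> Ob (UC A) \<Longrightarrow> U1 (Ide (UC A) B) = Ide (VC A) (U0 B)"
  "\<lbrakk>f \<in> Ar (UC A); g \<in> Ar (UC A); Cod (UC A) f = Dom (UC A) g\<rbrakk> \<Longrightarrow> U1 (g \<cdot>\<^sub>U f) = U1 g \<cdot>\<^sub>V U1 f"
  using adj by (auto simp: adjunction_def functor_def)

lemma L_simps [simp]:
  "f \<in> Ar (VC A) \<Longrightarrow> L1 f \<in> Ar (UC A)"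
  "f \<in> Ar (VC A) \<Longrightarrow> Dom (UC A) (L1 f) = L0 (Dom (VC A) f)"
  "f \<in> Ar (VC A) \<Longrightarrow> Cod (UC A) (L1 f) = L0 (Cod (VC A) f)"
  "X \<in> Ob (VC A) \<Longrightarrow> L0 X \<in> Ob (UC A)"
  "X \<in> Ob (VC A) \<Longrightarrow> L1 (Ide (VC A) X) = Ide (UC A) (L0 X)"
  "\<lbrakk>f \<in> Ar (VC A); g \<in> Ar (VC A); Cod (VC A) f = Dom (VC A) g\<rbrakk> \<Longrightarrow> L1 (g \<cdot>\<^sub>V f) = L1 g \<cdot>\<^sub>U L1 f"
  using adj by (auto simp: adjunction_def functor_def)

lemma eta_simps [simp]:
  "X \<in> Ob (VC A) \<Longrightarrow> \<eta> X \<in> Ar (VC A)"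
  "X \<in> Ob (VC A) \<Longrightarrow> Dom (VC A) (\<eta> X) = X"
  "X \<in> Ob (VC A) \<Longrightarrow> Cod (VC A) (\<eta> X) = U0 (L0 X)"
  using adj by (auto simp: adjunction_def nat_trans_def comp_func_def id_func_def)

lemma eta_nat [simp]:
  "\<lbrakk>f \<in> Ar (VC A); Dom (VC A) f = X\<rbrakk> \<Longrightarrow> U1 (L1 f) \<cdot>\<^sub>V \<eta> X = \<eta> (Cod (VC A) f) \<cdot>\<^sub>V f"
  using adj by (auto simp: adjunction_def nat_trans_def comp_func_def id_func_def)

lemma eps_simps [simp]:
  "B \<in> Ob (UC A) \<Longrightarrow> \<epsilon> B \<in> Ar (UC A)"
  "B \<in> Ob (UC A) \<Longrightarrow> Dom (UC A) (\<epsilon> B) = L0 (U0 B)"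
  "B \<in> Ob (UC A) \<Longrightarrow> Cod (UC A) (\<epsilon> B) = B"
  using adj by (auto simp: adjunction_def nat_trans_def comp_func_def id_func_def)

lemma eps_nat:
  "f \<in> Ar (UC A) \<Longrightarrow> \<epsilon> (Cod (UC A) f) \<cdot>\<^sub>U L1 (U1 f) = f \<cdot>\<^sub>U \<epsilon> (Dom (UC A) f)"
  using adj by (auto simp: adjunction_def nat_trans_def comp_func_def id_func_def)

lemma triangles:
  "X \<in> Ob (VC A) \<Longrightarrow> \<epsilon> (L0 X) \<cdot>\<^sub>U L1 (\<eta> X) = Ide (UC A) (L0 X)"
  "B \<in> Ob (UC A) \<Longrightarrow> U1 (\<epsilon> B) \<cdot>\<^sub>V \<eta> (U0 B) = Ide (VC A) (U0 B)"
  using adj by (auto simp: adjunction_def)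

text \<open>The transpose of \<open>k\<close> across the adjunction.\<close>

definition adjunct :: "'uo \<Rightarrow> 'vm \<Rightarrow> 'um" where
  "adjunct Q k = \<epsilon> Q \<cdot>\<^sub>U L1 k"

lemma adjunct_simps [simp]:
  assumes "k \<in> Ar (VC A)" "Q \<in> Ob (UC A)" "Cod (VC A) k = U0 Q"
  shows "adjunct Q k \<in> Ar (UC A)" "Dom (UC A) (adjunct Q k) = L0 (Dom (VC A) k)" "Cod (UC A) (adjunct Q k) = Q"
  using assms by (simp_all add: adjunct_def)

lemma U_adjunct [simp]:
  assumes "k \<in> Ar (VC A)" "Q \<in> Ob (UC A)" "Cod (VC A) k = U0 Q" "Dom (VC A) k = X"
  shows "U1 (adjunct Q k) \<cdot>\<^sub>V \<eta> X = k"
proof -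
  have X: "X \<in> Ob (VC A)" using assms by auto
  have "U1 (adjunct Q k) \<cdot>\<^sub>V \<eta> X = U1 (\<epsilon> Q) \<cdot>\<^sub>V (\<eta> (U0 Q) \<cdot>\<^sub>V k)" using assms X by (simp add: adjunct_def)
  also have "\<dots> = k" by (subst V.cmp_ext1[OF triangles(2)]) (use assms in simp_all)
  finally show ?thesis .
qed

lemma adjunct_U:
  assumes "f \<in> Ar (UC A)" "X \<in> Ob (VC A)" "Dom (UC A) f = L0 X" "Cod (UC A) f = Q"
  shows "adjunct Q (U1 f \<cdot>\<^sub>V \<eta> X) = f"
proof -
  have Q: "Q \<in> Ob (UC A)" using assms by auto
  have "adjunct Q (U1 f \<cdot>\<^sub>V \<eta> X) = \<epsilon> Q \<cdot>\<^sub>U (L1 (U1 f) \<cdot>\<^sub>U L1 (\<eta> X))" using assms by (simp add: adjunct_def)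
  also have "\<dots> = f \<cdot>\<^sub>U (\<epsilon> (L0 X) \<cdot>\<^sub>U L1 (\<eta> X))"
    by (rule U.cmp_ext[OF eps_nat[OF assms(1), unfolded assms(3,4)]]) (use assms Q in simp_all)
  finally show ?thesis using assms triangles(1) by simp
qed

lemma adjunct_comp [simp]:
  assumes "k \<in> Ar (VC A)" "g \<in> Ar (UC A)" "Dom (UC A) g = Q" "Cod (VC A) k = U0 Q"
  shows "g \<cdot>\<^sub>U adjunct Q k = adjunct (Cod (UC A) g) (U1 g \<cdot>\<^sub>V k)"
proof -
  have Q: "Q \<in> Ob (UC A)" using assms by auto
  have "\<epsilon> (Cod (UC A) g) \<cdot>\<^sub>U (L1 (U1 g) \<cdot>\<^sub>U L1 k) = g \<cdot>\<^sub>U (\<epsilon> Q \<cdot>\<^sub>U L1 k)"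
    by (rule U.cmp_ext[OF eps_nat[OF assms(2), unfolded assms(3)]]) (use assms Q in simp_all)
  thus ?thesis using assms Q by (simp add: adjunct_def)
qed

lemma adjunct_pre [simp]:
  assumes "k \<in> Ar (VC A)" "f \<in> Ar (VC A)" "Cod (VC A) f = Dom (VC A) k" "Q \<in> Ob (UC A)" "Cod (VC A) k = U0 Q"
  shows "adjunct Q k \<cdot>\<^sub>U L1 f = adjunct Q (k \<cdot>\<^sub>V f)"
  using assms by (simp add: adjunct_def)

lemma adjunct_inj:
  assumes "x \<in> Ar (VC A)" "y \<in> Ar (VC A)" "Dom (VC A) x = Dom (VC A) y" "Cod (VC A) x = U0 Q" "Cod (VC A) y = U0 Q"
    "Q \<in> Ob (UC A)" "adjunct Q x = adjunct Q y"
  shows "x = y"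
proof -
  have "U1 (adjunct Q x) \<cdot>\<^sub>V \<eta> (Dom (VC A) x) = U1 (adjunct Q y) \<cdot>\<^sub>V \<eta> (Dom (VC A) y)" by (simp only: assms(3,7))
  thus ?thesis using assms(1-6) U_adjunct[OF assms(1,6,4) refl] U_adjunct[OF assms(2,6,5) refl] by metis
qed

lemma U_monic:
  assumes m: "monic (UC A) m" shows "monic (VC A) (U1 m)"
  unfolding monic_def
proof (intro conjI ballI impI)
  have t: "m \<in> Ar (UC A)" using m by (simp add: monic_def)
  thus "U1 m \<in> Ar (VC A)" by simp
  fix x y assume x: "x \<in> Ar (VC A)" "y \<in> Ar (VC A)" "Dom (VC A) x = Dom (VC A) y" "Cod (VC A) x = Dom (VC A) (U1 m)"
    "Cod (VC A) y = Dom (VC A) (U1 m)" and e: "U1 m \<cdot>\<^sub>V x = U1 m \<cdot>\<^sub>V y"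
  have h: "adjunct (Dom (UC A) m) x = adjunct (Dom (UC A) m) y"
    by (rule U.monicD[OF m]) (use x t e in simp_all)
  show "x = y" by (rule adjunct_inj[OF x(1-3) _ _ _ h]) (use x t in simp_all)
qed

text \<open>A cone in \<open>VC A\<close> is transposed to \<open>UC A\<close>, factored there, and
  transposed back.\<close>

lemma U_pullback:
  assumes pb: "is_pullback (UC A) f g p q" shows "is_pullback (VC A) (U1 f) (U1 g) (U1 p) (U1 q)"
proof (rule V.pbI)
  note t = U.pb_typed[OF pb]
  have "U1 (f \<cdot>\<^sub>U p) = U1 (g \<cdot>\<^sub>U q)" using t(9) by simp
  thus "U1 f \<cdot>\<^sub>V U1 p = U1 g \<cdot>\<^sub>V U1 q" using t(1-8) by simp
  fix x y assume x: "x \<in> Ar (VC A)" "y \<in> Ar (VC A)" "Dom (VC A) x = Dom (VC A) y" "Cod (VC A) x = Dom (VC A) (U1 f)"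
    "Cod (VC A) y = Dom (VC A) (U1 g)" and e: "U1 f \<cdot>\<^sub>V x = U1 g \<cdot>\<^sub>V y"
  have X: "Dom (VC A) y \<in> Ob (VC A)" using x by simp
  have "cone (UC A) f g (adjunct (Dom (UC A) f) x) (adjunct (Dom (UC A) g) y)"
    by (rule U.coneI) (use x e t(1-8) in simp_all)
  then obtain w where w: "w \<in> Ar (UC A)" "Dom (UC A) w = L0 (Dom (VC A) y)" "Cod (UC A) w = Dom (UC A) p"
    "p \<cdot>\<^sub>U w = adjunct (Dom (UC A) f) x" "q \<cdot>\<^sub>U w = adjunct (Dom (UC A) g) y"
    using U.pb_fact'[OF pb _ _ refl, of "adjunct (Dom (UC A) f) x" _ "L0 (Dom (VC A) y)"] x t(1-8) by auto
  have "U1 (p \<cdot>\<^sub>U w) \<cdot>\<^sub>V \<eta> (Dom (VC A) y) = x" "U1 (q \<cdot>\<^sub>U w) \<cdot>\<^sub>V \<eta> (Dom (VC A) y) = y"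
    unfolding w(4,5) by (rule U_adjunct, use x t(1-8) in simp_all)+
  thus "\<exists>w. w \<in> Ar (VC A) \<and> Dom (VC A) w = Dom (VC A) x \<and> Cod (VC A) w = Dom (VC A) (U1 p) \<and> U1 p \<cdot>\<^sub>V w = x \<and> U1 q \<cdot>\<^sub>V w = y"
    using w(1-3) x(1-3) X t(1-8) by (intro exI[of _ "U1 w \<cdot>\<^sub>V \<eta> (Dom (VC A) y)"]) simp
next
  note t = U.pb_typed[OF pb]
  fix x y assume x: "x \<in> Ar (VC A)" "y \<in> Ar (VC A)" "Dom (VC A) x = Dom (VC A) y" "Cod (VC A) x = Dom (VC A) (U1 p)"
    "Cod (VC A) y = Dom (VC A) (U1 p)" and e: "U1 p \<cdot>\<^sub>V x = U1 p \<cdot>\<^sub>V y" "U1 q \<cdot>\<^sub>V x = U1 q \<cdot>\<^sub>V y"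
  have h: "adjunct (Dom (UC A) p) x = adjunct (Dom (UC A) p) y"
    by (rule U.pb_uniq[OF pb]) (use x t(1-8) e in simp_all)
  show "x = y" by (rule adjunct_inj[OF x(1-3) _ _ _ h]) (use x t(1-8) in simp_all)
qed (use U.pb_typed[OF pb] in simp_all)

lemma U_eq:
  assumes "g \<cdot>\<^sub>U f = h" "f \<in> Ar (UC A)" "g \<in> Ar (UC A)" "Cod (UC A) f = Dom (UC A) g"
  shows "U1 g \<cdot>\<^sub>V U1 f = U1 h"
  using assms(2-4) by (simp flip: assms(1))

lemma F0_Ob [simp]: "F0 A \<in> Ob (UC A)"
  by (simp add: F0_def)

text \<open>Both arrows are transposes of arrows out of the zero object, of which there is
  one.\<close>

lemma F0_unique:
  assumes "f \<in> Ar (UC A)" "g \<in> Ar (UC A)" "Dom (UC A) f = F0 A" "Dom (UC A) g = F0 A" "Cod (UC A) f = Cod (UC A) g"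
  shows "f = g"
proof -
  let ?z = "zero_ob (VC A)"
  have "U1 f \<cdot>\<^sub>V \<eta> ?z = from_zero (VC A) (U0 (Cod (UC A) f))" "U1 g \<cdot>\<^sub>V \<eta> ?z = from_zero (VC A) (U0 (Cod (UC A) g))"
    by (rule V.from_zero_unique, use assms in \<open>simp_all add: F0_def\<close>)+
  moreover have "adjunct (Cod (UC A) f) (U1 f \<cdot>\<^sub>V \<eta> ?z) = f" "adjunct (Cod (UC A) g) (U1 g \<cdot>\<^sub>V \<eta> ?z) = g"
    by (rule adjunct_U, use assms in \<open>simp_all add: F0_def\<close>)+
  ultimately show ?thesis using assms(5) by metis
qed

lemma iota_simps [simp]:
  assumes "B \<in> Ob (UC A)"
  shows "iota A B \<in> Ar (UC A)" "Dom (UC A) (iota A B) = F0 A" "Cod (UC A) (iota A B) = B"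
proof -
  have "\<exists>!f. f \<in> Hom (UC A) (F0 A) B"
  proof (rule ex_ex1I)
    show "\<exists>f. f \<in> Hom (UC A) (F0 A) B"
      using assms by (intro exI[of _ "adjunct B (from_zero (VC A) (U0 B))"]) (simp add: F0_def)
    show "f = g" if "f \<in> Hom (UC A) (F0 A) B" "g \<in> Hom (UC A) (F0 A) B" for f g
      using F0_unique[of f g] that by simp
  qed
  from theI'[OF this] show "iota A B \<in> Ar (UC A)" "Dom (UC A) (iota A B) = F0 A" "Cod (UC A) (iota A B) = B"
    by (auto simp: iota_def)
qed

lemma iota_unique: "\<lbrakk>f \<in> Ar (UC A); Dom (UC A) f = F0 A; Cod (UC A) f = B\<rbrakk> \<Longrightarrow> f = iota A B"
  by (rule F0_unique) auto

text \<open>It turns the second component of the free point into the transpose of a zero arrow, the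
  form in which \<open>sharp_proj\<close> is computed with.\<close>

lemma iota_L1_to_zero [simp]:
  assumes "B \<in> Ob (UC A)" "X \<in> Ob (VC A)"
  shows "iota A B \<cdot>\<^sub>U L1 (to_zero (VC A) X) = adjunct B (zero_arrow (VC A) X (U0 B))"
proof -
  have "iota A B = adjunct B (from_zero (VC A) (U0 B))"
    by (rule iota_unique[symmetric]) (use assms in \<open>simp_all add: F0_def\<close>)
  thus ?thesis using assms by simp
qed

section \<open>The monad \<open>B # (-)\<close> and the algebras of points\<close>

abbreviation copB where "copB B X \<equiv> Cod (UC A) (inj1 (UC A) B (L0 X))"
abbreviation kap where "kap B X \<equiv> sharp_kappa A B X"
abbreviation tob where "tob B X \<equiv> Dom (VC A) (sharp_kappa A B X)"

definition sharp_proj where "sharp_proj B X = cotuple (UC A) (Ide (UC A) B) (adjunct B (zero_arrow (VC A) X (U0 B)))"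

lemma sharp_point_eq: "\<lbrakk>B \<in> Ob (UC A); X \<in> Ob (VC A)\<rbrakk> \<Longrightarrow> sharp_point A B X = (sharp_proj B X, inj1 (UC A) B (L0 X))"
  by (simp add: sharp_point_def sharp_proj_def)

lemma sharp_proj_simps [simp]:
  assumes "B \<in> Ob (UC A)" "X \<in> Ob (VC A)"
  shows "sharp_proj B X \<in> Ar (UC A)" "Dom (UC A) (sharp_proj B X) = copB B X" "Cod (UC A) (sharp_proj B X) = B"
  using assms by (simp_all add: sharp_proj_def)

lemma kap_kernel: "\<lbrakk>B \<in> Ob (UC A); X \<in> Ob (VC A)\<rbrakk> \<Longrightarrow> is_kernel (VC A) (U1 (sharp_proj B X)) (kap B X)"
  by (simp add: sharp_kappa_def sharp_point_eq V.ker_kernel)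

lemma kap_simps [simp]:
  assumes "B \<in> Ob (UC A)" "X \<in> Ob (VC A)"
  shows "kap B X \<in> Ar (VC A)" "Cod (VC A) (kap B X) = U0 (copB B X)"
    "U1 (sharp_proj B X) \<cdot>\<^sub>V kap B X = zero_arrow (VC A) (tob B X) (U0 B)"
  using V.kernelD[OF kap_kernel[OF assms]] assms by simp_all

text \<open>\<open>sharp_unit\<close>, \<open>sharp_mult\<close> and \<open>sharp_map\<close> are
  the data of \<open>sharp_monad\<close> written with transposes; \<open>sharp_monad_simps\<close>
  identifies them on objects and arrows of \<open>VC A\<close>.\<close>

definition sharp_unit where "sharp_unit B X = factor_through (VC A) (kap B X) (U1 (inj2 (UC A) B (L0 X)) \<cdot>\<^sub>V \<eta> X)"
definition sharp_mult where "sharp_mult B X = factor_through (VC A) (kap B X)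
  (U1 (cotuple (UC A) (inj1 (UC A) B (L0 X)) (adjunct (copB B X) (kap B X))) \<cdot>\<^sub>V kap B (tob B X))"
definition sharp_map where "sharp_map B f = factor_through (VC A) (kap B (Cod (VC A) f))
  (U1 (coprod_map (UC A) (Ide (UC A) B) (L1 f)) \<cdot>\<^sub>V kap B (Dom (VC A) f))"

lemma sharp_unit_simps [simp]:
  assumes "B \<in> Ob (UC A)" "X \<in> Ob (VC A)"
  shows "sharp_unit B X \<in> Ar (VC A)" "Dom (VC A) (sharp_unit B X) = X" "Cod (VC A) (sharp_unit B X) = tob B X"
    "kap B X \<cdot>\<^sub>V sharp_unit B X = U1 (inj2 (UC A) B (L0 X)) \<cdot>\<^sub>V \<eta> X"
proof -
  have "U1 (sharp_proj B X \<cdot>\<^sub>U inj2 (UC A) B (L0 X)) \<cdot>\<^sub>V \<eta> X = zero_arrow (VC A) X (U0 B)"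
    unfolding sharp_proj_def using assms by simp
  hence "annihilated (VC A) (U1 (sharp_proj B X)) (U1 (inj2 (UC A) B (L0 X)) \<cdot>\<^sub>V \<eta> X)"
    by (intro V.annihilatedI) (use assms in simp_all)
  from V.factor_kernel[OF kap_kernel[OF assms] this] assms
  show "sharp_unit B X \<in> Ar (VC A)" "Dom (VC A) (sharp_unit B X) = X" "Cod (VC A) (sharp_unit B X) = tob B X"
    "kap B X \<cdot>\<^sub>V sharp_unit B X = U1 (inj2 (UC A) B (L0 X)) \<cdot>\<^sub>V \<eta> X"
    by (simp_all add: sharp_unit_def)
qed

lemma kap_lift:
  assumes "B \<in> Ob (UC A)" "X \<in> Ob (VC A)" "Y \<in> Ob (VC A)" "m \<in> Ar (UC A)" "Dom (UC A) m = copB B X" "Cod (UC A) m = copB B Y"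
    "sharp_proj B Y \<cdot>\<^sub>U m = sharp_proj B X"
  shows "annihilated (VC A) (U1 (sharp_proj B Y)) (U1 m \<cdot>\<^sub>V kap B X)"
proof (rule V.annihilatedI)
  have "U1 (sharp_proj B Y) \<cdot>\<^sub>V U1 m = U1 (sharp_proj B X)" using assms(1-6) by (simp flip: assms(7))
  from V.cmp_ext1[OF this, of "kap B X"]
  show "U1 (sharp_proj B Y) \<cdot>\<^sub>V (U1 m \<cdot>\<^sub>V kap B X) = zero_arrow (VC A) (Dom (VC A) (U1 m \<cdot>\<^sub>V kap B X)) (Cod (VC A) (U1 (sharp_proj B Y)))"
    using assms(1-6) by simp
qed (use assms in simp_all)

lemma sharp_mult_simps [simp]:
  assumes "B \<in> Ob (UC A)" "X \<in> Ob (VC A)"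
  shows "sharp_mult B X \<in> Ar (VC A)" "Dom (VC A) (sharp_mult B X) = tob B (tob B X)" "Cod (VC A) (sharp_mult B X) = tob B X"
    "kap B X \<cdot>\<^sub>V sharp_mult B X = U1 (cotuple (UC A) (inj1 (UC A) B (L0 X)) (adjunct (copB B X) (kap B X))) \<cdot>\<^sub>V kap B (tob B X)"
proof -
  have "sharp_proj B X \<cdot>\<^sub>U cotuple (UC A) (inj1 (UC A) B (L0 X)) (adjunct (copB B X) (kap B X)) = sharp_proj B (tob B X)"
    using assms by (simp add: sharp_proj_def[of B "tob B X"]) (simp add: sharp_proj_def)
  hence "annihilated (VC A) (U1 (sharp_proj B X)) (U1 (cotuple (UC A) (inj1 (UC A) B (L0 X)) (adjunct (copB B X) (kap B X))) \<cdot>\<^sub>V kap B (tob B X))"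
    by (intro kap_lift) (use assms in simp_all)
  from V.factor_kernel[OF kap_kernel[OF assms] this] assms
  show "sharp_mult B X \<in> Ar (VC A)" "Dom (VC A) (sharp_mult B X) = tob B (tob B X)" "Cod (VC A) (sharp_mult B X) = tob B X"
    "kap B X \<cdot>\<^sub>V sharp_mult B X = U1 (cotuple (UC A) (inj1 (UC A) B (L0 X)) (adjunct (copB B X) (kap B X))) \<cdot>\<^sub>V kap B (tob B X)"
    by (simp_all add: sharp_mult_def)
qed

lemma sharp_map_simps [simp]:
  assumes "B \<in> Ob (UC A)" "f \<in> Ar (VC A)"
  shows "sharp_map B f \<in> Ar (VC A)" "Dom (VC A) (sharp_map B f) = tob B (Dom (VC A) f)" "Cod (VC A) (sharp_map B f) = tob B (Cod (VC A) f)"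
    "Cod (VC A) f = Y \<Longrightarrow> kap B Y \<cdot>\<^sub>V sharp_map B f = U1 (coprod_map (UC A) (Ide (UC A) B) (L1 f)) \<cdot>\<^sub>V kap B (Dom (VC A) f)"
proof -
  have "sharp_proj B (Cod (VC A) f) \<cdot>\<^sub>U coprod_map (UC A) (Ide (UC A) B) (L1 f) = sharp_proj B (Dom (VC A) f)"
    using assms by (simp add: sharp_proj_def)
  hence "annihilated (VC A) (U1 (sharp_proj B (Cod (VC A) f))) (U1 (coprod_map (UC A) (Ide (UC A) B) (L1 f)) \<cdot>\<^sub>V kap B (Dom (VC A) f))"
    by (intro kap_lift) (use assms in simp_all)
  from V.factor_kernel[OF kap_kernel this] assms
  show "sharp_map B f \<in> Ar (VC A)" "Dom (VC A) (sharp_map B f) = tob B (Dom (VC A) f)" "Cod (VC A) (sharp_map B f) = tob B (Cod (VC A) f)"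
    "Cod (VC A) f = Y \<Longrightarrow> kap B Y \<cdot>\<^sub>V sharp_map B f = U1 (coprod_map (UC A) (Ide (UC A) B) (L1 f)) \<cdot>\<^sub>V kap B (Dom (VC A) f)"
    by (auto simp: sharp_map_def)
qed

lemma sharp_monad_simps:
  assumes "B \<in> Ob (UC A)"
  shows "X \<in> Ob (VC A) \<Longrightarrow> FOb (MFun (sharp_monad A B)) X = tob B X"
    "X \<in> Ob (VC A) \<Longrightarrow> MUnit (sharp_monad A B) X = sharp_unit B X"
    "X \<in> Ob (VC A) \<Longrightarrow> MMult (sharp_monad A B) X = sharp_mult B X"
    "f \<in> Ar (VC A) \<Longrightarrow> FAr (MFun (sharp_monad A B)) f = sharp_map B f"
proof -
  have k: "ker (VC A) (U1 (sharp_proj B X)) = kap B X" if "X \<in> Ob (VC A)" for X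
    using assms that by (simp add: sharp_kappa_def sharp_point_eq)
  show "X \<in> Ob (VC A) \<Longrightarrow> FOb (MFun (sharp_monad A B)) X = tob B X"
    using assms by (simp add: sharp_monad_def adj_monad_def sharp_adj_def comp_func_def sharp_point_eq k)
  show "X \<in> Ob (VC A) \<Longrightarrow> MUnit (sharp_monad A B) X = sharp_unit B X"
    using assms by (simp add: sharp_monad_def adj_monad_def sharp_adj_def sharp_unit_def)
  show "X \<in> Ob (VC A) \<Longrightarrow> MMult (sharp_monad A B) X = sharp_mult B X"
    using assms by (simp add: sharp_monad_def adj_monad_def sharp_adj_def comp_func_def sharp_point_eq k Let_def adjunct_def sharp_mult_def)
  show "f \<in> Ar (VC A) \<Longrightarrow> FAr (MFun (sharp_monad A B)) f = sharp_map B f"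
    using assms by (simp add: sharp_monad_def adj_monad_def sharp_adj_def comp_func_def sharp_point_eq k Let_def sharp_map_def)
qed

lemma Alg_Ob:
  assumes "B \<in> Ob (UC A)"
  shows "(X, \<xi>) \<in> Ob (Alg (VC A) (sharp_monad A B)) \<longleftrightarrow> X \<in> Ob (VC A) \<and> \<xi> \<in> Ar (VC A) \<and> Dom (VC A) \<xi> = tob B X \<and>
    Cod (VC A) \<xi> = X \<and> \<xi> \<cdot>\<^sub>V sharp_unit B X = Ide (VC A) X \<and> \<xi> \<cdot>\<^sub>V sharp_mult B X = \<xi> \<cdot>\<^sub>V sharp_map B \<xi>"
  using assms by (auto simp: Alg_def Let_def sharp_monad_simps)

lemma Alg_Ar:
  assumes "B \<in> Ob (UC A)"
  shows "((X, \<xi>), f, (Y, \<theta>)) \<in> Ar (Alg (VC A) (sharp_monad A B)) \<longleftrightarrow>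
    (X, \<xi>) \<in> Ob (Alg (VC A) (sharp_monad A B)) \<and> (Y, \<theta>) \<in> Ob (Alg (VC A) (sharp_monad A B)) \<and>
    f \<in> Ar (VC A) \<and> Dom (VC A) f = X \<and> Cod (VC A) f = Y \<and> f \<cdot>\<^sub>V \<xi> = \<theta> \<cdot>\<^sub>V sharp_map B f"
  using assms by (auto simp: Alg_def Let_def sharp_monad_simps)

text \<open>\<open>sact\<close> is the analogue of \<open>assoc_point\<close> for algebras of \<open>B # (-)\<close>.\<close>

definition sact :: "'uo \<Rightarrow> 'vo \<Rightarrow> 'vm \<Rightarrow> 'um \<Rightarrow> 'um \<Rightarrow> 'vm \<Rightarrow> bool" where
  "sact B X \<xi> p s k \<longleftrightarrow> (p, s) \<in> Ob (Pt (UC A) B) \<and> is_kernel (VC A) (U1 p) k \<and> Dom (VC A) k = X \<and>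
    \<xi> \<in> Ar (VC A) \<and> Dom (VC A) \<xi> = tob B X \<and> Cod (VC A) \<xi> = X \<and>
    k \<cdot>\<^sub>V \<xi> = U1 (cotuple (UC A) s (adjunct (Dom (UC A) p) k)) \<cdot>\<^sub>V kap B X"

lemma point_kernel_typed:
  assumes "(p, s) \<in> Ob (Pt (UC A) B)" "is_kernel (VC A) (U1 p) k" "Dom (VC A) k = X"
  shows "p \<in> Ar (UC A)" "Cod (UC A) p = B" "s \<in> Ar (UC A)" "Dom (UC A) s = B" "Cod (UC A) s = Dom (UC A) p"
    "p \<cdot>\<^sub>U s = Ide (UC A) B" "k \<in> Ar (VC A)" "Cod (VC A) k = U0 (Dom (UC A) p)" "U1 p \<cdot>\<^sub>V k = zero_arrow (VC A) X (U0 B)"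
    "B \<in> Ob (UC A)" "X \<in> Ob (VC A)" "Dom (UC A) p \<in> Ob (UC A)"
    "p \<cdot>\<^sub>U cotuple (UC A) s (adjunct (Dom (UC A) p) k) = sharp_proj B X"
proof -
  show t: "p \<in> Ar (UC A)" "Cod (UC A) p = B" "s \<in> Ar (UC A)" "Dom (UC A) s = B" "Cod (UC A) s = Dom (UC A) p"
    "p \<cdot>\<^sub>U s = Ide (UC A) B" "k \<in> Ar (VC A)" "Cod (VC A) k = U0 (Dom (UC A) p)" "U1 p \<cdot>\<^sub>V k = zero_arrow (VC A) X (U0 B)"
    using assms V.kernelD[OF assms(2)] by (auto simp: Pt_Ob_iff)
  show "B \<in> Ob (UC A)" "X \<in> Ob (VC A)" "Dom (UC A) p \<in> Ob (UC A)" using t assms(3) by auto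
  show "p \<cdot>\<^sub>U cotuple (UC A) s (adjunct (Dom (UC A) p) k) = sharp_proj B X"
    using t assms(3) by (simp add: sharp_proj_def)
qed

text \<open>On objects this is the comparison functor of the kernel functor, taken with an arbitrary
  kernel in place of the chosen one: \<open>\<xi>\<close> is the counit at the point restricted to
  kernels.\<close>

lemma sact_ex:
  assumes x: "(p, s) \<in> Ob (Pt (UC A) B)" and k: "is_kernel (VC A) (U1 p) k" and X: "Dom (VC A) k = X"
  obtains \<xi> where "sact B X \<xi> p s k"
proof -
  note t = point_kernel_typed[OF x k X]
  let ?m = "cotuple (UC A) s (adjunct (Dom (UC A) p) k)"
  have "U1 p \<cdot>\<^sub>V U1 ?m = U1 (sharp_proj B X)" by (rule U_eq[OF t(13)]) (use t(1-12) X in simp_all)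
  from V.cmp_ext1[OF this, of "kap B X"]
  have "U1 p \<cdot>\<^sub>V (U1 ?m \<cdot>\<^sub>V kap B X) = zero_arrow (VC A) (tob B X) (U0 B)"
    using t(1-12) X by simp
  hence an: "annihilated (VC A) (U1 p) (U1 ?m \<cdot>\<^sub>V kap B X)"
    by (intro V.annihilatedI) (use t(1-12) X in simp_all)
  from V.factor_kernel[OF k this] show thesis
    by (intro that[of "factor_through (VC A) k (U1 ?m \<cdot>\<^sub>V kap B X)"]) (use x k X t(1-12) in \<open>simp add: sact_def\<close>)
qed

lemma sactD:
  assumes "sact B X \<xi> p s k"
  shows "(p, s) \<in> Ob (Pt (UC A) B)" "is_kernel (VC A) (U1 p) k" "Dom (VC A) k = X" "\<xi> \<in> Ar (VC A)" "Dom (VC A) \<xi> = tob B X"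
    "Cod (VC A) \<xi> = X" "k \<cdot>\<^sub>V \<xi> = U1 (cotuple (UC A) s (adjunct (Dom (UC A) p) k)) \<cdot>\<^sub>V kap B X"
  using assms by (auto simp: sact_def)

lemma sact_sharp_map:
  assumes a: "sact B X \<xi> p s k" and f: "f \<in> Ar (VC A)" "Cod (VC A) f = X"
  shows "k \<cdot>\<^sub>V (\<xi> \<cdot>\<^sub>V sharp_map B f) = U1 (cotuple (UC A) s (adjunct (Dom (UC A) p) (k \<cdot>\<^sub>V f))) \<cdot>\<^sub>V kap B (Dom (VC A) f)"
proof -
  note a' = sactD[OF a] and t = point_kernel_typed[OF sactD(1-3)[OF a]]
  let ?Q = "Dom (UC A) p"
  have "k \<cdot>\<^sub>V (\<xi> \<cdot>\<^sub>V sharp_map B f) = U1 (cotuple (UC A) s (adjunct ?Q k)) \<cdot>\<^sub>V (kap B X \<cdot>\<^sub>V sharp_map B f)"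
    by (rule V.cmp_ext[OF a'(7)]) (use a'(3-6) t(1-12) f in simp_all)
  also have "\<dots> = U1 (cotuple (UC A) s (adjunct ?Q k) \<cdot>\<^sub>U coprod_map (UC A) (Ide (UC A) B) (L1 f)) \<cdot>\<^sub>V kap B (Dom (VC A) f)"
    using a'(3-6) t(1-12) f by (simp del: U.cotuple_coprod_map)
  finally show ?thesis using a'(3-6) t(1-12) f by simp
qed

text \<open>Both algebra laws are checked after the mono \<open>k\<close>, where
  \<open>\<xi>\<close> turns into the restriction of \<open>U1 ?m\<close> along
  \<open>kap B X\<close> and the laws become identities of cotuples.\<close>

lemma sact_algebra:
  assumes a: "sact B X \<xi> p s k"
  shows "(X, \<xi>) \<in> Ob (Alg (VC A) (sharp_monad A B))"
proof -
  note a' = sactD[OF a] and t = point_kernel_typed[OF sactD(1-3)[OF a]]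
  let ?Q = "Dom (UC A) p" let ?m = "cotuple (UC A) s (adjunct ?Q k)"
  have km: "monic (VC A) k" by (rule V.kernel_monic[OF a'(2)])
  have "k \<cdot>\<^sub>V (\<xi> \<cdot>\<^sub>V sharp_unit B X) = U1 ?m \<cdot>\<^sub>V (kap B X \<cdot>\<^sub>V sharp_unit B X)"
    by (rule V.cmp_ext[OF a'(7)]) (use a'(3-6) t(1-12) in simp_all)
  also have "\<dots> = U1 (?m \<cdot>\<^sub>U inj2 (UC A) B (L0 X)) \<cdot>\<^sub>V \<eta> X" using a'(3-6) t(1-12) by (simp del: U.cotuple_inj)
  also have "\<dots> = k" using a'(3-6) t(1-12) by simp
  finally have e1: "k \<cdot>\<^sub>V (\<xi> \<cdot>\<^sub>V sharp_unit B X) = k" .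
  have 1: "\<xi> \<cdot>\<^sub>V sharp_unit B X = Ide (VC A) X"
    by (rule V.monicD[OF km]) (use e1 a'(3-6) t(1-12) in simp_all)
  have "k \<cdot>\<^sub>V (\<xi> \<cdot>\<^sub>V sharp_mult B X) = U1 ?m \<cdot>\<^sub>V (kap B X \<cdot>\<^sub>V sharp_mult B X)"
    by (rule V.cmp_ext[OF a'(7)]) (use a'(3-6) t(1-12) in simp_all)
  also have "\<dots> = U1 (?m \<cdot>\<^sub>U cotuple (UC A) (inj1 (UC A) B (L0 X)) (adjunct (copB B X) (kap B X))) \<cdot>\<^sub>V kap B (tob B X)"
    using a'(3-6) t(1-12) by (simp del: U.cotuple_comp)
  also have "\<dots> = U1 (cotuple (UC A) s (adjunct ?Q (k \<cdot>\<^sub>V \<xi>))) \<cdot>\<^sub>V kap B (tob B X)"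
    unfolding a'(7) using a'(3-6) t(1-12) by simp
  also have "\<dots> = k \<cdot>\<^sub>V (\<xi> \<cdot>\<^sub>V sharp_map B \<xi>)" using sact_sharp_map[OF a a'(4,6)] a'(5) by simp
  finally have e2: "k \<cdot>\<^sub>V (\<xi> \<cdot>\<^sub>V sharp_mult B X) = k \<cdot>\<^sub>V (\<xi> \<cdot>\<^sub>V sharp_map B \<xi>)" .
  have 2: "\<xi> \<cdot>\<^sub>V sharp_mult B X = \<xi> \<cdot>\<^sub>V sharp_map B \<xi>"
    by (rule V.monicD[OF km _ _ _ _ _ e2]) (use a'(3-6) t(1-12) in simp_all)
  show ?thesis using 1 2 a'(4-6) t(10,11) by (simp add: Alg_Ob)
qed

lemma sact_unique:
  assumes a: "sact B X \<xi> p s k" and b: "sact B X \<xi>' p s k" shows "\<xi> = \<xi>'"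
proof -
  have e: "k \<cdot>\<^sub>V \<xi> = k \<cdot>\<^sub>V \<xi>'" using sactD(7)[OF a] sactD(7)[OF b] by simp
  show ?thesis
    by (rule V.monicD[OF V.kernel_monic[OF sactD(2)[OF a]] _ _ _ _ _ e]) (use sactD(3-6)[OF a] sactD(3-6)[OF b] in simp_all)
qed

lemma sact_morphism_algebra:
  assumes a: "sact B X1 \<xi>1 p1 s1 k1" and b: "sact B X2 \<xi>2 p2 s2 k2"
    and h: "((p1, s1), h, (p2, s2)) \<in> Ar (Pt (UC A) B)"
    and f: "f \<in> Ar (VC A)" "Dom (VC A) f = X1" "Cod (VC A) f = X2" and e: "U1 h \<cdot>\<^sub>V k1 = k2 \<cdot>\<^sub>V f"
  shows "f \<cdot>\<^sub>V \<xi>1 = \<xi>2 \<cdot>\<^sub>V sharp_map B f"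
proof -
  note a' = sactD[OF a] and t = point_kernel_typed[OF sactD(1-3)[OF a]]
  note b' = sactD[OF b] and u = point_kernel_typed[OF sactD(1-3)[OF b]]
  have ht: "h \<in> Ar (UC A)" "Dom (UC A) h = Dom (UC A) p1" "Cod (UC A) h = Dom (UC A) p2" "h \<cdot>\<^sub>U s1 = s2"
    using h by (auto simp: Pt_Ar_iff)
  have "k2 \<cdot>\<^sub>V (f \<cdot>\<^sub>V \<xi>1) = U1 h \<cdot>\<^sub>V (k1 \<cdot>\<^sub>V \<xi>1)"
    by (rule V.cmp_ext[OF e[symmetric]]) (use ht f a'(3-6) b'(3-6) t(1-12) u(1-12) in simp_all)
  also have "\<dots> = U1 (h \<cdot>\<^sub>U cotuple (UC A) s1 (adjunct (Dom (UC A) p1) k1)) \<cdot>\<^sub>V kap B X1"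
    unfolding a'(7) using ht(1-3) a'(3-6) t(1-12) by (simp del: U.cotuple_comp)
  also have "\<dots> = U1 (cotuple (UC A) s2 (adjunct (Dom (UC A) p2) (k2 \<cdot>\<^sub>V f))) \<cdot>\<^sub>V kap B X1"
    using ht a'(3-6) t(1-12) e by simp
  also have "\<dots> = k2 \<cdot>\<^sub>V (\<xi>2 \<cdot>\<^sub>V sharp_map B f)" using sact_sharp_map[OF b f(1,3)] f(2) by simp
  finally have e2: "k2 \<cdot>\<^sub>V (f \<cdot>\<^sub>V \<xi>1) = k2 \<cdot>\<^sub>V (\<xi>2 \<cdot>\<^sub>V sharp_map B f)" .
  show ?thesis
    by (rule V.monicD[OF V.kernel_monic[OF b'(2)] _ _ _ _ _ e2]) (use f a'(3-6) b'(3-6) t(10) in simp_all)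
qed

lemma point_U: "(p, s) \<in> Ob (Pt (UC A) B) \<Longrightarrow> (U1 p, U1 s) \<in> Ob (Pt (VC A) (U0 B))"
proof -
  assume "(p, s) \<in> Ob (Pt (UC A) B)"
  hence t: "p \<in> Ar (UC A)" "Cod (UC A) p = B" "s \<in> Ar (UC A)" "Dom (UC A) s = B" "Cod (UC A) s = Dom (UC A) p"
    "p \<cdot>\<^sub>U s = Ide (UC A) B" by (auto simp: Pt_Ob_iff)
  have "U1 (p \<cdot>\<^sub>U s) = Ide (VC A) (U0 B)" unfolding t(6) using t(1,2) by (metis U.Cod_Ob U_simps(5))
  thus "(U1 p, U1 s) \<in> Ob (Pt (VC A) (U0 B))" using t(1-5) by (simp add: Pt_Ob_iff)
qed

end

section \<open>From algebras and their morphisms back to points\<close>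

locale adj_ctx0 = adj_pre +
  assumes conservative: "\<lbrakk>f \<in> Ar (UC A); iso (VC A) (FAr (Radj A) f)\<rbrakk> \<Longrightarrow> iso (UC A) f"
    and faithful: "\<lbrakk>f \<in> Ar (UC A); g \<in> Ar (UC A); Dom (UC A) f = Dom (UC A) g; Cod (UC A) f = Cod (UC A) g;
      FAr (Radj A) f = FAr (Radj A) g\<rbrakk> \<Longrightarrow> f = g"
begin

text \<open>A point of \<open>UC A\<close> is covered by the free point on its kernel: the image of the cover contains
  the section and, after applying the right adjoint, the kernel.\<close>

lemma cover_regular_epi:
  assumes x: "(p, s) \<in> Ob (Pt (UC A) B)" and k: "is_kernel (VC A) (U1 p) k" and X: "Dom (VC A) k = X"
  shows "regular_epi (UC A) (cotuple (UC A) s (adjunct (Dom (UC A) p) k))" (is "regular_epi _ ?m")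
proof -
  note t = point_kernel_typed[OF x k X]
  have mt: "?m \<in> Ar (UC A)" using t(1-12) by simp
  obtain e m where e: "regular_epi (UC A) e" "e \<in> Ar (UC A)" "monic (UC A) m" "m \<in> Ar (UC A)" "Dom (UC A) e = Dom (UC A) ?m"
    "Cod (UC A) e = Dom (UC A) m" "Cod (UC A) m = Cod (UC A) ?m" and me: "m \<cdot>\<^sub>U e = ?m"
    by (rule U.image_factorization[OF mt])
  have et: "Dom (UC A) e = copB B X" "Cod (UC A) m = Dom (UC A) p" using e t(1-12) X by simp_all
  have es: "m \<cdot>\<^sub>U (e \<cdot>\<^sub>U inj1 (UC A) B (L0 X)) = s" "m \<cdot>\<^sub>U (e \<cdot>\<^sub>U inj2 (UC A) B (L0 X)) = adjunct (Dom (UC A) p) k"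
    using U.cmp_ext1[OF me, of "inj1 (UC A) B (L0 X)"] U.cmp_ext1[OF me, of "inj2 (UC A) B (L0 X)"] e(2,4,6) et t(1-12) X
    by simp_all
  have i: "iso (VC A) (U1 m)"
  proof (rule V.section_kernel_extremal[OF point_U[OF x] k U_monic[OF e(3)]])
    have "U1 (m \<cdot>\<^sub>U (e \<cdot>\<^sub>U inj1 (UC A) B (L0 X))) = U1 s" "U1 (m \<cdot>\<^sub>U (e \<cdot>\<^sub>U inj2 (UC A) B (L0 X))) \<cdot>\<^sub>V \<eta> X = k"
      unfolding es using t(1-12) X by simp_all
    thus "U1 m \<cdot>\<^sub>V U1 (e \<cdot>\<^sub>U inj1 (UC A) B (L0 X)) = U1 s" "U1 m \<cdot>\<^sub>V (U1 (e \<cdot>\<^sub>U inj2 (UC A) B (L0 X)) \<cdot>\<^sub>V \<eta> X) = k"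
      using e(2,4,6) et t(1-12) by simp_all
  qed (use e(2,4,6) et t(1-12) in simp_all)
  show ?thesis unfolding me[symmetric]
    by (rule U.iso_regular_epi[OF e(1) conservative[OF e(4) i]]) (use e in simp)
qed

text \<open>The desired \<open>h\<close> is forced on the section and on the kernel, so its
  composite with the cover \<open>m\<close> of the first point must be \<open>g\<close>. What has to
  be shown is that \<open>g\<close> descends along \<open>m\<close>, that is, identifies the kernel
  pair of \<open>m\<close>.\<close>

lemma algebra_morphism_point:
  assumes a: "sact B X1 \<xi>1 p1 s1 k1" and b: "sact B X2 \<xi>2 p2 s2 k2"
    and f: "f \<in> Ar (VC A)" "Dom (VC A) f = X1" "Cod (VC A) f = X2" and e: "f \<cdot>\<^sub>V \<xi>1 = \<xi>2 \<cdot>\<^sub>V sharp_map B f"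
  obtains h where "((p1, s1), h, (p2, s2)) \<in> Ar (Pt (UC A) B)" "U1 h \<cdot>\<^sub>V k1 = k2 \<cdot>\<^sub>V f"
proof -
  note a' = sactD[OF a] and t = point_kernel_typed[OF sactD(1-3)[OF a]]
  note b' = sactD[OF b] and u = point_kernel_typed[OF sactD(1-3)[OF b]]
  define m where "m = cotuple (UC A) s1 (adjunct (Dom (UC A) p1) k1)"
  define g where "g = cotuple (UC A) s2 (adjunct (Dom (UC A) p2) (k2 \<cdot>\<^sub>V f))"
  define Q where "Q = copB B X1"
  have mt: "m \<in> Ar (UC A)" "Dom (UC A) m = Q" "Cod (UC A) m = Dom (UC A) p1" "p1 \<cdot>\<^sub>U m = sharp_proj B X1"
    using t a'(3) by (simp_all add: m_def Q_def)
  have gt: "g \<in> Ar (UC A)" "Dom (UC A) g = Q" "Cod (UC A) g = Dom (UC A) p2"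
    using t u f a'(3) b'(3) by (simp_all add: g_def Q_def)
  have reg: "regular_epi (UC A) m" unfolding m_def by (rule cover_regular_epi[OF a'(1-3)])
  have spt: "sharp_proj B X1 \<in> Ar (UC A)" "Dom (UC A) (sharp_proj B X1) = Q" "Cod (UC A) (sharp_proj B X1) = B" using t by (simp_all add: Q_def)
  obtain r1 r2 where pb: "is_pullback (UC A) m m r1 r2" using U.pb_ex[of m m] mt by blast
  define R where "R = Dom (UC A) r1"
  have r: "r1 \<in> Ar (UC A)" "r2 \<in> Ar (UC A)" "Dom (UC A) r1 = R" "Dom (UC A) r2 = R" "Cod (UC A) r1 = Q" "Cod (UC A) r2 = Q"
    and re: "m \<cdot>\<^sub>U r1 = m \<cdot>\<^sub>U r2"
    using U.pb_typed[OF pb] mt by (simp_all add: R_def)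
  have R: "R \<in> Ob (UC A)" using r by auto
  define i1 where "i1 = inj1 (UC A) B (L0 X1)"
  have i1: "i1 \<in> Ar (UC A)" "Dom (UC A) i1 = B" "Cod (UC A) i1 = Q" using t by (simp_all add: i1_def Q_def)
  have "cone (UC A) m m i1 i1" by (rule U.coneI) (use mt i1 in simp_all)
  then obtain d where d: "d \<in> Ar (UC A)" "Dom (UC A) d = B" "Cod (UC A) d = R" and de: "r1 \<cdot>\<^sub>U d = i1" "r2 \<cdot>\<^sub>U d = i1"
    using U.pb_fact'[OF pb _ i1(2) r(3)] by blast
  have sr: "sharp_proj B X1 \<cdot>\<^sub>U r2 = sharp_proj B X1 \<cdot>\<^sub>U r1"
  proof -
    have "sharp_proj B X1 \<cdot>\<^sub>U r1 = p1 \<cdot>\<^sub>U (m \<cdot>\<^sub>U r1)" "sharp_proj B X1 \<cdot>\<^sub>U r2 = p1 \<cdot>\<^sub>U (m \<cdot>\<^sub>U r2)"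
      using U.cmp_ext1[OF mt(4), of r1] U.cmp_ext1[OF mt(4), of r2] t(1) mt(1-3) r by simp_all
    thus ?thesis using re by simp
  qed
  have spi: "sharp_proj B X1 \<cdot>\<^sub>U i1 = Ide (UC A) B" using t by (simp add: i1_def sharp_proj_def)
  \<comment> \<open>The kernel pair of \<open>m\<close> is itself a point over \<open>B\<close>, so
    the equality of \<open>g r1\<close> and \<open>g r2\<close> can be tested, after the right
    adjoint, on its section \<open>d\<close> and on its kernel \<open>n\<close>.\<close>
  have pt: "(sharp_proj B X1 \<cdot>\<^sub>U r1, d) \<in> Ob (Pt (UC A) B)"
    using r spt d de(1) spi by (simp add: Pt_Ob_iff)
  have srt: "sharp_proj B X1 \<cdot>\<^sub>U r1 \<in> Ar (UC A)" using r spt by simp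
  obtain n where n: "is_kernel (VC A) (U1 (sharp_proj B X1 \<cdot>\<^sub>U r1)) n" using V.ker_ex srt by (meson U_simps(1))
  define N where "N = Dom (VC A) n"
  have nt: "n \<in> Ar (VC A)" "Cod (VC A) n = U0 R" "N \<in> Ob (VC A)" "U1 (sharp_proj B X1 \<cdot>\<^sub>U r1) \<cdot>\<^sub>V n = zero_arrow (VC A) N (U0 B)"
    using V.kernelD[OF n] r spt by (simp_all add: N_def)
  have nd: "Dom (VC A) n = N" by (simp add: N_def)
  have rho: "\<exists>\<rho>. \<rho> \<in> Ar (VC A) \<and> Dom (VC A) \<rho> = N \<and> Cod (VC A) \<rho> = tob B X1 \<and> kap B X1 \<cdot>\<^sub>V \<rho> = U1 r \<cdot>\<^sub>V n"
    if r': "r \<in> Ar (UC A)" "Dom (UC A) r = R" "Cod (UC A) r = Q" "sharp_proj B X1 \<cdot>\<^sub>U r = sharp_proj B X1 \<cdot>\<^sub>U r1" for r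
  proof (rule V.kernel_fact[OF kap_kernel[OF t(10,11)] _ _ refl])
    have "U1 (sharp_proj B X1 \<cdot>\<^sub>U r) \<cdot>\<^sub>V n = zero_arrow (VC A) N (U0 B)" unfolding r'(4) by (rule nt(4))
    hence "U1 (sharp_proj B X1) \<cdot>\<^sub>V (U1 r \<cdot>\<^sub>V n) = zero_arrow (VC A) N (U0 B)" using r'(1-3) spt nt(1-3) nd by simp
    thus "annihilated (VC A) (U1 (sharp_proj B X1)) (U1 r \<cdot>\<^sub>V n)" by (intro V.annihilatedI) (use r'(1-3) spt nt(1-3) nd in simp_all)
  qed (use r' nt nd in simp)
  obtain \<rho>1 where rho1: "\<rho>1 \<in> Ar (VC A)" "Dom (VC A) \<rho>1 = N" "Cod (VC A) \<rho>1 = tob B X1" "kap B X1 \<cdot>\<^sub>V \<rho>1 = U1 r1 \<cdot>\<^sub>V n"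
    using rho[OF r(1,3,5) refl] by blast
  obtain \<rho>2 where rho2: "\<rho>2 \<in> Ar (VC A)" "Dom (VC A) \<rho>2 = N" "Cod (VC A) \<rho>2 = tob B X1" "kap B X1 \<cdot>\<^sub>V \<rho>2 = U1 r2 \<cdot>\<^sub>V n"
    using rho[OF r(2,4,6) sr] by blast
  have kt: "kap B X1 \<in> Ar (VC A)" "Cod (VC A) (kap B X1) = U0 Q" using t(10,11) by (simp_all add: Q_def)
  \<comment> \<open>On the kernel, both \<open>m\<close> and \<open>g\<close> factor through
    \<open>\<xi>1\<close>: \<open>m\<close> as \<open>k1\<close> after it, and \<open>g\<close>, by
    the morphism equation \<open>e\<close>, as \<open>k2 f\<close> after it. As \<open>k1\<close> is
    monic, \<open>g\<close> identifies there whatever \<open>m\<close> does.\<close>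
  have k\<xi>: "k1 \<cdot>\<^sub>V (\<xi>1 \<cdot>\<^sub>V \<rho>) = U1 (m \<cdot>\<^sub>U r) \<cdot>\<^sub>V n" "U1 (g \<cdot>\<^sub>U r) \<cdot>\<^sub>V n = k2 \<cdot>\<^sub>V (f \<cdot>\<^sub>V (\<xi>1 \<cdot>\<^sub>V \<rho>))"
    if rh: "\<rho> \<in> Ar (VC A)" "Dom (VC A) \<rho> = N" "Cod (VC A) \<rho> = tob B X1" "kap B X1 \<cdot>\<^sub>V \<rho> = U1 r \<cdot>\<^sub>V n"
      and r': "r \<in> Ar (UC A)" "Dom (UC A) r = R" "Cod (UC A) r = Q" for r \<rho>
  proof -
    have "k1 \<cdot>\<^sub>V (\<xi>1 \<cdot>\<^sub>V \<rho>) = U1 m \<cdot>\<^sub>V (kap B X1 \<cdot>\<^sub>V \<rho>)"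
      by (rule V.cmp_ext[OF a'(7)[folded m_def]]) (use a'(3-6) t(7,8) mt kt rh in simp_all)
    also have "\<dots> = U1 (m \<cdot>\<^sub>U r) \<cdot>\<^sub>V n" unfolding rh(4) using mt(1-3) r' nt(1-3) by simp
    finally show "k1 \<cdot>\<^sub>V (\<xi>1 \<cdot>\<^sub>V \<rho>) = U1 (m \<cdot>\<^sub>U r) \<cdot>\<^sub>V n" .
    have "U1 g \<cdot>\<^sub>V kap B X1 = k2 \<cdot>\<^sub>V (\<xi>2 \<cdot>\<^sub>V sharp_map B f)"
      using sact_sharp_map[OF b f(1,3)] f(2) by (simp add: g_def)
    also have "\<dots> = k2 \<cdot>\<^sub>V (f \<cdot>\<^sub>V \<xi>1)" by (simp only: e)
    finally have gk: "U1 g \<cdot>\<^sub>V kap B X1 = k2 \<cdot>\<^sub>V (f \<cdot>\<^sub>V \<xi>1)" .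
    have "U1 (g \<cdot>\<^sub>U r) \<cdot>\<^sub>V n = U1 g \<cdot>\<^sub>V (kap B X1 \<cdot>\<^sub>V \<rho>)" unfolding rh(4) using gt r' nt(1-3) by simp
    also have "\<dots> = (k2 \<cdot>\<^sub>V (f \<cdot>\<^sub>V \<xi>1)) \<cdot>\<^sub>V \<rho>"
      unfolding gk[symmetric] using gt kt rh(1-3) by simp
    also have "\<dots> = k2 \<cdot>\<^sub>V (f \<cdot>\<^sub>V (\<xi>1 \<cdot>\<^sub>V \<rho>))" using rh(1-3) a'(3-6) b'(3) u(7,8) f by simp
    finally show "U1 (g \<cdot>\<^sub>U r) \<cdot>\<^sub>V n = k2 \<cdot>\<^sub>V (f \<cdot>\<^sub>V (\<xi>1 \<cdot>\<^sub>V \<rho>))" .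
  qed
  have "k1 \<cdot>\<^sub>V (\<xi>1 \<cdot>\<^sub>V \<rho>1) = k1 \<cdot>\<^sub>V (\<xi>1 \<cdot>\<^sub>V \<rho>2)"
    using k\<xi>(1)[OF rho1 r(1,3,5)] k\<xi>(1)[OF rho2 r(2,4,6)] re by simp
  hence "\<xi>1 \<cdot>\<^sub>V \<rho>1 = \<xi>1 \<cdot>\<^sub>V \<rho>2"
    using rho1(1-3) rho2(1-3) a'(3-6) by (intro V.monicD[OF V.kernel_monic[OF a'(2)], of "\<xi>1 \<cdot>\<^sub>V \<rho>1" "\<xi>1 \<cdot>\<^sub>V \<rho>2"]) simp_all
  hence gn: "U1 (g \<cdot>\<^sub>U r1) \<cdot>\<^sub>V n = U1 (g \<cdot>\<^sub>U r2) \<cdot>\<^sub>V n"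
    using k\<xi>(2)[OF rho1 r(1,3,5)] k\<xi>(2)[OF rho2 r(2,4,6)] by simp
  have gd: "U1 (g \<cdot>\<^sub>U r1) \<cdot>\<^sub>V U1 d = U1 (g \<cdot>\<^sub>U r2) \<cdot>\<^sub>V U1 d"
  proof -
    have "U1 (g \<cdot>\<^sub>U (r1 \<cdot>\<^sub>U d)) = U1 (g \<cdot>\<^sub>U (r2 \<cdot>\<^sub>U d))" by (simp only: de)
    thus ?thesis using gt r d by simp
  qed
  have "U1 (g \<cdot>\<^sub>U r1) = U1 (g \<cdot>\<^sub>U r2)"
    by (rule V.section_kernel_joint_epi[OF point_U[OF pt] n _ _ _ _ gd gn]) (use gt r spt in simp_all)
  hence gr: "g \<cdot>\<^sub>U r1 = g \<cdot>\<^sub>U r2" using gt r by (intro faithful[of "g \<cdot>\<^sub>U r1" "g \<cdot>\<^sub>U r2"]) simp_all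
  \<comment> \<open>The pair of which \<open>m\<close> is a coequalizer factors through the kernel
    pair, so \<open>g\<close> identifies it as well and factors through \<open>m\<close>.\<close>
  obtain c0 c1 where co: "is_coequalizer (UC A) c0 c1 m" using reg by (auto simp: regular_epi_def)
  note ct = U.coeqD[OF co]
  have cQ: "Cod (UC A) c0 = Q" "Cod (UC A) c1 = Q" using ct mt by simp_all
  have "cone (UC A) m m c0 c1" by (rule U.coneI) (use ct(1,2,3,7) cQ mt in simp_all)
  then obtain w where w: "w \<in> Ar (UC A)" "Cod (UC A) w = R" "r1 \<cdot>\<^sub>U w = c0" "r2 \<cdot>\<^sub>U w = c1"
    using U.pb_fact'[OF pb _ refl r(3)] by blast
  have "g \<cdot>\<^sub>U c0 = g \<cdot>\<^sub>U c1" unfolding w(3,4)[symmetric]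
    by (rule U.cmp_ext[OF gr]) (use gt r w(1,2) in simp_all)
  then obtain h where h: "h \<in> Ar (UC A)" "Dom (UC A) h = Cod (UC A) m" "Cod (UC A) h = Cod (UC A) g" "h \<cdot>\<^sub>U m = g"
    using U.coeq_univ[OF co gt(1)] gt(2) cQ by metis
  have ht: "Dom (UC A) h = Dom (UC A) p1" "Cod (UC A) h = Dom (UC A) p2" using h mt gt by simp_all
  have mi: "m \<cdot>\<^sub>U i1 = s1" "m \<cdot>\<^sub>U inj2 (UC A) B (L0 X1) = adjunct (Dom (UC A) p1) k1"
    using t a'(3) by (simp_all add: m_def i1_def)
  have gi: "g \<cdot>\<^sub>U i1 = s2" "g \<cdot>\<^sub>U inj2 (UC A) B (L0 X1) = adjunct (Dom (UC A) p2) (k2 \<cdot>\<^sub>V f)"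
    using t u f a'(3) b'(3) by (simp_all add: g_def i1_def)
  have hs: "h \<cdot>\<^sub>U s1 = s2" unfolding mi(1)[symmetric] gi(1)[symmetric]
    by (rule U.cmp_ext1[OF h(4)]) (use h mt i1 in simp_all)
  have hk: "h \<cdot>\<^sub>U adjunct (Dom (UC A) p1) k1 = adjunct (Dom (UC A) p2) (k2 \<cdot>\<^sub>V f)" unfolding mi(2)[symmetric] gi(2)[symmetric]
    by (rule U.cmp_ext1[OF h(4)]) (use h mt Q_def t in simp_all)
  have "adjunct (Dom (UC A) p2) (U1 h \<cdot>\<^sub>V k1) = adjunct (Dom (UC A) p2) (k2 \<cdot>\<^sub>V f)"
    using hk h(1) ht t by simp
  hence 2: "U1 h \<cdot>\<^sub>V k1 = k2 \<cdot>\<^sub>V f"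
    by (intro adjunct_inj[of _ _ "Dom (UC A) p2"]) (use h(1) ht t u f a'(3) b'(3) in simp_all)
  have "p2 \<cdot>\<^sub>U g = sharp_proj B X1" using t u f a'(3) b'(3)
    V.cmp_ext1[OF u(9), of f] by (simp add: g_def sharp_proj_def)
  hence pe: "(p2 \<cdot>\<^sub>U h) \<cdot>\<^sub>U m = p1 \<cdot>\<^sub>U m" using h mt(1,3,4) ht u(1) by simp
  have "p2 \<cdot>\<^sub>U h = p1"
    by (rule U.regular_epi_cancel[OF reg _ _ _ _ pe]) (use h(1) ht mt(3) t(1) u(1) in simp_all)
  thus thesis using that[OF _ 2] a'(1) b'(1) h(1) ht hs by (simp add: Pt_Ar_iff)
qed

end

text \<open>The layers of assumptions follow their sources. \<open>adj_ctx0\<close> records what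
  monadicity yields. \<open>pres\<close>, which makes quotients in \<open>UC A\<close> visible in
  \<open>VC A\<close>, is derived from the cartesian unit in \<open>cart_ctx\<close> and is
  immediate for the identity adjunction.\<close>

locale adj_ctx = adj_ctx0 +
  assumes pres: "regular_epi (UC A) e \<Longrightarrow> regular_epi (VC A) (FAr (Radj A) e)"
begin

text \<open>Beck's argument: the reflexive pair presenting the free resolution of an algebra has an
  effective image, whose quotient is the point sought. Its kernel is computed by a split
  coequalizer.\<close>

lemma algebra_point:
  assumes B: "B \<in> Ob (UC A)" and al: "(X, \<xi>) \<in> Ob (Alg (VC A) (sharp_monad A B))"
  obtains p s k where "sact B X \<xi> p s k"
proof -
  have X: "X \<in> Ob (VC A)" and xi: "\<xi> \<in> Ar (VC A)" "Dom (VC A) \<xi> = tob B X" "Cod (VC A) \<xi> = X"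
    and xu: "\<xi> \<cdot>\<^sub>V sharp_unit B X = Ide (VC A) X" and xm: "\<xi> \<cdot>\<^sub>V sharp_mult B X = \<xi> \<cdot>\<^sub>V sharp_map B \<xi>"
    using al B by (simp_all add: Alg_Ob)
  define T where "T = tob B X"
  have T: "T \<in> Ob (VC A)" using B X by (simp add: T_def)
  have TD: "tob B X = T" by (simp add: T_def)
  define Q P i1 where "Q = copB B X" and "P = copB B T" and "i1 = inj1 (UC A) B (L0 X)"
  have QP: "Q \<in> Ob (UC A)" "P \<in> Ob (UC A)" using B X T by (simp_all add: Q_def P_def)
  have i1: "i1 \<in> Ar (UC A)" "Dom (UC A) i1 = B" "Cod (UC A) i1 = Q" using B X by (simp_all add: i1_def Q_def)
  \<comment> \<open>\<open>d0\<close> is the counit at the free point on \<open>X\<close>,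
    \<open>d1\<close> is the free functor applied to \<open>\<xi>\<close>, and their common section
    \<open>i\<close> is the free functor applied to the unit of the monad.\<close>
  define d0 where "d0 = cotuple (UC A) i1 (adjunct Q (kap B X))"
  define d1 where "d1 = coprod_map (UC A) (Ide (UC A) B) (L1 \<xi>)"
  define i where "i = coprod_map (UC A) (Ide (UC A) B) (L1 (sharp_unit B X))"
  have kt: "kap B X \<in> Ar (VC A)" "Dom (VC A) (kap B X) = T" "Cod (VC A) (kap B X) = U0 Q"
    "kap B T \<in> Ar (VC A)" "Cod (VC A) (kap B T) = U0 P" using B X T by (simp_all add: TD Q_def P_def)
  have d: "d0 \<in> Ar (UC A)" "d1 \<in> Ar (UC A)" "Dom (UC A) d0 = P" "Dom (UC A) d1 = P" "Cod (UC A) d0 = Q" "Cod (UC A) d1 = Q"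
    using B X xi i1 kt QP by (simp_all add: d0_def d1_def P_def Q_def TD)
  have it: "i \<in> Ar (UC A)" "Dom (UC A) i = Q" "Cod (UC A) i = P"
    using B X by (simp_all add: i_def P_def Q_def TD)
  have di0: "d0 \<cdot>\<^sub>U i = Ide (UC A) Q"
  proof -
    have "d0 \<cdot>\<^sub>U i = cotuple (UC A) i1 (adjunct Q (kap B X \<cdot>\<^sub>V sharp_unit B X))"
      using B X i1 kt QP by (simp add: d0_def i_def TD del: sharp_unit_simps(4))
    also have "\<dots> = cotuple (UC A) i1 (inj2 (UC A) B (L0 X))"
      using B X adjunct_U[of "inj2 (UC A) B (L0 X)" X Q] by (simp add: Q_def)
    finally show ?thesis using B X by (simp add: i1_def Q_def)
  qed
  have di1: "d1 \<cdot>\<^sub>U i = Ide (UC A) Q"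
  proof -
    have "L1 (\<xi> \<cdot>\<^sub>V sharp_unit B X) = Ide (UC A) (L0 X)" unfolding xu using X by simp
    hence l: "L1 \<xi> \<cdot>\<^sub>U L1 (sharp_unit B X) = Ide (UC A) (L0 X)" using B X xi by simp
    have "d1 \<cdot>\<^sub>U i = cotuple (UC A) i1 (inj2 (UC A) B (L0 X))"
      unfolding d1_def i_def coprod_map_def[of "UC A" "Ide (UC A) B" "L1 \<xi>"] using B X xi l by (simp add: i1_def)
    thus ?thesis using B X by (simp add: i1_def Q_def)
  qed
  obtain c r1 r2 e where c: "regular_epi (UC A) c" "c \<in> Ar (UC A)" "Dom (UC A) c = P" "Cod (UC A) c = Dom (UC A) r1"
    and rc: "r1 \<cdot>\<^sub>U c = d0" "r2 \<cdot>\<^sub>U c = d1" and pb: "is_pullback (UC A) e e r1 r2"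
    and e: "regular_epi (UC A) e" "e \<in> Ar (UC A)" "Dom (UC A) e = Q"
    by (rule U.reflexive_pair_effective[OF d it di0 di1])
  define R where "R = Dom (UC A) r1"
  have r: "r1 \<in> Ar (UC A)" "r2 \<in> Ar (UC A)" "Dom (UC A) r1 = R" "Dom (UC A) r2 = R" "Cod (UC A) r1 = Q" "Cod (UC A) r2 = Q" "Cod (UC A) c = R"
    and er: "e \<cdot>\<^sub>U r1 = e \<cdot>\<^sub>U r2"
    using U.pb_typed[OF pb] e c by (simp_all add: R_def)
  have spt: "sharp_proj B X \<in> Ar (UC A)" "Dom (UC A) (sharp_proj B X) = Q" "Cod (UC A) (sharp_proj B X) = B"
    "sharp_proj B T \<in> Ar (UC A)" "Dom (UC A) (sharp_proj B T) = P" "Cod (UC A) (sharp_proj B T) = B" using B X T by (simp_all add: Q_def P_def)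
  have spd: "sharp_proj B X \<cdot>\<^sub>U d0 = sharp_proj B T" "sharp_proj B X \<cdot>\<^sub>U d1 = sharp_proj B T"
  proof -
    have "sharp_proj B X \<cdot>\<^sub>U i1 = Ide (UC A) B" using B X by (simp add: sharp_proj_def i1_def)
    thus "sharp_proj B X \<cdot>\<^sub>U d0 = sharp_proj B T" using B X i1 kt spt(1-3) QP
      by (simp add: d0_def sharp_proj_def[of B T] TD)
    show "sharp_proj B X \<cdot>\<^sub>U d1 = sharp_proj B T" using B X T xi by (simp add: d1_def sharp_proj_def TD)
  qed
  \<comment> \<open>The projection to \<open>B\<close> must factor through the quotient
    \<open>e\<close>. It agrees on \<open>d0\<close> and \<open>d1\<close>, hence on
    \<open>r1\<close> and \<open>r2\<close>, because the cover \<open>c\<close> can be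
    cancelled.\<close>
  have "(sharp_proj B X \<cdot>\<^sub>U r1) \<cdot>\<^sub>U c = (sharp_proj B X \<cdot>\<^sub>U r2) \<cdot>\<^sub>U c" using spd rc spt r c by simp
  hence "sharp_proj B X \<cdot>\<^sub>U r1 = sharp_proj B X \<cdot>\<^sub>U r2"
    by (intro U.regular_epi_cancel[OF c(1), of "sharp_proj B X \<cdot>\<^sub>U r1" "sharp_proj B X \<cdot>\<^sub>U r2"]) (use spt r c in simp_all)
  obtain p where p: "p \<in> Ar (UC A)" "Dom (UC A) p = Cod (UC A) e" "Cod (UC A) p = B" "p \<cdot>\<^sub>U e = sharp_proj B X"
  proof -
    obtain c0 c1 where co: "is_coequalizer (UC A) c0 c1 e" using e by (auto simp: regular_epi_def)
    note ct = U.coeqD[OF co]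
    have "cone (UC A) e e c0 c1" by (rule U.coneI) (use ct in simp_all)
    then obtain w where w: "w \<in> Ar (UC A)" "Cod (UC A) w = R" "r1 \<cdot>\<^sub>U w = c0" "r2 \<cdot>\<^sub>U w = c1"
      using U.pb_fact'[OF pb _ refl r(3)] by blast
    have "sharp_proj B X \<cdot>\<^sub>U c0 = sharp_proj B X \<cdot>\<^sub>U c1" unfolding w(3,4)[symmetric]
      by (rule U.cmp_ext[OF \<open>sharp_proj B X \<cdot>\<^sub>U r1 = sharp_proj B X \<cdot>\<^sub>U r2\<close>]) (use spt r w(1,2) in simp_all)
    moreover have "Dom (UC A) (sharp_proj B X) = Cod (UC A) c0" using spt ct e by simp
    ultimately show thesis using U.coeq_univ[OF co spt(1)] that spt(3) by metis
  qed
  define s where "s = e \<cdot>\<^sub>U i1"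
  have st: "s \<in> Ar (UC A)" "Dom (UC A) s = B" "Cod (UC A) s = Dom (UC A) p" using e i1 p by (simp_all add: s_def)
  have "p \<cdot>\<^sub>U s = sharp_proj B X \<cdot>\<^sub>U i1" unfolding s_def by (rule U.cmp_ext1[OF p(4)]) (use e i1 p in simp_all)
  also have "\<dots> = Ide (UC A) B" using B X by (simp add: sharp_proj_def i1_def)
  finally have pt: "(p, s) \<in> Ob (Pt (UC A) B)" using p st by (simp add: Pt_Ob_iff)
  obtain k0 where k0: "is_kernel (VC A) (U1 p) k0" using V.ker_ex p(1) by (meson U_simps(1))
  define K where "K = Dom (VC A) k0"
  have k0t: "k0 \<in> Ar (VC A)" "Dom (VC A) k0 = K" "Cod (VC A) k0 = U0 (Cod (UC A) e)" "K \<in> Ob (VC A)"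
     "U1 p \<cdot>\<^sub>V k0 = zero_arrow (VC A) K (U0 B)"
    using V.kernelD[OF k0] p by (simp_all add: K_def)
  have Upe: "U1 p \<cdot>\<^sub>V U1 e = U1 (sharp_proj B X)" by (rule U_eq[OF p(4)]) (use p(1-3) e in simp_all)
  have "U1 p \<cdot>\<^sub>V (U1 e \<cdot>\<^sub>V kap B X) = U1 (sharp_proj B X) \<cdot>\<^sub>V kap B X"
    by (rule V.cmp_ext1[OF Upe]) (use p(1-3) e kt in simp_all)
  hence "annihilated (VC A) (U1 p) (U1 e \<cdot>\<^sub>V kap B X)"
    by (intro V.annihilatedI) (use p(1-3) e kt B X in \<open>simp_all add: TD\<close>)
  moreover have "Dom (VC A) (U1 e \<cdot>\<^sub>V kap B X) = T" using e kt by simp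
  ultimately obtain e0 where e0: "e0 \<in> Ar (VC A)" "Dom (VC A) e0 = T" "Cod (VC A) e0 = K" and e0e: "k0 \<cdot>\<^sub>V e0 = U1 e \<cdot>\<^sub>V kap B X"
    using V.kernel_fact[OF k0 _ _ k0t(2)] by blast
  \<comment> \<open>The restriction \<open>e0\<close> of \<open>U1 e\<close> to kernels is a
    pullback of \<open>U1 e\<close>, so it inherits being a regular epimorphism from
    \<open>pres\<close> and stability.\<close>
  have "is_pullback (VC A) k0 (U1 e) e0 (kap B X)"
  proof (rule V.pbI)
    fix x y assume x: "x \<in> Ar (VC A)" "y \<in> Ar (VC A)" "Dom (VC A) x = Dom (VC A) y" "Cod (VC A) x = Dom (VC A) k0"
      "Cod (VC A) y = Dom (VC A) (U1 e)" and xy: "k0 \<cdot>\<^sub>V x = U1 e \<cdot>\<^sub>V y"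
    have "U1 (sharp_proj B X) \<cdot>\<^sub>V y = U1 p \<cdot>\<^sub>V (U1 e \<cdot>\<^sub>V y)"
      by (rule V.cmp_ext1[OF Upe, symmetric]) (use p(1-3) e x in simp_all)
    also have "\<dots> = zero_arrow (VC A) K (U0 B) \<cdot>\<^sub>V x" unfolding xy[symmetric]
      by (rule V.cmp_ext1[OF k0t(5)]) (use p(1-3) k0t(1-4) x in simp_all)
    finally have "annihilated (VC A) (U1 (sharp_proj B X)) y" by (intro V.annihilatedI) (use p(1-3) k0t(1-4) x e spt B in simp_all)
    from V.kernel_fact[OF kap_kernel[OF B X] this refl TD]
    obtain w where w: "w \<in> Ar (VC A)" "Dom (VC A) w = Dom (VC A) y" "Cod (VC A) w = T" "kap B X \<cdot>\<^sub>V w = y" by blast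
    have k: "k0 \<cdot>\<^sub>V (e0 \<cdot>\<^sub>V w) = k0 \<cdot>\<^sub>V x" unfolding xy w(4)[symmetric]
      by (rule V.cmp_ext[OF e0e]) (use k0t(1-4) e0 w(1-3) kt e in simp_all)
    have "e0 \<cdot>\<^sub>V w = x"
      by (rule V.monicD[OF V.kernel_monic[OF k0] _ _ _ _ _ k]) (use k0t(1-4) e0 w(1-3) x in simp_all)
    thus "\<exists>w. w \<in> Ar (VC A) \<and> Dom (VC A) w = Dom (VC A) x \<and> Cod (VC A) w = Dom (VC A) e0 \<and> e0 \<cdot>\<^sub>V w = x \<and> kap B X \<cdot>\<^sub>V w = y"
      using w e0(2) x(3) by (intro exI[of _ w]) simp
  next
    fix w w' assume "w \<in> Ar (VC A)" "w' \<in> Ar (VC A)" "Dom (VC A) w = Dom (VC A) w'" "Cod (VC A) w = Dom (VC A) e0"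
      "Cod (VC A) w' = Dom (VC A) e0" "kap B X \<cdot>\<^sub>V w = kap B X \<cdot>\<^sub>V w'"
    thus "w = w'" by (intro V.monicD[OF V.kernel_monic[OF kap_kernel[OF B X]], of w w']) (use kt e0 in simp_all)
  qed (use k0t(1-4) e0 kt e e0e in simp_all)
  hence e0r: "regular_epi (VC A) e0" by (rule V.regular_epi_stable[OF _ pres[OF e(1)]])
  \<comment> \<open>The aim is that \<open>\<xi>\<close> identifies \<open>u\<close> and
    \<open>v\<close> and hence factors through \<open>e0\<close>. For this, \<open>u\<close> and
    \<open>v\<close> are first seen as a pair in the relation \<open>R\<close>.\<close>
  obtain u v where uv: "is_coequalizer (VC A) u v e0" using e0r by (auto simp: regular_epi_def)
  note ut = V.coeqD[OF uv]
  define N where "N = Dom (VC A) u"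
  have u: "u \<in> Ar (VC A)" "v \<in> Ar (VC A)" "Dom (VC A) u = N" "Dom (VC A) v = N" "Cod (VC A) u = T" "Cod (VC A) v = T"
    using ut(1-6) e0 by (simp_all add: N_def)
  have "U1 e \<cdot>\<^sub>V (kap B X \<cdot>\<^sub>V u) = k0 \<cdot>\<^sub>V (e0 \<cdot>\<^sub>V u)" "U1 e \<cdot>\<^sub>V (kap B X \<cdot>\<^sub>V v) = k0 \<cdot>\<^sub>V (e0 \<cdot>\<^sub>V v)"
    by (rule V.cmp_ext[OF e0e[symmetric]]; use u k0t(1-4) e0 kt e in simp)+
  hence "U1 e \<cdot>\<^sub>V (kap B X \<cdot>\<^sub>V u) = U1 e \<cdot>\<^sub>V (kap B X \<cdot>\<^sub>V v)" using ut(7) by simp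
  hence "cone (VC A) (U1 e) (U1 e) (kap B X \<cdot>\<^sub>V u) (kap B X \<cdot>\<^sub>V v)" by (intro V.coneI) (use u kt e in simp_all)
  moreover have "Dom (VC A) (kap B X \<cdot>\<^sub>V u) = N" "Dom (VC A) (U1 r1) = U0 R" using u kt r by simp_all
  ultimately obtain w where w: "w \<in> Ar (VC A)" "Dom (VC A) w = N" "Cod (VC A) w = U0 R"
    and we: "U1 r1 \<cdot>\<^sub>V w = kap B X \<cdot>\<^sub>V u" "U1 r2 \<cdot>\<^sub>V w = kap B X \<cdot>\<^sub>V v"
    using V.pb_fact'[OF U_pullback[OF pb]] by blast
  \<comment> \<open>\<open>R\<close> is only covered by \<open>P\<close>, so \<open>w\<close> lifts
    to \<open>w'\<close> after a further cover \<open>n\<close>. There \<open>u\<close> and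
    \<open>v\<close> become \<open>sharp_mult\<close> and \<open>sharp_map\<close> of
    \<open>\<xi>\<close> applied to one arrow \<open>z\<close>, which \<open>\<xi>\<close>
    identifies by the associativity law; the cover \<open>n\<close> is then cancelled.\<close>
  have "Cod (VC A) w = Cod (VC A) (U1 c)" using w c r by simp
  then obtain n w' where n: "regular_epi (VC A) n" "n \<in> Ar (VC A)" "Cod (VC A) n = Dom (VC A) w" "w' \<in> Ar (VC A)"
    "Dom (VC A) w' = Dom (VC A) n" "Cod (VC A) w' = Dom (VC A) (U1 c)" and nw: "U1 c \<cdot>\<^sub>V w' = w \<cdot>\<^sub>V n"
    using V.cover_lift[OF pres[OF c(1)] w(1)] by metis
  define N' where "N' = Dom (VC A) n"
  have nt: "Cod (VC A) n = N" "Dom (VC A) w' = N'" "Cod (VC A) w' = U0 P" "Dom (VC A) n = N'" "N' \<in> Ob (VC A)"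
    using n w c by (simp_all add: N'_def)
  have dw: "U1 d0 \<cdot>\<^sub>V w' = kap B X \<cdot>\<^sub>V (u \<cdot>\<^sub>V n)" "U1 d1 \<cdot>\<^sub>V w' = kap B X \<cdot>\<^sub>V (v \<cdot>\<^sub>V n)"
  proof -
    have "U1 (r \<cdot>\<^sub>U c) \<cdot>\<^sub>V w' = kap B X \<cdot>\<^sub>V (x \<cdot>\<^sub>V n)"
      if rr: "r \<in> Ar (UC A)" "Dom (UC A) r = R" "Cod (UC A) r = Q" "U1 r \<cdot>\<^sub>V w = kap B X \<cdot>\<^sub>V x"
        "x \<in> Ar (VC A)" "Dom (VC A) x = N" "Cod (VC A) x = T" for r x
    proof -
      have "U1 (r \<cdot>\<^sub>U c) \<cdot>\<^sub>V w' = U1 r \<cdot>\<^sub>V (U1 c \<cdot>\<^sub>V w')" using rr(1-3) c \<open>Cod (UC A) c = R\<close> n nt by simp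
      also have "\<dots> = U1 r \<cdot>\<^sub>V (w \<cdot>\<^sub>V n)" by (simp only: nw)
      also have "\<dots> = kap B X \<cdot>\<^sub>V (x \<cdot>\<^sub>V n)" by (rule V.cmp_ext[OF rr(4)]) (use rr(1-3,5-7) w kt n nt in simp_all)
      finally show ?thesis .
    qed
    from this[OF r(1,3,5) we(1) u(1,3,5)] this[OF r(2,4,6) we(2) u(2,4,6)]
    show "U1 d0 \<cdot>\<^sub>V w' = kap B X \<cdot>\<^sub>V (u \<cdot>\<^sub>V n)" "U1 d1 \<cdot>\<^sub>V w' = kap B X \<cdot>\<^sub>V (v \<cdot>\<^sub>V n)" unfolding rc by simp_all
  qed
  have Usd: "U1 (sharp_proj B X) \<cdot>\<^sub>V U1 d0 = U1 (sharp_proj B T)" by (rule U_eq[OF spd(1)]) (use spt d in simp_all)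
  have "U1 (sharp_proj B T) \<cdot>\<^sub>V w' = U1 (sharp_proj B X) \<cdot>\<^sub>V (U1 d0 \<cdot>\<^sub>V w')"
    by (rule V.cmp_ext1[OF Usd, symmetric]) (use spt d n nt in simp_all)
  also have "\<dots> = zero_arrow (VC A) T (U0 B) \<cdot>\<^sub>V (u \<cdot>\<^sub>V n)" unfolding dw(1)
    by (rule V.cmp_ext1[OF kap_simps(3)[OF B X, unfolded TD]]) (use spt kt u n nt in simp_all)
  finally have "annihilated (VC A) (U1 (sharp_proj B T)) w'" by (intro V.annihilatedI) (use spt n nt u B in simp_all)
  from V.kernel_fact[OF kap_kernel[OF B T] this nt(2) refl]
  obtain z where z: "z \<in> Ar (VC A)" "Dom (VC A) z = N'" "Cod (VC A) z = tob B T" and ze: "kap B T \<cdot>\<^sub>V z = w'" by blast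
  have mut: "sharp_mult B X \<in> Ar (VC A)" "Dom (VC A) (sharp_mult B X) = tob B T" "Cod (VC A) (sharp_mult B X) = T"
    "sharp_map B \<xi> \<in> Ar (VC A)" "Dom (VC A) (sharp_map B \<xi>) = tob B T" "Cod (VC A) (sharp_map B \<xi>) = T"
    using B X xi by (simp_all add: TD)
  have kmu: "kap B X \<cdot>\<^sub>V sharp_mult B X = U1 d0 \<cdot>\<^sub>V kap B T" "kap B X \<cdot>\<^sub>V sharp_map B \<xi> = U1 d1 \<cdot>\<^sub>V kap B T"
    using B X xi by (simp_all add: TD d0_def d1_def i1_def Q_def)
  note kmono = V.monicD[OF V.kernel_monic[OF kap_kernel[OF B X]]]
  have un: "u \<cdot>\<^sub>V n = sharp_mult B X \<cdot>\<^sub>V z"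
  proof (rule kmono)
    have "kap B X \<cdot>\<^sub>V (sharp_mult B X \<cdot>\<^sub>V z) = U1 d0 \<cdot>\<^sub>V (kap B T \<cdot>\<^sub>V z)"
      by (rule V.cmp_ext[OF kmu(1)]) (use kt mut d z in simp_all)
    thus "kap B X \<cdot>\<^sub>V (u \<cdot>\<^sub>V n) = kap B X \<cdot>\<^sub>V (sharp_mult B X \<cdot>\<^sub>V z)" using dw(1) ze by simp
  qed (use u n nt mut z kt in simp_all)
  have vn: "v \<cdot>\<^sub>V n = sharp_map B \<xi> \<cdot>\<^sub>V z"
  proof (rule kmono)
    have "kap B X \<cdot>\<^sub>V (sharp_map B \<xi> \<cdot>\<^sub>V z) = U1 d1 \<cdot>\<^sub>V (kap B T \<cdot>\<^sub>V z)"
      by (rule V.cmp_ext[OF kmu(2)]) (use kt mut d z in simp_all)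
    thus "kap B X \<cdot>\<^sub>V (v \<cdot>\<^sub>V n) = kap B X \<cdot>\<^sub>V (sharp_map B \<xi> \<cdot>\<^sub>V z)" using dw(2) ze by simp
  qed (use u n nt mut z kt in simp_all)
  have xt: "Dom (VC A) \<xi> = T" using xi by (simp add: TD)
  have "\<xi> \<cdot>\<^sub>V (sharp_mult B X \<cdot>\<^sub>V z) = \<xi> \<cdot>\<^sub>V (sharp_map B \<xi> \<cdot>\<^sub>V z)"
    by (rule V.cmp_ext[OF xm]) (use xi(1) xt mut z in simp_all)
  hence "(\<xi> \<cdot>\<^sub>V u) \<cdot>\<^sub>V n = (\<xi> \<cdot>\<^sub>V v) \<cdot>\<^sub>V n" using un vn xi(1) xt u n(2) nt by simp
  hence "\<xi> \<cdot>\<^sub>V u = \<xi> \<cdot>\<^sub>V v"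
    by (intro V.regular_epi_cancel[OF n(1), of "\<xi> \<cdot>\<^sub>V u" "\<xi> \<cdot>\<^sub>V v"]) (use xi(1) xt u nt in simp_all)
  moreover have "Dom (VC A) \<xi> = Cod (VC A) u" using xt u by simp
  ultimately obtain l where l: "l \<in> Ar (VC A)" "Dom (VC A) l = Cod (VC A) e0" "Cod (VC A) l = Cod (VC A) \<xi>" and le: "l \<cdot>\<^sub>V e0 = \<xi>"
    using V.coeq_univ[OF uv xi(1)] by metis
  have lt: "Dom (VC A) l = K" "Cod (VC A) l = X" using l e0 xi by simp_all
  have tut: "sharp_unit B X \<in> Ar (VC A)" "Dom (VC A) (sharp_unit B X) = X" "Cod (VC A) (sharp_unit B X) = T" using B X by (simp_all add: TD)
  \<comment> \<open>\<open>j\<close> and the factorization \<open>l\<close> of \<open>\<xi>\<close>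
    through \<open>e0\<close> turn out to be mutually inverse. So \<open>X\<close> itself, embedded
    by \<open>k0 j\<close>, is a kernel of the quotient point.\<close>
  define j where "j = e0 \<cdot>\<^sub>V sharp_unit B X"
  have jt: "j \<in> Ar (VC A)" "Dom (VC A) j = X" "Cod (VC A) j = K" using e0 tut by (simp_all add: j_def)
  have kj: "k0 \<cdot>\<^sub>V j = U1 (e \<cdot>\<^sub>U inj2 (UC A) B (L0 X)) \<cdot>\<^sub>V \<eta> X"
  proof -
    have "k0 \<cdot>\<^sub>V j = U1 e \<cdot>\<^sub>V (kap B X \<cdot>\<^sub>V sharp_unit B X)" unfolding j_def
      by (rule V.cmp_ext[OF e0e]) (use k0t(1-4) e0 tut kt e in simp_all)
    thus ?thesis using B X e by (simp add: Q_def)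
  qed
  \<comment> \<open>With respect to the kernel \<open>k0 j\<close>, the quotient map
    \<open>e\<close> is the canonical cover of the point, as required by
    \<open>sact\<close>.\<close>
  have eh: "e = cotuple (UC A) s (adjunct (Dom (UC A) p) (k0 \<cdot>\<^sub>V j))"
  proof (rule U.coprod_eqI[of B "L0 X"])
    have "adjunct (Dom (UC A) p) (k0 \<cdot>\<^sub>V j) = e \<cdot>\<^sub>U inj2 (UC A) B (L0 X)" unfolding kj
      by (rule adjunct_U) (use B X e p in \<open>simp_all add: Q_def\<close>)
    thus "e \<cdot>\<^sub>U inj2 (UC A) B (L0 X) = cotuple (UC A) s (adjunct (Dom (UC A) p) (k0 \<cdot>\<^sub>V j)) \<cdot>\<^sub>U inj2 (UC A) B (L0 X)"
      using B X st k0t(1-4) jt p(1-3) e(2,3) by (simp add: Q_def)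
    show "e \<cdot>\<^sub>U inj1 (UC A) B (L0 X) = cotuple (UC A) s (adjunct (Dom (UC A) p) (k0 \<cdot>\<^sub>V j)) \<cdot>\<^sub>U inj1 (UC A) B (L0 X)"
      using B X st k0t(1-4) jt p(1-3) e(2) s_def[unfolded i1_def, symmetric] by simp
  qed (use B X e st k0t(1-4) jt p(1-3) in \<open>simp_all add: Q_def\<close>)
  have k0m: "monic (VC A) k0" by (rule V.kernel_monic[OF k0])
  have jx: "j \<cdot>\<^sub>V \<xi> = e0"
  proof (rule V.monicD[OF k0m])
    \<comment> \<open>\<open>e\<close> coequalizes \<open>d0\<close> and \<open>d1\<close>, so \<open>e0\<close> coequalizes the multiplication and \<open>\<xi>\<close>; precompose with the unit.\<close>
    have ed: "e \<cdot>\<^sub>U d0 = e \<cdot>\<^sub>U d1"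
    proof -
      have "e \<cdot>\<^sub>U (r1 \<cdot>\<^sub>U c) = e \<cdot>\<^sub>U (r2 \<cdot>\<^sub>U c)" by (rule U.cmp_ext[OF er]) (use e r c in simp_all)
      thus ?thesis by (simp add: rc)
    qed
    have "k0 \<cdot>\<^sub>V (j \<cdot>\<^sub>V \<xi>) = (U1 (e \<cdot>\<^sub>U inj2 (UC A) B (L0 X)) \<cdot>\<^sub>V \<eta> X) \<cdot>\<^sub>V \<xi>"
      by (simp flip: kj) (use k0t(1-4) jt xi in simp)
    also have "\<dots> = U1 (e \<cdot>\<^sub>U inj2 (UC A) B (L0 X)) \<cdot>\<^sub>V (U1 (L1 \<xi>) \<cdot>\<^sub>V \<eta> T)"
      using B X e xi xt by (simp add: Q_def)
    also have "\<dots> = U1 (e \<cdot>\<^sub>U (inj2 (UC A) B (L0 X) \<cdot>\<^sub>U L1 \<xi>)) \<cdot>\<^sub>V \<eta> T"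
      using B X e xi xt T by (simp add: Q_def del: eta_nat)
    also have "inj2 (UC A) B (L0 X) \<cdot>\<^sub>U L1 \<xi> = d1 \<cdot>\<^sub>U inj2 (UC A) B (L0 T)"
      using B X T xi xt by (simp add: d1_def)
    also have "e \<cdot>\<^sub>U (d1 \<cdot>\<^sub>U inj2 (UC A) B (L0 T)) = e \<cdot>\<^sub>U (d0 \<cdot>\<^sub>U inj2 (UC A) B (L0 T))"
      by (rule U.cmp_ext[OF ed[symmetric]]) (use e d B T in \<open>simp_all add: P_def\<close>)
    also have "d0 \<cdot>\<^sub>U inj2 (UC A) B (L0 T) = adjunct Q (kap B X)" using B T i1 kt QP by (simp add: d0_def)
    also have "U1 (e \<cdot>\<^sub>U adjunct Q (kap B X)) \<cdot>\<^sub>V \<eta> T = U1 e \<cdot>\<^sub>V kap B X"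
      using e kt QP T by (simp del: adjunct_comp)
    finally show "k0 \<cdot>\<^sub>V (j \<cdot>\<^sub>V \<xi>) = k0 \<cdot>\<^sub>V e0" using e0e by simp
  qed (use jt xi xt e0 k0t in simp_all)
  have lj: "l \<cdot>\<^sub>V j = Ide (VC A) X"
  proof -
    have "l \<cdot>\<^sub>V j = \<xi> \<cdot>\<^sub>V sharp_unit B X" unfolding j_def by (rule V.cmp_ext1[OF le]) (use l lt e0 tut in simp_all)
    thus ?thesis using xu by simp
  qed
  have jl: "j \<cdot>\<^sub>V l = Ide (VC A) K"
    by (rule V.regular_epi_cancel[OF e0r]) (use jx le jt l(1) lt e0 k0t(4) in simp_all)
  have kk: "is_kernel (VC A) (U1 p) (k0 \<cdot>\<^sub>V j)"
  proof (rule V.kernelI)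
    show "U1 p \<cdot>\<^sub>V (k0 \<cdot>\<^sub>V j) = zero_arrow (VC A) (Dom (VC A) (k0 \<cdot>\<^sub>V j)) (Cod (VC A) (U1 p))"
      using V.cmp_ext1[OF k0t(5), of j] p(1-3) k0t(1-4) jt B by simp
    show "monic (VC A) (k0 \<cdot>\<^sub>V j)" unfolding monic_def
    proof (intro conjI ballI impI)
      fix x y assume x: "x \<in> Ar (VC A)" "y \<in> Ar (VC A)" "Dom (VC A) x = Dom (VC A) y" "Cod (VC A) x = Dom (VC A) (k0 \<cdot>\<^sub>V j)"
        "Cod (VC A) y = Dom (VC A) (k0 \<cdot>\<^sub>V j)" and xy: "(k0 \<cdot>\<^sub>V j) \<cdot>\<^sub>V x = (k0 \<cdot>\<^sub>V j) \<cdot>\<^sub>V y"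
      have "j \<cdot>\<^sub>V x = j \<cdot>\<^sub>V y" by (rule V.monicD[OF k0m]) (use x xy jt k0t in simp_all)
      hence "l \<cdot>\<^sub>V (j \<cdot>\<^sub>V x) = l \<cdot>\<^sub>V (j \<cdot>\<^sub>V y)" by simp
      thus "x = y" using V.cmp_ext1[OF lj, of x] V.cmp_ext1[OF lj, of y] l(1) lt jt x k0t by simp
    qed (use k0t jt in simp)
    fix x assume an: "annihilated (VC A) (U1 p) x"
    from V.kernel_fact[OF k0 an refl k0t(2)] obtain w where w: "w \<in> Ar (VC A)" "Dom (VC A) w = Dom (VC A) x" "Cod (VC A) w = K" "k0 \<cdot>\<^sub>V w = x" by blast
    have "(k0 \<cdot>\<^sub>V j) \<cdot>\<^sub>V (l \<cdot>\<^sub>V w) = x" using V.cmp_ext1[OF jl, of w] w jt l(1) lt k0t(1-4) by simp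
    thus "\<exists>w. w \<in> Ar (VC A) \<and> Dom (VC A) w = Dom (VC A) x \<and> Cod (VC A) w = Dom (VC A) (k0 \<cdot>\<^sub>V j) \<and> (k0 \<cdot>\<^sub>V j) \<cdot>\<^sub>V w = x"
      using w(1-3) l(1) lt jt k0t(1-4) by (intro exI[of _ "l \<cdot>\<^sub>V w"]) simp
  qed (use k0t p jt in simp_all)
  have "(k0 \<cdot>\<^sub>V j) \<cdot>\<^sub>V \<xi> = U1 e \<cdot>\<^sub>V kap B X" using k0t(1-4) jt xi jx e0e by simp
  hence "sact B X \<xi> p s (k0 \<cdot>\<^sub>V j)"
    unfolding sact_def eh[symmetric] using pt kk k0t jt xi by simp
  thus thesis by (rule that)
qed

end

section \<open>Internal actions as the case of the identity adjunction\<close>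

text \<open>Monads are built from total functions, and \<open>flat_monad\<close> has to agree with
  the monad of the identity adjunction only on objects and arrows of the category.
  \<open>Alg\<close> looks at nothing else.\<close>

lemma Alg_cong:
  assumes "\<And>X. X \<in> Ob C \<Longrightarrow> FOb (MFun T) X = FOb (MFun T') X" "\<And>f. f \<in> Ar C \<Longrightarrow> FAr (MFun T) f = FAr (MFun T') f"
    "\<And>X. X \<in> Ob C \<Longrightarrow> MUnit T X = MUnit T' X" "\<And>X. X \<in> Ob C \<Longrightarrow> MMult T X = MMult T' X"
  shows "Alg C T = Alg C T'"
proof -
  have 1: "Ob (Alg C T) = Ob (Alg C T')" using assms by (auto simp: Alg_def Let_def)
  hence "Ar (Alg C T) = Ar (Alg C T')" using assms by (auto simp: Alg_def Let_def)
  with 1 show ?thesis by (simp add: Alg_def Let_def)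
qed

lemma Alg_simps [simp]:
  "Dom (Alg C T) (x, f, y) = x" "Cod (Alg C T) (x, f, y) = y"
  "Ide (Alg C T) (X, \<xi>) = ((X, \<xi>), Ide C X, (X, \<xi>))"
  "(y, g, z) \<cdot>\<^bsub>Alg C T\<^esub> (x, f, y') = (x, g \<cdot>\<^bsub>C\<^esub> f, z)"
  by (simp_all add: Alg_def Let_def)

context adj_ctx
begin

text \<open>Functoriality of \<open>B # (-)\<close> is bypassed: identities and composites of
  algebra morphisms are obtained from identities and composites of morphisms of points.\<close>

lemma category_Alg:
  assumes B: "B \<in> Ob (UC A)"
  shows "category (Alg (VC A) (sharp_monad A B))"
proof -
  let ?C = "Alg (VC A) (sharp_monad A B)"
  have ide: "((X, \<xi>), Ide (VC A) X, (X, \<xi>)) \<in> Ar ?C" if al: "(X, \<xi>) \<in> Ob ?C" for X \<xi>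
  proof -
    obtain p s k where a: "sact B X \<xi> p s k" by (rule algebra_point[OF B al])
    note t = point_kernel_typed[OF sactD(1-3)[OF a]]
    have h: "((p, s), Ide (UC A) (Dom (UC A) p), (p, s)) \<in> Ar (Pt (UC A) B)"
      using sactD(1)[OF a] t by (simp add: Pt_Ar_iff)
    show ?thesis
      using sact_morphism_algebra[OF a a h, of "Ide (VC A) X"] al t sactD(3)[OF a] B by (simp add: Alg_Ar)
  qed
  have cmp: "((X1, \<xi>1), g \<cdot>\<^sub>V f, (X3, \<xi>3)) \<in> Ar ?C"
    if "((X1, \<xi>1), f, (X2, \<xi>2)) \<in> Ar ?C" "((X2, \<xi>2), g, (X3, \<xi>3)) \<in> Ar ?C" for X1 \<xi>1 f X2 \<xi>2 g X3 \<xi>3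
  proof -
    have f: "(X1, \<xi>1) \<in> Ob ?C" "(X2, \<xi>2) \<in> Ob ?C" "(X3, \<xi>3) \<in> Ob ?C" "f \<in> Ar (VC A)" "Dom (VC A) f = X1" "Cod (VC A) f = X2" "f \<cdot>\<^sub>V \<xi>1 = \<xi>2 \<cdot>\<^sub>V sharp_map B f"
      "g \<in> Ar (VC A)" "Dom (VC A) g = X2" "Cod (VC A) g = X3" "g \<cdot>\<^sub>V \<xi>2 = \<xi>3 \<cdot>\<^sub>V sharp_map B g"
      using that by (simp_all add: Alg_Ar[OF B])
    obtain p1 s1 k1 where a1: "sact B X1 \<xi>1 p1 s1 k1" by (rule algebra_point[OF B f(1)])
    obtain p2 s2 k2 where a2: "sact B X2 \<xi>2 p2 s2 k2" by (rule algebra_point[OF B f(2)])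
    obtain p3 s3 k3 where a3: "sact B X3 \<xi>3 p3 s3 k3" by (rule algebra_point[OF B f(3)])
    obtain h where h: "((p1, s1), h, (p2, s2)) \<in> Ar (Pt (UC A) B)" "U1 h \<cdot>\<^sub>V k1 = k2 \<cdot>\<^sub>V f"
      by (rule algebra_morphism_point[OF a1 a2 f(4-7)])
    obtain h' where h': "((p2, s2), h', (p3, s3)) \<in> Ar (Pt (UC A) B)" "U1 h' \<cdot>\<^sub>V k2 = k3 \<cdot>\<^sub>V g"
      by (rule algebra_morphism_point[OF a2 a3 f(8-11)])
    interpret P: cat_loc "Pt (UC A) B" by unfold_locales (rule U.category_Pt)
    have hh: "((p1, s1), h' \<cdot>\<^sub>U h, (p3, s3)) \<in> Ar (Pt (UC A) B)" using P.Cmp_Ar[OF h(1) h'(1)] by simp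
    have ht: "h \<in> Ar (UC A)" "h' \<in> Ar (UC A)" "Cod (UC A) h = Dom (UC A) p2" "Dom (UC A) h' = Dom (UC A) p2" "Dom (UC A) h = Dom (UC A) p1"
       "Cod (UC A) h' = Dom (UC A) p3"
      using h h' by (simp_all add: Pt_Ar_iff)
    note t1 = point_kernel_typed[OF sactD(1-3)[OF a1]] and t2 = point_kernel_typed[OF sactD(1-3)[OF a2]] and t3 = point_kernel_typed[OF sactD(1-3)[OF a3]]
    have "U1 (h' \<cdot>\<^sub>U h) \<cdot>\<^sub>V k1 = U1 h' \<cdot>\<^sub>V (k2 \<cdot>\<^sub>V f)" using ht t1(7,8) by (simp flip: h(2))
    also have "\<dots> = k3 \<cdot>\<^sub>V (g \<cdot>\<^sub>V f)"
      by (rule V.cmp_ext[OF h'(2)]) (use ht t2(7,8) t3(7,8) f sactD(3)[OF a2] sactD(3)[OF a3] in simp_all)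
    finally have e: "U1 (h' \<cdot>\<^sub>U h) \<cdot>\<^sub>V k1 = k3 \<cdot>\<^sub>V (g \<cdot>\<^sub>V f)" .
    have gf: "g \<cdot>\<^sub>V f \<in> Ar (VC A)" "Dom (VC A) (g \<cdot>\<^sub>V f) = X1" "Cod (VC A) (g \<cdot>\<^sub>V f) = X3" using f by simp_all
    show ?thesis using sact_morphism_algebra[OF a1 a3 hh gf e] gf f(1,3) by (simp add: Alg_Ar[OF B])
  qed
  show ?thesis unfolding category_def
  proof (intro conjI ballI impI)
    fix x assume x: "x \<in> Ar ?C"
    obtain X1 \<xi>1 f X2 \<xi>2 where xe: "x = ((X1, \<xi>1), f, (X2, \<xi>2))" by (metis surj_pair)
    show "Dom ?C x \<in> Ob ?C" "Cod ?C x \<in> Ob ?C" using x by (simp_all add: xe Alg_Ar[OF B])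
    show "x \<cdot>\<^bsub>?C\<^esub> Ide ?C (Dom ?C x) = x" "Ide ?C (Cod ?C x) \<cdot>\<^bsub>?C\<^esub> x = x"
      using x by (simp_all add: xe Alg_Ar[OF B])
    fix y assume y: "y \<in> Ar ?C" and c: "Cod ?C x = Dom ?C y"
    obtain g X3 \<xi>3 where ye: "y = ((X2, \<xi>2), g, (X3, \<xi>3))" using c xe by (cases y) auto
    show "y \<cdot>\<^bsub>?C\<^esub> x \<in> Hom ?C (Dom ?C x) (Cod ?C y)"
      using cmp[OF x[unfolded xe] y[unfolded ye]] by (simp add: xe ye)
    fix z assume z: "z \<in> Ar ?C" and c: "Cod ?C y = Dom ?C z"
    obtain h X4 \<xi>4 where ze: "z = ((X3, \<xi>3), h, (X4, \<xi>4))" using c ye by (cases z) auto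
    show "z \<cdot>\<^bsub>?C\<^esub> (y \<cdot>\<^bsub>?C\<^esub> x) = (z \<cdot>\<^bsub>?C\<^esub> y) \<cdot>\<^bsub>?C\<^esub> x"
      using x y z by (simp add: xe ye ze Alg_Ar[OF B])
  next
    fix x assume "x \<in> Ob ?C"
    thus "Ide ?C x \<in> Hom ?C x x" using ide by (cases x) simp
  qed
qed

end

definition id_adj :: "('o, 'm) cat \<Rightarrow> ('o, 'm, 'o, 'm) adj" where
  "id_adj C = \<lparr>UC = C, VC = C, Ladj = id_func, Radj = id_func, Unit = Ide C, Counit = Ide C\<rparr>"

lemma id_adj_simps [simp]:
  "UC (id_adj C) = C" "VC (id_adj C) = C" "FOb (Ladj (id_adj C)) a = a" "FAr (Ladj (id_adj C)) f = f"
  "FOb (Radj (id_adj C)) a = a" "FAr (Radj (id_adj C)) f = f" "Unit (id_adj C) a = Ide C a" "Counit (id_adj C) a = Ide C a"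
  by (simp_all add: id_adj_def id_func_def)

text \<open>\<open>assoc_point\<close> does not force \<open>\<xi>\<close> to be an arrow.\<close>

definition point_action :: "('o, 'm) cat \<Rightarrow> 'o \<Rightarrow> 'o \<Rightarrow> 'm \<Rightarrow> 'm \<Rightarrow> 'm \<Rightarrow> 'm \<Rightarrow> bool" where
  "point_action C D X \<xi> p s k \<longleftrightarrow> assoc_point C D X \<xi> p s k \<and> \<xi> \<in> Ar C \<and> Dom C \<xi> = flat_ob C D X \<and> Cod C \<xi> = X"

context semi_loc
begin

lemma id_adj_ctx: "adj_ctx (id_adj C)"
proof unfold_locales
  have F: "functor C C id_func" using cat by (simp add: functor_def id_func_def)
  show "adjunction (id_adj C)"
    using F by (simp add: adjunction_def nat_trans_def id_adj_def comp_func_def id_func_def functor_def)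
qed (simp_all add: cat fc pm be cop ptd)

lemma id_adj_pre: "adj_pre (id_adj C)"
  by (rule adj_ctx0.axioms(1)[OF adj_ctx.axioms(1)[OF id_adj_ctx]])

text \<open>An equality and not just an isomorphism: for the identity adjunction both sides unfold
  to \<open>ker\<close> of the same arrow, so the same kernel is chosen.\<close>

lemma flat_kappa_sharp: "flat_kappa C D X = sharp_kappa (id_adj C) D X"
  by (simp add: flat_kappa_def sharp_kappa_def sharp_point_def iota_def F0_def from_zero_def zero_arrow_def)

lemma flat_kappa_kernel:
  assumes "D \<in> Ob C" "X \<in> Ob C"
  shows "is_kernel C (cotuple C (Ide C D) (zero_arrow C X D)) (flat_kappa C D X)"
  unfolding flat_kappa_def by (rule ker_kernel) (use assms in simp)

lemma flat_kappa_simps [simp]: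
  assumes "D \<in> Ob C" "X \<in> Ob C"
  shows "flat_kappa C D X \<in> Ar C" "Cod C (flat_kappa C D X) = Cod C (inj1 C D X)" "Dom C (flat_kappa C D X) = flat_ob C D X"
    "cotuple C (Ide C D) (zero_arrow C X D) \<cdot> flat_kappa C D X = zero_arrow C (flat_ob C D X) D"
  using kernelD[OF flat_kappa_kernel[OF assms]] assms by (simp_all add: flat_ob_def)

lemma flat_ob_Ob [simp]: "\<lbrakk>D \<in> Ob C; X \<in> Ob C\<rbrakk> \<Longrightarrow> flat_ob C D X \<in> Ob C"
  by (metis flat_kappa_simps(1) Dom_Ob flat_ob_def)

lemma Alg_flat:
  assumes D: "D \<in> Ob C"
  shows "Alg C (flat_monad C D) = Alg C (sharp_monad (id_adj C) D)"
proof -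
  interpret I: adj_ctx "id_adj C" by (rule id_adj_ctx)
  show ?thesis
  proof (rule Alg_cong)
    fix X assume X: "X \<in> Ob C"
    have q: "flat_kappa C D X \<in> Ar C" "Cod C (flat_kappa C D X) = Cod C (inj1 C D X)" using D X by simp_all
    show "FOb (MFun (flat_monad C D)) X = FOb (MFun (sharp_monad (id_adj C) D)) X"
      using D X by (simp add: I.sharp_monad_simps flat_monad_def flat_ob_def flat_kappa_sharp)
    show "MUnit (flat_monad C D) X = MUnit (sharp_monad (id_adj C) D) X"
      using D X by (simp add: I.sharp_monad_simps flat_monad_def I.sharp_unit_def flat_kappa_sharp)
    show "MMult (flat_monad C D) X = MMult (sharp_monad (id_adj C) D) X"
      using D X q by (simp add: I.sharp_monad_simps flat_monad_def I.sharp_mult_def I.adjunct_def flat_kappa_sharp flat_ob_def)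
  next
    fix f assume f: "f \<in> Ar C"
    show "FAr (MFun (flat_monad C D)) f = FAr (MFun (sharp_monad (id_adj C) D)) f"
      using D f by (simp add: I.sharp_monad_simps flat_monad_def I.sharp_map_def flat_map_def flat_kappa_sharp)
  qed
qed

lemma category_Alg_flat: "D \<in> Ob C \<Longrightarrow> category (Alg C (flat_monad C D))"
  using adj_ctx.category_Alg[OF id_adj_ctx, of D] by (simp add: Alg_flat)

lemma point_action_sact:
  shows "point_action C D X \<xi> p s k \<longleftrightarrow> adj_pre.sact (id_adj C) D X \<xi> p s k"
proof -
  interpret I: adj_ctx "id_adj C" by (rule id_adj_ctx)
  have "I.adjunct (Dom C p) k = k" if "is_kernel C p k"
    using kernelD[OF that] by (simp add: I.adjunct_def)
  thus ?thesis
    by (auto simp: point_action_def I.sact_def assoc_point_def flat_ob_def flat_kappa_sharp)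
qed

lemma point_actionD:
  assumes "point_action C D X \<xi> p s k"
  shows "(p, s) \<in> Ob (Pt C D)" "is_kernel C p k" "Dom C k = X" "\<xi> \<in> Ar C" "Dom C \<xi> = flat_ob C D X"
    "Cod C \<xi> = X" "k \<cdot> \<xi> = cotuple C s k \<cdot> flat_kappa C D X"
  using assms by (auto simp: point_action_def assoc_point_def)

lemma point_actionI:
  assumes "(p, s) \<in> Ob (Pt C D)" "is_kernel C p k" "Dom C k = X" "\<xi> \<in> Ar C" "Dom C \<xi> = flat_ob C D X"
    "Cod C \<xi> = X" "k \<cdot> \<xi> = cotuple C s k \<cdot> flat_kappa C D X"
  shows "point_action C D X \<xi> p s k"
  using assms by (auto simp: point_action_def assoc_point_def)

lemma point_action_typed:
  assumes "point_action C D X \<xi> p s k"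
  shows "p \<in> Ar C" "Cod C p = D" "s \<in> Ar C" "Dom C s = D" "Cod C s = Dom C p"
    "p \<cdot> s = Ide C D" "k \<in> Ar C" "Cod C k = Dom C p" "p \<cdot> k = zero_arrow C X D"
    "D \<in> Ob C" "X \<in> Ob C" "Dom C p \<in> Ob C"
  using adj_pre.point_kernel_typed[OF id_adj_pre, of p s D k X] point_actionD[OF assms] by simp_all

lemma point_action_ex:
  assumes "(p, s) \<in> Ob (Pt C D)" "is_kernel C p k" "Dom C k = X"
  obtains \<xi> where "point_action C D X \<xi> p s k"
  using adj_pre.sact_ex[OF id_adj_pre, of p s D k X] assms by (auto simp: point_action_sact)

lemma point_action_unique: "point_action C D X \<xi> p s k \<Longrightarrow> point_action C D X \<xi>' p s k \<Longrightarrow> \<xi> = \<xi>'"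
  using adj_pre.sact_unique[OF id_adj_pre, of D X \<xi> p s k \<xi>'] by (simp add: point_action_sact)

lemma point_action_algebra: "point_action C D X \<xi> p s k \<Longrightarrow> (X, \<xi>) \<in> Ob (Alg C (flat_monad C D))"
  using adj_pre.sact_algebra[OF id_adj_pre, of D X \<xi> p s k] point_action_typed(10)[of D X \<xi> p s k]
  by (simp add: point_action_sact Alg_flat)

lemma action_point:
  assumes "D \<in> Ob C" "(X, \<xi>) \<in> Ob (Alg C (flat_monad C D))"
  obtains p s k where "point_action C D X \<xi> p s k"
  using adj_ctx.algebra_point[OF id_adj_ctx, of D X \<xi>] assms by (auto simp: point_action_sact Alg_flat)

lemma point_morphism_action:
  assumes a: "point_action C D X1 \<xi>1 p1 s1 k1" and b: "point_action C D X2 \<xi>2 p2 s2 k2"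
    and h: "((p1, s1), h, (p2, s2)) \<in> Ar (Pt C D)"
    and f: "f \<in> Ar C" "Dom C f = X1" "Cod C f = X2" and e: "h \<cdot> k1 = k2 \<cdot> f"
  shows "((X1, \<xi>1), f, (X2, \<xi>2)) \<in> Ar (Alg C (flat_monad C D))"
proof -
  interpret I: adj_ctx "id_adj C" by (rule id_adj_ctx)
  have D: "D \<in> Ob C" by (rule point_action_typed(10)[OF a])
  have 1: "f \<cdot> \<xi>1 = \<xi>2 \<cdot> I.sharp_map D f"
    using I.sact_morphism_algebra[OF a[unfolded point_action_sact] b[unfolded point_action_sact], of h f] h f e by simp
  show ?thesis unfolding Alg_flat[OF D] using I.Alg_Ar[of D X1 \<xi>1 f X2 \<xi>2] D f 1
    point_action_algebra[OF a, unfolded Alg_flat[OF D]] point_action_algebra[OF b, unfolded Alg_flat[OF D]] by simp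
qed

lemma action_morphism_point:
  assumes a: "point_action C D X1 \<xi>1 p1 s1 k1" and b: "point_action C D X2 \<xi>2 p2 s2 k2"
    and f: "((X1, \<xi>1), f, (X2, \<xi>2)) \<in> Ar (Alg C (flat_monad C D))"
  obtains h where "((p1, s1), h, (p2, s2)) \<in> Ar (Pt C D)" "h \<cdot> k1 = k2 \<cdot> f"
proof -
  interpret I: adj_ctx "id_adj C" by (rule id_adj_ctx)
  have D: "D \<in> Ob C" by (rule point_action_typed(10)[OF a])
  have f': "f \<in> Ar C" "Dom C f = X1" "Cod C f = X2" "f \<cdot> \<xi>1 = \<xi>2 \<cdot> I.sharp_map D f"
    using f[unfolded Alg_flat[OF D]] I.Alg_Ar[of D X1 \<xi>1 f X2 \<xi>2] D by simp_all
  obtain h where "((p1, s1), h, (p2, s2)) \<in> Ar (Pt (UC (id_adj C)) D)" "h \<cdot>\<^bsub>VC (id_adj C)\<^esub> k1 = k2 \<cdot>\<^bsub>VC (id_adj C)\<^esub> f"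
    using I.algebra_morphism_point[OF a[unfolded point_action_sact] b[unfolded point_action_sact], unfolded id_adj_simps, OF f']
    unfolding id_adj_simps by blast
  thus thesis using that by simp
qed

lemma flat_Alg_Ar_typed:
  assumes D: "D \<in> Ob C" and f: "((X1, \<xi>1), f, (X2, \<xi>2)) \<in> Ar (Alg C (flat_monad C D))"
  shows "f \<in> Ar C" "Dom C f = X1" "Cod C f = X2" "(X1, \<xi>1) \<in> Ob (Alg C (flat_monad C D))" "(X2, \<xi>2) \<in> Ob (Alg C (flat_monad C D))"
  using f by (auto simp: Alg_def Let_def)

lemma flat_Alg_Ob_typed:
  assumes "(X, \<xi>) \<in> Ob (Alg C (flat_monad C D))"
  shows "X \<in> Ob C" "\<xi> \<in> Ar C" "Dom C \<xi> = flat_ob C D X" "Cod C \<xi> = X"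
  using assms by (auto simp: Alg_def Let_def flat_monad_def)

lemma flat_map_simps [simp]:
  assumes g: "g \<in> Ar C" "Dom C g = E" "Cod C g = D" and X: "X \<in> Ob C"
  shows "flat_map C g (Ide C X) \<in> Ar C" "Dom C (flat_map C g (Ide C X)) = flat_ob C E X"
    "Cod C (flat_map C g (Ide C X)) = flat_ob C D X"
    "flat_kappa C D X \<cdot> flat_map C g (Ide C X) = coprod_map C g (Ide C X) \<cdot> flat_kappa C E X"
proof -
  have ob: "E \<in> Ob C" "D \<in> Ob C" using g by auto
  have c: "cotuple C (Ide C D) (zero_arrow C X D) \<cdot> coprod_map C g (Ide C X) = g \<cdot> cotuple C (Ide C E) (zero_arrow C X E)"
    using g X ob by simp
  have "cotuple C (Ide C D) (zero_arrow C X D) \<cdot> (coprod_map C g (Ide C X) \<cdot> flat_kappa C E X) =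
      g \<cdot> (cotuple C (Ide C E) (zero_arrow C X E) \<cdot> flat_kappa C E X)"
    by (rule cmp_ext[OF c]) (use g X ob in \<open>simp_all del: cotuple_comp\<close>)
  hence "annihilated C (cotuple C (Ide C D) (zero_arrow C X D)) (coprod_map C g (Ide C X) \<cdot> flat_kappa C E X)"
    by (intro annihilatedI) (use g X ob in simp_all)
  from factor_kernel[OF flat_kappa_kernel[OF ob(2) X] this] g X ob
  show "flat_map C g (Ide C X) \<in> Ar C" "Dom C (flat_map C g (Ide C X)) = flat_ob C E X"
    "Cod C (flat_map C g (Ide C X)) = flat_ob C D X"
    "flat_kappa C D X \<cdot> flat_map C g (Ide C X) = coprod_map C g (Ide C X) \<cdot> flat_kappa C E X"
    by (simp_all add: flat_map_def)
qed

text \<open>Base change of points is restriction of actions. The defining equation of the restricted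
  action is tested on the two projections: \<open>r\<close> makes both sides zero, and
  \<open>q\<close> reduces it to the equation for \<open>\<xi>\<close>.\<close>

lemma point_action_base_change:
  assumes a: "point_action C D X \<xi> p s k" and pb: "is_pullback C g p r q" and E: "Dom C g = E"
    and z: "z \<in> Ar C" "Dom C z = E" "Cod C z = Dom C r" "r \<cdot> z = Ide C E" "q \<cdot> z = s \<cdot> g"
    and k': "is_kernel C r k'" "Dom C k' = X" "q \<cdot> k' = k"
  shows "point_action C E X (\<xi> \<cdot> flat_map C g (Ide C X)) r z k'"
proof (rule point_actionI)
  note a' = point_actionD[OF a] and t = point_action_typed[OF a] and T = pb_typed[OF pb] and kt = kernelD[OF k'(1)]
  have g: "g \<in> Ar C" "Dom C g = E" "Cod C g = D" and Eo: "E \<in> Ob C" using T t E by auto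
  have r: "r \<in> Ar C" "Cod C r = E" "q \<in> Ar C" "Dom C q = Dom C r" "Cod C q = Dom C p" using T g by simp_all
  have k't: "k' \<in> Ar C" "Cod C k' = Dom C r" "r \<cdot> k' = zero_arrow C X E" using kt k' r by simp_all
  note fl = flat_map_simps[OF g t(11)]
  show "(r, z) \<in> Ob (Pt C E)" using r z by (simp add: Pt_Ob_iff)
  show "k' \<cdot> (\<xi> \<cdot> flat_map C g (Ide C X)) = cotuple C z k' \<cdot> flat_kappa C E X"
  proof (rule pb_uniq[OF pb])
    have "r \<cdot> (k' \<cdot> (\<xi> \<cdot> flat_map C g (Ide C X))) = zero_arrow C X E \<cdot> (\<xi> \<cdot> flat_map C g (Ide C X))"
      by (rule cmp_ext1[OF k't(3)]) (use r k't k'(2) a'(4-6) fl in simp_all)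
    also have "\<dots> = zero_arrow C (flat_ob C E X) E" using a'(4-6) fl Eo t(10,11) by simp
    also have "\<dots> = (r \<cdot> cotuple C z k') \<cdot> flat_kappa C E X" using r z k't k'(2) Eo t(11) by simp
    also have "\<dots> = r \<cdot> (cotuple C z k' \<cdot> flat_kappa C E X)" using r z(1-3) k't k'(2) Eo t(11) by (simp del: cotuple_comp)
    finally show "r \<cdot> (k' \<cdot> (\<xi> \<cdot> flat_map C g (Ide C X))) = r \<cdot> (cotuple C z k' \<cdot> flat_kappa C E X)" .
    have "q \<cdot> (k' \<cdot> (\<xi> \<cdot> flat_map C g (Ide C X))) = k \<cdot> (\<xi> \<cdot> flat_map C g (Ide C X))"
      by (rule cmp_ext1[OF k'(3)]) (use r k't k'(2) a'(4-6) fl in simp_all)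
    also have "\<dots> = cotuple C s k \<cdot> (flat_kappa C D X \<cdot> flat_map C g (Ide C X))"
      by (rule cmp_ext[OF a'(7)]) (use a'(3-6) fl(1-3) t(1-5,7,8,10-12) in simp_all)
    also have "\<dots> = (cotuple C s k \<cdot> coprod_map C g (Ide C X)) \<cdot> flat_kappa C E X"
      unfolding fl(4) using a'(3) g t(1-5,7,8,10-12) Eo by (simp del: cotuple_coprod_map)
    also have "\<dots> = (q \<cdot> cotuple C z k') \<cdot> flat_kappa C E X"
      using a'(3) g t(1-5,7,8,10-12) r z k't(1,2) k'(2,3) Eo by simp
    also have "\<dots> = q \<cdot> (cotuple C z k' \<cdot> flat_kappa C E X)" using r z(1-3) k't k'(2) Eo t(11) by (simp del: cotuple_comp)
    finally show "q \<cdot> (k' \<cdot> (\<xi> \<cdot> flat_map C g (Ide C X))) = q \<cdot> (cotuple C z k' \<cdot> flat_kappa C E X)" .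
  qed (use r z(1-3) k't k'(2) a'(4-6) fl(1-3) Eo t(10,11) in simp_all)
  show "\<xi> \<cdot> flat_map C g (Ide C X) \<in> Ar C" "Dom C (\<xi> \<cdot> flat_map C g (Ide C X)) = flat_ob C E X" "Cod C (\<xi> \<cdot> flat_map C g (Ide C X)) = X"
    using a'(4-6) fl(1-3) by simp_all
qed (use k' in simp_all)

text \<open>Only the kernel moves along \<open>h\<close>, the action stays. This is what lets strict
  equations between actions follow from points known up to isomorphism.\<close>

lemma point_action_iso:
  assumes a: "point_action C D X \<xi> p s k" and h: "((p, s), h, (q, t)) \<in> Ar (Pt C D)" "iso C h"
  shows "point_action C D X \<xi> q t (h \<cdot> k)"
proof (rule point_actionI)
  note a' = point_actionD[OF a] and u = point_action_typed[OF a]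
  have ht: "h \<in> Ar C" "Dom C h = Dom C p" "Cod C h = Dom C q" "q \<cdot> h = p" "h \<cdot> s = t" "(q, t) \<in> Ob (Pt C D)" "q \<in> Ar C"
    using h(1) by (simp_all add: Pt_Ar_iff Pt_Ob_iff)
  obtain h' where i: "inverse_arrows C h h'" using h(2) by (rule isoE)
  show "is_kernel C q (h \<cdot> k)" by (rule kernel_iso[OF a'(2) i]) (use ht in simp_all)
  show "(q, t) \<in> Ob (Pt C D)" by (rule ht)
  have "(h \<cdot> k) \<cdot> \<xi> = h \<cdot> (k \<cdot> \<xi>)" using ht u a' by simp
  also have "\<dots> = (h \<cdot> cotuple C s k) \<cdot> flat_kappa C D X" unfolding a'(7) using ht(1-3) u a'(3) by (simp del: cotuple_comp)
  also have "\<dots> = cotuple C t (h \<cdot> k) \<cdot> flat_kappa C D X" using ht u a'(3) by simp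
  finally show "(h \<cdot> k) \<cdot> \<xi> = cotuple C t (h \<cdot> k) \<cdot> flat_kappa C D X" .
  show "Dom C (h \<cdot> k) = X" using ht u a'(3) by simp
qed (use point_actionD[OF a] in simp_all)

end

section \<open>Equivalences of categories and cartesian units\<close>

locale functor_loc = C: cat_loc C + D: cat_loc D for C :: "('o1, 'm1) cat" and D :: "('o2, 'm2) cat" +
  fixes F :: "('o1, 'm1, 'o2, 'm2) func"
  assumes F: "functor C D F"
begin

lemma F_simps [simp]:
  "f \<in> Ar C \<Longrightarrow> FAr F f \<in> Ar D"
  "f \<in> Ar C \<Longrightarrow> Dom D (FAr F f) = FOb F (Dom C f)"
  "f \<in> Ar C \<Longrightarrow> Cod D (FAr F f) = FOb F (Cod C f)"
  "a \<in> Ob C \<Longrightarrow> FOb F a \<in> Ob D"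
  "a \<in> Ob C \<Longrightarrow> FAr F (Ide C a) = Ide D (FOb F a)"
  "\<lbrakk>f \<in> Ar C; g \<in> Ar C; Cod C f = Dom C g\<rbrakk> \<Longrightarrow> FAr F (g \<cdot>\<^bsub>C\<^esub> f) = FAr F g \<cdot>\<^bsub>D\<^esub> FAr F f"
  using F by (auto simp: functor_def)

lemma F_iso: "iso C f \<Longrightarrow> iso D (FAr F f)"
proof -
  assume "iso C f"
  then obtain g where i: "inverse_arrows C f g" by (rule C.isoE)
  note i' = C.invD[OF i]
  have "FAr F g \<cdot>\<^bsub>D\<^esub> FAr F f = FAr F (g \<cdot>\<^bsub>C\<^esub> f)" "FAr F f \<cdot>\<^bsub>D\<^esub> FAr F g = FAr F (f \<cdot>\<^bsub>C\<^esub> g)" using i'(1-4) by simp_all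
  thus "iso D (FAr F f)"
    by (intro D.isoI[of _ "FOb F (Dom C f)" "FOb F (Cod C f)" "FAr F g"]) (use i'(1-6) in simp_all)
qed

end

lemma functor_loc: "functor C D F \<Longrightarrow> functor_loc C D F"
  by unfold_locales (auto simp: functor_def)

lemma nat_isoD:
  assumes "nat_iso C D F G \<alpha>"
  shows "functor C D F" "functor C D G"
    "a \<in> Ob C \<Longrightarrow> \<alpha> a \<in> Ar D" "a \<in> Ob C \<Longrightarrow> Dom D (\<alpha> a) = FOb F a" "a \<in> Ob C \<Longrightarrow> Cod D (\<alpha> a) = FOb G a"
    "f \<in> Ar C \<Longrightarrow> \<alpha> (Cod C f) \<cdot>\<^bsub>D\<^esub> FAr F f = FAr G f \<cdot>\<^bsub>D\<^esub> \<alpha> (Dom C f)" "a \<in> Ob C \<Longrightarrow> iso D (\<alpha> a)"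
  using assms by (auto simp: nat_iso_def nat_trans_def)

lemma id_func_simps [simp]: "FOb id_func a = a" "FAr id_func f = f"
  by (simp_all add: id_func_def)

lemma comp_func_simps [simp]: "FOb (G \<circ>\<^sub>F F) a = FOb G (FOb F a)" "FAr (G \<circ>\<^sub>F F) f = FAr G (FAr F f)"
  by (simp_all add: comp_func_def)

context cat_loc
begin

lemma iso_cancel_left:
  assumes "iso C i" "f \<in> Ar C" "Cod C f = Dom C i" "iso C (i \<cdot> f)"
  shows "iso C f"
proof -
  obtain j where ij: "inverse_arrows C i j" using assms(1) by (rule isoE)
  note j = invD[OF ij]
  have "iso C (j \<cdot> (i \<cdot> f))" by (rule iso_comp[OF assms(4) inverse_arrows_iso(2)[OF ij]]) (use assms j in simp)
  thus ?thesis using j(7)[of f] assms by simp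
qed

lemma iso_epi:
  assumes "iso C i" "x \<in> Ar C" "y \<in> Ar C" "Dom C x = Cod C i" "Dom C y = Cod C i" "x \<cdot> i = y \<cdot> i"
  shows "x = y"
proof -
  obtain j where ij: "inverse_arrows C i j" using assms(1) by (rule isoE)
  note j = invD[OF ij]
  have "x \<cdot> (i \<cdot> j) = y \<cdot> (i \<cdot> j)" by (rule cmp_ext[OF assms(6)]) (use j(1-4) assms in simp_all)
  thus ?thesis using j(6) assms by simp
qed

text \<open>If \<open>e\<close> coequalizes \<open>u\<close>, \<open>v\<close> and \<open>z\<close>
  inverts \<open>w\<close>, then \<open>e w\<close> is a coequalizer of \<open>z u\<close> and
  \<open>z v\<close>.\<close>

lemma regular_epi_iso:
  assumes e: "regular_epi C e" and w: "iso C w" "Cod C w = Dom C e"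
  shows "regular_epi C (e \<cdot> w)"
proof -
  from e obtain u v where c: "is_coequalizer C u v e" by (auto simp: regular_epi_def)
  define Q where "Q = Dom C e"
  have t: "u \<in> Ar C" "v \<in> Ar C" "Dom C v = Dom C u" "Cod C u = Q" "e \<in> Ar C" "Dom C e = Q" "e \<cdot> u = e \<cdot> v" "Cod C v = Q"
    and wQ: "Cod C w = Q"
    using coeqD[OF c] w by (simp_all add: Q_def)
  obtain z where wz: "inverse_arrows C w z" using w(1) by (rule isoE)
  note z = invD[OF wz]
  note uv = t(8) wQ
  have "\<exists>!h. h \<in> Hom C (Cod C (e \<cdot> w)) (Cod C x) \<and> h \<cdot> (e \<cdot> w) = x"
    if x: "x \<in> Ar C" "Dom C x = Cod C (z \<cdot> u)" "x \<cdot> (z \<cdot> u) = x \<cdot> (z \<cdot> v)" for x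
  proof (rule ex_ex1I)
    have xd: "Dom C x = Dom C w" using x(2) z(1-4) t(1-6) uv by simp
    have "(x \<cdot> z) \<cdot> u = (x \<cdot> z) \<cdot> v" using x(1,3) xd z(1-4) t(1-6) uv by simp
    moreover have "x \<cdot> z \<in> Ar C" "Dom C (x \<cdot> z) = Cod C u" "Cod C (x \<cdot> z) = Cod C x" using x(1) xd z(1-4) uv t(4) by simp_all
    ultimately obtain h where h: "h \<in> Ar C" "Dom C h = Cod C e" "Cod C h = Cod C x" and he: "h \<cdot> e = x \<cdot> z"
      using coeq_univ[OF c, of "x \<cdot> z"] by metis
    have "h \<cdot> (e \<cdot> w) = x \<cdot> (z \<cdot> w)" by (rule cmp_ext[OF he]) (use h z(1-4) t(5,6) wQ x(1) xd in simp_all)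
    hence "h \<cdot> (e \<cdot> w) = x" using z(5) x(1) xd by simp
    thus "\<exists>h. h \<in> Hom C (Cod C (e \<cdot> w)) (Cod C x) \<and> h \<cdot> (e \<cdot> w) = x" using h z(1) t(5,6) wQ by auto
  next
    fix h h' assume h: "h \<in> Hom C (Cod C (e \<cdot> w)) (Cod C x) \<and> h \<cdot> (e \<cdot> w) = x" "h' \<in> Hom C (Cod C (e \<cdot> w)) (Cod C x) \<and> h' \<cdot> (e \<cdot> w) = x"
    have ht: "h \<in> Ar C" "Dom C h = Cod C e" "h' \<in> Ar C" "Dom C h' = Cod C e" using h z(1) t(5,6) wQ by simp_all
    have "(h \<cdot> e) \<cdot> w = (h' \<cdot> e) \<cdot> w" using h ht t(5,6) z(1) wQ by simp
    hence 1: "h \<cdot> e = h' \<cdot> e" using ht t(5,6) wQ by (intro iso_epi[OF w(1), of "h \<cdot> e" "h' \<cdot> e"]) simp_all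
    show "h = h'" by (rule regular_epi_cancel[OF e ht(1,3,2,4) 1])
  qed
  moreover have "(e \<cdot> w) \<cdot> (z \<cdot> u) = (e \<cdot> w) \<cdot> (z \<cdot> v)"
    using z(1-4,8) t uv wQ by simp
  ultimately have "is_coequalizer C (z \<cdot> u) (z \<cdot> v) (e \<cdot> w)"
    unfolding is_coequalizer_def using z(1-4) t(1-6) uv wQ by simp
  thus ?thesis by (auto simp: regular_epi_def)
qed

end

section \<open>Equivalences as full, faithful and essentially surjective functors\<close>

lemma equivalenceE:
  assumes "equivalence_of_cats C D F"
  obtains G \<alpha> \<beta> where "functor_loc C D F" "functor_loc D C G" "nat_iso C C id_func (G \<circ>\<^sub>F F) \<alpha>" "nat_iso D D (F \<circ>\<^sub>F G) id_func \<beta>"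
  using assms functor_loc unfolding equivalence_of_cats_def by metis

lemma equivalence_faithful:
  assumes E: "equivalence_of_cats C D F" and f: "f \<in> Ar C" "g \<in> Ar C" "Dom C f = Dom C g" "Cod C f = Cod C g"
    and e: "FAr F f = FAr F g"
  shows "f = g"
proof -
  obtain G \<alpha> \<beta> where l: "functor_loc C D F" "functor_loc D C G" and a: "nat_iso C C id_func (G \<circ>\<^sub>F F) \<alpha>"
    by (rule equivalenceE[OF E])
  interpret F: functor_loc C D F by (rule l)
  note a' = nat_isoD[OF a]
  have "\<alpha> (Cod C g) \<cdot>\<^bsub>C\<^esub> f = \<alpha> (Cod C g) \<cdot>\<^bsub>C\<^esub> g"
    using a'(6)[OF f(1)] a'(6)[OF f(2)] f(3,4) e by simp
  thus ?thesis using f a'(3-5)[of "Cod C g"] a'(7)[of "Cod C g"]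
    by (intro F.C.monicD[OF F.C.iso_monic, of "\<alpha> (Cod C g)" f g]) simp_all
qed

lemma equivalence_reflects_iso:
  assumes E: "equivalence_of_cats C D F" and f: "f \<in> Ar C" and i: "iso D (FAr F f)"
  shows "iso C f"
proof -
  obtain G \<alpha> \<beta> where l: "functor_loc C D F" "functor_loc D C G" and a: "nat_iso C C id_func (G \<circ>\<^sub>F F) \<alpha>"
    by (rule equivalenceE[OF E])
  interpret F: functor_loc C D F by (rule l)
  interpret G: functor_loc D C G by (rule l)
  note a' = nat_isoD[OF a]
  have "iso C (FAr G (FAr F f) \<cdot>\<^bsub>C\<^esub> \<alpha> (Dom C f))"
    by (rule F.C.iso_comp) (use a'(5,7)[of "Dom C f"] G.F_iso[OF i] f in simp_all)
  hence 1: "iso C (\<alpha> (Cod C f) \<cdot>\<^bsub>C\<^esub> f)" using a'(6)[OF f] by simp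
  show ?thesis by (rule F.C.iso_cancel_left[OF _ f _ 1]) (use f a'(4,7)[of "Cod C f"] in simp_all)
qed

lemma equivalence_full:
  assumes E: "equivalence_of_cats C D F" and ab: "a \<in> Ob C" "b \<in> Ob C" and h: "h \<in> Ar D" "Dom D h = FOb F a" "Cod D h = FOb F b"
  obtains f where "f \<in> Ar C" "Dom C f = a" "Cod C f = b" "FAr F f = h"
proof -
  obtain G \<alpha> \<beta> where l: "functor_loc C D F" "functor_loc D C G" and a: "nat_iso C C id_func (G \<circ>\<^sub>F F) \<alpha>"
    and b: "nat_iso D D (F \<circ>\<^sub>F G) id_func \<beta>"
    by (rule equivalenceE[OF E])
  interpret F: functor_loc C D F by (rule l)
  interpret G: functor_loc D C G by (rule l)
  note a' = nat_isoD[OF a] and b' = nat_isoD[OF b]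
  obtain c where c: "inverse_arrows C (\<alpha> b) c" using a'(7)[OF ab(2)] by (rule F.C.isoE)
  note c' = F.C.invD[OF c]
  define f where "f = c \<cdot>\<^bsub>C\<^esub> (FAr G h \<cdot>\<^bsub>C\<^esub> \<alpha> a)"
  have f: "f \<in> Ar C" "Dom C f = a" "Cod C f = b" using ab h c' a'(3-5)[OF ab(1)] a'(3-5)[OF ab(2)] by (simp_all add: f_def)
  have "\<alpha> b \<cdot>\<^bsub>C\<^esub> f = FAr G h \<cdot>\<^bsub>C\<^esub> \<alpha> a" unfolding f_def
    using c'(8)[of "FAr G h \<cdot>\<^bsub>C\<^esub> \<alpha> a"] ab h c'(1) a'(3-5)[OF ab(1)] a'(3-5)[OF ab(2)] by simp
  hence 1: "FAr G (FAr F f) \<cdot>\<^bsub>C\<^esub> \<alpha> a = FAr G h \<cdot>\<^bsub>C\<^esub> \<alpha> a" using a'(6)[OF f(1)] f by simp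
  have 2: "FAr G (FAr F f) = FAr G h"
    by (rule F.C.iso_epi[OF a'(7)[OF ab(1)] _ _ _ _ 1]) (use f h a'(5)[OF ab(1)] in simp_all)
  have Fa: "FOb F a \<in> Ob D" "FOb F b \<in> Ob D" using ab by simp_all
  have "h \<cdot>\<^bsub>D\<^esub> \<beta> (FOb F a) = FAr F f \<cdot>\<^bsub>D\<^esub> \<beta> (FOb F a)"
    using b'(6)[OF h(1)] b'(6)[of "FAr F f"] 2 f h by simp
  hence "FAr F f = h" using h f b'(5)[OF Fa(1)] by (intro F.D.iso_epi[OF b'(7)[OF Fa(1)], of "FAr F f" h]) simp_all
  thus thesis using that f by blast
qed

lemma equivalence_ess_surj:
  assumes E: "equivalence_of_cats C D F" and d: "d \<in> Ob D"
  obtains c \<theta> where "c \<in> Ob C" "iso D \<theta>" "Dom D \<theta> = FOb F c" "Cod D \<theta> = d"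
proof -
  obtain G \<alpha> \<beta> where l: "functor_loc C D F" "functor_loc D C G" and b: "nat_iso D D (F \<circ>\<^sub>F G) id_func \<beta>"
    by (rule equivalenceE[OF E])
  interpret G: functor_loc D C G by (rule l)
  show thesis by (rule that[of "FOb G d" "\<beta> d"]) (use nat_isoD[OF b] d in simp_all)
qed

text \<open>The quasi-inverse is obtained by choice: an object goes to a preimage up to the
  isomorphism \<open>\<beta>\<close>, an arrow to the preimage of its conjugate by
  \<open>\<beta>\<close>. Its laws and the naturality of \<open>\<alpha>\<close> are checked after
  the faithful \<open>F\<close>.\<close>

lemma equivalenceI:
  assumes F: "functor C D F"
    and faithful: "\<And>f g. \<lbrakk>f \<in> Ar C; g \<in> Ar C; Dom C f = Dom C g; Cod C f = Cod C g; FAr F f = FAr F g\<rbrakk> \<Longrightarrow> f = g"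
    and full: "\<And>a b h. \<lbrakk>a \<in> Ob C; b \<in> Ob C; h \<in> Ar D; Dom D h = FOb F a; Cod D h = FOb F b\<rbrakk> \<Longrightarrow>
      \<exists>f. f \<in> Ar C \<and> Dom C f = a \<and> Cod C f = b \<and> FAr F f = h"
    and surj: "\<And>d. d \<in> Ob D \<Longrightarrow> \<exists>c \<theta>. c \<in> Ob C \<and> iso D \<theta> \<and> Dom D \<theta> = FOb F c \<and> Cod D \<theta> = d"
  shows "equivalence_of_cats C D F"
proof -
  interpret F: functor_loc C D F by (rule functor_loc[OF F])
  obtain G0 \<beta> where G0: "\<And>d. d \<in> Ob D \<Longrightarrow> G0 d \<in> Ob C" "\<And>d. d \<in> Ob D \<Longrightarrow> iso D (\<beta> d)"
    "\<And>d. d \<in> Ob D \<Longrightarrow> Dom D (\<beta> d) = FOb F (G0 d)" "\<And>d. d \<in> Ob D \<Longrightarrow> Cod D (\<beta> d) = d"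
    using surj by metis
  have bA: "\<beta> d \<in> Ar D" if "d \<in> Ob D" for d using F.D.iso_Ar G0(2) that by simp
  have "\<exists>b'. \<forall>d\<in>Ob D. inverse_arrows D (\<beta> d) (b' d)"
    by (rule bchoice) (use G0(2) F.D.isoE in metis)
  then obtain b' where b': "\<And>d. d \<in> Ob D \<Longrightarrow> inverse_arrows D (\<beta> d) (b' d)" by blast
  have b't: "b' d \<in> Ar D" "Dom D (b' d) = d" "Cod D (b' d) = FOb F (G0 d)" "b' d \<cdot>\<^bsub>D\<^esub> \<beta> d = Ide D (FOb F (G0 d))" "\<beta> d \<cdot>\<^bsub>D\<^esub> b' d = Ide D d" "iso D (b' d)"
    if "d \<in> Ob D" for d using F.D.invD(1-6)[OF b'[OF that]] G0 that F.D.inverse_arrows_iso(2)[OF b'[OF that]] by simp_all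
  have bext: "\<beta> d \<cdot>\<^bsub>D\<^esub> (b' d \<cdot>\<^bsub>D\<^esub> x) = x" if "d \<in> Ob D" "x \<in> Ar D" "Cod D x = d" for d x
    using F.D.invD(8)[OF b'[OF that(1)]] G0 that by simp
  have b'ext: "b' d \<cdot>\<^bsub>D\<^esub> (\<beta> d \<cdot>\<^bsub>D\<^esub> x) = x" if "d \<in> Ob D" "x \<in> Ar D" "Cod D x = FOb F (G0 d)" for d x
    using F.D.invD(7)[OF b'[OF that(1)]] G0 that by simp
  have "\<exists>g. \<forall>h\<in>Ar D. g h \<in> Ar C \<and> Dom C (g h) = G0 (Dom D h) \<and> Cod C (g h) = G0 (Cod D h) \<and>
      FAr F (g h) = b' (Cod D h) \<cdot>\<^bsub>D\<^esub> (h \<cdot>\<^bsub>D\<^esub> \<beta> (Dom D h))"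
  proof (rule bchoice, rule ballI)
    fix h assume h: "h \<in> Ar D"
    have "Dom D h \<in> Ob D" "Cod D h \<in> Ob D" using h by simp_all
    thus "\<exists>f. f \<in> Ar C \<and> Dom C f = G0 (Dom D h) \<and> Cod C f = G0 (Cod D h) \<and> FAr F f = b' (Cod D h) \<cdot>\<^bsub>D\<^esub> (h \<cdot>\<^bsub>D\<^esub> \<beta> (Dom D h))"
      by (intro full) (use h G0 bA b't in simp_all)
  qed
  then obtain g where g: "\<And>h. h \<in> Ar D \<Longrightarrow> g h \<in> Ar C" "\<And>h. h \<in> Ar D \<Longrightarrow> Dom C (g h) = G0 (Dom D h)"
    "\<And>h. h \<in> Ar D \<Longrightarrow> Cod C (g h) = G0 (Cod D h)" "\<And>h. h \<in> Ar D \<Longrightarrow> FAr F (g h) = b' (Cod D h) \<cdot>\<^bsub>D\<^esub> (h \<cdot>\<^bsub>D\<^esub> \<beta> (Dom D h))"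
    by blast
  define G where "G = \<lparr>FOb = G0, FAr = g\<rparr>"
  have Gs [simp]: "FOb G = G0" "FAr G = g" by (simp_all add: G_def)
  have bg: "\<beta> (Cod D h) \<cdot>\<^bsub>D\<^esub> FAr F (g h) = h \<cdot>\<^bsub>D\<^esub> \<beta> (Dom D h)" if "h \<in> Ar D" for h
    using that g(4) bext[of "Cod D h" "h \<cdot>\<^bsub>D\<^esub> \<beta> (Dom D h)"] bA G0 by simp
  have Gf: "functor D C G" unfolding functor_def
  proof (intro conjI ballI impI)
    fix d assume d: "d \<in> Ob D"
    show "FAr G (Ide D d) = Ide C (FOb G d)" unfolding Gs
      by (rule faithful) (use d g(1-4)[of "Ide D d"] G0(1)[OF d] G0(3,4)[OF d] bA[OF d] b't[OF d] in simp_all)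
  next
    fix f h assume f: "f \<in> Ar D" "h \<in> Ar D" "Cod D f = Dom D h"
    have hf: "h \<cdot>\<^bsub>D\<^esub> f \<in> Ar D" "Dom D (h \<cdot>\<^bsub>D\<^esub> f) = Dom D f" "Cod D (h \<cdot>\<^bsub>D\<^esub> f) = Cod D h" using f by simp_all
    have ob: "Dom D f \<in> Ob D" "Dom D h \<in> Ob D" "Cod D h \<in> Ob D" using f by simp_all
    have "FAr F (g h) \<cdot>\<^bsub>D\<^esub> FAr F (g f) = b' (Cod D h) \<cdot>\<^bsub>D\<^esub> (h \<cdot>\<^bsub>D\<^esub> (\<beta> (Dom D h) \<cdot>\<^bsub>D\<^esub> (b' (Dom D h) \<cdot>\<^bsub>D\<^esub> (f \<cdot>\<^bsub>D\<^esub> \<beta> (Dom D f)))))"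
      using f g(4)[OF f(1)] g(4)[OF f(2)] G0[OF ob(1)] G0[OF ob(2)] G0[OF ob(3)] bA[OF ob(1)] bA[OF ob(2)] b't[OF ob(2)] b't[OF ob(3)] by simp
    also have "\<dots> = FAr F (g (h \<cdot>\<^bsub>D\<^esub> f))"
      using f g(4)[OF hf(1)] hf G0[OF ob(1)] bA[OF ob(1)] bext[OF ob(2), of "f \<cdot>\<^bsub>D\<^esub> \<beta> (Dom D f)"] b't[OF ob(3)] by simp
    finally have e: "FAr F (g h) \<cdot>\<^bsub>D\<^esub> FAr F (g f) = FAr F (g (h \<cdot>\<^bsub>D\<^esub> f))" .
    show "FAr G (h \<cdot>\<^bsub>D\<^esub> f) = FAr G h \<cdot>\<^bsub>C\<^esub> FAr G f" unfolding Gs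
      by (rule faithful) (use f hf g(1-3)[OF f(1)] g(1-3)[OF f(2)] g(1-3)[OF hf(1)] e in simp_all)
  qed (use F.C.cat F.D.cat G0 g in simp_all)
  have beta: "nat_iso D D (F \<circ>\<^sub>F G) id_func \<beta>" unfolding nat_iso_def nat_trans_def
  proof (intro conjI ballI)
    show "functor D D (F \<circ>\<^sub>F G)" using F Gf by (auto simp: functor_def)
    show "functor D D id_func" using F.D.cat by (auto simp: functor_def)
  qed (use G0 bA bg in simp_all)
  have "\<exists>\<alpha>. \<forall>a\<in>Ob C. \<alpha> a \<in> Ar C \<and> Dom C (\<alpha> a) = a \<and> Cod C (\<alpha> a) = G0 (FOb F a) \<and> FAr F (\<alpha> a) = b' (FOb F a)"
  proof (rule bchoice, rule ballI)
    fix a assume a: "a \<in> Ob C"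
    have Fa: "FOb F a \<in> Ob D" using a by simp
    show "\<exists>f. f \<in> Ar C \<and> Dom C f = a \<and> Cod C f = G0 (FOb F a) \<and> FAr F f = b' (FOb F a)"
      by (rule full[OF a G0(1)[OF Fa] b't(1-3)[OF Fa]])
  qed
  then obtain \<alpha> where al: "\<And>a. a \<in> Ob C \<Longrightarrow> \<alpha> a \<in> Ar C" "\<And>a. a \<in> Ob C \<Longrightarrow> Dom C (\<alpha> a) = a"
    "\<And>a. a \<in> Ob C \<Longrightarrow> Cod C (\<alpha> a) = G0 (FOb F a)" "\<And>a. a \<in> Ob C \<Longrightarrow> FAr F (\<alpha> a) = b' (FOb F a)" by blast
  have reflect: "iso C f" if f: "f \<in> Ar C" and i: "iso D (FAr F f)" for f
  proof -
    obtain h where h: "inverse_arrows D (FAr F f) h" using i by (rule F.D.isoE)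
    note h' = F.D.invD[OF h]
    obtain k where k: "k \<in> Ar C" "Dom C k = Cod C f" "Cod C k = Dom C f" "FAr F k = h"
      using full[of "Cod C f" "Dom C f" h] f h' by auto
    have 1: "k \<cdot>\<^bsub>C\<^esub> f = Ide C (Dom C f)" by (rule faithful) (use f k h' in simp_all)
    have 2: "f \<cdot>\<^bsub>C\<^esub> k = Ide C (Cod C f)" by (rule faithful) (use f k h' in simp_all)
    show ?thesis by (rule F.C.isoI[OF _ _ 1 2]) (use f k in simp_all)
  qed
  have "nat_iso C C id_func (G \<circ>\<^sub>F F) \<alpha>" unfolding nat_iso_def nat_trans_def
  proof (intro conjI ballI)
    show "functor C C (G \<circ>\<^sub>F F)" using F Gf by (auto simp: functor_def)
    show "functor C C id_func" using F.C.cat by (auto simp: functor_def)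
    fix f assume f: "f \<in> Ar C"
    have ob: "Dom C f \<in> Ob C" "Cod C f \<in> Ob C" "FOb F (Dom C f) \<in> Ob D" "FOb F (Cod C f) \<in> Ob D" using f by simp_all
    have Ff: "FAr F f \<in> Ar D" "Dom D (FAr F f) = FOb F (Dom C f)" "Cod D (FAr F f) = FOb F (Cod C f)" using f by simp_all
    have 1: "FAr F (g (FAr F f)) \<cdot>\<^bsub>D\<^esub> FAr F (\<alpha> (Dom C f)) = b' (FOb F (Cod C f)) \<cdot>\<^bsub>D\<^esub> FAr F f"
      using g(4)[OF Ff(1)] al(4)[OF ob(1)] Ff bA[OF ob(3)] G0(3,4)[OF ob(3)] b't[OF ob(3)] b't[OF ob(4)] by simp
    have "\<alpha> (Cod C f) \<cdot>\<^bsub>C\<^esub> f = g (FAr F f) \<cdot>\<^bsub>C\<^esub> \<alpha> (Dom C f)"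
      by (rule faithful) (use f 1 Ff al[OF ob(1)] al[OF ob(2)] g(1-3)[OF Ff(1)] in simp_all)
    thus "\<alpha> (Cod C f) \<cdot>\<^bsub>C\<^esub> FAr id_func f = FAr (G \<circ>\<^sub>F F) f \<cdot>\<^bsub>C\<^esub> \<alpha> (Dom C f)" by simp
  next
    fix a assume a: "a \<in> Ob C"
    show "iso C (\<alpha> a)" by (rule reflect[OF al(1)[OF a]]) (use al(4)[OF a] b't(6)[of "FOb F a"] a in simp)
  qed (use al in simp_all)
  thus ?thesis using F Gf beta unfolding equivalence_of_cats_def by blast
qed

context adj_pre
begin

lemma adj_comparison_simps:
  "FOb (adj_comparison A) B = (U0 B, U1 (\<epsilon> B))"
  "FAr (adj_comparison A) f = ((U0 (Dom (UC A) f), U1 (\<epsilon> (Dom (UC A) f))), U1 f, (U0 (Cod (UC A) f), U1 (\<epsilon> (Cod (UC A) f))))"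
  by (simp_all add: adj_comparison_def Let_def)

text \<open>The comparison is an equivalence, so it remains that the forgetful functor of algebras
  is faithful and reflects isomorphisms: the inverse of an underlying isomorphism again commutes
  with the structure maps.\<close>

lemma monadic_adj_ctx0:
  assumes M: "monadic A" shows "adj_ctx0 A"
proof unfold_locales
  note E = M[unfolded monadic_def]
  show "f = g" if f: "f \<in> Ar (UC A)" "g \<in> Ar (UC A)" "Dom (UC A) f = Dom (UC A) g" "Cod (UC A) f = Cod (UC A) g" "U1 f = U1 g" for f g
    by (rule equivalence_faithful[OF E f(1-4)]) (use f in \<open>simp add: adj_comparison_simps\<close>)
  fix f assume f: "f \<in> Ar (UC A)" and i: "iso (VC A) (U1 f)"
  interpret K: functor_loc "UC A" "Alg (VC A) (adj_monad A)" "adj_comparison A"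
    by (rule functor_loc) (use E in \<open>simp add: equivalence_of_cats_def\<close>)
  let ?a = "Dom (UC A) f" let ?b = "Cod (UC A) f"
  obtain g where fg: "inverse_arrows (VC A) (U1 f) g" using i by (rule V.isoE)
  note g = V.invD[OF fg]
  have Kf: "((U0 ?a, U1 (\<epsilon> ?a)), U1 f, (U0 ?b, U1 (\<epsilon> ?b))) \<in> Ar (Alg (VC A) (adj_monad A))"
    using K.F_simps(1)[OF f] by (simp add: adj_comparison_simps)
  have ob: "(U0 ?a, U1 (\<epsilon> ?a)) \<in> Ob (Alg (VC A) (adj_monad A))" "(U0 ?b, U1 (\<epsilon> ?b)) \<in> Ob (Alg (VC A) (adj_monad A))"
    using Kf by (auto simp: Alg_def Let_def)
  have ft: "?a \<in> Ob (UC A)" "?b \<in> Ob (UC A)" "g \<in> Ar (VC A)" "Dom (VC A) g = U0 ?b" "Cod (VC A) g = U0 ?a" using f g by simp_all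
  have nat: "U1 f \<cdot>\<^sub>V U1 (\<epsilon> ?a) = U1 (\<epsilon> ?b) \<cdot>\<^sub>V U1 (L1 (U1 f))"
  proof -
    have "U1 (f \<cdot>\<^sub>U \<epsilon> ?a) = U1 (\<epsilon> ?b \<cdot>\<^sub>U L1 (U1 f))" by (simp only: eps_nat[OF f])
    thus ?thesis using f by simp
  qed
  have l: "L1 (U1 f) \<cdot>\<^sub>U L1 g = Ide (UC A) (L0 (U0 ?b))"
  proof -
    have "L1 (U1 f \<cdot>\<^sub>V g) = Ide (UC A) (L0 (U0 ?b))" unfolding g(6) using f by simp
    thus ?thesis using f ft by simp
  qed
  have 1: "U1 f \<cdot>\<^sub>V (U1 (\<epsilon> ?a) \<cdot>\<^sub>V U1 (L1 g)) = U1 f \<cdot>\<^sub>V (g \<cdot>\<^sub>V U1 (\<epsilon> ?b))"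
  proof -
    have "U1 f \<cdot>\<^sub>V (U1 (\<epsilon> ?a) \<cdot>\<^sub>V U1 (L1 g)) = U1 (\<epsilon> ?b) \<cdot>\<^sub>V (U1 (L1 (U1 f)) \<cdot>\<^sub>V U1 (L1 g))"
      by (rule V.cmp_ext[OF nat]) (use f ft in simp_all)
    also have "\<dots> = U1 (\<epsilon> ?b) \<cdot>\<^sub>V U1 (L1 (U1 f) \<cdot>\<^sub>U L1 g)" using f ft by simp
    also have "\<dots> = U1 (\<epsilon> ?b)" unfolding l using f by simp
    also have "\<dots> = U1 f \<cdot>\<^sub>V (g \<cdot>\<^sub>V U1 (\<epsilon> ?b))" using g(8)[of "U1 (\<epsilon> ?b)"] f by simp
    finally show ?thesis .
  qed
  have 2: "U1 (\<epsilon> ?a) \<cdot>\<^sub>V U1 (L1 g) = g \<cdot>\<^sub>V U1 (\<epsilon> ?b)"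
    by (rule V.monicD[OF V.iso_monic[OF i] _ _ _ _ _ 1]) (use f ft in simp_all)
  have Kg: "((U0 ?b, U1 (\<epsilon> ?b)), g, (U0 ?a, U1 (\<epsilon> ?a))) \<in> Ar (Alg (VC A) (adj_monad A))"
    using ob 2 ft by (simp add: Alg_def Let_def adj_monad_def)
  have "iso (Alg (VC A) (adj_monad A)) (FAr (adj_comparison A) f)"
    by (rule K.D.isoI[of _ "(U0 ?a, U1 (\<epsilon> ?a))" "(U0 ?b, U1 (\<epsilon> ?b))" "((U0 ?b, U1 (\<epsilon> ?b)), g, (U0 ?a, U1 (\<epsilon> ?a)))"])
      (use Kf Kg g(5,6) f in \<open>simp_all add: adj_comparison_simps\<close>)
  thus "iso (UC A) f" by (rule equivalence_reflects_iso[OF E f])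
qed

end

section \<open>Consequences of a cartesian unit\<close>

locale cart_ctx = adj_ctx0 +
  assumes cart: "cartesian_unit A"
begin

lemma unit_pullback: "f \<in> Ar (VC A) \<Longrightarrow> is_pullback (VC A) (\<eta> (Cod (VC A) f)) (U1 (L1 f)) f (\<eta> (Dom (VC A) f))"
  using cart by (simp add: cartesian_unit_def)

lemma L0_zero [simp]: "L0 (zero_ob (VC A)) = F0 A"
  by (simp add: F0_def)

text \<open>The naturality square of the unit at the arrow from \<open>X\<close> to zero is a
  pullback, and the unit at the zero object is the arrow from zero.\<close>

lemma unit_kernel:
  assumes X: "X \<in> Ob (VC A)" shows "is_kernel (VC A) (U1 (L1 (to_zero (VC A) X))) (\<eta> X)"
proof -
  have e: "\<eta> (zero_ob (VC A)) = from_zero (VC A) (U0 (F0 A))" by (rule V.from_zero_unique) simp_all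
  show ?thesis
    by (rule V.pullback_kernel[of "U0 (F0 A)" _ "to_zero (VC A) X"])
      (use unit_pullback[of "to_zero (VC A) X"] X e in simp_all)
qed

lemma unit_monic: "X \<in> Ob (VC A) \<Longrightarrow> monic (VC A) (\<eta> X)"
  by (rule V.kernel_monic[OF unit_kernel])

lemma free_point:
  assumes X: "X \<in> Ob (VC A)"
  shows "(L1 (to_zero (VC A) X), L1 (from_zero (VC A) X)) \<in> Ob (Pt (UC A) (F0 A))"
proof -
  have "to_zero (VC A) X \<cdot>\<^sub>V from_zero (VC A) X = Ide (VC A) (zero_ob (VC A))"
    using X V.from_zero_unique[of "Ide (VC A) (zero_ob (VC A))"] by simp
  hence "L1 (to_zero (VC A) X \<cdot>\<^sub>V from_zero (VC A) X) = Ide (UC A) (F0 A)" by simp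
  hence "L1 (to_zero (VC A) X) \<cdot>\<^sub>U L1 (from_zero (VC A) X) = Ide (UC A) (F0 A)"
    using X by (subst (asm) L_simps(6)) simp_all
  thus ?thesis using X by (simp add: Pt_Ob_iff)
qed

text \<open>\<open>w\<close> compares the naturality square of the counit at \<open>f\<close> with
  the pullback. Over F(0) both vertices are points, with kernels \<open>\<eta> (U0 a)\<close> and
  \<open>l\<close>, and \<open>w\<close> induces the identity on kernels. The short five lemma
  inverts \<open>U1 w\<close>, and conservativity inverts \<open>w\<close>.\<close>

lemma counit_pullback:
  assumes f: "f \<in> Ar (UC A)" and pb: "is_pullback (UC A) (\<epsilon> (Cod (UC A) f)) f p q"
  obtains w where "iso (UC A) w" "Cod (UC A) w = Dom (UC A) p" "p \<cdot>\<^sub>U w = L1 (U1 f)"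
proof -
  define a b P where "a = Dom (UC A) f" and "b = Cod (UC A) f" and "P = Dom (UC A) p"
  have ob: "a \<in> Ob (UC A)" "b \<in> Ob (UC A)" "U0 a \<in> Ob (VC A)" "U0 b \<in> Ob (VC A)" and ft: "Dom (UC A) f = a" "Cod (UC A) f = b"
    using f by (simp_all add: a_def b_def)
  have pq: "p \<in> Ar (UC A)" "q \<in> Ar (UC A)" "Dom (UC A) p = P" "Dom (UC A) q = P" "Cod (UC A) p = L0 (U0 b)" "Cod (UC A) q = a"
    and pqe: "\<epsilon> b \<cdot>\<^sub>U p = f \<cdot>\<^sub>U q"
    using U.pb_typed[OF pb] f by (simp_all add: P_def a_def b_def)
  have Uf: "U1 f \<in> Ar (VC A)" "Dom (VC A) (U1 f) = U0 a" "Cod (VC A) (U1 f) = U0 b" using f ft by simp_all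
  have "cone (UC A) (\<epsilon> (Cod (UC A) f)) f (L1 (U1 f)) (\<epsilon> a)" by (rule U.coneI) (use f eps_nat[OF f] ft ob in simp_all)
  moreover have "Dom (UC A) (L1 (U1 f)) = L0 (U0 a)" using Uf by simp
  ultimately obtain w where w: "w \<in> Ar (UC A)" "Dom (UC A) w = L0 (U0 a)" "Cod (UC A) w = P" and we: "p \<cdot>\<^sub>U w = L1 (U1 f)" "q \<cdot>\<^sub>U w = \<epsilon> a"
    using U.pb_fact'[OF pb _ _ pq(3)] by blast
  let ?ta = "to_zero (VC A) (U0 a)" let ?tb = "to_zero (VC A) (U0 b)" let ?fa = "from_zero (VC A) (U0 a)"
  have pt: "(L1 ?ta, L1 ?fa) \<in> Ob (Pt (UC A) (F0 A))" by (rule free_point[OF ob(3)])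
  have pta: "L1 ?ta \<cdot>\<^sub>U L1 ?fa = Ide (UC A) (F0 A)" using pt by (simp add: Pt_Ob_iff)
  have tw: "(L1 ?tb \<cdot>\<^sub>U p) \<cdot>\<^sub>U w = L1 ?ta"
  proof -
    have "(L1 ?tb \<cdot>\<^sub>U p) \<cdot>\<^sub>U w = L1 ?tb \<cdot>\<^sub>U L1 (U1 f)" using we w pq ob by simp
    also have "\<dots> = L1 (?tb \<cdot>\<^sub>V U1 f)" by (rule L_simps(6)[symmetric]) (use Uf ob in simp_all)
    also have "?tb \<cdot>\<^sub>V U1 f = ?ta" using V.to_zero_comp[of "U1 f" "U0 b"] Uf by simp
    finally show ?thesis .
  qed
  have pt2: "(L1 ?tb \<cdot>\<^sub>U p, w \<cdot>\<^sub>U L1 ?fa) \<in> Ob (Pt (UC A) (F0 A))"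
  proof -
    have "((L1 ?tb \<cdot>\<^sub>U p) \<cdot>\<^sub>U w) \<cdot>\<^sub>U L1 ?fa = Ide (UC A) (F0 A)" unfolding tw by (rule pta)
    thus ?thesis using w pq ob by (simp add: Pt_Ob_iff)
  qed
  have h: "((U1 (L1 ?ta), U1 (L1 ?fa)), U1 w, (U1 (L1 ?tb \<cdot>\<^sub>U p), U1 (w \<cdot>\<^sub>U L1 ?fa))) \<in> Ar (Pt (VC A) (U0 (F0 A)))"
    unfolding Pt_Ar_iff
  proof (intro conjI)
    show "U1 (L1 ?tb \<cdot>\<^sub>U p) \<cdot>\<^sub>V U1 w = U1 (L1 ?ta)" by (rule U_eq[OF tw]) (use w pq ob in simp_all)
  qed (use point_U[OF pt] point_U[OF pt2] w pq ob in simp_all)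
  \<comment> \<open>As an arrow into the pullback, \<open>l\<close> has the components
    \<open>\<eta> (U0 b)\<close> after \<open>U1 f\<close>, and the identity of
    \<open>U0 a\<close>.\<close>
  define l where "l = U1 w \<cdot>\<^sub>V \<eta> (U0 a)"
  have l: "l \<in> Ar (VC A)" "Dom (VC A) l = U0 a" "Cod (VC A) l = U0 P" using w ob by (simp_all add: l_def)
  have Upw: "U1 p \<cdot>\<^sub>V U1 w = U1 (L1 (U1 f))" by (rule U_eq[OF we(1)]) (use w pq in simp_all)
  have Uqw: "U1 q \<cdot>\<^sub>V U1 w = U1 (\<epsilon> a)" by (rule U_eq[OF we(2)]) (use w pq in simp_all)
  have le: "U1 p \<cdot>\<^sub>V l = \<eta> (U0 b) \<cdot>\<^sub>V U1 f" "U1 q \<cdot>\<^sub>V l = Ide (VC A) (U0 a)"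
    using V.cmp_ext1[OF Upw, of "\<eta> (U0 a)"] V.cmp_ext1[OF Uqw, of "\<eta> (U0 a)"] w pq ob f ft triangles(2)[OF ob(1)]
    by (simp_all add: l_def)
  note UPB = U_pullback[OF pb]
  \<comment> \<open>If \<open>x\<close> is killed, \<open>unit_kernel\<close> writes
    \<open>U1 p\<close> after \<open>x\<close> as \<open>\<eta> (U0 b)\<close> after some
    \<open>y\<close>. Applying the counit shows that \<open>y\<close> is \<open>U1 f\<close> after
    \<open>U1 q\<close> after \<open>x\<close>, so \<open>x\<close> factors through \<open>l\<close>
    by its \<open>q\<close>-component.\<close>
  have lk: "is_kernel (VC A) (U1 (L1 ?tb \<cdot>\<^sub>U p)) l"
  proof (rule V.kernelI)
    have tb0: "U1 (L1 ?tb) \<cdot>\<^sub>V \<eta> (U0 b) = zero_arrow (VC A) (U0 b) (U0 (F0 A))"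
      using V.kernelD(4)[OF unit_kernel[OF ob(4)]] ob by simp
    have "U1 (L1 ?tb) \<cdot>\<^sub>V (U1 p \<cdot>\<^sub>V l) = zero_arrow (VC A) (U0 b) (U0 (F0 A)) \<cdot>\<^sub>V U1 f" unfolding le(1)
      by (rule V.cmp_ext1[OF tb0]) (use Uf ob in simp_all)
    thus "U1 (L1 ?tb \<cdot>\<^sub>U p) \<cdot>\<^sub>V l = zero_arrow (VC A) (Dom (VC A) l) (Cod (VC A) (U1 (L1 ?tb \<cdot>\<^sub>U p)))"
      using l pq ob Uf by simp
    show "monic (VC A) l" unfolding monic_def
    proof (intro conjI ballI impI)
      fix x y assume x: "x \<in> Ar (VC A)" "y \<in> Ar (VC A)" "Dom (VC A) x = Dom (VC A) y" "Cod (VC A) x = Dom (VC A) l" "Cod (VC A) y = Dom (VC A) l" "l \<cdot>\<^sub>V x = l \<cdot>\<^sub>V y"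
      have "U1 q \<cdot>\<^sub>V (l \<cdot>\<^sub>V x) = x" "U1 q \<cdot>\<^sub>V (l \<cdot>\<^sub>V y) = y"
        using V.cmp_ext1[OF le(2), of x] V.cmp_ext1[OF le(2), of y] pq l x(1-5) by simp_all
      thus "x = y" using x(6) by metis
    qed (rule l)
    fix x assume "annihilated (VC A) (U1 (L1 ?tb \<cdot>\<^sub>U p)) x"
    hence x: "x \<in> Ar (VC A)" "Cod (VC A) x = U0 P" "U1 (L1 ?tb) \<cdot>\<^sub>V (U1 p \<cdot>\<^sub>V x) = zero_arrow (VC A) (Dom (VC A) x) (U0 (F0 A))"
      using pq ob by (auto simp: annihilated_def)
    have "annihilated (VC A) (U1 (L1 ?tb)) (U1 p \<cdot>\<^sub>V x)" by (rule V.annihilatedI) (use x pq ob in simp_all)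
    moreover have "Dom (VC A) (U1 p \<cdot>\<^sub>V x) = Dom (VC A) x" using x pq by simp
    ultimately obtain y where y: "y \<in> Ar (VC A)" "Dom (VC A) y = Dom (VC A) x" "Cod (VC A) y = U0 b" and ye: "\<eta> (U0 b) \<cdot>\<^sub>V y = U1 p \<cdot>\<^sub>V x"
      using V.kernel_fact[OF unit_kernel[OF ob(4)] _ _ eta_simps(2)[OF ob(4)]] by blast
    have Ueq: "U1 (\<epsilon> b) \<cdot>\<^sub>V U1 p = U1 f \<cdot>\<^sub>V U1 q"
    proof -
      have "U1 (\<epsilon> b \<cdot>\<^sub>U p) = U1 (f \<cdot>\<^sub>U q)" by (simp only: pqe)
      thus ?thesis using pq ob f ft by simp
    qed
    have "U1 f \<cdot>\<^sub>V (U1 q \<cdot>\<^sub>V x) = U1 (\<epsilon> b) \<cdot>\<^sub>V (U1 p \<cdot>\<^sub>V x)"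
      by (rule V.cmp_ext[OF Ueq[symmetric]]) (use pq ob f ft x in simp_all)
    also have "\<dots> = y" unfolding ye[symmetric] using V.cmp_ext1[OF triangles(2)[OF ob(2)], of y] ob y by simp
    finally have fy: "U1 f \<cdot>\<^sub>V (U1 q \<cdot>\<^sub>V x) = y" .
    have "l \<cdot>\<^sub>V (U1 q \<cdot>\<^sub>V x) = x"
    proof (rule V.pb_uniq[OF UPB])
      have "U1 p \<cdot>\<^sub>V (l \<cdot>\<^sub>V (U1 q \<cdot>\<^sub>V x)) = \<eta> (U0 b) \<cdot>\<^sub>V (U1 f \<cdot>\<^sub>V (U1 q \<cdot>\<^sub>V x))"
        by (rule V.cmp_ext[OF le(1)]) (use pq ob Uf x l in simp_all)
      thus "U1 p \<cdot>\<^sub>V (l \<cdot>\<^sub>V (U1 q \<cdot>\<^sub>V x)) = U1 p \<cdot>\<^sub>V x" using fy ye by simp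
      show "U1 q \<cdot>\<^sub>V (l \<cdot>\<^sub>V (U1 q \<cdot>\<^sub>V x)) = U1 q \<cdot>\<^sub>V x"
        using V.cmp_ext1[OF le(2), of "U1 q \<cdot>\<^sub>V x"] pq l x by simp
    qed (use pq l x in simp_all)
    thus "\<exists>w. w \<in> Ar (VC A) \<and> Dom (VC A) w = Dom (VC A) x \<and> Cod (VC A) w = Dom (VC A) l \<and> l \<cdot>\<^sub>V w = x"
      using pq l x by (intro exI[of _ "U1 q \<cdot>\<^sub>V x"]) simp
  qed (use l pq ob in simp_all)
  have i: "iso (VC A) (U1 w)"
    by (rule V.short_five[OF h unit_kernel[OF ob(3)] lk, of "Ide (VC A) (U0 a)"]) (use l ob in \<open>simp_all add: l_def\<close>)
  show thesis by (rule that[OF conservative[OF w(1) i] _ we(1)]) (use w pq in simp)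
qed

text \<open>\<open>U1 (L1 m)\<close> has trivial kernel: what it kills is also killed by the
  projection to UF(0), so it is \<open>\<eta> I\<close> after some \<open>y\<close>; naturality and
  monicity of \<open>\<eta> J\<close> and of \<open>m\<close> make \<open>y\<close> zero. The
  faithful right adjoint then reflects monos.\<close>

lemma L_monic:
  assumes m: "monic (VC A) m" shows "monic (UC A) (L1 m)"
proof -
  have mt: "m \<in> Ar (VC A)" using m by (simp add: monic_def)
  define I J where "I = Dom (VC A) m" and "J = Cod (VC A) m"
  have IJ: "Dom (VC A) m = I" "Cod (VC A) m = J" "I \<in> Ob (VC A)" "J \<in> Ob (VC A)" using mt by (simp_all add: I_def J_def)
  have "monic (VC A) (U1 (L1 m))"
  proof (rule V.trivial_kernel_monic)
    fix z assume "annihilated (VC A) (U1 (L1 m)) z"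
    hence z: "z \<in> Ar (VC A)" "Cod (VC A) z = U0 (L0 I)" "U1 (L1 m) \<cdot>\<^sub>V z = zero_arrow (VC A) (Dom (VC A) z) (U0 (L0 J))"
      using mt IJ by (simp_all add: annihilated_def)
    have zo: "Dom (VC A) z \<in> Ob (VC A)" using z by simp
    have "L1 (to_zero (VC A) J \<cdot>\<^sub>V m) = L1 (to_zero (VC A) I)" using V.to_zero_comp[of m J] mt IJ by simp
    hence lm: "L1 (to_zero (VC A) J) \<cdot>\<^sub>U L1 m = L1 (to_zero (VC A) I)" using mt IJ by (subst (asm) L_simps(6)) simp_all
    have tm: "U1 (L1 (to_zero (VC A) J)) \<cdot>\<^sub>V U1 (L1 m) = U1 (L1 (to_zero (VC A) I))" by (rule U_eq[OF lm]) (use mt IJ in simp_all)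
    have "U1 (L1 (to_zero (VC A) I)) \<cdot>\<^sub>V z = U1 (L1 (to_zero (VC A) J)) \<cdot>\<^sub>V (U1 (L1 m) \<cdot>\<^sub>V z)"
      by (rule V.cmp_ext1[OF tm, symmetric]) (use mt IJ z in simp_all)
    hence "annihilated (VC A) (U1 (L1 (to_zero (VC A) I))) z" by (intro V.annihilatedI) (use z zo IJ in simp_all)
    from V.kernel_fact[OF unit_kernel[OF IJ(3)] this refl eta_simps(2)[OF IJ(3)]]
    obtain y where y: "y \<in> Ar (VC A)" "Dom (VC A) y = Dom (VC A) z" "Cod (VC A) y = I" "\<eta> I \<cdot>\<^sub>V y = z" by blast
    have "\<eta> J \<cdot>\<^sub>V (m \<cdot>\<^sub>V y) = U1 (L1 m) \<cdot>\<^sub>V (\<eta> I \<cdot>\<^sub>V y)"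
      by (rule V.cmp_ext[OF eta_nat[symmetric, of m I, unfolded IJ(2)]]) (use mt IJ y(1-3) in simp_all)
    hence 1: "\<eta> J \<cdot>\<^sub>V (m \<cdot>\<^sub>V y) = \<eta> J \<cdot>\<^sub>V zero_arrow (VC A) (Dom (VC A) z) J" using y(4) z(3) zo IJ by simp
    have 2: "m \<cdot>\<^sub>V y = zero_arrow (VC A) (Dom (VC A) z) J"
      by (rule V.monicD[OF unit_monic[OF IJ(4)] _ _ _ _ _ 1]) (use mt IJ y(1-3) zo in simp_all)
    have "y = zero_arrow (VC A) (Dom (VC A) z) I"
      by (rule V.monicD[OF m]) (use mt IJ y(1-3) zo 2 in simp_all)
    thus "z = zero_arrow (VC A) (Dom (VC A) z) (Dom (VC A) (U1 (L1 m)))" using y(4) zo IJ mt by simp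
  qed (use mt in simp)
  note um = this
  show ?thesis unfolding monic_def
  proof (intro conjI ballI impI)
    fix x y assume x: "x \<in> Ar (UC A)" "y \<in> Ar (UC A)" "Dom (UC A) x = Dom (UC A) y" "Cod (UC A) x = Dom (UC A) (L1 m)"
      "Cod (UC A) y = Dom (UC A) (L1 m)" and e: "L1 m \<cdot>\<^sub>U x = L1 m \<cdot>\<^sub>U y"
    have "U1 (L1 m \<cdot>\<^sub>U x) = U1 (L1 m \<cdot>\<^sub>U y)" by (simp only: e)
    hence e': "U1 (L1 m) \<cdot>\<^sub>V U1 x = U1 (L1 m) \<cdot>\<^sub>V U1 y" using x mt by simp
    have "U1 x = U1 y" by (rule V.monicD[OF um _ _ _ _ _ e']) (use x mt in simp_all)
    thus "x = y" using x by (intro faithful) simp_all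
  qed (use mt in simp)
qed

lemma U_iso:
  assumes "iso (UC A) f" shows "iso (VC A) (U1 f)"
proof -
  interpret F: functor_loc "UC A" "VC A" "Radj A" by (rule functor_loc) (use adj in \<open>simp add: adjunction_def\<close>)
  show ?thesis by (rule F.F_iso[OF assms])
qed

text \<open>The naturality square of the counit at \<open>f\<close> is a pullback, so \<open>L1 (U1 f)\<close> is a regular
  epimorphism; as \<open>L1\<close> preserves monomorphisms and the unit is cartesian, the mono part of the image
  of \<open>U1 f\<close> is invertible.\<close>

lemma U_regular_epi:
  assumes f: "regular_epi (UC A) f" shows "regular_epi (VC A) (U1 f)"
proof -
  have fA: "f \<in> Ar (UC A)" by (rule U.regular_epi_Ar[OF f])
  obtain p q where pb: "is_pullback (UC A) (\<epsilon> (Cod (UC A) f)) f p q"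
    using U.pb_ex[of "\<epsilon> (Cod (UC A) f)" f] fA by auto
  obtain w where w: "iso (UC A) w" "Cod (UC A) w = Dom (UC A) p" "p \<cdot>\<^sub>U w = L1 (U1 f)" by (rule counit_pullback[OF fA pb])
  have r: "regular_epi (UC A) (L1 (U1 f))" unfolding w(3)[symmetric]
    by (rule U.regular_epi_iso[OF U.regular_epi_stable[OF pb f] w(1,2)])
  have Uf: "U1 f \<in> Ar (VC A)" using fA by simp
  obtain e m where e: "regular_epi (VC A) e" "e \<in> Ar (VC A)" "monic (VC A) m" "m \<in> Ar (VC A)" "Dom (VC A) e = Dom (VC A) (U1 f)"
    "Cod (VC A) e = Dom (VC A) m" "Cod (VC A) m = Cod (VC A) (U1 f)" and me: "m \<cdot>\<^sub>V e = U1 f"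
    by (rule V.image_factorization[OF Uf])
  have "L1 m \<cdot>\<^sub>U L1 e = L1 (U1 f)" unfolding me[symmetric] using e by simp
  hence "iso (UC A) (L1 m)"
    by (intro U.regular_epi_factor_monic_iso[OF _ L_monic[OF e(3)], of "L1 e"]) (use r e in simp_all)
  hence i: "iso (VC A) (U1 (L1 m))" by (rule U_iso)
  then obtain n where mn: "inverse_arrows (VC A) (U1 (L1 m)) n" by (rule V.isoE)
  note n = V.invD[OF mn]
  define J where "J = Cod (VC A) m"
  have J: "J \<in> Ob (VC A)" "Cod (VC A) m = J" using V.Cod_Ob[OF e(4)] by (simp_all add: J_def)
  \<comment> \<open>Since \<open>U1 (L1 m)\<close> is invertible, the identity of \<open>J\<close>
    gives a cone over the naturality square of the unit at \<open>m\<close>. Its factorization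
    through that pullback is a right inverse of \<open>m\<close>.\<close>
  have "cone (VC A) (\<eta> (Cod (VC A) m)) (U1 (L1 m)) (Ide (VC A) J) (n \<cdot>\<^sub>V \<eta> J)"
    by (rule V.coneI) (use n(8)[of "\<eta> J"] n(1-4) J e in simp_all)
  from V.pb_fact'[OF unit_pullback[OF e(4)] this V.Dom_Ide[OF J(1)] refl]
  obtain v where "v \<in> Ar (VC A)" "Dom (VC A) v = J" "Cod (VC A) v = Dom (VC A) m" "m \<cdot>\<^sub>V v = Ide (VC A) J" by blast
  hence "iso (VC A) m" using J by (intro V.monic_split_iso[OF e(3)]) simp_all
  thus ?thesis unfolding me[symmetric] by (rule V.iso_regular_epi[OF e(1)]) (use e in simp)
qed

end

sublocale cart_ctx \<subseteq> adj_ctx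
  by unfold_locales (rule U_regular_epi)

lemma ideally_exact_context_cart_ctx:
  assumes I: "ideally_exact_context A" shows "cart_ctx A"
proof -
  have I': "adjunction A" "monadic A" "ideally_exact (UC A)" "semi_abelian (VC A)" "cartesian_unit A"
    using I by (simp_all add: ideally_exact_context_def)
  interpret adj_pre A
    by unfold_locales (use I' in \<open>simp_all add: ideally_exact_def semi_abelian_def protomodular_def\<close>)
  interpret adj_ctx0 A by (rule monadic_adj_ctx0[OF I'(2)])
  show ?thesis by unfold_locales (rule I'(5))
qed

section \<open>Lifting points and their morphisms\<close>

context cat_loc
begin

lemma Pt_comp:
  assumes "((p, s), h, (q, t)) \<in> Ar (Pt C B)" "((q, t), g, (r, u)) \<in> Ar (Pt C B)"
  shows "((p, s), g \<cdot> h, (r, u)) \<in> Ar (Pt C B)"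
proof -
  interpret P: cat_loc "Pt C B" by unfold_locales (rule category_Pt)
  show ?thesis using P.Cmp_Ar[OF assms] by simp
qed

lemma Pt_inverse:
  assumes h: "((p, s), h, (q, t)) \<in> Ar (Pt C B)" and i: "iso C h"
  obtains g where "inverse_arrows C h g" "((q, t), g, (p, s)) \<in> Ar (Pt C B)"
proof -
  obtain g where hg: "inverse_arrows C h g" using i by (rule isoE)
  note g = invD[OF hg]
  have ht: "(p, s) \<in> Ob (Pt C B)" "(q, t) \<in> Ob (Pt C B)" "Dom C h = Dom C p" "Cod C h = Dom C q" "q \<cdot> h = p" "h \<cdot> s = t"
    using h by (simp_all add: Pt_Ar_iff)
  have o: "q \<in> Ar C" "s \<in> Ar C" "Cod C s = Dom C p" using ht(1,2) by (simp_all add: Pt_Ob_iff)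
  have "g \<cdot> (h \<cdot> s) = s" using g(7)[of s] o ht(3) by simp
  hence 1: "g \<cdot> t = s" by (simp only: ht(6))
  have "q \<cdot> (h \<cdot> g) = p \<cdot> g" by (rule cmp_ext1[OF ht(5)]) (use g(1-4) o ht(3,4) in simp_all)
  hence 2: "p \<cdot> g = q" using g(6) o(1) ht(4) by simp
  have "((q, t), g, (p, s)) \<in> Ar (Pt C B)" using 1 2 ht(1-4) g(1-4) by (simp add: Pt_Ar_iff)
  thus thesis using that hg by blast
qed

end

context functor_loc
begin

text \<open>Bijectivity on objects and on arrows suffices, as injectivity transfers the functor laws
  to the inverse maps.\<close>

lemma isomorphism_of_catsI:
  assumes o: "inj_on (FOb F) (Ob C)" "Ob D \<subseteq> FOb F ` Ob C" and a: "inj_on (FAr F) (Ar C)" "Ar D \<subseteq> FAr F ` Ar C"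
  shows "isomorphism_of_cats C D F"
proof -
  define G where "G = \<lparr>FOb = inv_into (Ob C) (FOb F), FAr = inv_into (Ar C) (FAr F)\<rparr>"
  have Go: "FOb G d \<in> Ob C" "FOb F (FOb G d) = d" if "d \<in> Ob D" for d
    using that o by (auto simp: G_def inv_into_into f_inv_into_f)
  have Ga: "FAr G h \<in> Ar C" "FAr F (FAr G h) = h" if "h \<in> Ar D" for h
    using that a by (auto simp: G_def inv_into_into f_inv_into_f)
  have oI: "x = y" if "x \<in> Ob C" "y \<in> Ob C" "FOb F x = FOb F y" for x y using o(1) that by (auto dest: inj_onD)
  have aI: "x = y" if "x \<in> Ar C" "y \<in> Ar C" "FAr F x = FAr F y" for x y using a(1) that by (auto dest: inj_onD)
  have Gd: "Dom C (FAr G h) = FOb G (Dom D h)" "Cod C (FAr G h) = FOb G (Cod D h)" if h: "h \<in> Ar D" for h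
  proof -
    have "Dom D (FAr F (FAr G h)) = Dom D h" "Cod D (FAr F (FAr G h)) = Cod D h" using Ga(2)[OF h] by simp_all
    thus "Dom C (FAr G h) = FOb G (Dom D h)" "Cod C (FAr G h) = FOb G (Cod D h)"
      using Ga(1)[OF h] Go[of "Dom D h"] Go[of "Cod D h"] h
      by (intro oI; simp)+
  qed
  have "functor D C G" unfolding functor_def
  proof (intro conjI ballI impI)
    fix d assume d: "d \<in> Ob D"
    show "FOb G d \<in> Ob C" by (rule Go[OF d])
    show "FAr G (Ide D d) = Ide C (FOb G d)"
      by (rule aI) (use d Go[OF d] Ga[of "Ide D d"] in simp_all)
  next
    fix h assume h: "h \<in> Ar D"
    show "FAr G h \<in> Hom C (FOb G (Dom D h)) (FOb G (Cod D h))" using Ga(1)[OF h] Gd[OF h] by simp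
    fix k assume k: "k \<in> Ar D" "Cod D h = Dom D k"
    show "FAr G (k \<cdot>\<^bsub>D\<^esub> h) = FAr G k \<cdot>\<^bsub>C\<^esub> FAr G h"
      by (rule aI) (use h k Ga[OF h] Ga[OF k(1)] Ga[of "k \<cdot>\<^bsub>D\<^esub> h"] Gd[OF h] Gd[OF k(1)] in simp_all)
  qed (use C.cat D.cat in simp_all)
  moreover have "func_eq C (G \<circ>\<^sub>F F) id_func"
    unfolding func_eq_def using o(1) a(1) by (simp add: G_def)
  moreover have "func_eq D (F \<circ>\<^sub>F G) id_func"
    unfolding func_eq_def using Go Ga by simp
  ultimately show ?thesis using F unfolding isomorphism_of_cats_def by blast
qed

end

lemma isomorphism_of_catsD:
  assumes "isomorphism_of_cats C D F"
  shows "y \<in> Ob D \<Longrightarrow> \<exists>x\<in>Ob C. FOb F x = y" "y' \<in> Ar D \<Longrightarrow> \<exists>x\<in>Ar C. FAr F x = y'"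
    "\<lbrakk>a \<in> Ob C; b \<in> Ob C; FOb F a = FOb F b\<rbrakk> \<Longrightarrow> a = b"
proof -
  obtain G where G: "functor D C G" "func_eq C (G \<circ>\<^sub>F F) id_func" "func_eq D (F \<circ>\<^sub>F G) id_func"
    using assms by (auto simp: isomorphism_of_cats_def)
  interpret G: functor_loc D C G by (rule functor_loc[OF G(1)])
  show "y \<in> Ob D \<Longrightarrow> \<exists>x\<in>Ob C. FOb F x = y" using G(3) by (intro bexI[of _ "FOb G y"]) (auto simp: func_eq_def)
  show "y' \<in> Ar D \<Longrightarrow> \<exists>x\<in>Ar C. FAr F x = y'" using G(3) by (intro bexI[of _ "FAr G y'"]) (auto simp: func_eq_def)
  show "\<lbrakk>a \<in> Ob C; b \<in> Ob C; FOb F a = FOb F b\<rbrakk> \<Longrightarrow> a = b" using G(2) by (metis func_eq_def comp_func_simps(1) id_func_simps(1))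
qed

lemma category_pullback_cat:
  assumes H: "functor B D H" and K: "functor C D K"
  shows "category (pullback_cat B C H K)"
proof -
  interpret H: functor_loc B D H by (rule functor_loc[OF H])
  interpret K: functor_loc C D K by (rule functor_loc[OF K])
  show ?thesis unfolding category_def
    by (auto simp: pullback_cat_def)
      (metis H.F_simps(2) K.F_simps(2) H.F_simps(3) K.F_simps(3))+
qed

lemma functor_to_pullback_cat:
  assumes P: "functor A B P" and Q: "functor A C Q" and H: "functor B D H" and K: "functor C D K"
    and e: "func_eq A (H \<circ>\<^sub>F P) (K \<circ>\<^sub>F Q)"
  shows "functor A (pullback_cat B C H K) \<lparr>FOb = (\<lambda>a. (FOb P a, FOb Q a)), FAr = (\<lambda>f. (FAr P f, FAr Q f))\<rparr>"
proof -
  interpret P: functor_loc A B P by (rule functor_loc[OF P])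
  interpret Q: functor_loc A C Q by (rule functor_loc[OF Q])
  show ?thesis using category_pullback_cat[OF H K] P.C.cat e unfolding functor_def func_eq_def
    by (auto simp: pullback_cat_def)
qed

context cart_ctx
begin

section \<open>Restriction along \<open>gamma\<close> and points over F(0)\<close>

lemma sharp_proj_inj:
  assumes "B \<in> Ob (UC A)" "X \<in> Ob (VC A)"
  shows "sharp_proj B X \<cdot>\<^sub>U inj1 (UC A) B (L0 X) = Ide (UC A) B" "sharp_proj B X \<cdot>\<^sub>U inj2 (UC A) B (L0 X) = adjunct B (zero_arrow (VC A) X (U0 B))"
  using assms by (simp_all add: sharp_proj_def)

lemma gamma_simps [simp]:
  assumes B: "B \<in> Ob (UC A)" and X: "X \<in> Ob (VC A)"
  shows "gamma A B X \<in> Ar (VC A)" "Dom (VC A) (gamma A B X) = flat_ob (VC A) (U0 B) X" "Cod (VC A) (gamma A B X) = tob B X"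
    "kap B X \<cdot>\<^sub>V gamma A B X = cotuple (VC A) (U1 (inj1 (UC A) B (L0 X))) (U1 (inj2 (UC A) B (L0 X)) \<cdot>\<^sub>V \<eta> X) \<cdot>\<^sub>V flat_kappa (VC A) (U0 B) X"
proof -
  let ?i1 = "inj1 (UC A) B (L0 X)" and ?i2 = "inj2 (UC A) B (L0 X)"
  have 1: "U1 (sharp_proj B X) \<cdot>\<^sub>V U1 ?i1 = Ide (VC A) (U0 B)" using U_eq[OF sharp_proj_inj(1)[OF B X]] B X by simp
  have 2: "U1 (sharp_proj B X) \<cdot>\<^sub>V U1 ?i2 = U1 (adjunct B (zero_arrow (VC A) X (U0 B)))" using U_eq[OF sharp_proj_inj(2)[OF B X]] B X by simp
  have 3: "U1 (sharp_proj B X) \<cdot>\<^sub>V (U1 ?i2 \<cdot>\<^sub>V \<eta> X) = zero_arrow (VC A) X (U0 B)"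
    by (subst V.cmp_ext1[OF 2]) (use B X in simp_all)
  have 4: "U1 (sharp_proj B X) \<cdot>\<^sub>V cotuple (VC A) (U1 ?i1) (U1 ?i2 \<cdot>\<^sub>V \<eta> X) = cotuple (VC A) (Ide (VC A) (U0 B)) (zero_arrow (VC A) X (U0 B))"
    using B X 1 3 by simp
  have "U1 (sharp_proj B X) \<cdot>\<^sub>V (cotuple (VC A) (U1 ?i1) (U1 ?i2 \<cdot>\<^sub>V \<eta> X) \<cdot>\<^sub>V flat_kappa (VC A) (U0 B) X) = zero_arrow (VC A) (flat_ob (VC A) (U0 B) X) (U0 B)"
    by (subst V.cmp_ext1[OF 4]) (use B X in simp_all)
  hence "annihilated (VC A) (U1 (sharp_proj B X)) (cotuple (VC A) (U1 ?i1) (U1 ?i2 \<cdot>\<^sub>V \<eta> X) \<cdot>\<^sub>V flat_kappa (VC A) (U0 B) X)"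
    by (intro V.annihilatedI) (use B X in simp_all)
  from V.factor_kernel[OF kap_kernel[OF B X] this] B X
  show "gamma A B X \<in> Ar (VC A)" "Dom (VC A) (gamma A B X) = flat_ob (VC A) (U0 B) X" "Cod (VC A) (gamma A B X) = tob B X"
    "kap B X \<cdot>\<^sub>V gamma A B X = cotuple (VC A) (U1 ?i1) (U1 ?i2 \<cdot>\<^sub>V \<eta> X) \<cdot>\<^sub>V flat_kappa (VC A) (U0 B) X"
    by (simp_all add: gamma_def)
qed

text \<open>Restriction of algebras along \<open>gamma\<close> corresponds to applying the right
  adjoint to points: the cotuple that defines \<open>gamma\<close>, followed by the image of the
  cover of the point, is the cotuple of \<open>U1 s\<close> and \<open>k\<close>.\<close>

lemma sact_point_action:
  assumes a: "sact B X \<xi> p s k"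
  shows "point_action (VC A) (U0 B) X (\<xi> \<cdot>\<^sub>V gamma A B X) (U1 p) (U1 s) k"
proof (rule V.point_actionI)
  note a' = sactD[OF a] and t = point_kernel_typed[OF sactD(1-3)[OF a]]
  let ?Q = "Dom (UC A) p" let ?m = "cotuple (UC A) s (adjunct ?Q k)"
  let ?i1 = "inj1 (UC A) B (L0 X)" and ?i2 = "inj2 (UC A) B (L0 X)"
  have m: "?m \<in> Ar (UC A)" "Dom (UC A) ?m = copB B X" "Cod (UC A) ?m = ?Q" using t a'(3) by simp_all
  have 1: "U1 ?m \<cdot>\<^sub>V U1 ?i1 = U1 s" by (rule U_eq) (use t a'(3) m in simp_all)
  have 2: "U1 ?m \<cdot>\<^sub>V U1 ?i2 = U1 (adjunct ?Q k)" by (rule U_eq) (use t a'(3) m in simp_all)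
  have 3: "U1 ?m \<cdot>\<^sub>V (U1 ?i2 \<cdot>\<^sub>V \<eta> X) = k" by (subst V.cmp_ext1[OF 2]) (use t a'(3) m in simp_all)
  have 4: "U1 ?m \<cdot>\<^sub>V cotuple (VC A) (U1 ?i1) (U1 ?i2 \<cdot>\<^sub>V \<eta> X) = cotuple (VC A) (U1 s) k"
    by (subst V.cotuple_comp) (use t(10,11) m 1 3 in simp_all)
  have "k \<cdot>\<^sub>V (\<xi> \<cdot>\<^sub>V gamma A B X) = U1 ?m \<cdot>\<^sub>V (kap B X \<cdot>\<^sub>V gamma A B X)"
    by (rule V.cmp_ext[OF a'(7)]) (use a'(3-6) t(7,8,10,11) m in simp_all)
  also have "\<dots> = cotuple (VC A) (U1 s) k \<cdot>\<^sub>V flat_kappa (VC A) (U0 B) X"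
    unfolding gamma_simps(4)[OF t(10,11)] by (rule V.cmp_ext1[OF 4]) (use t(10,11) m in simp_all)
  finally show "k \<cdot>\<^sub>V (\<xi> \<cdot>\<^sub>V gamma A B X) = cotuple (VC A) (U1 s) k \<cdot>\<^sub>V flat_kappa (VC A) (U0 B) X" .
  show "(U1 p, U1 s) \<in> Ob (Pt (VC A) (U0 B))" by (rule point_U[OF a'(1)])
  show "is_kernel (VC A) (U1 p) k" "Dom (VC A) k = X" by (rule a')+
  show "\<xi> \<cdot>\<^sub>V gamma A B X \<in> Ar (VC A)" "Dom (VC A) (\<xi> \<cdot>\<^sub>V gamma A B X) = flat_ob (VC A) (U0 B) X" "Cod (VC A) (\<xi> \<cdot>\<^sub>V gamma A B X) = X"
    using a'(4-6) t(10,11) by simp_all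
qed

lemma iota_F0: "iota A (F0 A) = Ide (UC A) (F0 A)"
  by (rule iota_unique[symmetric]) simp_all

lemma adjunct_from_zero:
  assumes "Q \<in> Ob (UC A)" "k \<in> Ar (VC A)" "Dom (VC A) k = X" "Cod (VC A) k = U0 Q" "t \<in> Ar (UC A)" "Dom (UC A) t = F0 A" "Cod (UC A) t = Q"
  shows "adjunct Q k \<cdot>\<^sub>U L1 (from_zero (VC A) X) = t"
proof (rule F0_unique)
  have "X \<in> Ob (VC A)" using assms by auto
  thus "adjunct Q k \<cdot>\<^sub>U L1 (from_zero (VC A) X) \<in> Ar (UC A)" "Dom (UC A) (adjunct Q k \<cdot>\<^sub>U L1 (from_zero (VC A) X)) = F0 A"
    "Cod (UC A) (adjunct Q k \<cdot>\<^sub>U L1 (from_zero (VC A) X)) = Cod (UC A) t"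
    using assms by (simp_all del: adjunct_pre)
qed (use assms in simp_all)

lemma xi0_simps [simp]:
  assumes X: "X \<in> Ob (VC A)"
  shows "xi0 A X \<in> Ar (VC A)" "Dom (VC A) (xi0 A X) = flat_ob (VC A) (U0 (F0 A)) X" "Cod (VC A) (xi0 A X) = X"
    "\<eta> X \<cdot>\<^sub>V xi0 A X = cotuple (VC A) (U1 (L1 (from_zero (VC A) X))) (\<eta> X) \<cdot>\<^sub>V flat_kappa (VC A) (U0 (F0 A)) X"
proof -
  let ?c = "cotuple (VC A) (U1 (L1 (from_zero (VC A) X))) (\<eta> X)" let ?t = "U1 (L1 (to_zero (VC A) X))"
  note pt = free_point[OF X, unfolded Pt_Ob_iff]
  have 1: "?t \<cdot>\<^sub>V U1 (L1 (from_zero (VC A) X)) = Ide (VC A) (U0 (F0 A))"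
    using U_eq[of "L1 (to_zero (VC A) X)" "L1 (from_zero (VC A) X)"] pt X by simp
  have 2: "?t \<cdot>\<^sub>V \<eta> X = zero_arrow (VC A) X (U0 (F0 A))" using V.kernelD(4)[OF unit_kernel[OF X]] X by simp
  have 3: "?t \<cdot>\<^sub>V ?c = cotuple (VC A) (Ide (VC A) (U0 (F0 A))) (zero_arrow (VC A) X (U0 (F0 A)))"
    by (subst V.cotuple_comp) (use X 1 2 in \<open>simp_all del: eta_nat\<close>)
  have "?t \<cdot>\<^sub>V (?c \<cdot>\<^sub>V flat_kappa (VC A) (U0 (F0 A)) X) = zero_arrow (VC A) (flat_ob (VC A) (U0 (F0 A)) X) (U0 (F0 A))"
    by (subst V.cmp_ext1[OF 3]) (use X in simp_all)
  hence "annihilated (VC A) ?t (?c \<cdot>\<^sub>V flat_kappa (VC A) (U0 (F0 A)) X)"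
    by (intro V.annihilatedI) (use X in simp_all)
  from V.factor_kernel[OF unit_kernel[OF X] this] X
  show "xi0 A X \<in> Ar (VC A)" "Dom (VC A) (xi0 A X) = flat_ob (VC A) (U0 (F0 A)) X" "Cod (VC A) (xi0 A X) = X"
    "\<eta> X \<cdot>\<^sub>V xi0 A X = ?c \<cdot>\<^sub>V flat_kappa (VC A) (U0 (F0 A)) X"
    by (simp_all add: xi0_def)
qed

text \<open>Every point over \<open>F(0)\<close> carries the action \<open>xi0\<close>, because the transpose of its kernel is
  compatible with the sections by initiality.\<close>

lemma xi0_point_action:
  assumes x: "(q, t) \<in> Ob (Pt (UC A) (F0 A))" and k: "is_kernel (VC A) (U1 q) k" and X: "Dom (VC A) k = X"
  shows "point_action (VC A) (U0 (F0 A)) X (xi0 A X) (U1 q) (U1 t) k"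
proof (rule V.point_actionI)
  note u = point_kernel_typed[OF x k X]
  let ?Q = "Dom (UC A) q" let ?c = "cotuple (VC A) (U1 (L1 (from_zero (VC A) X))) (\<eta> X)"
  have h: "adjunct ?Q k \<in> Ar (UC A)" "Dom (UC A) (adjunct ?Q k) = L0 X" "Cod (UC A) (adjunct ?Q k) = ?Q" using u X by simp_all
  have ht: "adjunct ?Q k \<cdot>\<^sub>U L1 (from_zero (VC A) X) = t" by (rule adjunct_from_zero) (use u X in simp_all)
  have 1: "U1 (adjunct ?Q k) \<cdot>\<^sub>V U1 (L1 (from_zero (VC A) X)) = U1 t" by (rule U_eq[OF ht]) (use u(11) h in simp_all)
  have 2: "U1 (adjunct ?Q k) \<cdot>\<^sub>V \<eta> X = k" by (rule U_adjunct) (use u X in simp_all)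
  have 3: "U1 (adjunct ?Q k) \<cdot>\<^sub>V ?c = cotuple (VC A) (U1 t) k" by (subst V.cotuple_comp) (use u(11) h 1 2 in simp_all)
  have "k \<cdot>\<^sub>V xi0 A X = U1 (adjunct ?Q k) \<cdot>\<^sub>V (\<eta> X \<cdot>\<^sub>V xi0 A X)" by (rule V.cmp_ext1[OF 2, symmetric]) (use u(11) h in simp_all)
  also have "\<dots> = cotuple (VC A) (U1 t) k \<cdot>\<^sub>V flat_kappa (VC A) (U0 (F0 A)) X"
    unfolding xi0_simps(4)[OF u(11)] by (rule V.cmp_ext1[OF 3]) (use u(11) h in simp_all)
  finally show "k \<cdot>\<^sub>V xi0 A X = cotuple (VC A) (U1 t) k \<cdot>\<^sub>V flat_kappa (VC A) (U0 (F0 A)) X" .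
  show "(U1 q, U1 t) \<in> Ob (Pt (VC A) (U0 (F0 A)))" by (rule point_U[OF x])
qed (use k X point_kernel_typed[OF x k X] in simp_all)

lemma U_Pt_arrow:
  assumes h: "((p, s), h, (q, t)) \<in> Ar (Pt (UC A) B)"
  shows "((U1 p, U1 s), U1 h, (U1 q, U1 t)) \<in> Ar (Pt (VC A) (U0 B))"
proof -
  have h': "(p, s) \<in> Ob (Pt (UC A) B)" "(q, t) \<in> Ob (Pt (UC A) B)" "h \<in> Ar (UC A)" "Dom (UC A) h = Dom (UC A) p" "Cod (UC A) h = Dom (UC A) q"
    "q \<cdot>\<^sub>U h = p" "h \<cdot>\<^sub>U s = t" using h by (simp_all add: Pt_Ar_iff)
  have o: "p \<in> Ar (UC A)" "q \<in> Ar (UC A)" "s \<in> Ar (UC A)" "Cod (UC A) s = Dom (UC A) p" using h'(1,2) by (simp_all add: Pt_Ob_iff)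
  have "U1 q \<cdot>\<^sub>V U1 h = U1 p" by (rule U_eq[OF h'(6)]) (use h' o in simp_all)
  moreover have "U1 h \<cdot>\<^sub>V U1 s = U1 t" by (rule U_eq[OF h'(7)]) (use h' o in simp_all)
  ultimately show ?thesis using point_U[OF h'(1)] point_U[OF h'(2)] h'(3-5) o by (simp add: Pt_Ar_iff)
qed

lemma reflect_Pt_arrow:
  assumes x: "(p, s) \<in> Ob (Pt (UC A) B)" "(q, t) \<in> Ob (Pt (UC A) B)"
    and h: "h \<in> Ar (UC A)" "Dom (UC A) h = Dom (UC A) p" "Cod (UC A) h = Dom (UC A) q"
    and e: "((U1 p, U1 s), U1 h, (U1 q, U1 t)) \<in> Ar (Pt (VC A) (U0 B))"
  shows "((p, s), h, (q, t)) \<in> Ar (Pt (UC A) B)"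
proof -
  have o: "p \<in> Ar (UC A)" "q \<in> Ar (UC A)" "s \<in> Ar (UC A)" "t \<in> Ar (UC A)" "Cod (UC A) s = Dom (UC A) p" "Dom (UC A) s = B"
    "Dom (UC A) t = B" "Cod (UC A) t = Dom (UC A) q" "Cod (UC A) p = B" "Cod (UC A) q = B" using x by (simp_all add: Pt_Ob_iff)
  have "q \<cdot>\<^sub>U h = p" by (rule faithful) (use o h e in \<open>simp_all add: Pt_Ar_iff\<close>)
  moreover have "h \<cdot>\<^sub>U s = t" by (rule faithful) (use o h e in \<open>simp_all add: Pt_Ar_iff\<close>)
  ultimately show ?thesis using x h by (simp add: Pt_Ar_iff)
qed

text \<open>The transpose of the kernel inclusion is compatible with the sections by initiality of
  F(0), and it is the identity on kernels. So every point over F(0) is the free one on its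
  kernel.\<close>

lemma free_point_iso:
  assumes x: "(q, t) \<in> Ob (Pt (UC A) (F0 A))" and k: "is_kernel (VC A) (U1 q) k" and X: "Dom (VC A) k = X"
  shows "((L1 (to_zero (VC A) X), L1 (from_zero (VC A) X)), adjunct (Dom (UC A) q) k, (q, t)) \<in> Ar (Pt (UC A) (F0 A))"
    "iso (UC A) (adjunct (Dom (UC A) q) k)"
proof -
  note u = point_kernel_typed[OF x k X]
  let ?h = "adjunct (Dom (UC A) q) k"
  have h: "?h \<in> Ar (UC A)" "Dom (UC A) ?h = L0 X" "Cod (UC A) ?h = Dom (UC A) q" using u X by simp_all
  have "q \<cdot>\<^sub>U ?h = adjunct (F0 A) (zero_arrow (VC A) X (U0 (F0 A)))" using u X by simp
  also have "\<dots> = L1 (to_zero (VC A) X)"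
    using iota_L1_to_zero[OF F0_Ob u(11)] u(11) by (simp add: iota_F0 del: iota_L1_to_zero)
  finally have 1: "q \<cdot>\<^sub>U ?h = L1 (to_zero (VC A) X)" .
  have 2: "?h \<cdot>\<^sub>U L1 (from_zero (VC A) X) = t" by (rule adjunct_from_zero) (use u X in simp_all)
  show a: "((L1 (to_zero (VC A) X), L1 (from_zero (VC A) X)), ?h, (q, t)) \<in> Ar (Pt (UC A) (F0 A))"
    unfolding Pt_Ar_iff using free_point[OF u(11)] x h 1 2 u(11) by (simp del: adjunct_pre adjunct_comp)
  have "iso (VC A) (U1 ?h)"
    by (rule V.short_five[OF U_Pt_arrow[OF a] unit_kernel[OF u(11)] k, of "Ide (VC A) X"]) (use u X in simp_all)
  thus "iso (UC A) ?h" by (rule conservative[OF h(1)])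
qed

lemma kernel_arrow:
  assumes h: "((p, s), h, (q, t)) \<in> Ar (Pt (VC A) D)" and k: "is_kernel (VC A) p k" and l: "is_kernel (VC A) q l"
  obtains f where "f \<in> Ar (VC A)" "Dom (VC A) f = Dom (VC A) k" "Cod (VC A) f = Dom (VC A) l" "h \<cdot>\<^sub>V k = l \<cdot>\<^sub>V f"
proof -
  have h': "h \<in> Ar (VC A)" "Dom (VC A) h = Dom (VC A) p" "Cod (VC A) h = Dom (VC A) q" "q \<cdot>\<^sub>V h = p" "Cod (VC A) p = D" "Cod (VC A) q = D"
    using h by (simp_all add: Pt_Ar_iff Pt_Ob_iff)
  note kt = V.kernelD[OF k] and lt = V.kernelD[OF l]
  have "q \<cdot>\<^sub>V (h \<cdot>\<^sub>V k) = p \<cdot>\<^sub>V k" by (rule V.cmp_ext1[OF h'(4)]) (use h' kt(1-3) lt(1-3) in simp_all)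
  hence "annihilated (VC A) q (h \<cdot>\<^sub>V k)" by (intro V.annihilatedI) (use h' kt lt in simp_all)
  moreover have "Dom (VC A) (h \<cdot>\<^sub>V k) = Dom (VC A) k" using h' kt by simp
  ultimately show thesis using V.kernel_fact[OF l _ _ refl] that by metis
qed

text \<open>The first point is free on its kernel, so the restriction \<open>f\<close> of
  \<open>h\<close> to kernels transposes to an arrow of \<open>UC A\<close>. Its image agrees with
  \<open>h\<close> on the section, by initiality, and on the kernel.\<close>

lemma full_over_F0:
  assumes x: "(q1, t1) \<in> Ob (Pt (UC A) (F0 A))" "(q2, t2) \<in> Ob (Pt (UC A) (F0 A))"
    and h: "((U1 q1, U1 t1), h, (U1 q2, U1 t2)) \<in> Ar (Pt (VC A) (U0 (F0 A)))"
  obtains h' where "((q1, t1), h', (q2, t2)) \<in> Ar (Pt (UC A) (F0 A))" "U1 h' = h"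
proof -
  have qA: "q1 \<in> Ar (UC A)" "q2 \<in> Ar (UC A)" using x by (simp_all add: Pt_Ob_iff)
  obtain k1 where k1: "is_kernel (VC A) (U1 q1) k1" using V.ker_ex qA by (meson U_simps(1))
  obtain k2 where k2: "is_kernel (VC A) (U1 q2) k2" using V.ker_ex qA by (meson U_simps(1))
  define X1 X2 where "X1 = Dom (VC A) k1" and "X2 = Dom (VC A) k2"
  have X: "Dom (VC A) k1 = X1" "Dom (VC A) k2 = X2" by (simp_all add: X1_def X2_def)
  note u = point_kernel_typed[OF x(1) k1 X(1)] and v = point_kernel_typed[OF x(2) k2 X(2)]
  note i = free_point_iso[OF x(1) k1 X(1)]
  obtain f where f: "f \<in> Ar (VC A)" "Dom (VC A) f = X1" "Cod (VC A) f = X2" and fe: "h \<cdot>\<^sub>V k1 = k2 \<cdot>\<^sub>V f"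
    using kernel_arrow[OF h k1 k2] X by metis
  have ht: "h \<in> Ar (VC A)" "Dom (VC A) h = U0 (Dom (UC A) q1)" "Cod (VC A) h = U0 (Dom (UC A) q2)" "h \<cdot>\<^sub>V U1 t1 = U1 t2"
    using h qA by (simp_all add: Pt_Ar_iff)
  obtain j where ij: "inverse_arrows (UC A) (adjunct (Dom (UC A) q1) k1) j"
    and jp: "((q1, t1), j, (L1 (to_zero (VC A) X1), L1 (from_zero (VC A) X1))) \<in> Ar (Pt (UC A) (F0 A))"
    by (rule U.Pt_inverse[OF i])
  note j = U.invD[OF ij]
  have jt: "j \<in> Ar (UC A)" "Dom (UC A) j = Dom (UC A) q1" "Cod (UC A) j = L0 X1" using j(1-4) u X by simp_all
  let ?h0 = "adjunct (Dom (UC A) q2) (k2 \<cdot>\<^sub>V f)"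
  have h0: "?h0 \<in> Ar (UC A)" "Dom (UC A) ?h0 = L0 X1" "Cod (UC A) ?h0 = Dom (UC A) q2" using v X f by simp_all
  have h0k: "U1 ?h0 \<cdot>\<^sub>V \<eta> X1 = k2 \<cdot>\<^sub>V f" by (rule U_adjunct) (use v X f in simp_all)
  have jk: "U1 j \<cdot>\<^sub>V k1 = \<eta> X1"
  proof -
    have "U1 j \<cdot>\<^sub>V U1 (adjunct (Dom (UC A) q1) k1) = U1 (Ide (UC A) (L0 X1))"
      by (rule U_eq) (use j(1-5) u X in simp_all)
    from V.cmp_ext1[OF this, of "\<eta> X1"] show ?thesis using jt u X by simp
  qed
  have "U1 (?h0 \<cdot>\<^sub>U j) = h"
  proof (rule V.section_kernel_joint_epi[OF point_U[OF x(1)] k1])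
    have "?h0 \<cdot>\<^sub>U j \<cdot>\<^sub>U t1 = t2" by (rule F0_unique) (use h0 jt u v in simp_all)
    hence "U1 (?h0 \<cdot>\<^sub>U j) \<cdot>\<^sub>V U1 t1 = U1 t2" by (intro U_eq) (use h0 jt u in simp_all)
    thus "U1 (?h0 \<cdot>\<^sub>U j) \<cdot>\<^sub>V U1 t1 = h \<cdot>\<^sub>V U1 t1" using ht by simp
    show "U1 (?h0 \<cdot>\<^sub>U j) \<cdot>\<^sub>V k1 = h \<cdot>\<^sub>V k1" unfolding fe using h0 jt u h0k jk by simp
  qed (use h0 jt u ht in simp_all)
  moreover from this have "((q1, t1), ?h0 \<cdot>\<^sub>U j, (q2, t2)) \<in> Ar (Pt (UC A) (F0 A))"
    by (intro reflect_Pt_arrow[OF x]) (use h h0 jt in simp_all)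
  ultimately show thesis using that by blast
qed

lemma iota_flat_simps [simp]:
  assumes "B \<in> Ob (UC A)" "X \<in> Ob (VC A)"
  shows "iota_flat A B X \<in> Ar (VC A)" "Dom (VC A) (iota_flat A B X) = flat_ob (VC A) (U0 (F0 A)) X"
    "Cod (VC A) (iota_flat A B X) = flat_ob (VC A) (U0 B) X"
  unfolding iota_flat_def using V.flat_map_simps(1-3)[of "U1 (iota A B)" "U0 (F0 A)" "U0 B" X] assms by simp_all

text \<open>The pullback is arbitrary because it is the image of a pullback of \<open>UC A\<close>
  in \<open>sact_coherent\<close> and the chosen one in
  \<open>base_change_point_action\<close>.\<close>

lemma point_action_iota:
  assumes B: "B \<in> Ob (UC A)" and a: "point_action (VC A) (U0 B) X \<xi> p s k"
    and pb: "is_pullback (VC A) (U1 (iota A B)) p r q"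
    and z: "z \<in> Ar (VC A)" "Dom (VC A) z = U0 (F0 A)" "Cod (VC A) z = Dom (VC A) r" "r \<cdot>\<^sub>V z = Ide (VC A) (U0 (F0 A))" "q \<cdot>\<^sub>V z = s \<cdot>\<^sub>V U1 (iota A B)"
  obtains k' where "point_action (VC A) (U0 (F0 A)) X (\<xi> \<cdot>\<^sub>V iota_flat A B X) r z k'" "q \<cdot>\<^sub>V k' = k"
proof -
  obtain k' where k': "is_kernel (VC A) r k'" "Dom (VC A) k' = Dom (VC A) k" "q \<cdot>\<^sub>V k' = k"
    by (rule V.kernel_of_base_change[OF pb V.point_actionD(2)[OF a]])
  have "point_action (VC A) (U0 (F0 A)) X (\<xi> \<cdot>\<^sub>V flat_map (VC A) (U1 (iota A B)) (Ide (VC A) X)) r z k'"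
    by (rule V.point_action_base_change[OF a pb _ z]) (use k' B V.point_actionD(3)[OF a] in simp_all)
  thus thesis using that k'(3) by (simp add: iota_flat_def)
qed

text \<open>The point is pulled back along \<open>iota A B\<close> inside \<open>UC A\<close>. The
  right adjoint preserves this pullback, so the restricted action belongs to the image of a point
  over F(0), which carries \<open>xi0\<close>; an action is determined by its point and
  kernel.\<close>

lemma sact_coherent:
  assumes a: "sact B X \<xi> p s k"
  shows "coherent A B X (\<xi> \<cdot>\<^sub>V gamma A B X)"
proof -
  note a' = sactD[OF a] and t = point_kernel_typed[OF sactD(1-3)[OF a]]
  have i: "iota A B \<in> Ar (UC A)" "Dom (UC A) (iota A B) = F0 A" "Cod (UC A) (iota A B) = B" using t(10) by simp_all
  obtain r q where pb: "is_pullback (UC A) (iota A B) p r q" using U.pb_ex[of "iota A B" p] i t by auto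
  note T = U.pb_typed[OF pb]
  define z where "z = pb_lift (UC A) r q (Ide (UC A) (Dom (UC A) (iota A B))) (s \<cdot>\<^sub>U iota A B)"
  have x: "(p, s) \<in> Ob (Pt (UC A) (Cod (UC A) (iota A B)))" using a'(1) i by simp
  note z = U.pt_section_lift[OF i(1) x pb, folded z_def, unfolded i(2)]
  have Uz: "U1 z \<in> Ar (VC A)" "Dom (VC A) (U1 z) = U0 (F0 A)" "Cod (VC A) (U1 z) = Dom (VC A) (U1 r)" using z T by simp_all
  have 1: "U1 r \<cdot>\<^sub>V U1 z = Ide (VC A) (U0 (F0 A))" using U_eq[OF z(4)] z T by simp
  have "U1 (q \<cdot>\<^sub>U z) = U1 (s \<cdot>\<^sub>U iota A B)" by (simp only: z(5))
  hence 2: "U1 q \<cdot>\<^sub>V U1 z = U1 s \<cdot>\<^sub>V U1 (iota A B)" using z(1-3) T(4-8) t i by simp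
  obtain k' where k': "point_action (VC A) (U0 (F0 A)) X (\<xi> \<cdot>\<^sub>V gamma A B X \<cdot>\<^sub>V iota_flat A B X) (U1 r) (U1 z) k'"
    by (rule point_action_iota[OF t(10) sact_point_action[OF a] U_pullback[OF pb] Uz 1 2])
  note kd = V.point_actionD(2,3)[OF k']
  show ?thesis unfolding coherent_def
    by (rule V.point_action_unique[OF k' xi0_point_action[OF z(6) kd]])
qed

section \<open>The two conditions on points and their equivalence with \<open>BAT\<close>\<close>

definition points_lift :: bool where
  "points_lift \<longleftrightarrow> (\<forall>B\<in>Ob (UC A). \<forall>X \<xi> p s k. point_action (VC A) (U0 B) X \<xi> p s k \<longrightarrow> coherent A B X \<xi> \<longrightarrow>
    (\<exists>p' s' \<sigma>. lifts_point A B p' s' \<sigma> p s))"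

text \<open>The ends of the lifted arrow are the given points of \<open>UC A\<close>, not points
  isomorphic to them; from \<open>BAT\<close> this strict form is reached by fullness on
  isomorphisms.\<close>

definition points_full :: bool where
  "points_full \<longleftrightarrow> (\<forall>B\<in>Ob (UC A). \<forall>p1 s1 p2 s2 h. (p1, s1) \<in> Ob (Pt (UC A) B) \<longrightarrow> (p2, s2) \<in> Ob (Pt (UC A) B) \<longrightarrow>
    ((U1 p1, U1 s1), h, (U1 p2, U1 s2)) \<in> Ar (Pt (VC A) (U0 B)) \<longrightarrow>
    (\<exists>h'. ((p1, s1), h', (p2, s2)) \<in> Ar (Pt (UC A) B) \<and> U1 h' = h))"

lemma lifts_arrow:
  assumes l: "lifts_point A B p' s' \<sigma> p s" and x: "(p, s) \<in> Ob (Pt (VC A) (U0 B))"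
  shows "(p', s') \<in> Ob (Pt (UC A) B)" "((U1 p', U1 s'), \<sigma>, (p, s)) \<in> Ar (Pt (VC A) (U0 B))" "iso (VC A) \<sigma>"
proof -
  show a: "(p', s') \<in> Ob (Pt (UC A) B)" "iso (VC A) \<sigma>" using l by (simp_all add: lifts_point_def)
  have "p' \<in> Ar (UC A)" using a(1) by (simp add: Pt_Ob_iff)
  thus "((U1 p', U1 s'), \<sigma>, (p, s)) \<in> Ar (Pt (VC A) (U0 B))"
    using l x point_U[OF a(1)] by (simp add: lifts_point_def Pt_Ar_iff)
qed

lemma arrow_lifts:
  assumes x: "(p', s') \<in> Ob (Pt (UC A) B)" and h: "((U1 p', U1 s'), \<sigma>, (p, s)) \<in> Ar (Pt (VC A) (U0 B))" and i: "iso (VC A) \<sigma>"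
  shows "lifts_point A B p' s' \<sigma> p s"
proof -
  have "p' \<in> Ar (UC A)" using x by (simp add: Pt_Ob_iff)
  thus ?thesis using x h i by (simp add: lifts_point_def Pt_Ar_iff)
qed

lemma sact_chosen:
  assumes x: "(p, s) \<in> Ob (Pt (UC A) B)"
  obtains X \<xi> k where "sact B X \<xi> p s k"
proof -
  have "p \<in> Ar (UC A)" using x by (simp add: Pt_Ob_iff)
  then obtain k where k: "is_kernel (VC A) (U1 p) k" using V.ker_ex by (meson U_simps(1))
  show thesis by (rule sact_ex[OF x k refl]) (rule that)
qed

text \<open>Images of points over \<open>B\<close> have coherent actions, so \<open>BAT\<close>
  applies to arrows between them. Conversely, an arrow between points with coherent actions is
  conjugated into one between images of points, which then lifts.\<close>

lemma BAT_iff: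
  assumes full: "full_on_isos (UC A) (VC A) (Radj A)"
  shows "BAT A \<longleftrightarrow> points_lift \<and> points_full"
proof (intro iffI conjI)
  assume bat: "BAT A"
  show points_lift unfolding points_lift_def
  proof (intro ballI allI impI)
    fix B X \<xi> p s k assume B: "B \<in> Ob (UC A)" and a: "point_action (VC A) (U0 B) X \<xi> p s k" and c: "coherent A B X \<xi>"
    have "relative_action A B X \<xi>" using V.point_action_algebra[OF a] by (simp add: relative_action_def action_def)
    hence "ideal_action A B X \<xi>" using bat B c by (simp add: BAT_def)
    moreover have "assoc_point (VC A) (U0 B) X \<xi> p s k" using a by (simp add: point_action_def)
    ultimately show "\<exists>p' s' \<sigma>. lifts_point A B p' s' \<sigma> p s" unfolding ideal_action_def ideal_point_def by blast
  qed
  show points_full unfolding points_full_def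
  proof (intro ballI allI impI)
    fix B p1 s1 p2 s2 h assume B: "B \<in> Ob (UC A)" and x: "(p1, s1) \<in> Ob (Pt (UC A) B)" "(p2, s2) \<in> Ob (Pt (UC A) B)"
      and h: "((U1 p1, U1 s1), h, (U1 p2, U1 s2)) \<in> Ar (Pt (VC A) (U0 B))"
    have pA: "p1 \<in> Ar (UC A)" "p2 \<in> Ar (UC A)" using x by (simp_all add: Pt_Ob_iff)
    obtain X1 \<xi>1 k1 where a1: "sact B X1 \<xi>1 p1 s1 k1" by (rule sact_chosen[OF x(1)])
    obtain X2 \<xi>2 k2 where a2: "sact B X2 \<xi>2 p2 s2 k2" by (rule sact_chosen[OF x(2)])
    note b1 = sact_point_action[OF a1] and b2 = sact_point_action[OF a2]
    obtain f where f: "f \<in> Ar (VC A)" "Dom (VC A) f = X1" "Cod (VC A) f = X2" and fe: "h \<cdot>\<^sub>V k1 = k2 \<cdot>\<^sub>V f"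
      using kernel_arrow[OF h sactD(2)[OF a1] sactD(2)[OF a2]] sactD(3)[OF a1] sactD(3)[OF a2] by metis
    have "((X1, \<xi>1 \<cdot>\<^sub>V gamma A B X1), f, (X2, \<xi>2 \<cdot>\<^sub>V gamma A B X2)) \<in> Ar (Alg (VC A) (UB_monad A B))"
      unfolding UB_monad_def by (rule V.point_morphism_action[OF b1 b2 h f fe])
    hence "ideal_action_morphism A B (X1, \<xi>1 \<cdot>\<^sub>V gamma A B X1) f (X2, \<xi>2 \<cdot>\<^sub>V gamma A B X2)"
      using bat B sact_coherent[OF a1] sact_coherent[OF a2] unfolding BAT_def by blast
    hence "ideal_point_morphism A B (U1 p1, U1 s1) h (U1 p2, U1 s2)"
      using b1 b2 h fe unfolding ideal_action_morphism_def point_action_def by auto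
    then obtain p1' s1' \<sigma>1 p2' s2' \<sigma>2 h0 where l1: "lifts_point A B p1' s1' \<sigma>1 (U1 p1) (U1 s1)" and l2: "lifts_point A B p2' s2' \<sigma>2 (U1 p2) (U1 s2)"
      and h0: "((p1', s1'), h0, (p2', s2')) \<in> Ar (Pt (UC A) B)" and he: "h \<cdot>\<^sub>V \<sigma>1 = \<sigma>2 \<cdot>\<^sub>V U1 h0"
      unfolding ideal_point_morphism_def by auto
    have pA': "p1' \<in> Ar (UC A)" "p2' \<in> Ar (UC A)" "h0 \<in> Ar (UC A)" "Dom (UC A) h0 = Dom (UC A) p1'" "Cod (UC A) h0 = Dom (UC A) p2'"
      using h0 by (simp_all add: Pt_Ar_iff Pt_Ob_iff)
    \<comment> \<open>\<open>BAT\<close> lifts \<open>h\<close> only between points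
      \<open>p1'\<close> and \<open>p2'\<close> that correspond to the given ones. Fullness on
      isomorphisms lifts the comparisons \<open>\<sigma>1\<close> and \<open>\<sigma>2\<close> to
      \<open>UC A\<close>, so that \<open>h0\<close> can be conjugated there.\<close>
    have "\<exists>\<beta>\<in>Hom (UC A) (Dom (UC A) p1') (Dom (UC A) p1). iso (UC A) \<beta> \<and> U1 \<beta> = \<sigma>1"
      using full l1 pA pA' unfolding full_on_isos_def lifts_point_def by auto
    then obtain \<beta>1 where \<beta>1: "\<beta>1 \<in> Ar (UC A)" "Dom (UC A) \<beta>1 = Dom (UC A) p1'" "Cod (UC A) \<beta>1 = Dom (UC A) p1" "iso (UC A) \<beta>1" "U1 \<beta>1 = \<sigma>1" by auto
    have "\<exists>\<beta>\<in>Hom (UC A) (Dom (UC A) p2') (Dom (UC A) p2). iso (UC A) \<beta> \<and> U1 \<beta> = \<sigma>2"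
      using full l2 pA pA' unfolding full_on_isos_def lifts_point_def by auto
    then obtain \<beta>2 where \<beta>2: "\<beta>2 \<in> Ar (UC A)" "Dom (UC A) \<beta>2 = Dom (UC A) p2'" "Cod (UC A) \<beta>2 = Dom (UC A) p2" "iso (UC A) \<beta>2" "U1 \<beta>2 = \<sigma>2" by auto
    obtain j where bj: "inverse_arrows (UC A) \<beta>1 j" using \<beta>1(4) by (rule U.isoE)
    note j = U.invD[OF bj]
    define h' where "h' = \<beta>2 \<cdot>\<^sub>U (h0 \<cdot>\<^sub>U j)"
    have h't: "h' \<in> Ar (UC A)" "Dom (UC A) h' = Dom (UC A) p1" "Cod (UC A) h' = Dom (UC A) p2"
      unfolding h'_def using \<beta>1 \<beta>2 pA' j(1-4) by simp_all
    have ht: "h \<in> Ar (VC A)" "Dom (VC A) h = U0 (Dom (UC A) p1)" "Cod (VC A) h = U0 (Dom (UC A) p2)" using h pA by (simp_all add: Pt_Ar_iff)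
    have "U1 h' = U1 \<beta>2 \<cdot>\<^sub>V (U1 h0 \<cdot>\<^sub>V U1 j)" unfolding h'_def using \<beta>1(1-3) \<beta>2(1-3) pA' j(1-4) by simp
    also have "\<dots> = h \<cdot>\<^sub>V (U1 \<beta>1 \<cdot>\<^sub>V U1 j)"
      by (rule V.cmp_ext[OF he[folded \<beta>1(5) \<beta>2(5), symmetric]]) (use \<beta>1(1-3) \<beta>2(1-3) pA' j(1-4) ht in simp_all)
    also have "U1 \<beta>1 \<cdot>\<^sub>V U1 j = Ide (VC A) (U0 (Dom (UC A) p1))"
      using U_eq[OF j(6)] j(1-4) \<beta>1(1-3) pA by simp
    finally have "U1 h' = h" using ht by simp
    moreover from this have "((p1, s1), h', (p2, s2)) \<in> Ar (Pt (UC A) B)"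
      by (intro reflect_Pt_arrow[OF x h't]) (use h in simp)
    ultimately show "\<exists>h'. ((p1, s1), h', (p2, s2)) \<in> Ar (Pt (UC A) B) \<and> U1 h' = h" by blast
  qed
next
  assume "points_lift \<and> points_full"
  hence pl: points_lift and pf: points_full by auto
  show "BAT A" unfolding BAT_def
  proof (intro conjI ballI allI impI)
    fix B X \<xi> assume B: "B \<in> Ob (UC A)" and r: "relative_action A B X \<xi>" and c: "coherent A B X \<xi>"
    have t: "\<xi> \<in> Ar (VC A)" "Dom (VC A) \<xi> = flat_ob (VC A) (U0 B) X" "Cod (VC A) \<xi> = X"
      using V.flat_Alg_Ob_typed(2-4)[of X \<xi> "U0 B"] r by (simp_all add: relative_action_def action_def)
    show "ideal_action A B X \<xi>" unfolding ideal_action_def ideal_point_def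
    proof (intro conjI allI impI)
      fix p s k assume a: "assoc_point (VC A) (U0 B) X \<xi> p s k"
      thus "(p, s) \<in> Ob (Pt (VC A) (U0 B))" by (simp add: assoc_point_def)
      have "point_action (VC A) (U0 B) X \<xi> p s k" using a t by (simp add: point_action_def)
      thus "\<exists>p' s' \<sigma>. lifts_point A B p' s' \<sigma> p s" using pl B c unfolding points_lift_def by blast
    qed (rule r)
  next
    fix B X1 \<xi>1 X2 \<xi>2 f assume B: "B \<in> Ob (UC A)" and f: "((X1, \<xi>1), f, (X2, \<xi>2)) \<in> Ar (Alg (VC A) (UB_monad A B))"
      and c: "coherent A B X1 \<xi>1" "coherent A B X2 \<xi>2"
    note ft = V.flat_Alg_Ar_typed[OF U_simps(4)[OF B] f[unfolded UB_monad_def]]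
    note t1 = V.flat_Alg_Ob_typed[OF ft(4)] and t2 = V.flat_Alg_Ob_typed[OF ft(5)]
    show "ideal_action_morphism A B (X1, \<xi>1) f (X2, \<xi>2)" unfolding ideal_action_morphism_def fst_conv snd_conv
    proof (intro conjI allI impI f)
      fix p1 s1 k1 p2 s2 k2 h
      assume "assoc_point (VC A) (U0 B) X1 \<xi>1 p1 s1 k1" "assoc_point (VC A) (U0 B) X2 \<xi>2 p2 s2 k2"
        and h: "((p1, s1), h, (p2, s2)) \<in> Ar (Pt (VC A) (U0 B))" and e: "h \<cdot>\<^sub>V k1 = k2 \<cdot>\<^sub>V f"
      hence a: "point_action (VC A) (U0 B) X1 \<xi>1 p1 s1 k1" "point_action (VC A) (U0 B) X2 \<xi>2 p2 s2 k2"
        using t1 t2 by (simp_all add: point_action_def)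
      obtain p1' s1' \<sigma>1 where l1: "lifts_point A B p1' s1' \<sigma>1 p1 s1" using pl B a(1) c(1) unfolding points_lift_def by blast
      obtain p2' s2' \<sigma>2 where l2: "lifts_point A B p2' s2' \<sigma>2 p2 s2" using pl B a(2) c(2) unfolding points_lift_def by blast
      note m1 = lifts_arrow[OF l1 V.point_actionD(1)[OF a(1)]] and m2 = lifts_arrow[OF l2 V.point_actionD(1)[OF a(2)]]
      obtain \<tau> where st: "inverse_arrows (VC A) \<sigma>2 \<tau>" and tp: "((p2, s2), \<tau>, (U1 p2', U1 s2')) \<in> Ar (Pt (VC A) (U0 B))"
        by (rule V.Pt_inverse[OF m2(2,3)])
      \<comment> \<open>Conjugation by the comparison isomorphisms moves \<open>h\<close> between
        images of points, where \<open>points_full\<close> applies.\<close>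
      have "((U1 p1', U1 s1'), \<tau> \<cdot>\<^sub>V (h \<cdot>\<^sub>V \<sigma>1), (U1 p2', U1 s2')) \<in> Ar (Pt (VC A) (U0 B))"
        by (rule V.Pt_comp[OF V.Pt_comp[OF m1(2) h] tp])
      then obtain h' where h': "((p1', s1'), h', (p2', s2')) \<in> Ar (Pt (UC A) B)" "U1 h' = \<tau> \<cdot>\<^sub>V (h \<cdot>\<^sub>V \<sigma>1)"
        using pf B m1(1) m2(1) unfolding points_full_def by blast
      have hs: "h \<cdot>\<^sub>V \<sigma>1 \<in> Ar (VC A)" "Cod (VC A) (h \<cdot>\<^sub>V \<sigma>1) = Cod (VC A) \<sigma>2"
        using h m1(2) m2(2) by (simp_all add: Pt_Ar_iff)
      have "h \<cdot>\<^sub>V \<sigma>1 = \<sigma>2 \<cdot>\<^sub>V U1 h'" unfolding h'(2) using V.invD(8)[OF st hs] by simp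
      thus "ideal_point_morphism A B (p1, s1) h (p2, s2)"
        unfolding ideal_point_morphism_def fst_conv snd_conv using h l1 l2 h'(1) by blast
    qed
  qed
qed

end

section \<open>The pullback of categories of algebras\<close>

lemma category_Alg_functor:
  assumes "category C" "category (Alg D T)"
    and "\<And>X. X \<in> Ob C \<Longrightarrow> (FOb F X) \<in> Ob (Alg D T)"
    and "\<And>f. f \<in> Ar C \<Longrightarrow> FAr F f \<in> Ar (Alg D T) \<and> Dom (Alg D T) (FAr F f) = FOb F (Dom C f) \<and> Cod (Alg D T) (FAr F f) = FOb F (Cod C f)"
    and "\<And>X. X \<in> Ob C \<Longrightarrow> FAr F (Ide C X) = Ide (Alg D T) (FOb F X)"
    and "\<And>f g. f \<in> Ar C \<Longrightarrow> g \<in> Ar C \<Longrightarrow> Cod C f = Dom C g \<Longrightarrow> FAr F (g \<cdot>\<^bsub>C\<^esub> f) = FAr F g \<cdot>\<^bsub>Alg D T\<^esub> FAr F f"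
  shows "functor C (Alg D T) F"
  using assms unfolding functor_def by auto

lemma functor_alg_restrict:
  assumes C: "category (Alg C T)" "category (Alg C T')"
    and ob: "\<And>X \<xi>. (X, \<xi>) \<in> Ob (Alg C T) \<Longrightarrow> (X, \<xi> \<cdot>\<^bsub>C\<^esub> \<gamma> X) \<in> Ob (Alg C T')"
    and ar: "\<And>X \<xi> f Y \<theta>. ((X, \<xi>), f, (Y, \<theta>)) \<in> Ar (Alg C T) \<Longrightarrow> ((X, \<xi> \<cdot>\<^bsub>C\<^esub> \<gamma> X), f, (Y, \<theta> \<cdot>\<^bsub>C\<^esub> \<gamma> Y)) \<in> Ar (Alg C T')"
  shows "functor (Alg C T) (Alg C T') (alg_restrict C \<gamma>)"
proof (rule category_Alg_functor[OF C])
  fix x assume x: "x \<in> Ob (Alg C T)"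
  thus "FOb (alg_restrict C \<gamma>) x \<in> Ob (Alg C T')" by (cases x) (simp add: alg_restrict_def ob)
  show "FAr (alg_restrict C \<gamma>) (Ide (Alg C T) x) = Ide (Alg C T') (FOb (alg_restrict C \<gamma>) x)"
    by (cases x) (simp add: alg_restrict_def)
next
  fix f assume f: "f \<in> Ar (Alg C T)"
  obtain X \<xi> h Y \<theta> where fe: "f = ((X, \<xi>), h, (Y, \<theta>))" by (metis surj_pair)
  show "FAr (alg_restrict C \<gamma>) f \<in> Ar (Alg C T') \<and> Dom (Alg C T') (FAr (alg_restrict C \<gamma>) f) = FOb (alg_restrict C \<gamma>) (Dom (Alg C T) f) \<and>
      Cod (Alg C T') (FAr (alg_restrict C \<gamma>) f) = FOb (alg_restrict C \<gamma>) (Cod (Alg C T) f)"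
    using ar[OF f[unfolded fe]] by (simp add: fe alg_restrict_def)
  fix g assume g: "g \<in> Ar (Alg C T)" and c: "Cod (Alg C T) f = Dom (Alg C T) g"
  obtain k Z \<zeta> where ge: "g = ((Y, \<theta>), k, (Z, \<zeta>))" using c fe by (cases g) auto
  show "FAr (alg_restrict C \<gamma>) (g \<cdot>\<^bsub>Alg C T\<^esub> f) = FAr (alg_restrict C \<gamma>) g \<cdot>\<^bsub>Alg C T'\<^esub> FAr (alg_restrict C \<gamma>) f"
    by (simp add: fe ge alg_restrict_def)
qed

lemma functor_alg_forget:
  assumes "category (Alg C T)" "category C"
  shows "functor (Alg C T) C alg_forget"
  unfolding functor_def
proof (intro conjI ballI impI assms)
  fix x assume "x \<in> Ob (Alg C T)"
  thus "FOb alg_forget x \<in> Ob C" "FAr alg_forget (Ide (Alg C T) x) = Ide C (FOb alg_forget x)"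
    by (cases x; simp add: alg_forget_def Alg_def Let_def)+
next
  fix f assume f: "f \<in> Ar (Alg C T)"
  obtain X \<xi> h Y \<theta> where fe: "f = ((X, \<xi>), h, (Y, \<theta>))" by (metis surj_pair)
  show "FAr alg_forget f \<in> Hom C (FOb alg_forget (Dom (Alg C T) f)) (FOb alg_forget (Cod (Alg C T) f))"
    using f by (simp add: fe alg_forget_def Alg_def Let_def)
  fix g assume g: "g \<in> Ar (Alg C T)" and c: "Cod (Alg C T) f = Dom (Alg C T) g"
  obtain k Z \<zeta> where ge: "g = ((Y, \<theta>), k, (Z, \<zeta>))" using c fe by (cases g) auto
  show "FAr alg_forget (g \<cdot>\<^bsub>Alg C T\<^esub> f) = FAr alg_forget g \<cdot>\<^bsub>C\<^esub> FAr alg_forget f"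
    by (simp add: fe ge alg_forget_def)
qed

context cart_ctx
begin

text \<open>The axioms of a morphism of monads are bypassed: algebras and their morphisms come from
  points over \<open>B\<close>, and the images of these are points and morphisms over
  \<open>U0 B\<close>.\<close>

lemma functor_gamma:
  assumes B: "B \<in> Ob (UC A)"
  shows "functor (Alg (VC A) (sharp_monad A B)) (Alg (VC A) (UB_monad A B)) (alg_restrict (VC A) (gamma A B))"
proof (rule functor_alg_restrict)
  show "category (Alg (VC A) (sharp_monad A B))" by (rule category_Alg[OF B])
  show "category (Alg (VC A) (UB_monad A B))" unfolding UB_monad_def by (rule V.category_Alg_flat) (use B in simp)
  fix X \<xi> assume x: "(X, \<xi>) \<in> Ob (Alg (VC A) (sharp_monad A B))"
  obtain p s k where a: "sact B X \<xi> p s k" by (rule algebra_point[OF B x])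
  show "(X, \<xi> \<cdot>\<^sub>V gamma A B X) \<in> Ob (Alg (VC A) (UB_monad A B))"
    unfolding UB_monad_def by (rule V.point_action_algebra[OF sact_point_action[OF a]])
next
  fix X \<xi> f Y \<theta> assume f: "((X, \<xi>), f, (Y, \<theta>)) \<in> Ar (Alg (VC A) (sharp_monad A B))"
  hence f': "(X, \<xi>) \<in> Ob (Alg (VC A) (sharp_monad A B))" "(Y, \<theta>) \<in> Ob (Alg (VC A) (sharp_monad A B))"
    "f \<in> Ar (VC A)" "Dom (VC A) f = X" "Cod (VC A) f = Y" "f \<cdot>\<^sub>V \<xi> = \<theta> \<cdot>\<^sub>V sharp_map B f" by (simp_all add: Alg_Ar[OF B])
  obtain p s k where a: "sact B X \<xi> p s k" by (rule algebra_point[OF B f'(1)])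
  obtain q t l where b: "sact B Y \<theta> q t l" by (rule algebra_point[OF B f'(2)])
  obtain h where h: "((p, s), h, (q, t)) \<in> Ar (Pt (UC A) B)" "U1 h \<cdot>\<^sub>V k = l \<cdot>\<^sub>V f" by (rule algebra_morphism_point[OF a b f'(3-6)])
  show "((X, \<xi> \<cdot>\<^sub>V gamma A B X), f, (Y, \<theta> \<cdot>\<^sub>V gamma A B Y)) \<in> Ar (Alg (VC A) (UB_monad A B))"
    unfolding UB_monad_def
    by (rule V.point_morphism_action[OF sact_point_action[OF a] sact_point_action[OF b] U_Pt_arrow[OF h(1)] f'(3-5) h(2)])
qed

text \<open>The pulled back point is spelled out with the chosen pullback and its
  \<open>pb_lift\<close> so that it matches the object part of \<open>pt_pullback\<close>.\<close>

lemma base_change_point_action: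
  assumes B: "B \<in> Ob (UC A)" and a: "point_action (VC A) (U0 B) X \<xi> p s k"
  obtains k' where "point_action (VC A) (U0 (F0 A)) X (\<xi> \<cdot>\<^sub>V iota_flat A B X) (pb1 (VC A) (U1 (iota A B)) p)
      (pb_lift (VC A) (pb1 (VC A) (U1 (iota A B)) p) (pb2 (VC A) (U1 (iota A B)) p) (Ide (VC A) (U0 (F0 A))) (s \<cdot>\<^sub>V U1 (iota A B))) k'"
    "pb2 (VC A) (U1 (iota A B)) p \<cdot>\<^sub>V k' = k"
    "is_pullback (VC A) (U1 (iota A B)) p (pb1 (VC A) (U1 (iota A B)) p) (pb2 (VC A) (U1 (iota A B)) p)"
proof -
  let ?i = "U1 (iota A B)"
  have i: "?i \<in> Ar (VC A)" "Dom (VC A) ?i = U0 (F0 A)" "Cod (VC A) ?i = U0 B" using B by simp_all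
  note t = V.point_action_typed[OF a]
  have pb: "is_pullback (VC A) ?i p (pb1 (VC A) ?i p) (pb2 (VC A) ?i p)" by (rule V.pb_chosen) (use i t in simp_all)
  have x: "(p, s) \<in> Ob (Pt (VC A) (Cod (VC A) ?i))" using V.point_actionD(1)[OF a] i by simp
  note z = V.pt_section_lift[OF i(1) x pb, unfolded i(2)]
  show thesis by (rule point_action_iota[OF B a pb z(1-5)]) (rule that[OF _ _ pb])
qed

lemma functor_iota:
  assumes B: "B \<in> Ob (UC A)"
  shows "functor (Alg (VC A) (UB_monad A B)) (Alg (VC A) (UB_monad A (F0 A))) (alg_restrict (VC A) (iota_flat A B))"
proof (rule functor_alg_restrict)
  let ?i = "U1 (iota A B)"
  have UB: "U0 B \<in> Ob (VC A)" "U0 (F0 A) \<in> Ob (VC A)" using B by simp_all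
  show "category (Alg (VC A) (UB_monad A B))" "category (Alg (VC A) (UB_monad A (F0 A)))"
    unfolding UB_monad_def by (rule V.category_Alg_flat, use UB in simp)+
  fix X \<xi> assume "(X, \<xi>) \<in> Ob (Alg (VC A) (UB_monad A B))"
  then obtain p s k where a: "point_action (VC A) (U0 B) X \<xi> p s k" unfolding UB_monad_def by (rule V.action_point[OF UB(1)])
  obtain k' where "point_action (VC A) (U0 (F0 A)) X (\<xi> \<cdot>\<^sub>V iota_flat A B X) (pb1 (VC A) ?i p)
      (pb_lift (VC A) (pb1 (VC A) ?i p) (pb2 (VC A) ?i p) (Ide (VC A) (U0 (F0 A))) (s \<cdot>\<^sub>V ?i)) k'"
    by (rule base_change_point_action[OF B a])
  thus "(X, \<xi> \<cdot>\<^sub>V iota_flat A B X) \<in> Ob (Alg (VC A) (UB_monad A (F0 A)))"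
    unfolding UB_monad_def by (rule V.point_action_algebra)
next
  let ?i = "U1 (iota A B)"
  have UB: "U0 B \<in> Ob (VC A)" "U0 (F0 A) \<in> Ob (VC A)" using B by simp_all
  have i: "?i \<in> Ar (VC A)" "Dom (VC A) ?i = U0 (F0 A)" "Cod (VC A) ?i = U0 B" using B by simp_all
  fix X \<xi> f Y \<theta> assume f: "((X, \<xi>), f, (Y, \<theta>)) \<in> Ar (Alg (VC A) (UB_monad A B))"
  note ft = V.flat_Alg_Ar_typed[OF UB(1) f[unfolded UB_monad_def]]
  obtain p s k where a: "point_action (VC A) (U0 B) X \<xi> p s k" by (rule V.action_point[OF UB(1) ft(4)])
  obtain q t l where b: "point_action (VC A) (U0 B) Y \<theta> q t l" by (rule V.action_point[OF UB(1) ft(5)])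
  obtain h where h: "((p, s), h, (q, t)) \<in> Ar (Pt (VC A) (U0 B))" "h \<cdot>\<^sub>V k = l \<cdot>\<^sub>V f"
    by (rule V.action_morphism_point[OF a b f[unfolded UB_monad_def]])
  obtain k' where k': "point_action (VC A) (U0 (F0 A)) X (\<xi> \<cdot>\<^sub>V iota_flat A B X) (pb1 (VC A) ?i p)
      (pb_lift (VC A) (pb1 (VC A) ?i p) (pb2 (VC A) ?i p) (Ide (VC A) (U0 (F0 A))) (s \<cdot>\<^sub>V ?i)) k'" "pb2 (VC A) ?i p \<cdot>\<^sub>V k' = k"
    and pb: "is_pullback (VC A) ?i p (pb1 (VC A) ?i p) (pb2 (VC A) ?i p)"
    by (rule base_change_point_action[OF B a])
  obtain l' where l': "point_action (VC A) (U0 (F0 A)) Y (\<theta> \<cdot>\<^sub>V iota_flat A B Y) (pb1 (VC A) ?i q)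
      (pb_lift (VC A) (pb1 (VC A) ?i q) (pb2 (VC A) ?i q) (Ide (VC A) (U0 (F0 A))) (t \<cdot>\<^sub>V ?i)) l'" "pb2 (VC A) ?i q \<cdot>\<^sub>V l' = l"
    and pb': "is_pullback (VC A) ?i q (pb1 (VC A) ?i q) (pb2 (VC A) ?i q)"
    by (rule base_change_point_action[OF B b])
  define m where "m = pb_lift (VC A) (pb1 (VC A) ?i q) (pb2 (VC A) ?i q) (pb1 (VC A) ?i p) (h \<cdot>\<^sub>V pb2 (VC A) ?i p)"
  have hc: "((p, s), h, (q, t)) \<in> Ar (Pt (VC A) (Cod (VC A) ?i))" using h i by simp
  note m = V.pt_arrow_lift[OF i(1) hc pb pb', folded m_def, unfolded i(2)]
  note T = V.pb_typed[OF pb] and T' = V.pb_typed[OF pb']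
  note k't = V.point_action_typed(7-9)[OF k'(1)] V.point_actionD(3)[OF k'(1)]
  note l't = V.point_action_typed(7-9)[OF l'(1)] V.point_actionD(3)[OF l'(1)]
  have ht: "h \<in> Ar (VC A)" "Dom (VC A) h = Dom (VC A) p" "Cod (VC A) h = Dom (VC A) q" using h by (simp_all add: Pt_Ar_iff)
  \<comment> \<open>The base change \<open>m\<close> of \<open>h\<close> restricts to the same
    \<open>f\<close> on kernels; this is tested on the two projections of the pullback.\<close>
  have "m \<cdot>\<^sub>V k' = l' \<cdot>\<^sub>V f"
  proof (rule V.pb_uniq[OF pb'])
    have "pb1 (VC A) ?i q \<cdot>\<^sub>V (m \<cdot>\<^sub>V k') = pb1 (VC A) ?i p \<cdot>\<^sub>V k'"
      by (rule V.cmp_ext1[OF m(4)]) (use m(1-3) k't T' in simp_all)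
    also have "\<dots> = pb1 (VC A) ?i q \<cdot>\<^sub>V (l' \<cdot>\<^sub>V f)"
      by (subst V.cmp_ext1[OF l't(3)]) (use k't l't ft(1-3) T'(4) UB in simp_all)
    finally show "pb1 (VC A) ?i q \<cdot>\<^sub>V (m \<cdot>\<^sub>V k') = pb1 (VC A) ?i q \<cdot>\<^sub>V (l' \<cdot>\<^sub>V f)" .
    have "pb2 (VC A) ?i q \<cdot>\<^sub>V (m \<cdot>\<^sub>V k') = h \<cdot>\<^sub>V (pb2 (VC A) ?i p \<cdot>\<^sub>V k')"
      by (rule V.cmp_ext[OF m(5)]) (use m(1-3) k't(1,2) T(4-8) T'(4-8) ht in simp_all)
    also have "\<dots> = pb2 (VC A) ?i q \<cdot>\<^sub>V (l' \<cdot>\<^sub>V f)" unfolding k'(2) h(2)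
      by (rule V.cmp_ext1[OF l'(2), symmetric]) (use l't ft(1-3) T'(4-8) in simp_all)
    finally show "pb2 (VC A) ?i q \<cdot>\<^sub>V (m \<cdot>\<^sub>V k') = pb2 (VC A) ?i q \<cdot>\<^sub>V (l' \<cdot>\<^sub>V f)" .
  qed (use m(1-3) k't l't ft(1-3) in simp_all)
  thus "((X, \<xi> \<cdot>\<^sub>V iota_flat A B X), f, (Y, \<theta> \<cdot>\<^sub>V iota_flat A B Y)) \<in> Ar (Alg (VC A) (UB_monad A (F0 A)))"
    unfolding UB_monad_def by (intro V.point_morphism_action[OF k'(1) l'(1) m(6) ft(1-3)])
qed

lemma xi0_free: "X \<in> Ob (VC A) \<Longrightarrow>
    point_action (VC A) (U0 (F0 A)) X (xi0 A X) (U1 (L1 (to_zero (VC A) X))) (U1 (L1 (from_zero (VC A) X))) (\<eta> X)"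
  by (rule xi0_point_action[OF free_point unit_kernel]) simp_all

lemma functor_xi0: "functor (VC A) (Alg (VC A) (UB_monad A (F0 A))) (xi0_func A)"
proof (rule category_Alg_functor)
  show "category (VC A)" by (rule V.cat)
  show "category (Alg (VC A) (UB_monad A (F0 A)))" unfolding UB_monad_def by (rule V.category_Alg_flat) simp
  fix X assume X: "X \<in> Ob (VC A)"
  show "FOb (xi0_func A) X \<in> Ob (Alg (VC A) (UB_monad A (F0 A)))"
    using V.point_action_algebra[OF xi0_free[OF X]] by (simp add: xi0_func_def UB_monad_def)
  show "FAr (xi0_func A) (Ide (VC A) X) = Ide (Alg (VC A) (UB_monad A (F0 A))) (FOb (xi0_func A) X)"
    using X by (simp add: xi0_func_def)
next
  fix f assume f: "f \<in> Ar (VC A)"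
  let ?X = "Dom (VC A) f" let ?Y = "Cod (VC A) f"
  have ob: "?X \<in> Ob (VC A)" "?Y \<in> Ob (VC A)" using f by simp_all
  have "L1 (to_zero (VC A) ?Y \<cdot>\<^sub>V f) = L1 (to_zero (VC A) ?X)" using V.to_zero_comp[OF f refl] by simp
  hence 1: "L1 (to_zero (VC A) ?Y) \<cdot>\<^sub>U L1 f = L1 (to_zero (VC A) ?X)" using f by (subst (asm) L_simps(6)) simp_all
  have "L1 (f \<cdot>\<^sub>V from_zero (VC A) ?X) = L1 (from_zero (VC A) ?Y)" using V.comp_from_zero[OF f refl] by simp
  hence 2: "L1 f \<cdot>\<^sub>U L1 (from_zero (VC A) ?X) = L1 (from_zero (VC A) ?Y)" using f by (subst (asm) L_simps(6)) simp_all
  have "((L1 (to_zero (VC A) ?X), L1 (from_zero (VC A) ?X)), L1 f, (L1 (to_zero (VC A) ?Y), L1 (from_zero (VC A) ?Y))) \<in> Ar (Pt (UC A) (F0 A))"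
    unfolding Pt_Ar_iff using free_point[OF ob(1)] free_point[OF ob(2)] 1 2 f by simp
  from V.point_morphism_action[OF xi0_free[OF ob(1)] xi0_free[OF ob(2)] U_Pt_arrow[OF this], of f]
  show "FAr (xi0_func A) f \<in> Ar (Alg (VC A) (UB_monad A (F0 A))) \<and>
      Dom (Alg (VC A) (UB_monad A (F0 A))) (FAr (xi0_func A) f) = FOb (xi0_func A) ?X \<and>
      Cod (Alg (VC A) (UB_monad A (F0 A))) (FAr (xi0_func A) f) = FOb (xi0_func A) ?Y"
    using f by (simp add: xi0_func_def UB_monad_def)
qed (simp add: xi0_func_def)

text \<open>A morphism of the restricted actions is turned into one of points over
  \<open>U0 B\<close>, lifted by \<open>points_full\<close>, and read back as a morphism of
  algebras.\<close>

lemma algebra_lift_morphism: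
  assumes B: "B \<in> Ob (UC A)" and pf: points_full
    and o: "(X1, \<xi>1) \<in> Ob (Alg (VC A) (sharp_monad A B))" "(X2, \<xi>2) \<in> Ob (Alg (VC A) (sharp_monad A B))"
    and f: "((X1, \<xi>1 \<cdot>\<^sub>V gamma A B X1), f, (X2, \<xi>2 \<cdot>\<^sub>V gamma A B X2)) \<in> Ar (Alg (VC A) (UB_monad A B))"
  shows "((X1, \<xi>1), f, (X2, \<xi>2)) \<in> Ar (Alg (VC A) (sharp_monad A B))"
proof -
  note ft = V.flat_Alg_Ar_typed[OF U_simps(4)[OF B] f[unfolded UB_monad_def]]
  obtain p s k where a: "sact B X1 \<xi>1 p s k" by (rule algebra_point[OF B o(1)])
  obtain q t l where b: "sact B X2 \<xi>2 q t l" by (rule algebra_point[OF B o(2)])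
  obtain h where h: "((U1 p, U1 s), h, (U1 q, U1 t)) \<in> Ar (Pt (VC A) (U0 B))" "h \<cdot>\<^sub>V k = l \<cdot>\<^sub>V f"
    by (rule V.action_morphism_point[OF sact_point_action[OF a] sact_point_action[OF b] f[unfolded UB_monad_def]])
  obtain h' where h': "((p, s), h', (q, t)) \<in> Ar (Pt (UC A) B)" "U1 h' = h"
    using pf B sactD(1)[OF a] sactD(1)[OF b] h(1) unfolding points_full_def by blast
  have "f \<cdot>\<^sub>V \<xi>1 = \<xi>2 \<cdot>\<^sub>V sharp_map B f" by (rule sact_morphism_algebra[OF a b h'(1) ft(1-3)]) (simp add: h' h)
  thus ?thesis using o ft(1-3) by (simp add: Alg_Ar[OF B])
qed

text \<open>The point of \<open>\<xi>\<close> lifts only up to \<open>\<sigma>\<close>, but with the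
  kernel transported by its inverse \<open>\<tau>\<close> the lifted point carries
  \<open>\<xi>\<close> itself. Uniqueness of the action then gives the strict equation.\<close>

lemma algebra_lift:
  assumes B: "B \<in> Ob (UC A)" and pl: points_lift
    and x: "(X, \<xi>) \<in> Ob (Alg (VC A) (UB_monad A B))" and c: "coherent A B X \<xi>"
  obtains \<xi>' where "(X, \<xi>') \<in> Ob (Alg (VC A) (sharp_monad A B))" "\<xi>' \<cdot>\<^sub>V gamma A B X = \<xi>"
proof -
  obtain p s k where a: "point_action (VC A) (U0 B) X \<xi> p s k"
    by (rule V.action_point[OF U_simps(4)[OF B] x[unfolded UB_monad_def]])
  obtain p' s' \<sigma> where l: "lifts_point A B p' s' \<sigma> p s" using pl B a c unfolding points_lift_def by blast
  note m = lifts_arrow[OF l V.point_actionD(1)[OF a]]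
  obtain \<tau> where t: "inverse_arrows (VC A) \<sigma> \<tau>" "((p, s), \<tau>, (U1 p', U1 s')) \<in> Ar (Pt (VC A) (U0 B))"
    by (rule V.Pt_inverse[OF m(2,3)])
  have b: "point_action (VC A) (U0 B) X \<xi> (U1 p') (U1 s') (\<tau> \<cdot>\<^sub>V k)"
    by (rule V.point_action_iso[OF a t(2) V.inverse_arrows_iso(2)[OF t(1)]])
  obtain \<xi>' where s: "sact B X \<xi>' p' s' (\<tau> \<cdot>\<^sub>V k)" by (rule sact_ex[OF m(1) V.point_actionD(2,3)[OF b]])
  show thesis
    by (rule that[OF sact_algebra[OF s] V.point_action_unique[OF sact_point_action[OF s] b]])
qed

text \<open>The comparison functor has to be bijective on objects and arrows. Surjectivity comes
  from lifting; injectivity on objects comes from fullness, applied to identities. In the other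
  direction, preimages under the comparison are turned back into points.\<close>

lemma pullback_iff:
  "(\<forall>B\<in>Ob (UC A). is_pullback_of_cats
         (Alg (VC A) (sharp_monad A B)) (Alg (VC A) (UB_monad A B)) (VC A) (Alg (VC A) (UB_monad A (F0 A)))
         (alg_restrict (VC A) (gamma A B)) alg_forget
         (alg_restrict (VC A) (iota_flat A B)) (xi0_func A)) \<longleftrightarrow> points_lift \<and> points_full"
  (is "(\<forall>B\<in>_. ?pb B) \<longleftrightarrow> _")
proof (intro iffI conjI ballI)
  fix B assume B: "B \<in> Ob (UC A)" and "points_lift \<and> points_full"
  hence pl: points_lift and pf: points_full by auto
  let ?S = "Alg (VC A) (sharp_monad A B)" and ?T = "Alg (VC A) (UB_monad A B)"
  let ?P = "pullback_cat ?T (VC A) (alg_restrict (VC A) (iota_flat A B)) (xi0_func A)"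
  let ?F = "\<lparr>FOb = (\<lambda>a. (FOb (alg_restrict (VC A) (gamma A B)) a, FOb alg_forget a)),
    FAr = (\<lambda>f. (FAr (alg_restrict (VC A) (gamma A B)) f, FAr alg_forget f))\<rparr>"
  have fgt: "functor ?S (VC A) alg_forget" by (rule functor_alg_forget[OF category_Alg[OF B] V.cat])
  have coh: "\<xi> \<cdot>\<^sub>V gamma A B X \<cdot>\<^sub>V iota_flat A B X = xi0 A X" if al: "(X, \<xi>) \<in> Ob ?S" for X \<xi>
  proof -
    obtain p s k where a: "sact B X \<xi> p s k" by (rule algebra_point[OF B al])
    show ?thesis using sact_coherent[OF a] unfolding coherent_def .
  qed
  have eq: "func_eq ?S (alg_restrict (VC A) (iota_flat A B) \<circ>\<^sub>F alg_restrict (VC A) (gamma A B)) (xi0_func A \<circ>\<^sub>F alg_forget)"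
    unfolding func_eq_def
  proof (intro conjI ballI)
    fix x assume x: "x \<in> Ob ?S"
    obtain X \<xi> where xe: "x = (X, \<xi>)" by fastforce
    show "FOb (alg_restrict (VC A) (iota_flat A B) \<circ>\<^sub>F alg_restrict (VC A) (gamma A B)) x = FOb (xi0_func A \<circ>\<^sub>F alg_forget) x"
      using coh[OF x[unfolded xe]] by (simp add: xe alg_restrict_def alg_forget_def xi0_func_def)
  next
    fix x assume x: "x \<in> Ar ?S"
    obtain X \<xi> f Y \<theta> where xe: "x = ((X, \<xi>), f, (Y, \<theta>))" by (metis surj_pair)
    have o: "(X, \<xi>) \<in> Ob ?S" "(Y, \<theta>) \<in> Ob ?S" "Dom (VC A) f = X" "Cod (VC A) f = Y" using x by (simp_all add: xe Alg_Ar[OF B])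
    show "FAr (alg_restrict (VC A) (iota_flat A B) \<circ>\<^sub>F alg_restrict (VC A) (gamma A B)) x = FAr (xi0_func A \<circ>\<^sub>F alg_forget) x"
      using coh[OF o(1)] coh[OF o(2)] o(3,4) by (simp add: xe alg_restrict_def alg_forget_def xi0_func_def)
  qed
  have FF: "functor ?S ?P ?F" by (rule functor_to_pullback_cat[OF functor_gamma[OF B] fgt functor_iota[OF B] functor_xi0 eq])
  interpret F: functor_loc ?S ?P ?F by (rule functor_loc[OF FF])
  \<comment> \<open>Two algebras with the same restriction have the identity as a morphism between
    their restrictions. By \<open>algebra_lift_morphism\<close> it is a morphism between the
    algebras themselves, which forces their structure maps to agree.\<close>
  have inj: "\<xi> = \<theta>" if o: "(X, \<xi>) \<in> Ob ?S" "(X, \<theta>) \<in> Ob ?S" and e: "\<xi> \<cdot>\<^sub>V gamma A B X = \<theta> \<cdot>\<^sub>V gamma A B X" for X \<xi> \<theta>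
  proof -
    have ft: "X \<in> Ob (VC A)" "\<xi> \<in> Ar (VC A)" "Cod (VC A) \<xi> = X" "\<theta> \<in> Ar (VC A)" "Dom (VC A) \<theta> = tob B X"
      using o by (simp_all add: Alg_Ob[OF B])
    interpret T: functor_loc ?S ?T "alg_restrict (VC A) (gamma A B)" by (rule functor_loc[OF functor_gamma[OF B]])
    have "((X, \<xi> \<cdot>\<^sub>V gamma A B X), Ide (VC A) X, (X, \<xi> \<cdot>\<^sub>V gamma A B X)) \<in> Ar ?T"
      using T.D.Ide_Ar[OF T.F_simps(4)[OF o(1)]] by (simp add: alg_restrict_def)
    hence "((X, \<xi>), Ide (VC A) X, (X, \<theta>)) \<in> Ar ?S" using algebra_lift_morphism[OF B pf o] e by simp
    hence "Ide (VC A) X \<cdot>\<^sub>V \<xi> = \<theta> \<cdot>\<^sub>V sharp_map B (Ide (VC A) X)" by (simp add: Alg_Ar[OF B])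
    moreover have "Ide (VC A) X \<cdot>\<^sub>V \<theta> = \<theta> \<cdot>\<^sub>V sharp_map B (Ide (VC A) X)"
      using F.C.Ide_Ar[OF o(2)] by (simp add: Alg_Ar[OF B])
    ultimately show ?thesis using o ft by (simp add: Alg_Ob[OF B])
  qed
  have lift: "\<exists>\<xi>'. (X, \<xi>') \<in> Ob ?S \<and> \<xi>' \<cdot>\<^sub>V gamma A B X = \<xi>"
    if "(X, \<xi>) \<in> Ob ?T" "\<xi> \<cdot>\<^sub>V iota_flat A B X = xi0 A X" for X \<xi>
    using algebra_lift[OF B pl that(1)] that(2) unfolding coherent_def by blast
  have "isomorphism_of_cats ?S ?P ?F"
  proof (rule F.isomorphism_of_catsI)
    show "inj_on (FOb ?F) (Ob ?S)"
    proof (rule inj_onI)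
      fix x y assume "x \<in> Ob ?S" "y \<in> Ob ?S" "FOb ?F x = FOb ?F y"
      thus "x = y" using inj by (cases x; cases y) (auto simp: alg_restrict_def alg_forget_def)
    qed
    show "Ob ?P \<subseteq> FOb ?F ` Ob ?S"
    proof
      fix y assume "y \<in> Ob ?P"
      then obtain X \<xi> Y where y: "y = ((X, \<xi>), Y)" "(X, \<xi>) \<in> Ob ?T" "\<xi> \<cdot>\<^sub>V iota_flat A B X = xi0 A X" "Y = X"
        by (auto simp: pullback_cat_def alg_restrict_def xi0_func_def)
      obtain \<xi>' where "(X, \<xi>') \<in> Ob ?S" "\<xi>' \<cdot>\<^sub>V gamma A B X = \<xi>" using lift[OF y(2,3)] by blast
      thus "y \<in> FOb ?F ` Ob ?S" using y by (intro image_eqI[of _ _ "(X, \<xi>')"]) (simp_all add: alg_restrict_def alg_forget_def)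
    qed
    show "inj_on (FAr ?F) (Ar ?S)"
    proof (rule inj_onI)
      fix x y assume x: "x \<in> Ar ?S" and y: "y \<in> Ar ?S" and e: "FAr ?F x = FAr ?F y"
      obtain X \<xi> f Y \<theta> where xe: "x = ((X, \<xi>), f, (Y, \<theta>))" by (metis surj_pair)
      obtain X' \<xi>' f' Y' \<theta>' where ye: "y = ((X', \<xi>'), f', (Y', \<theta>'))" by (metis surj_pair)
      have o: "(X, \<xi>) \<in> Ob ?S" "(Y, \<theta>) \<in> Ob ?S" "(X', \<xi>') \<in> Ob ?S" "(Y', \<theta>') \<in> Ob ?S"
        using x y by (simp_all add: xe ye Alg_Ar[OF B])
      have e': "X = X'" "Y = Y'" "f = f'" "\<xi> \<cdot>\<^sub>V gamma A B X = \<xi>' \<cdot>\<^sub>V gamma A B X" "\<theta> \<cdot>\<^sub>V gamma A B Y = \<theta>' \<cdot>\<^sub>V gamma A B Y"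
        using e by (auto simp: xe ye alg_restrict_def alg_forget_def)
      show "x = y" using e' o inj[of X \<xi> \<xi>'] inj[of Y \<theta> \<theta>'] by (simp add: xe ye)
    qed
    show "Ar ?P \<subseteq> FAr ?F ` Ar ?S"
    proof
      fix y assume "y \<in> Ar ?P"
      then obtain X \<xi> f Y \<theta> g where y: "y = (((X, \<xi>), f, (Y, \<theta>)), g)" "((X, \<xi>), f, (Y, \<theta>)) \<in> Ar ?T" "g \<in> Ar (VC A)"
        "\<xi> \<cdot>\<^sub>V iota_flat A B X = xi0 A X" "\<theta> \<cdot>\<^sub>V iota_flat A B Y = xi0 A Y" "g = f"
        by (auto simp: pullback_cat_def alg_restrict_def xi0_func_def)
      note ft = V.flat_Alg_Ar_typed[OF U_simps(4)[OF B] y(2)[unfolded UB_monad_def]]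
      obtain \<xi>' where x1: "(X, \<xi>') \<in> Ob ?S" "\<xi>' \<cdot>\<^sub>V gamma A B X = \<xi>" using lift[of X \<xi>] ft(4) y(4) unfolding UB_monad_def by blast
      obtain \<theta>' where x2: "(Y, \<theta>') \<in> Ob ?S" "\<theta>' \<cdot>\<^sub>V gamma A B Y = \<theta>" using lift[of Y \<theta>] ft(5) y(5) unfolding UB_monad_def by blast
      have "((X, \<xi>'), f, (Y, \<theta>')) \<in> Ar ?S"
        by (rule algebra_lift_morphism[OF B pf x1(1) x2(1)]) (use y(2) x1(2) x2(2) in simp)
      thus "y \<in> FAr ?F ` Ar ?S" using y(1,6) x1(2) x2(2)
        by (intro image_eqI[of _ _ "((X, \<xi>'), f, (Y, \<theta>'))"]) (simp_all add: alg_restrict_def alg_forget_def)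
    qed
  qed
  thus "?pb B" unfolding is_pullback_of_cats_def
    using functor_gamma[OF B] fgt functor_iota[OF B] functor_xi0 eq by blast
next
  assume all: "\<forall>B\<in>Ob (UC A). ?pb B"
  have iso: "isomorphism_of_cats (Alg (VC A) (sharp_monad A B))
     (pullback_cat (Alg (VC A) (UB_monad A B)) (VC A) (alg_restrict (VC A) (iota_flat A B)) (xi0_func A))
     \<lparr>FOb = (\<lambda>a. (FOb (alg_restrict (VC A) (gamma A B)) a, FOb alg_forget a)),
      FAr = (\<lambda>f. (FAr (alg_restrict (VC A) (gamma A B)) f, FAr alg_forget f))\<rparr>" if "B \<in> Ob (UC A)" for B
    using all that unfolding is_pullback_of_cats_def by blast
  show points_lift unfolding points_lift_def
  proof (intro ballI allI impI)
    fix B X \<xi> p s k assume B: "B \<in> Ob (UC A)" and a: "point_action (VC A) (U0 B) X \<xi> p s k" and c: "coherent A B X \<xi>"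
    have "((X, \<xi>), X) \<in> Ob (pullback_cat (Alg (VC A) (UB_monad A B)) (VC A) (alg_restrict (VC A) (iota_flat A B)) (xi0_func A))"
      using V.point_action_algebra[OF a] c V.point_action_typed(11)[OF a]
      by (simp add: pullback_cat_def UB_monad_def alg_restrict_def xi0_func_def coherent_def)
    from isomorphism_of_catsD(1)[OF iso[OF B] this]
    obtain \<xi>' where x: "(X, \<xi>') \<in> Ob (Alg (VC A) (sharp_monad A B))" "\<xi>' \<cdot>\<^sub>V gamma A B X = \<xi>"
      by (auto simp: alg_restrict_def alg_forget_def)
    obtain p' s' k' where b: "sact B X \<xi>' p' s' k'" by (rule algebra_point[OF B x(1)])
    note b' = sact_point_action[OF b, unfolded x(2)]
    have X: "X \<in> Ob (VC A)" by (rule V.point_action_typed(11)[OF a])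
    have "((X, \<xi>), Ide (VC A) X, (X, \<xi>)) \<in> Ar (Alg (VC A) (flat_monad (VC A) (U0 B)))"
    proof -
      interpret T: cat_loc "Alg (VC A) (flat_monad (VC A) (U0 B))" by unfold_locales (rule V.category_Alg_flat, use B in simp)
      show ?thesis using T.Ide_Ar[OF V.point_action_algebra[OF a]] by simp
    qed
    then obtain h where h: "((U1 p', U1 s'), h, (p, s)) \<in> Ar (Pt (VC A) (U0 B))" "h \<cdot>\<^sub>V k' = k \<cdot>\<^sub>V Ide (VC A) X"
      by (rule V.action_morphism_point[OF b' a])
    \<comment> \<open>The point of the lifted algebra has the same action as the given point, and
      \<open>h\<close> is the morphism induced by the identity of \<open>X\<close>, hence invertible
      by the short five lemma.\<close>
    have "iso (VC A) h"
      by (rule V.short_five[OF h(1) V.point_actionD(2)[OF b'] V.point_actionD(2)[OF a], of "Ide (VC A) X"])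
        (use X h V.point_actionD(3)[OF b'] V.point_actionD(3)[OF a] in simp_all)
    thus "\<exists>p' s' \<sigma>. lifts_point A B p' s' \<sigma> p s" using arrow_lifts[OF sactD(1)[OF b] h(1)] by blast
  qed
  show points_full unfolding points_full_def
  proof (intro ballI allI impI)
    fix B p1 s1 p2 s2 h assume B: "B \<in> Ob (UC A)" and x: "(p1, s1) \<in> Ob (Pt (UC A) B)" "(p2, s2) \<in> Ob (Pt (UC A) B)"
      and h: "((U1 p1, U1 s1), h, (U1 p2, U1 s2)) \<in> Ar (Pt (VC A) (U0 B))"
    have pA: "p1 \<in> Ar (UC A)" "p2 \<in> Ar (UC A)" using x by (simp_all add: Pt_Ob_iff)
    obtain X1 \<xi>1 k1 where a1: "sact B X1 \<xi>1 p1 s1 k1" by (rule sact_chosen[OF x(1)])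
    obtain X2 \<xi>2 k2 where a2: "sact B X2 \<xi>2 p2 s2 k2" by (rule sact_chosen[OF x(2)])
    note b1 = sact_point_action[OF a1] and b2 = sact_point_action[OF a2]
    obtain f where f: "f \<in> Ar (VC A)" "Dom (VC A) f = X1" "Cod (VC A) f = X2" and fe: "h \<cdot>\<^sub>V k1 = k2 \<cdot>\<^sub>V f"
      using kernel_arrow[OF h sactD(2)[OF a1] sactD(2)[OF a2]] sactD(3)[OF a1] sactD(3)[OF a2] by metis
    have fa: "((X1, \<xi>1 \<cdot>\<^sub>V gamma A B X1), f, (X2, \<xi>2 \<cdot>\<^sub>V gamma A B X2)) \<in> Ar (Alg (VC A) (UB_monad A B))"
      unfolding UB_monad_def by (rule V.point_morphism_action[OF b1 b2 h f fe])
    have "(((X1, \<xi>1 \<cdot>\<^sub>V gamma A B X1), f, (X2, \<xi>2 \<cdot>\<^sub>V gamma A B X2)), f) \<in>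
        Ar (pullback_cat (Alg (VC A) (UB_monad A B)) (VC A) (alg_restrict (VC A) (iota_flat A B)) (xi0_func A))"
      using fa f sact_coherent[OF a1] sact_coherent[OF a2]
      by (simp add: pullback_cat_def alg_restrict_def xi0_func_def coherent_def del: V.assoc)
    from isomorphism_of_catsD(2)[OF iso[OF B] this]
    obtain \<theta>1 \<theta>2 where g: "((X1, \<theta>1), f, (X2, \<theta>2)) \<in> Ar (Alg (VC A) (sharp_monad A B))"
      and e: "\<theta>1 \<cdot>\<^sub>V gamma A B X1 = \<xi>1 \<cdot>\<^sub>V gamma A B X1" "\<theta>2 \<cdot>\<^sub>V gamma A B X2 = \<xi>2 \<cdot>\<^sub>V gamma A B X2"
      by (auto simp: alg_restrict_def alg_forget_def)
    have go: "(X1, \<theta>1) \<in> Ob (Alg (VC A) (sharp_monad A B))" "(X2, \<theta>2) \<in> Ob (Alg (VC A) (sharp_monad A B))"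
      using g by (simp_all add: Alg_Ar[OF B])
    \<comment> \<open>The preimage arrow comes with its own ends \<open>\<theta>1\<close> and
      \<open>\<theta>2\<close>. Injectivity on objects identifies them with the algebras of the
      given points, so that \<open>f\<close> is a morphism between those.\<close>
    have "\<theta>1 = \<xi>1" "\<theta>2 = \<xi>2"
      using isomorphism_of_catsD(3)[OF iso[OF B] go(1) sact_algebra[OF a1]] isomorphism_of_catsD(3)[OF iso[OF B] go(2) sact_algebra[OF a2]] e
      by (simp_all add: alg_restrict_def alg_forget_def)
    hence "f \<cdot>\<^sub>V \<xi>1 = \<xi>2 \<cdot>\<^sub>V sharp_map B f" using g by (simp add: Alg_Ar[OF B])
    then obtain h' where h': "((p1, s1), h', (p2, s2)) \<in> Ar (Pt (UC A) B)" "U1 h' \<cdot>\<^sub>V k1 = k2 \<cdot>\<^sub>V f"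
      by (rule algebra_morphism_point[OF a1 a2 f])
    have "U1 h' = h"
    proof (rule V.section_kernel_joint_epi[OF point_U[OF x(1)] sactD(2)[OF a1]])
      show "U1 h' \<cdot>\<^sub>V U1 s1 = h \<cdot>\<^sub>V U1 s1" using U_Pt_arrow[OF h'(1)] h by (simp add: Pt_Ar_iff)
      show "U1 h' \<cdot>\<^sub>V k1 = h \<cdot>\<^sub>V k1" by (simp only: h' fe)
    qed (use U_Pt_arrow[OF h'(1)] h in \<open>simp_all add: Pt_Ar_iff\<close>)
    thus "\<exists>h'. ((p1, s1), h', (p2, s2)) \<in> Ar (Pt (UC A) B) \<and> U1 h' = h" using h'(1) by blast
  qed
qed

end

section \<open>The pseudopullback of categories of points\<close>

lemma iso_comma_Ob_iff:
  "(b, c, \<theta>) \<in> Ob (iso_comma_cat B C D H K) \<longleftrightarrow>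
    b \<in> Ob B \<and> c \<in> Ob C \<and> \<theta> \<in> Ar D \<and> Dom D \<theta> = FOb H b \<and> Cod D \<theta> = FOb K c \<and> iso D \<theta>"
  by (auto simp: iso_comma_cat_def Let_def)

lemma iso_comma_Ar_iff:
  "((b, c, \<theta>), (f, g), (b', c', \<theta>')) \<in> Ar (iso_comma_cat B C D H K) \<longleftrightarrow>
    (b, c, \<theta>) \<in> Ob (iso_comma_cat B C D H K) \<and> (b', c', \<theta>') \<in> Ob (iso_comma_cat B C D H K) \<and>
    f \<in> Ar B \<and> Dom B f = b \<and> Cod B f = b' \<and> g \<in> Ar C \<and> Dom C g = c \<and> Cod C g = c' \<and>
    FAr K g \<cdot>\<^bsub>D\<^esub> \<theta> = \<theta>' \<cdot>\<^bsub>D\<^esub> FAr H f"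
  by (auto simp: iso_comma_cat_def Let_def)

lemma iso_comma_simps [simp]:
  "Dom (iso_comma_cat B C D H K) (x, fg, y) = x" "Cod (iso_comma_cat B C D H K) (x, fg, y) = y"
  "Ide (iso_comma_cat B C D H K) (b, c, \<theta>) = ((b, c, \<theta>), (Ide B b, Ide C c), (b, c, \<theta>))"
  "(y, (f', g'), z) \<cdot>\<^bsub>iso_comma_cat B C D H K\<^esub> (x, (f, g), y') = (x, (f' \<cdot>\<^bsub>B\<^esub> f, g' \<cdot>\<^bsub>C\<^esub> g), z)"
  by (simp_all add: iso_comma_cat_def Let_def)

section \<open>The iso-comma category\<close>

locale comma_loc = H: functor_loc B D H + K: functor_loc C D K
  for B :: "('bo, 'bm) cat" and C :: "('co, 'cm) cat" and D :: "('do, 'dm) cat" and H K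
begin

abbreviation I where "I \<equiv> iso_comma_cat B C D H K"

lemma category_comma: "category I"
  unfolding category_def
proof (intro conjI ballI impI)
  fix x assume x: "x \<in> Ar I"
  obtain b c \<theta> f g b' c' \<theta>' where xe: "x = ((b, c, \<theta>), (f, g), (b', c', \<theta>'))" by (metis surj_pair)
  note x' = x[unfolded xe iso_comma_Ar_iff iso_comma_Ob_iff]
  show "Dom I x \<in> Ob I" "Cod I x \<in> Ob I" using x by (simp_all add: xe iso_comma_Ar_iff)
  show "x \<cdot>\<^bsub>I\<^esub> Ide I (Dom I x) = x" "Ide I (Cod I x) \<cdot>\<^bsub>I\<^esub> x = x" using x' by (simp_all add: xe)
  fix y assume y: "y \<in> Ar I" and c: "Cod I x = Dom I y"
  obtain f' g' b'' c'' \<theta>'' where ye: "y = ((b', c', \<theta>'), (f', g'), (b'', c'', \<theta>''))" using c by (cases y) (auto simp: xe)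
  note y' = y[unfolded ye iso_comma_Ar_iff iso_comma_Ob_iff]
  have e1: "FAr K g \<cdot>\<^bsub>D\<^esub> \<theta> = \<theta>' \<cdot>\<^bsub>D\<^esub> FAr H f" and e2: "FAr K g' \<cdot>\<^bsub>D\<^esub> \<theta>' = \<theta>'' \<cdot>\<^bsub>D\<^esub> FAr H f'"
    using x' y' by simp_all
  have t: "f \<in> Ar B" "Dom B f = b" "Cod B f = b'" "g \<in> Ar C" "Dom C g = c" "Cod C g = c'"
     "f' \<in> Ar B" "Dom B f' = b'" "Cod B f' = b''" "g' \<in> Ar C" "Dom C g' = c'" "Cod C g' = c''"
     "\<theta> \<in> Ar D" "Dom D \<theta> = FOb H b" "Cod D \<theta> = FOb K c" "\<theta>' \<in> Ar D" "Dom D \<theta>' = FOb H b'" "Cod D \<theta>' = FOb K c'"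
     "\<theta>'' \<in> Ar D" "Dom D \<theta>'' = FOb H b''" "Cod D \<theta>'' = FOb K c''"
    using x' y' by simp_all
  have "FAr K (g' \<cdot>\<^bsub>C\<^esub> g) \<cdot>\<^bsub>D\<^esub> \<theta> = FAr K g' \<cdot>\<^bsub>D\<^esub> (\<theta>' \<cdot>\<^bsub>D\<^esub> FAr H f)" using t by (simp flip: e1)
  also have "\<dots> = \<theta>'' \<cdot>\<^bsub>D\<^esub> FAr H (f' \<cdot>\<^bsub>B\<^esub> f)" using H.D.cmp_ext[OF e2, of "FAr H f"] t by simp
  finally have "FAr K (g' \<cdot>\<^bsub>C\<^esub> g) \<cdot>\<^bsub>D\<^esub> \<theta> = \<theta>'' \<cdot>\<^bsub>D\<^esub> FAr H (f' \<cdot>\<^bsub>B\<^esub> f)" .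
  thus "y \<cdot>\<^bsub>I\<^esub> x \<in> Hom I (Dom I x) (Cod I y)"
    using x y t by (simp add: xe ye iso_comma_Ar_iff)
  fix z assume z: "z \<in> Ar I" and c: "Cod I y = Dom I z"
  obtain f'' g'' b3 c3 \<theta>3 where ze: "z = ((b'', c'', \<theta>''), (f'', g''), (b3, c3, \<theta>3))" using c by (cases z) (auto simp: ye)
  show "z \<cdot>\<^bsub>I\<^esub> (y \<cdot>\<^bsub>I\<^esub> x) = (z \<cdot>\<^bsub>I\<^esub> y) \<cdot>\<^bsub>I\<^esub> x"
    using x' y' z[unfolded ze iso_comma_Ar_iff] by (simp add: xe ye ze)
next
  fix x assume x: "x \<in> Ob I"
  obtain b c \<theta> where xe: "x = (b, c, \<theta>)" by (metis surj_pair)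
  show "Ide I x \<in> Hom I x x" using x by (simp add: xe iso_comma_Ar_iff iso_comma_Ob_iff)
qed

lemma comma_iso:
  assumes x: "((b, c, \<theta>), (f, g), (b', c', \<theta>')) \<in> Ar I" and f: "iso B f" and g: "iso C g"
  shows "iso I ((b, c, \<theta>), (f, g), (b', c', \<theta>'))"
proof -
  interpret I: cat_loc I by unfold_locales (rule category_comma)
  note x' = x[unfolded iso_comma_Ar_iff iso_comma_Ob_iff]
  obtain f' where ff: "inverse_arrows B f f'" using f by (rule H.C.isoE)
  obtain g' where gg: "inverse_arrows C g g'" using g by (rule K.C.isoE)
  note fi = H.C.invD[OF ff] and gi = K.C.invD[OF gg]
  have t: "f' \<in> Ar B" "Dom B f' = b'" "Cod B f' = b" "g' \<in> Ar C" "Dom C g' = c'" "Cod C g' = c"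
    "f \<in> Ar B" "Dom B f = b" "Cod B f = b'" "g \<in> Ar C" "Dom C g = c" "Cod C g = c'"
    "\<theta> \<in> Ar D" "Dom D \<theta> = FOb H b" "Cod D \<theta> = FOb K c" "\<theta>' \<in> Ar D" "Dom D \<theta>' = FOb H b'" "Cod D \<theta>' = FOb K c'"
    and e: "FAr K g \<cdot>\<^bsub>D\<^esub> \<theta> = \<theta>' \<cdot>\<^bsub>D\<^esub> FAr H f"
    using x' fi gi by simp_all
  have b': "b' \<in> Ob B" "c \<in> Ob C" using x' by simp_all
  have hf: "FAr H f \<cdot>\<^bsub>D\<^esub> FAr H f' = Ide D (FOb H b')"
    using H.F_simps(6)[of f' f] fi(6) t b' by simp
  have kg: "FAr K g' \<cdot>\<^bsub>D\<^esub> FAr K g = Ide D (FOb K c)"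
    using K.F_simps(6)[of g g'] gi(5) t b' by simp
  have "FAr K g' \<cdot>\<^bsub>D\<^esub> \<theta>' = FAr K g' \<cdot>\<^bsub>D\<^esub> (\<theta>' \<cdot>\<^bsub>D\<^esub> (FAr H f \<cdot>\<^bsub>D\<^esub> FAr H f'))" unfolding hf using t by simp
  also have "\<dots> = FAr K g' \<cdot>\<^bsub>D\<^esub> (FAr K g \<cdot>\<^bsub>D\<^esub> (\<theta> \<cdot>\<^bsub>D\<^esub> FAr H f'))"
    using H.D.cmp_ext[OF e, of "FAr H f'"] t by simp
  also have "\<dots> = \<theta> \<cdot>\<^bsub>D\<^esub> FAr H f'" by (subst H.D.cmp_ext1[OF kg]) (use t in simp_all)
  finally have "((b', c', \<theta>'), (f', g'), (b, c, \<theta>)) \<in> Ar I" using x t by (simp add: iso_comma_Ar_iff)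
  thus ?thesis using fi gi x t
    by (intro I.isoI[of _ "(b, c, \<theta>)" "(b', c', \<theta>')" "((b', c', \<theta>'), (f', g'), (b, c, \<theta>))"]) simp_all
qed

lemma comma_isoD:
  assumes "iso I ((b, c, \<theta>), (f, g), (b', c', \<theta>'))"
  shows "iso B f"
proof -
  interpret I: cat_loc I by unfold_locales (rule category_comma)
  let ?x = "((b, c, \<theta>), (f, g), (b', c', \<theta>'))"
  obtain y where xy: "inverse_arrows I ?x y" using assms by (rule I.isoE)
  note y = I.invD(1-6)[OF xy]
  obtain f' g' where ye: "y = ((b', c', \<theta>'), (f', g'), (b, c, \<theta>))" using y(3,4) by (cases y) auto
  show ?thesis using y by (intro H.C.isoI[of f b b' f']) (simp_all add: ye iso_comma_Ar_iff)
qed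

lemma functor_to_comma:
  assumes P: "functor A B P" and Q: "functor A C Q" and n: "nat_iso A D (H \<circ>\<^sub>F P) (K \<circ>\<^sub>F Q) \<phi>"
  shows "functor A I \<lparr>FOb = (\<lambda>a. (FOb P a, FOb Q a, \<phi> a)),
       FAr = (\<lambda>f. ((FOb P (Dom A f), FOb Q (Dom A f), \<phi> (Dom A f)), (FAr P f, FAr Q f),
                    (FOb P (Cod A f), FOb Q (Cod A f), \<phi> (Cod A f))))\<rparr>"
proof -
  interpret P: functor_loc A B P by (rule functor_loc[OF P])
  interpret Q: functor_loc A C Q by (rule functor_loc[OF Q])
  note n' = nat_isoD[OF n]
  have o: "(FOb P a, FOb Q a, \<phi> a) \<in> Ob I" if "a \<in> Ob A" for a
    using that n'(3,4,5,7)[OF that] by (simp add: iso_comma_Ob_iff)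
  show ?thesis unfolding functor_def
  proof (intro conjI ballI impI)
    fix f assume f: "f \<in> Ar A"
    show "FAr \<lparr>FOb = (\<lambda>a. (FOb P a, FOb Q a, \<phi> a)),
       FAr = (\<lambda>f. ((FOb P (Dom A f), FOb Q (Dom A f), \<phi> (Dom A f)), (FAr P f, FAr Q f),
                    (FOb P (Cod A f), FOb Q (Cod A f), \<phi> (Cod A f))))\<rparr> f
      \<in> Hom I (FOb \<lparr>FOb = (\<lambda>a. (FOb P a, FOb Q a, \<phi> a)),
       FAr = (\<lambda>f. ((FOb P (Dom A f), FOb Q (Dom A f), \<phi> (Dom A f)), (FAr P f, FAr Q f),
                    (FOb P (Cod A f), FOb Q (Cod A f), \<phi> (Cod A f))))\<rparr> (Dom A f))
        (FOb \<lparr>FOb = (\<lambda>a. (FOb P a, FOb Q a, \<phi> a)),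
       FAr = (\<lambda>f. ((FOb P (Dom A f), FOb Q (Dom A f), \<phi> (Dom A f)), (FAr P f, FAr Q f),
                    (FOb P (Cod A f), FOb Q (Cod A f), \<phi> (Cod A f))))\<rparr> (Cod A f))"
      using f o[of "Dom A f"] o[of "Cod A f"] n'(6)[OF f] by (simp add: iso_comma_Ar_iff)
  qed (use P.C.cat category_comma o in simp_all)
qed

end

context cart_ctx
begin

section \<open>The square of base change functors and its comparison\<close>

lemma pt_map_simps [simp]:
  "FOb (pt_map G) (p, s) = (FAr G p, FAr G s)"
  "FAr (pt_map G) ((p, s), h, (q, t)) = ((FAr G p, FAr G s), FAr G h, (FAr G q, FAr G t))"
  by (simp_all add: pt_map_def)

lemma functor_pt_map: "functor (Pt (UC A) B) (Pt (VC A) (U0 B)) (pt_map (Radj A))"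
  unfolding functor_def
proof (intro conjI ballI impI)
  show "category (Pt (UC A) B)" "category (Pt (VC A) (U0 B))" by (rule U.category_Pt V.category_Pt)+
  fix x assume x: "x \<in> Ob (Pt (UC A) B)"
  obtain p s where xe: "x = (p, s)" by fastforce
  show "FOb (pt_map (Radj A)) x \<in> Ob (Pt (VC A) (U0 B))" using point_U x by (simp add: xe)
  have "p \<in> Ar (UC A)" using x by (simp add: xe Pt_Ob_iff)
  thus "FAr (pt_map (Radj A)) (Ide (Pt (UC A) B) x) = Ide (Pt (VC A) (U0 B)) (FOb (pt_map (Radj A)) x)"
    by (simp add: xe)
next
  fix f assume f: "f \<in> Ar (Pt (UC A) B)"
  obtain p s h q t where fe: "f = ((p, s), h, (q, t))" by (metis surj_pair)
  show "FAr (pt_map (Radj A)) f \<in> Hom (Pt (VC A) (U0 B)) (FOb (pt_map (Radj A)) (Dom (Pt (UC A) B) f)) (FOb (pt_map (Radj A)) (Cod (Pt (UC A) B) f))"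
    using U_Pt_arrow[OF f[unfolded fe]] by (simp add: fe)
  fix g assume g: "g \<in> Ar (Pt (UC A) B)" and c: "Cod (Pt (UC A) B) f = Dom (Pt (UC A) B) g"
  obtain h' q' t' where ge: "g = ((q, t), h', (q', t'))" using c by (cases g) (auto simp: fe)
  have "h \<in> Ar (UC A)" "h' \<in> Ar (UC A)" "Cod (UC A) h = Dom (UC A) h'" using f g by (simp_all add: fe ge Pt_Ar_iff)
  thus "FAr (pt_map (Radj A)) (g \<cdot>\<^bsub>Pt (UC A) B\<^esub> f) = FAr (pt_map (Radj A)) g \<cdot>\<^bsub>Pt (VC A) (U0 B)\<^esub> FAr (pt_map (Radj A)) f"
    by (simp add: fe ge)
qed

lemma pt_map_faithful:
  assumes "f \<in> Ar (Pt (UC A) B)" "g \<in> Ar (Pt (UC A) B)" "Dom (Pt (UC A) B) f = Dom (Pt (UC A) B) g" "Cod (Pt (UC A) B) f = Cod (Pt (UC A) B) g"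
    "FAr (pt_map (Radj A)) f = FAr (pt_map (Radj A)) g"
  shows "f = g"
proof -
  obtain p s h q t where fe: "f = ((p, s), h, (q, t))" by (metis surj_pair)
  obtain h' where ge: "g = ((p, s), h', (q, t))" using assms(3,4) by (cases g) (auto simp: fe)
  have "h = h'" by (rule faithful) (use assms in \<open>simp_all add: fe ge Pt_Ar_iff\<close>)
  thus ?thesis by (simp add: fe ge)
qed

definition phi where "phi B p = pb_lift (VC A) (U1 (pb1 (UC A) (iota A B) p)) (U1 (pb2 (UC A) (iota A B) p))
  (pb1 (VC A) (U1 (iota A B)) (U1 p)) (pb2 (VC A) (U1 (iota A B)) (U1 p))"

lemma base_change_iso_eq:
  "base_change_iso A B (p, s) = (FOb (pt_pullback (VC A) (U1 (iota A B))) (U1 p, U1 s), phi B p,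
    FOb (pt_map (Radj A)) (FOb (pt_pullback (UC A) (iota A B)) (p, s)))"
  by (simp add: base_change_iso_def Let_def phi_def)

lemma iota_pullbacks:
  assumes x: "(p, s) \<in> Ob (Pt (UC A) B)"
  shows "is_pullback (UC A) (iota A B) p (pb1 (UC A) (iota A B) p) (pb2 (UC A) (iota A B) p)"
    "is_pullback (VC A) (U1 (iota A B)) (U1 p) (U1 (pb1 (UC A) (iota A B) p)) (U1 (pb2 (UC A) (iota A B) p))"
    "is_pullback (VC A) (U1 (iota A B)) (U1 p) (pb1 (VC A) (U1 (iota A B)) (U1 p)) (pb2 (VC A) (U1 (iota A B)) (U1 p))"
    "B \<in> Ob (UC A)"
proof -
  have p: "p \<in> Ar (UC A)" "Cod (UC A) p = B" using x by (simp_all add: Pt_Ob_iff)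
  thus B: "B \<in> Ob (UC A)" by auto
  show 1: "is_pullback (UC A) (iota A B) p (pb1 (UC A) (iota A B) p) (pb2 (UC A) (iota A B) p)"
    by (rule U.pb_chosen) (use p B in simp_all)
  show "is_pullback (VC A) (U1 (iota A B)) (U1 p) (U1 (pb1 (UC A) (iota A B) p)) (U1 (pb2 (UC A) (iota A B) p))"
    by (rule U_pullback[OF 1])
  show "is_pullback (VC A) (U1 (iota A B)) (U1 p) (pb1 (VC A) (U1 (iota A B)) (U1 p)) (pb2 (VC A) (U1 (iota A B)) (U1 p))"
    by (rule V.pb_chosen) (use p B in simp_all)
qed

lemma phi_props:
  assumes x: "(p, s) \<in> Ob (Pt (UC A) B)"
  shows "phi B p \<in> Ar (VC A)" "Dom (VC A) (phi B p) = Dom (VC A) (pb1 (VC A) (U1 (iota A B)) (U1 p))"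
    "Cod (VC A) (phi B p) = U0 (Dom (UC A) (pb1 (UC A) (iota A B) p))"
    "U1 (pb1 (UC A) (iota A B) p) \<cdot>\<^sub>V phi B p = pb1 (VC A) (U1 (iota A B)) (U1 p)"
    "U1 (pb2 (UC A) (iota A B) p) \<cdot>\<^sub>V phi B p = pb2 (VC A) (U1 (iota A B)) (U1 p)"
    "iso (VC A) (phi B p)"
proof -
  note pb = iota_pullbacks[OF x]
  note T = U.pb_typed[OF pb(1)] and T2 = V.pb_typed[OF pb(2)] and T3 = V.pb_typed[OF pb(3)]
  have "cone (VC A) (U1 (iota A B)) (U1 p) (pb1 (VC A) (U1 (iota A B)) (U1 p)) (pb2 (VC A) (U1 (iota A B)) (U1 p))"
    by (rule V.coneI) (rule T3)+
  note l = V.pb_lift[OF pb(2) this, folded phi_def]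
  show l1: "phi B p \<in> Ar (VC A)" "Dom (VC A) (phi B p) = Dom (VC A) (pb1 (VC A) (U1 (iota A B)) (U1 p))"
    "U1 (pb1 (UC A) (iota A B) p) \<cdot>\<^sub>V phi B p = pb1 (VC A) (U1 (iota A B)) (U1 p)"
    "U1 (pb2 (UC A) (iota A B) p) \<cdot>\<^sub>V phi B p = pb2 (VC A) (U1 (iota A B)) (U1 p)" by (rule l)+
  show "Cod (VC A) (phi B p) = U0 (Dom (UC A) (pb1 (UC A) (iota A B) p))" using l(3) T(4) by simp
  show "iso (VC A) (phi B p)" by (rule V.pb_comparison_iso[OF pb(2,3) l])
qed

lemma base_change_iso_arrow:
  assumes x: "(p, s) \<in> Ob (Pt (UC A) B)"
  shows "base_change_iso A B (p, s) \<in> Ar (Pt (VC A) (U0 (F0 A)))" "iso (Pt (VC A) (U0 (F0 A))) (base_change_iso A B (p, s))"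
proof -
  note pb = iota_pullbacks[OF x] and f = phi_props[OF x]
  note T = U.pb_typed[OF pb(1)] and T2 = V.pb_typed[OF pb(2)] and T3 = V.pb_typed[OF pb(3)]
  have i: "iota A B \<in> Ar (UC A)" "Dom (UC A) (iota A B) = F0 A" "Cod (UC A) (iota A B) = B" using pb(4) by simp_all
  have Ui: "U1 (iota A B) \<in> Ar (VC A)" "Dom (VC A) (U1 (iota A B)) = U0 (F0 A)" "Cod (VC A) (U1 (iota A B)) = U0 B" using i by simp_all
  define z where "z = pb_lift (UC A) (pb1 (UC A) (iota A B) p) (pb2 (UC A) (iota A B) p) (Ide (UC A) (F0 A)) (s \<cdot>\<^sub>U iota A B)"
  define z' where "z' = pb_lift (VC A) (pb1 (VC A) (U1 (iota A B)) (U1 p)) (pb2 (VC A) (U1 (iota A B)) (U1 p)) (Ide (VC A) (U0 (F0 A))) (U1 s \<cdot>\<^sub>V U1 (iota A B))"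
  have xc: "(p, s) \<in> Ob (Pt (UC A) (Cod (UC A) (iota A B)))" using x i by simp
  have xc': "(U1 p, U1 s) \<in> Ob (Pt (VC A) (Cod (VC A) (U1 (iota A B))))" using point_U[OF x] Ui by simp
  note z = U.pt_section_lift[OF i(1) xc pb(1), unfolded i(2), folded z_def]
  note z' = V.pt_section_lift[OF Ui(1) xc' pb(3), unfolded Ui(2), folded z'_def]
  have st: "s \<in> Ar (UC A)" "Dom (UC A) s = B" using x by (simp_all add: Pt_Ob_iff)
  have e: "phi B p \<cdot>\<^sub>V z' = U1 z"
  proof (rule V.pb_uniq[OF pb(2)])
    have "U1 (pb1 (UC A) (iota A B) p) \<cdot>\<^sub>V (phi B p \<cdot>\<^sub>V z') = Ide (VC A) (U0 (F0 A))"
      by (subst V.cmp_ext1[OF f(4)]) (use f(1-3) z' T(4) T2(4) in simp_all)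
    also have "\<dots> = U1 (pb1 (UC A) (iota A B) p) \<cdot>\<^sub>V U1 z" using U_eq[OF z(4)] z(1-3) T(4) by simp
    finally show "U1 (pb1 (UC A) (iota A B) p) \<cdot>\<^sub>V (phi B p \<cdot>\<^sub>V z') = U1 (pb1 (UC A) (iota A B) p) \<cdot>\<^sub>V U1 z" .
    have "U1 (pb2 (UC A) (iota A B) p) \<cdot>\<^sub>V (phi B p \<cdot>\<^sub>V z') = pb2 (VC A) (U1 (iota A B)) (U1 p) \<cdot>\<^sub>V z'"
      by (rule V.cmp_ext1[OF f(5)]) (use f(1-3) z'(1-3) T(4-6) T2(4,5) in simp_all)
    also have "\<dots> = U1 (s \<cdot>\<^sub>U iota A B)" using z'(5) st i by simp
    also have "\<dots> = U1 (pb2 (UC A) (iota A B) p) \<cdot>\<^sub>V U1 z" using U_eq[OF z(5)] z(1-3) T(4-6) by simp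
    finally show "U1 (pb2 (UC A) (iota A B) p) \<cdot>\<^sub>V (phi B p \<cdot>\<^sub>V z') = U1 (pb2 (UC A) (iota A B) p) \<cdot>\<^sub>V U1 z" .
  qed (use f(1-3) z(1-3) z'(1-3) T(4) in simp_all)
  have b: "base_change_iso A B (p, s) = ((pb1 (VC A) (U1 (iota A B)) (U1 p), z'), phi B p, (U1 (pb1 (UC A) (iota A B) p), U1 z))"
    using i Ui by (simp add: base_change_iso_eq V.pt_pullback_FOb U.pt_pullback_FOb z_def z'_def)
  show a: "base_change_iso A B (p, s) \<in> Ar (Pt (VC A) (U0 (F0 A)))"
    unfolding b Pt_Ar_iff using z'(6) point_U[OF z(6)] f(1-4) e T(4) by simp
  show "iso (Pt (VC A) (U0 (F0 A))) (base_change_iso A B (p, s))"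
    using V.Pt_iso_iff[OF a[unfolded b]] f(6) by (simp add: b)
qed

lemma base_change_nat_iso:
  assumes B: "B \<in> Ob (UC A)"
  shows "functor (Pt (UC A) B) (Pt (UC A) (F0 A)) (pt_pullback (UC A) (iota A B))"
    "functor (Pt (VC A) (U0 B)) (Pt (VC A) (U0 (F0 A))) (pt_pullback (VC A) (U1 (iota A B)))"
    "nat_iso (Pt (UC A) B) (Pt (VC A) (U0 (F0 A))) (pt_pullback (VC A) (U1 (iota A B)) \<circ>\<^sub>F pt_map (Radj A))
      (pt_map (Radj A) \<circ>\<^sub>F pt_pullback (UC A) (iota A B)) (base_change_iso A B)"
proof -
  let ?i = "iota A B"
  have i: "?i \<in> Ar (UC A)" "Dom (UC A) ?i = F0 A" "Cod (UC A) ?i = B" using B by simp_all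
  have Ui: "U1 ?i \<in> Ar (VC A)" "Dom (VC A) (U1 ?i) = U0 (F0 A)" "Cod (VC A) (U1 ?i) = U0 B" using i by simp_all
  show Q: "functor (Pt (UC A) B) (Pt (UC A) (F0 A)) (pt_pullback (UC A) ?i)" using U.functor_pt_pullback[OF i(1)] i by simp
  show H: "functor (Pt (VC A) (U0 B)) (Pt (VC A) (U0 (F0 A))) (pt_pullback (VC A) (U1 ?i))" using V.functor_pt_pullback[OF Ui(1)] Ui by simp
  have comp: "functor X Z (G \<circ>\<^sub>F F)" if "functor X Y F" "functor Y Z G" for X Y Z F G
    using that by (auto simp: functor_def)
  show "nat_iso (Pt (UC A) B) (Pt (VC A) (U0 (F0 A))) (pt_pullback (VC A) (U1 ?i) \<circ>\<^sub>F pt_map (Radj A))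
      (pt_map (Radj A) \<circ>\<^sub>F pt_pullback (UC A) ?i) (base_change_iso A B)"
    unfolding nat_iso_def nat_trans_def
  proof (intro conjI ballI)
    show "functor (Pt (UC A) B) (Pt (VC A) (U0 (F0 A))) (pt_pullback (VC A) (U1 ?i) \<circ>\<^sub>F pt_map (Radj A))"
      by (rule comp[OF functor_pt_map H])
    show "functor (Pt (UC A) B) (Pt (VC A) (U0 (F0 A))) (pt_map (Radj A) \<circ>\<^sub>F pt_pullback (UC A) ?i)"
      by (rule comp[OF Q functor_pt_map])
    fix x assume x: "x \<in> Ob (Pt (UC A) B)"
    obtain p s where xe: "x = (p, s)" by fastforce
    show "base_change_iso A B x \<in> Hom (Pt (VC A) (U0 (F0 A))) (FOb (pt_pullback (VC A) (U1 ?i) \<circ>\<^sub>F pt_map (Radj A)) x)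
        (FOb (pt_map (Radj A) \<circ>\<^sub>F pt_pullback (UC A) ?i) x)"
      using base_change_iso_arrow(1)[OF x[unfolded xe]] by (simp add: xe base_change_iso_eq)
    show "iso (Pt (VC A) (U0 (F0 A))) (base_change_iso A B x)" using base_change_iso_arrow(2)[OF x[unfolded xe]] by (simp add: xe)
  next
    fix f assume f: "f \<in> Ar (Pt (UC A) B)"
    obtain p s h q t where fe: "f = ((p, s), h, (q, t))" by (metis surj_pair)
    have ob: "(p, s) \<in> Ob (Pt (UC A) B)" "(q, t) \<in> Ob (Pt (UC A) B)" "h \<in> Ar (UC A)" "Dom (UC A) h = Dom (UC A) p" "Cod (UC A) h = Dom (UC A) q"
      using f by (simp_all add: fe Pt_Ar_iff)
    note pp = iota_pullbacks[OF ob(1)] and pq = iota_pullbacks[OF ob(2)] and fp = phi_props[OF ob(1)] and fq = phi_props[OF ob(2)]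
    note T = U.pb_typed[OF pp(1)] and T' = U.pb_typed[OF pq(1)] and S = V.pb_typed[OF pp(3)] and S' = V.pb_typed[OF pq(3)]
    define l where "l = pb_lift (UC A) (pb1 (UC A) ?i q) (pb2 (UC A) ?i q) (pb1 (UC A) ?i p) (h \<cdot>\<^sub>U pb2 (UC A) ?i p)"
    define m where "m = pb_lift (VC A) (pb1 (VC A) (U1 ?i) (U1 q)) (pb2 (VC A) (U1 ?i) (U1 q)) (pb1 (VC A) (U1 ?i) (U1 p)) (U1 h \<cdot>\<^sub>V pb2 (VC A) (U1 ?i) (U1 p))"
    have fc: "((p, s), h, (q, t)) \<in> Ar (Pt (UC A) (Cod (UC A) ?i))" using f i by (simp add: fe)
    have fc': "((U1 p, U1 s), U1 h, (U1 q, U1 t)) \<in> Ar (Pt (VC A) (Cod (VC A) (U1 ?i)))" using U_Pt_arrow f Ui by (simp add: fe)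
    note l = U.pt_arrow_lift(1-5)[OF i(1) fc pp(1) pq(1), folded l_def]
    note m = V.pt_arrow_lift(1-5)[OF Ui(1) fc' pp(3) pq(3), folded m_def]
    have pt: "pb1 (UC A) ?i p \<in> Ar (UC A)" "pb2 (UC A) ?i p \<in> Ar (UC A)" "pb1 (UC A) ?i q \<in> Ar (UC A)" "pb2 (UC A) ?i q \<in> Ar (UC A)"
      "Dom (UC A) (pb2 (UC A) ?i p) = Dom (UC A) (pb1 (UC A) ?i p)" "Dom (UC A) (pb2 (UC A) ?i q) = Dom (UC A) (pb1 (UC A) ?i q)"
      "Cod (UC A) (pb2 (UC A) ?i p) = Dom (UC A) p" "Cod (UC A) (pb2 (UC A) ?i q) = Dom (UC A) q"
      using T T' by simp_all
    have e1: "U1 (pb1 (UC A) ?i q) \<cdot>\<^sub>V U1 l = U1 (pb1 (UC A) ?i p)" by (rule U_eq[OF l(4)]) (use l(1-3) pt in simp_all)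
    have "U1 (pb2 (UC A) ?i q \<cdot>\<^sub>U l) = U1 (h \<cdot>\<^sub>U pb2 (UC A) ?i p)" by (simp only: l(5))
    hence e2: "U1 (pb2 (UC A) ?i q) \<cdot>\<^sub>V U1 l = U1 h \<cdot>\<^sub>V U1 (pb2 (UC A) ?i p)" using l(1-3) pt ob(3-5) by simp
    \<comment> \<open>Naturality is tested on the projections of the image of the chosen pullback in
      \<open>UC A\<close>, the pullback through which \<open>phi\<close> is defined.\<close>
    have "phi B q \<cdot>\<^sub>V m = U1 l \<cdot>\<^sub>V phi B p"
    proof (rule V.pb_uniq[OF pq(2)])
      have "U1 (pb1 (UC A) ?i q) \<cdot>\<^sub>V (phi B q \<cdot>\<^sub>V m) = pb1 (VC A) (U1 ?i) (U1 q) \<cdot>\<^sub>V m"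
        by (rule V.cmp_ext1[OF fq(4)]) (use fq(1-3) m(1-3) pt in simp_all)
      also have "\<dots> = U1 (pb1 (UC A) ?i q) \<cdot>\<^sub>V (U1 l \<cdot>\<^sub>V phi B p)" unfolding m(4)
        by (subst V.cmp_ext1[OF e1]) (use fp(1-4) l(1-3) pt in simp_all)
      finally show "U1 (pb1 (UC A) ?i q) \<cdot>\<^sub>V (phi B q \<cdot>\<^sub>V m) = U1 (pb1 (UC A) ?i q) \<cdot>\<^sub>V (U1 l \<cdot>\<^sub>V phi B p)" .
      have "U1 (pb2 (UC A) ?i q) \<cdot>\<^sub>V (phi B q \<cdot>\<^sub>V m) = pb2 (VC A) (U1 ?i) (U1 q) \<cdot>\<^sub>V m"
        by (rule V.cmp_ext1[OF fq(5)]) (use fq(1-3) m(1-3) pt in simp_all)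
      also have "\<dots> = U1 h \<cdot>\<^sub>V (U1 (pb2 (UC A) ?i p) \<cdot>\<^sub>V phi B p)" unfolding m(5) fp(5) ..
      also have "\<dots> = U1 (pb2 (UC A) ?i q) \<cdot>\<^sub>V (U1 l \<cdot>\<^sub>V phi B p)"
        by (rule V.cmp_ext[OF e2[symmetric]]) (use fp(1-3) l(1-3) pt ob(3-5) in simp_all)
      finally show "U1 (pb2 (UC A) ?i q) \<cdot>\<^sub>V (phi B q \<cdot>\<^sub>V m) = U1 (pb2 (UC A) ?i q) \<cdot>\<^sub>V (U1 l \<cdot>\<^sub>V phi B p)" .
    qed (use fp(1-3) fq(1-3) l(1-3) m(1-3) pt in simp_all)
    thus "base_change_iso A B (Cod (Pt (UC A) B) f) \<cdot>\<^bsub>Pt (VC A) (U0 (F0 A))\<^esub> FAr (pt_pullback (VC A) (U1 ?i) \<circ>\<^sub>F pt_map (Radj A)) f =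
      FAr (pt_map (Radj A) \<circ>\<^sub>F pt_pullback (UC A) ?i) f \<cdot>\<^bsub>Pt (VC A) (U0 (F0 A))\<^esub> base_change_iso A B (Dom (Pt (UC A) B) f)"
      by (simp add: fe base_change_iso_eq V.pt_pullback_FAr U.pt_pullback_FAr V.pt_pullback_FOb U.pt_pullback_FOb l_def m_def)
  qed
qed

lemma full_over_F0':
  assumes x: "x \<in> Ob (Pt (UC A) (F0 A))" "y \<in> Ob (Pt (UC A) (F0 A))"
    and h: "h \<in> Ar (Pt (VC A) (U0 (F0 A)))" "Dom (Pt (VC A) (U0 (F0 A))) h = FOb (pt_map (Radj A)) x"
      "Cod (Pt (VC A) (U0 (F0 A))) h = FOb (pt_map (Radj A)) y"
  obtains g where "g \<in> Ar (Pt (UC A) (F0 A))" "Dom (Pt (UC A) (F0 A)) g = x" "Cod (Pt (UC A) (F0 A)) g = y" "FAr (pt_map (Radj A)) g = h"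
proof -
  obtain q1 t1 where xe: "x = (q1, t1)" by fastforce
  obtain q2 t2 where ye: "y = (q2, t2)" by fastforce
  obtain k where he: "h = ((U1 q1, U1 t1), k, (U1 q2, U1 t2))" using h(2,3) by (cases h) (auto simp: xe ye)
  obtain h' where "((q1, t1), h', (q2, t2)) \<in> Ar (Pt (UC A) (F0 A))" "U1 h' = k"
    by (rule full_over_F0[OF x[unfolded xe ye] h(1)[unfolded he]])
  thus thesis by (intro that[of "((q1, t1), h', (q2, t2))"]) (simp_all add: xe ye he)
qed

text \<open>The component over \<open>B\<close> of an arrow or object of the iso-comma category is
  lifted by \<open>points_full\<close> or \<open>points_lift\<close>; the component over F(0) then
  follows, since the right adjoint is fully faithful on points there.\<close>

lemma pseudopullback_iff:
  "(\<forall>B\<in>Ob (UC A). is_pseudopullback_of_cats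
         (Pt (UC A) B) (Pt (VC A) (U0 B)) (Pt (UC A) (F0 A)) (Pt (VC A) (U0 (F0 A)))
         (pt_map (Radj A)) (pt_pullback (UC A) (iota A B))
         (pt_pullback (VC A) (U1 (iota A B))) (pt_map (Radj A))
         (base_change_iso A B)) \<longleftrightarrow> points_lift \<and> points_full"
  (is "(\<forall>B\<in>_. ?pp B) \<longleftrightarrow> _")
proof (intro iffI conjI ballI)
  fix B assume B: "B \<in> Ob (UC A)" and "points_lift \<and> points_full"
  hence pl: points_lift and pf: points_full by auto
  let ?A = "Pt (UC A) B" and ?B = "Pt (VC A) (U0 B)" and ?C = "Pt (UC A) (F0 A)" and ?D = "Pt (VC A) (U0 (F0 A))"
  let ?P = "pt_map (Radj A)" and ?Q = "pt_pullback (UC A) (iota A B)" and ?H = "pt_pullback (VC A) (U1 (iota A B))"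
  let ?\<phi> = "base_change_iso A B"
  note bc = base_change_nat_iso[OF B] and \<phi> = nat_isoD[OF base_change_nat_iso(3)[OF B]]
  interpret comma_loc ?B ?C ?D ?H ?P by (intro comma_loc.intro functor_loc functor_pt_map bc)
  interpret P: functor_loc ?A ?B ?P by (intro functor_loc functor_pt_map)
  interpret Q: functor_loc ?A ?C ?Q by (intro functor_loc bc)
  let ?F = "\<lparr>FOb = (\<lambda>a. (FOb ?P a, FOb ?Q a, ?\<phi> a)),
       FAr = (\<lambda>f. ((FOb ?P (Dom ?A f), FOb ?Q (Dom ?A f), ?\<phi> (Dom ?A f)), (FAr ?P f, FAr ?Q f),
                    (FOb ?P (Cod ?A f), FOb ?Q (Cod ?A f), ?\<phi> (Cod ?A f))))\<rparr>"
  have F: "functor ?A I ?F" by (rule functor_to_comma[OF functor_pt_map bc(1,3)])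
  have "equivalence_of_cats ?A I ?F"
  proof (rule equivalenceI[OF F])
    fix f g assume "f \<in> Ar ?A" "g \<in> Ar ?A" "Dom ?A f = Dom ?A g" "Cod ?A f = Cod ?A g" "FAr ?F f = FAr ?F g"
    thus "f = g" by (intro pt_map_faithful[of f B g]) simp_all
  next
    fix a b h assume a: "a \<in> Ob ?A" and b: "b \<in> Ob ?A" and h: "h \<in> Ar I" "Dom I h = FOb ?F a" "Cod I h = FOb ?F b"
    obtain f g where he: "h = ((FOb ?P a, FOb ?Q a, ?\<phi> a), (f, g), (FOb ?P b, FOb ?Q b, ?\<phi> b))"
      using h(2,3) by (cases h) auto
    note h' = h(1)[unfolded he iso_comma_Ar_iff]
    obtain p1 s1 where ae: "a = (p1, s1)" by fastforce
    obtain p2 s2 where be: "b = (p2, s2)" by fastforce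
    obtain f0 where fe: "f = ((U1 p1, U1 s1), f0, (U1 p2, U1 s2))" using h' by (cases f) (auto simp: ae be)
    have "((U1 p1, U1 s1), f0, (U1 p2, U1 s2)) \<in> Ar ?B" unfolding fe[symmetric] using h' by simp
    then obtain k where k: "((p1, s1), k, (p2, s2)) \<in> Ar ?A" "U1 k = f0"
      using pf B a b unfolding points_full_def ae be by blast
    let ?k = "((p1, s1), k, (p2, s2))"
    have kt: "Dom ?A ?k = a" "Cod ?A ?k = b" by (simp_all add: ae be)
    have Pk: "FAr ?P ?k = f" using k(2) by (simp add: fe)
    have gt: "g \<in> Ar ?C" "Dom ?C g = FOb ?Q a" "Cod ?C g = FOb ?Q b" using h' by simp_all
    \<comment> \<open>The second component is forced: after \<open>U'\<close> both candidates fit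
      the same square with the invertible \<open>?\<phi> a\<close>, and \<open>U'\<close> is
      faithful.\<close>
    have 1: "FAr ?P (FAr ?Q ?k) \<cdot>\<^bsub>?D\<^esub> ?\<phi> a = FAr ?P g \<cdot>\<^bsub>?D\<^esub> ?\<phi> a"
      using \<phi>(6)[OF k(1), unfolded kt comp_func_simps Pk] h' by simp
    have 2: "FAr ?P (FAr ?Q ?k) = FAr ?P g"
      by (rule H.D.iso_epi[OF \<phi>(7)[OF a] _ _ _ _ 1]) (use \<phi>(5)[OF a] Q.F_simps(1-3)[OF k(1), unfolded kt] gt in simp_all)
    have "FAr ?Q ?k = g"
      by (rule pt_map_faithful[OF _ gt(1) _ _ 2]) (use Q.F_simps(1-3)[OF k(1), unfolded kt] gt in simp_all)
    thus "\<exists>f. f \<in> Ar ?A \<and> Dom ?A f = a \<and> Cod ?A f = b \<and> FAr ?F f = h"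
      using k(1) kt Pk by (intro exI[of _ ?k]) (simp add: he del: pt_map_simps Pt_simps)
  next
    fix d assume d: "d \<in> Ob I"
    obtain p s q t \<theta> where de: "d = ((p, s), (q, t), \<theta>)" by (metis surj_pair)
    note d' = d[unfolded de iso_comma_Ob_iff]
    have x: "(p, s) \<in> Ob ?B" and y: "(q, t) \<in> Ob ?C" using d' by simp_all
    have i: "Dom (VC A) (U1 (iota A B)) = U0 (F0 A)" using B by simp
    have "p \<in> Ar (VC A)" using x by (simp add: Pt_Ob_iff)
    then obtain k where k: "is_kernel (VC A) p k" using V.ker_ex by blast
    obtain \<xi> where a: "point_action (VC A) (U0 B) (Dom (VC A) k) \<xi> p s k" by (rule V.point_action_ex[OF x k refl])
    obtain k' where k': "point_action (VC A) (U0 (F0 A)) (Dom (VC A) k) (\<xi> \<cdot>\<^sub>V iota_flat A B (Dom (VC A) k)) (pb1 (VC A) (U1 (iota A B)) p)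
      (pb_lift (VC A) (pb1 (VC A) (U1 (iota A B)) p) (pb2 (VC A) (U1 (iota A B)) p) (Ide (VC A) (U0 (F0 A))) (s \<cdot>\<^sub>V U1 (iota A B))) k'"
      by (rule base_change_point_action[OF B a])
    obtain m where th: "\<theta> = (FOb ?H (p, s), m, (U1 q, U1 t))" using d' by (cases \<theta>) auto
    have ma: "((pb1 (VC A) (U1 (iota A B)) p,
      pb_lift (VC A) (pb1 (VC A) (U1 (iota A B)) p) (pb2 (VC A) (U1 (iota A B)) p) (Ide (VC A) (U0 (F0 A))) (s \<cdot>\<^sub>V U1 (iota A B))), m, (U1 q, U1 t)) \<in> Ar ?D"
      using d' by (simp add: th V.pt_pullback_FOb i)
    have "iso ?D \<theta>" using d' by simp
    hence mi: "iso (VC A) m" using V.Pt_iso_iff[OF ma] by (simp add: th V.pt_pullback_FOb i)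
    note c = V.point_action_iso[OF k' ma mi]
    \<comment> \<open>\<open>\<theta>\<close> identifies the base change of the point with the image
      of (\<open>q\<close>, \<open>t\<close>). So the restricted action is the one of a point over
      F(0), namely \<open>xi0\<close>.\<close>
    have "coherent A B (Dom (VC A) k) \<xi>" unfolding coherent_def
      by (rule V.point_action_unique[OF c xi0_point_action[OF y V.point_actionD(2,3)[OF c]]])
    then obtain p' s' \<sigma> where l: "lifts_point A B p' s' \<sigma> p s" using pl B a unfolding points_lift_def by blast
    note la = lifts_arrow[OF l x]
    let ?c = "(p', s')" and ?S = "((U1 p', U1 s'), \<sigma>, (p, s))"
    have Si: "iso ?B ?S" using V.Pt_iso_iff[OF la(2)] la(3) by simp
    have St: "Dom ?B ?S = FOb ?P ?c" "Cod ?B ?S = (p, s)" by simp_all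
    obtain \<psi> where inv: "inverse_arrows ?D (?\<phi> ?c) \<psi>" using \<phi>(7)[OF la(1)] by (rule H.D.isoE)
    note iv = H.D.invD[OF inv]
    note f1 = \<phi>(3,4,5)[OF la(1), unfolded comp_func_simps]
    have tht: "\<theta> \<in> Ar ?D" "Dom ?D \<theta> = FOb ?H (p, s)" "Cod ?D \<theta> = FOb ?P (q, t)" "iso ?D \<theta>" using d' by simp_all
    note HS = H.F_simps(1-3)[OF la(2), unfolded St]
    \<comment> \<open>\<open>E\<close> is what the image of the second component must be for the
      square over \<open>?D\<close> to commute. Fullness over F(0) provides an arrow
      \<open>g\<close> with that image.\<close>
    define E where "E = \<theta> \<cdot>\<^bsub>?D\<^esub> (FAr ?H ?S \<cdot>\<^bsub>?D\<^esub> \<psi>)"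
    have Et: "E \<in> Ar ?D" "Dom ?D E = FOb ?P (FOb ?Q ?c)" "Cod ?D E = FOb ?P (q, t)"
      unfolding E_def using tht(1-3) HS iv(1-4) f1 by (simp_all del: pt_map_simps Pt_simps)
    have "iso ?D (FAr ?H ?S \<cdot>\<^bsub>?D\<^esub> \<psi>)"
      by (rule H.D.iso_comp[OF H.D.inverse_arrows_iso(2)[OF inv] H.F_iso[OF Si]]) (use HS iv(1-4) f1 in \<open>simp del: pt_map_simps Pt_simps\<close>)
    hence Ei: "iso ?D E" unfolding E_def
      by (rule H.D.iso_comp[OF _ tht(4)]) (use tht(1-3) HS iv(1-4) f1 in \<open>simp del: pt_map_simps Pt_simps\<close>)
    obtain g where g: "g \<in> Ar ?C" "Dom ?C g = FOb ?Q ?c" "Cod ?C g = (q, t)" "FAr ?P g = E"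
      by (rule full_over_F0'[OF Q.F_simps(4)[OF la(1)] y Et])
    have gi: "iso ?C g"
    proof -
      obtain x1 g0 y1 where ge: "g = (x1, g0, y1)" by (metis surj_pair)
      obtain q1 t1 q2 t2 where xy: "x1 = (q1, t1)" "y1 = (q2, t2)" by fastforce
      have "iso (VC A) (U1 g0)" using V.Pt_iso_iff[OF U_Pt_arrow[OF g(1)[unfolded ge xy]]] Ei g(4) by (simp add: ge xy)
      hence "iso (UC A) g0" using g(1) by (intro conservative) (simp_all add: ge xy Pt_Ar_iff)
      thus ?thesis using U.Pt_iso_iff[OF g(1)[unfolded ge xy]] by (simp add: ge xy)
    qed
    have co: "(FOb ?P ?c, FOb ?Q ?c, ?\<phi> ?c) \<in> Ob I"
      using functor_loc.F_simps(4)[OF functor_loc[OF F] la(1)] by simp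
    have "E \<cdot>\<^bsub>?D\<^esub> ?\<phi> ?c = \<theta> \<cdot>\<^bsub>?D\<^esub> (FAr ?H ?S \<cdot>\<^bsub>?D\<^esub> (\<psi> \<cdot>\<^bsub>?D\<^esub> ?\<phi> ?c))"
      unfolding E_def using tht(1-3) HS iv(1-4) f1 by (simp del: pt_map_simps Pt_simps)
    also have "\<dots> = \<theta> \<cdot>\<^bsub>?D\<^esub> FAr ?H ?S" unfolding iv(5) using HS f1 by (simp del: pt_map_simps Pt_simps)
    finally have sq: "FAr ?P g \<cdot>\<^bsub>?D\<^esub> ?\<phi> ?c = \<theta> \<cdot>\<^bsub>?D\<^esub> FAr ?H ?S" using g(4) by simp
    have ar: "((FOb ?P ?c, FOb ?Q ?c, ?\<phi> ?c), (?S, g), ((p, s), (q, t), \<theta>)) \<in> Ar I"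
      unfolding iso_comma_Ar_iff by (intro conjI co d[unfolded de] la(2) St g(1-3) sq)
    show "\<exists>c \<theta>. c \<in> Ob ?A \<and> iso I \<theta> \<and> Dom I \<theta> = FOb ?F c \<and> Cod I \<theta> = d"
      using la(1) comma_iso[OF ar Si gi] by (intro exI[of _ ?c] exI[of _ "((FOb ?P ?c, FOb ?Q ?c, ?\<phi> ?c), (?S, g), ((p, s), (q, t), \<theta>))"]) (simp add: de)
  qed
  thus "?pp B" unfolding is_pseudopullback_of_cats_def using functor_pt_map bc by blast
next
  assume all: "\<forall>B\<in>Ob (UC A). ?pp B"
  have eq: "equivalence_of_cats (Pt (UC A) B)
    (iso_comma_cat (Pt (VC A) (U0 B)) (Pt (UC A) (F0 A)) (Pt (VC A) (U0 (F0 A))) (pt_pullback (VC A) (U1 (iota A B))) (pt_map (Radj A)))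
      \<lparr>FOb = (\<lambda>a. (FOb (pt_map (Radj A)) a, FOb (pt_pullback (UC A) (iota A B)) a, base_change_iso A B a)),
       FAr = (\<lambda>f. ((FOb (pt_map (Radj A)) (Dom (Pt (UC A) B) f), FOb (pt_pullback (UC A) (iota A B)) (Dom (Pt (UC A) B) f), base_change_iso A B (Dom (Pt (UC A) B) f)),
          (FAr (pt_map (Radj A)) f, FAr (pt_pullback (UC A) (iota A B)) f),
                    (FOb (pt_map (Radj A)) (Cod (Pt (UC A) B) f), FOb (pt_pullback (UC A) (iota A B)) (Cod (Pt (UC A) B) f), base_change_iso A B (Cod (Pt (UC A) B) f))))\<rparr>"
    if "B \<in> Ob (UC A)" for B
    using all that unfolding is_pseudopullback_of_cats_def by blast
  show points_lift unfolding points_lift_def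
  proof (intro ballI allI impI)
    fix B X \<xi> p s k assume B: "B \<in> Ob (UC A)" and a: "point_action (VC A) (U0 B) X \<xi> p s k" and c: "coherent A B X \<xi>"
    let ?A = "Pt (UC A) B" and ?B = "Pt (VC A) (U0 B)" and ?C = "Pt (UC A) (F0 A)" and ?D = "Pt (VC A) (U0 (F0 A))"
    let ?H = "pt_pullback (VC A) (U1 (iota A B))"
    note bc = base_change_nat_iso[OF B]
    interpret comma_loc ?B ?C ?D ?H "pt_map (Radj A)" by (intro comma_loc.intro functor_loc functor_pt_map bc)
    have i: "Dom (VC A) (U1 (iota A B)) = U0 (F0 A)" using B by simp
    have X: "X \<in> Ob (VC A)" by (rule V.point_action_typed(11)[OF a])
    obtain k' where k': "point_action (VC A) (U0 (F0 A)) X (\<xi> \<cdot>\<^sub>V iota_flat A B X) (pb1 (VC A) (U1 (iota A B)) p)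
      (pb_lift (VC A) (pb1 (VC A) (U1 (iota A B)) p) (pb2 (VC A) (U1 (iota A B)) p) (Ide (VC A) (U0 (F0 A))) (s \<cdot>\<^sub>V U1 (iota A B))) k'"
      by (rule base_change_point_action[OF B a])
    let ?t = "L1 (to_zero (VC A) X)" and ?f = "L1 (from_zero (VC A) X)"
    note k'' = k'[unfolded c[unfolded coherent_def]] and xf = xi0_free[OF X]
    \<comment> \<open>By coherence the base change of the given point and the image of the free
      point on \<open>X\<close> carry the same action \<open>xi0\<close>. The identity of
      \<open>X\<close> therefore induces a morphism \<open>m\<close> between them, invertible by the
      short five lemma.\<close>
    have "((X, xi0 A X), Ide (VC A) X, (X, xi0 A X)) \<in> Ar (Alg (VC A) (flat_monad (VC A) (U0 (F0 A))))"
    proof -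
      interpret T: cat_loc "Alg (VC A) (flat_monad (VC A) (U0 (F0 A)))" by unfold_locales (rule V.category_Alg_flat, simp)
      show ?thesis using T.Ide_Ar[OF V.point_action_algebra[OF xf]] by simp
    qed
    then obtain m where m: "((pb1 (VC A) (U1 (iota A B)) p,
      pb_lift (VC A) (pb1 (VC A) (U1 (iota A B)) p) (pb2 (VC A) (U1 (iota A B)) p) (Ide (VC A) (U0 (F0 A))) (s \<cdot>\<^sub>V U1 (iota A B))), m, (U1 ?t, U1 ?f)) \<in> Ar ?D"
      and mk: "m \<cdot>\<^sub>V k' = \<eta> X \<cdot>\<^sub>V Ide (VC A) X"
      by (rule V.action_morphism_point[OF k'' xf])
    have mi: "iso (VC A) m"
      by (rule V.short_five[OF m V.point_actionD(2)[OF k''] V.point_actionD(2)[OF xf], of "Ide (VC A) X"])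
        (use X mk V.point_actionD(3)[OF k''] in simp_all)
    \<comment> \<open>With this isomorphism the given point becomes an object of the iso-comma
      category. Essential surjectivity yields a point over \<open>B\<close> whose image is
      isomorphic to it in the first component.\<close>
    let ?\<theta> = "(FOb ?H (p, s), m, (U1 ?t, U1 ?f))"
    have th: "?\<theta> \<in> Ar ?D" using m by (simp add: V.pt_pullback_FOb i)
    moreover have "iso ?D ?\<theta>" using V.Pt_iso_iff[OF m] mi by (simp add: V.pt_pullback_FOb i)
    ultimately have dO: "((p, s), (?t, ?f), ?\<theta>) \<in> Ob I"
      using V.point_actionD(1)[OF a] free_point[OF X] by (simp add: iso_comma_Ob_iff)
    obtain x \<Theta> where x: "x \<in> Ob ?A" and Th: "iso I \<Theta>"
      "Dom I \<Theta> = (FOb (pt_map (Radj A)) x, FOb (pt_pullback (UC A) (iota A B)) x, base_change_iso A B x)"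
      "Cod I \<Theta> = ((p, s), (?t, ?f), ?\<theta>)"
      by (rule equivalence_ess_surj[OF eq[OF B] dO, unfolded func.select_convs])
    obtain p' s' where xe: "x = (p', s')" by fastforce
    obtain f g where Te: "\<Theta> = ((FOb (pt_map (Radj A)) x, FOb (pt_pullback (UC A) (iota A B)) x, base_change_iso A B x), (f, g), ((p, s), (?t, ?f), ?\<theta>))"
      using Th(2,3) by (cases \<Theta>) auto
    have fi: "iso ?B f" using comma_isoD[OF Th(1)[unfolded Te]] .
    have "\<Theta> \<in> Ar I" using Th(1) by (simp add: iso_def)
    hence fA: "f \<in> Ar ?B" "Dom ?B f = (U1 p', U1 s')" "Cod ?B f = (p, s)" unfolding Te iso_comma_Ar_iff by (simp_all add: xe)
    obtain \<sigma> where fe: "f = ((U1 p', U1 s'), \<sigma>, (p, s))" using fA(2,3) by (cases f) auto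
    have "lifts_point A B p' s' \<sigma> p s"
      by (rule arrow_lifts[OF x[unfolded xe] fA(1)[unfolded fe]]) (use V.Pt_iso_iff[OF fA(1)[unfolded fe]] fi fe in simp)
    thus "\<exists>p' s' \<sigma>. lifts_point A B p' s' \<sigma> p s" by blast
  qed
  show points_full unfolding points_full_def
  proof (intro ballI allI impI)
    fix B p1 s1 p2 s2 h assume B: "B \<in> Ob (UC A)" and x: "(p1, s1) \<in> Ob (Pt (UC A) B)" "(p2, s2) \<in> Ob (Pt (UC A) B)"
      and h: "((U1 p1, U1 s1), h, (U1 p2, U1 s2)) \<in> Ar (Pt (VC A) (U0 B))"
    let ?A = "Pt (UC A) B" and ?B = "Pt (VC A) (U0 B)" and ?C = "Pt (UC A) (F0 A)" and ?D = "Pt (VC A) (U0 (F0 A))"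
    let ?P = "pt_map (Radj A)" and ?Q = "pt_pullback (UC A) (iota A B)" and ?H = "pt_pullback (VC A) (U1 (iota A B))"
    let ?\<phi> = "base_change_iso A B"
    note bc = base_change_nat_iso[OF B] and \<phi> = nat_isoD[OF base_change_nat_iso(3)[OF B]]
    interpret comma_loc ?B ?C ?D ?H ?P by (intro comma_loc.intro functor_loc functor_pt_map bc)
    interpret Q: functor_loc ?A ?C ?Q by (intro functor_loc bc)
    let ?x = "(p1, s1)" and ?y = "(p2, s2)" and ?f = "((U1 p1, U1 s1), h, (U1 p2, U1 s2))"
    have ft: "Dom ?B ?f = FOb ?P ?x" "Cod ?B ?f = FOb ?P ?y" by simp_all
    obtain \<psi> where inv: "inverse_arrows ?D (?\<phi> ?x) \<psi>" using \<phi>(7)[OF x(1)] by (rule H.D.isoE)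
    note iv = H.D.invD[OF inv]
    note f1 = \<phi>(3,4,5)[OF x(1), unfolded comp_func_simps] and f2 = \<phi>(3,4,5)[OF x(2), unfolded comp_func_simps]
    note Hf = H.F_simps(1-3)[OF h, unfolded ft]
    \<comment> \<open>To use fullness of the comparison, \<open>h\<close> is completed to an arrow
      of the iso-comma category. Its second component must map to the base change of
      \<open>h\<close> conjugated by \<open>?\<phi>\<close>, and it exists by fullness over
      F(0).\<close>
    define E where "E = ?\<phi> ?y \<cdot>\<^bsub>?D\<^esub> (FAr ?H ?f \<cdot>\<^bsub>?D\<^esub> \<psi>)"
    have Et: "E \<in> Ar ?D" "Dom ?D E = FOb ?P (FOb ?Q ?x)" "Cod ?D E = FOb ?P (FOb ?Q ?y)"
      unfolding E_def using f2 Hf iv(1-4) f1 by (simp_all del: pt_map_simps Pt_simps)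
    obtain g where g: "g \<in> Ar ?C" "Dom ?C g = FOb ?Q ?x" "Cod ?C g = FOb ?Q ?y" "FAr ?P g = E"
      by (rule full_over_F0'[OF Q.F_simps(4)[OF x(1)] Q.F_simps(4)[OF x(2)] Et])
    have "E \<cdot>\<^bsub>?D\<^esub> ?\<phi> ?x = ?\<phi> ?y \<cdot>\<^bsub>?D\<^esub> (FAr ?H ?f \<cdot>\<^bsub>?D\<^esub> (\<psi> \<cdot>\<^bsub>?D\<^esub> ?\<phi> ?x))"
      unfolding E_def using f2 Hf iv(1-4) f1 by (simp del: pt_map_simps Pt_simps)
    also have "\<dots> = ?\<phi> ?y \<cdot>\<^bsub>?D\<^esub> FAr ?H ?f" unfolding iv(5) using Hf f1 by (simp del: pt_map_simps Pt_simps)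
    finally have sq: "FAr ?P g \<cdot>\<^bsub>?D\<^esub> ?\<phi> ?x = ?\<phi> ?y \<cdot>\<^bsub>?D\<^esub> FAr ?H ?f" using g(4) by simp
    note F = functor_loc[OF functor_to_comma[OF functor_pt_map bc(1,3)]]
    have o: "(FOb ?P ?x, FOb ?Q ?x, ?\<phi> ?x) \<in> Ob I" "(FOb ?P ?y, FOb ?Q ?y, ?\<phi> ?y) \<in> Ob I"
      using functor_loc.F_simps(4)[OF F x(1)] functor_loc.F_simps(4)[OF F x(2)] by simp_all
    have ar: "((FOb ?P ?x, FOb ?Q ?x, ?\<phi> ?x), (?f, g), (FOb ?P ?y, FOb ?Q ?y, ?\<phi> ?y)) \<in> Ar I"
      unfolding iso_comma_Ar_iff by (intro conjI o h ft g(1-3) sq)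
    obtain k where k: "k \<in> Ar ?A" "Dom ?A k = ?x" "Cod ?A k = ?y" and kF: "((FOb ?P (Dom ?A k), FOb ?Q (Dom ?A k), ?\<phi> (Dom ?A k)), (FAr ?P k, FAr ?Q k),
        (FOb ?P (Cod ?A k), FOb ?Q (Cod ?A k), ?\<phi> (Cod ?A k))) = ((FOb ?P ?x, FOb ?Q ?x, ?\<phi> ?x), (?f, g), (FOb ?P ?y, FOb ?Q ?y, ?\<phi> ?y))"
      by (rule equivalence_full[OF eq[OF B] x ar, unfolded func.select_convs iso_comma_simps]) simp_all
    have kP: "FAr ?P k = ?f" using kF by simp
    obtain h' where ke: "k = (?x, h', ?y)" using k(2,3) by (cases k) auto
    show "\<exists>h'. ((p1, s1), h', (p2, s2)) \<in> Ar (Pt (UC A) B) \<and> U1 h' = h"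
      using k kP by (intro exI[of _ h']) (simp add: ke)
  qed
qed

end

theorem corollary5p3:
  fixes A :: "('uo, 'um, 'vo, 'vm) adj"
  assumes "ideally_exact_context A"
    and "full_on_isos (UC A) (VC A) (Radj A)"
  shows
    "(BAT A \<longleftrightarrow>
       (\<forall>B\<in>Ob (UC A). is_pullback_of_cats
         (Alg (VC A) (sharp_monad A B)) (Alg (VC A) (UB_monad A B)) (VC A) (Alg (VC A) (UB_monad A (F0 A)))
         (alg_restrict (VC A) (gamma A B)) alg_forget
         (alg_restrict (VC A) (iota_flat A B)) (xi0_func A))) \<and>
     (BAT A \<longleftrightarrow>
       (\<forall>B\<in>Ob (UC A). is_pseudopullback_of_cats
         (Pt (UC A) B) (Pt (VC A) (FOb (Radj A) B)) (Pt (UC A) (F0 A)) (Pt (VC A) (FOb (Radj A) (F0 A)))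
         (pt_map (Radj A)) (pt_pullback (UC A) (iota A B))
         (pt_pullback (VC A) (FAr (Radj A) (iota A B))) (pt_map (Radj A))
         (base_change_iso A B)))"
proof -
  interpret cart_ctx A by (rule ideally_exact_context_cart_ctx[OF assms(1)])
  show ?thesis by (simp only: BAT_iff[OF assms(2)] pullback_iff pseudopullback_iff)
qed

end
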